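(* Let $B\subset\mathbb{R}^2$ be a ball with $|B|=\pi$ and let $\{\Omega_\varepsilon\}_{\varepsilon>0}$ be a sequence of planar sets such that $|\Omega_\varepsilon|=\pi=|B|$ and $|B\Delta\Omega_\varepsilon|=4\varepsilon$. Let $\Omega_\varepsilon^*$ be the rearrangement of $\Omega_\varepsilon$ with respect to $B$. Then $$\liminf_{\varepsilon\to0}\mathcal{F}(\Omega_\varepsilon^* )\ \ge\ \frac{\pi}{8(4-\pi)}.$$
   Context: $|\cdot|$ is Lebesgue measure, $P$ the De Giorgi perimeter, $\mathcal{H}^1$ the one-dimensional Hausdorff measure. For a planar Borel set with $0<|\Omega|<\infty$: $\delta(\Omega)=\frac{P(\Omega)-P(B)}{P(B)}$ with $B$ a ball, $|B|=|\Omega|$; $\lambda(\Omega)=\min_{x\in\mathbb{R}^2}\frac{|\Omega\Delta B_x|}{|\Omega|}$ with $B_x$ the ball centered at $x$, $|B_x|=|\Omega|$. For $\Omega$ not a ball, $\mathcal{F}(\Omega)=\delta(\Omega)/\lambda^2(\Omega)$. Rearrangement of $\Omega$ with respect to $B$ ($|\Omega|=|B|=\pi$). Put $\Omega^{OUT}=\Omega\setminus B$, $\Omega^{IN}=B\setminus\Omega$, $\gamma^{IN}=\mathcal{H}^1(\partial\Omega^{IN}\setminus\partial\Omega)$ and $\gamma^{OUT}=\mathcal{H}^1(\partial\Omega^{OUT}\setminus\partial\Omega)$. Transversal case ($\partial\Omega\cap\partial B$ finite, so $\gamma^{OUT}+\gamma^{IN}=2\pi$): choose four consecutive points $A_1,A_2,A_3,A_4$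 on $\partial B$ such that the arcs $\sigma_{12},\sigma_{34}$ of $\partial B$ (with endpoints $A_1,A_2$ and $A_3,A_4$) have length $\gamma^{OUT}/2$ each and the arcs $\sigma_{23},\sigma_{41}$ of $\partial B$ (with endpoints $A_2,A_3$ and $A_4,A_1$) have length $\gamma^{IN}/2$ each. Replace each of $\sigma_{12},\sigma_{34}$ by the arc of circle with the same endpoints, lying outside $B$, such that the region between it and the replaced arc has area $|\Omega^{OUT}|/2$; replace each of $\sigma_{23},\sigma_{41}$ by the arc of circle with the same endpoints, lying inside $B$, such that the region between it and the replaced arc has area $|\Omega^{IN}|/2$. $\Omega^*$ is the set bounded by the four resulting arcs. General case: the same construction, except that consecutive arcs among the two of length $\gamma^{OUT}/2$ and the two of length $\gamma^{IN}/2$ (taken alternately around $\partial B$) are separated by four congruent arcs of $\partial B$, of length $(2\pi-\gamma^{IN}-\gamma^{OUT})/4$ each, which are kept unchanged as part of $\partial\Omega^*$. Thus $\Omega^*$ has two orthogonal axes of symmetry and $|\Omega^*|=\pi$. Convention: the rearrangement is only considered for sets with $|\Omega\Delta B|$ small enough and such that this construction is possible. *)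

theory Defs
  imports "HOL-Analysis.Analysis"
begin

text \<open>
  The Euclidean plane is \<open>real \<times> real\<close>, whose norm is the Euclidean one and whose \<open>lborel\<close> is
  the product Lebesgue measure.
\<close>

type_synonym plane = "real \<times> real"


subsection \<open>De Giorgi perimeter\<close>

definition divergence :: "('a::euclidean_space \<Rightarrow> 'a) \<Rightarrow> 'a \<Rightarrow> real" where
  "divergence \<phi> x = (\<Sum>b\<in>Basis. frechet_derivative \<phi> (at x) b \<bullet> b)"

text \<open>Compactly supported \<open>C\<^sup>1\<close> vector fields bounded by 1 in Euclidean norm.\<close>

definition test_fields :: "('a::euclidean_space \<Rightarrow> 'a) set" where
  "test_fields =
     {\<phi>. (\<forall>x. \<phi> differentiable (at x)) \<and>
         (\<forall>v. continuous_on UNIV (\<lambda>x. frechet_derivative \<phi> (at x) v)) \<and>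
         compact (closure {x. \<phi> x \<noteq> 0}) \<and>
         (\<forall>x. norm (\<phi> x) \<le> 1)}"

definition perimeter :: "'a::euclidean_space set \<Rightarrow> ereal" where
  "perimeter E = (SUP \<phi>\<in>test_fields. ereal (LINT x:E|lborel. divergence \<phi> x))"


subsection \<open>One-dimensional Hausdorff measure\<close>

text \<open>
  Normalised so that the measure of a rectifiable Jordan arc is its length.  The covering sets are
  required to be bounded because \<open>diameter\<close> is unspecified on unbounded sets.
\<close>

definition hausdorff1_content :: "real \<Rightarrow> 'a::metric_space set \<Rightarrow> ennreal" where
  "hausdorff1_content d A =
     (INF U\<in>{U :: nat \<Rightarrow> 'a set. A \<subseteq> (\<Union>n. U n) \<and> (\<forall>n. bounded (U n) \<and> diameter (U n) \<le> d)}.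
        \<Sum>n. ennreal (diameter (U n)))"

definition hausdorff1 :: "'a::metric_space set \<Rightarrow> ennreal" where
  "hausdorff1 A = (SUP d\<in>{0<..}. hausdorff1_content d A)"


subsection \<open>Isoperimetric deficit, Fraenkel asymmetry and their quotient\<close>

definition eq_radius :: "plane set \<Rightarrow> real" where
  "eq_radius E = sqrt (measure lborel E / pi)"

lemma measure_ball_eq_radius: "measure lborel (ball x (eq_radius E)) = measure lborel E"
  for x :: plane
  by (simp add: eq_radius_def content_ball unit_ball_vol_2 eval_nat_numeral(3)[symmetric])

definition iso_deficit :: "plane set \<Rightarrow> ereal" where
  "iso_deficit E =
     (perimeter E - perimeter (ball (0::plane) (eq_radius E))) / perimeter (ball (0::plane) (eq_radius E))"

definition asymmetry :: "plane set \<Rightarrow> real" where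
  "asymmetry E = (INF x. measure lborel (sym_diff E (ball x (eq_radius E))) / measure lborel E)"

text \<open>Only meaningful when \<open>E\<close> is not (equivalent to) a ball, i.e. when \<open>asymmetry E > 0\<close>.\<close>

definition iso_quotient :: "plane set \<Rightarrow> ereal" where
  "iso_quotient E = iso_deficit E / ereal ((asymmetry E)\<^sup>2)"


subsection \<open>Circular arcs\<close>

definition circ_point :: "plane \<Rightarrow> real \<Rightarrow> real \<Rightarrow> plane" where
  "circ_point c r t = c + r *\<^sub>R (cos t, sin t)"

definition circ_arc :: "plane \<Rightarrow> real \<Rightarrow> real \<Rightarrow> real \<Rightarrow> plane set" where
  "circ_arc c r u v = circ_point c r ` {u..v}"

text \<open>
  \<open>\<tau>\<close> is an arc of a circle with endpoints \<open>p\<close> and \<open>q\<close>; the straight segment is admitted as the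
  arc of infinite radius.
\<close>

definition arc_between :: "plane set \<Rightarrow> plane \<Rightarrow> plane \<Rightarrow> bool" where
  "arc_between \<tau> p q \<longleftrightarrow>
     (\<exists>c r u v. 0 < r \<and> u < v \<and> v < u + 2 * pi \<and>
        \<tau> = circ_arc c r u v \<and> {p, q} = {circ_point c r u, circ_point c r v}) \<or>
     \<tau> = closed_segment p q"


subsection \<open>The rearrangement with respect to a disc of area \<open>pi\<close>\<close>

definition gamma_out :: "plane set \<Rightarrow> plane set \<Rightarrow> real" where
  "gamma_out B \<Omega> = enn2real (hausdorff1 (frontier (\<Omega> - B) - frontier \<Omega>))"

definition gamma_in :: "plane set \<Rightarrow> plane set \<Rightarrow> real" where
  "gamma_in B \<Omega> = enn2real (hausdorff1 (frontier (B - \<Omega>) - frontier \<Omega>))"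

text \<open>
  \<open>\<tau>\<close> is an arc with the same endpoints as the arc \<open>circ_arc c 1 u v\<close> of the unit circle around
  \<open>c\<close>, lies outside (inside) the unit disc, and encloses area \<open>m\<close> together with the replaced arc;
  \<open>inside\<close> is the union of the bounded components of the complement.
\<close>

definition outer_replacement :: "plane \<Rightarrow> real \<Rightarrow> real \<Rightarrow> real \<Rightarrow> plane set \<Rightarrow> bool" where
  "outer_replacement c u v m \<tau> \<longleftrightarrow>
     arc_between \<tau> (circ_point c 1 u) (circ_point c 1 v) \<and>
     \<tau> \<inter> ball c 1 = {} \<and>
     measure lborel (inside (circ_arc c 1 u v \<union> \<tau>)) = m"

definition inner_replacement :: "plane \<Rightarrow> real \<Rightarrow> real \<Rightarrow> real \<Rightarrow> plane set \<Rightarrow> bool" where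
  "inner_replacement c u v m \<tau> \<longleftrightarrow>
     arc_between \<tau> (circ_point c 1 u) (circ_point c 1 v) \<and>
     \<tau> \<subseteq> cball c 1 \<and>
     measure lborel (inside (circ_arc c 1 u v \<union> \<tau>)) = m"

text \<open>
  \<open>S\<close> is a rearrangement of \<open>\<Omega>\<close> with respect to \<open>B\<close>.  It is a relation because the position of the
  first arc on the circle is a free choice (the angle \<open>t0\<close>) and because the construction need not be
  possible.  On the unit circle arc length equals angle; going round counterclockwise from \<open>t0\<close> one
  meets the arcs
    \<open>[t0,t1]\<close> (length \<open>gamma_out/2\<close>), \<open>[t1,t2]\<close> (kept), \<open>[t2,t3]\<close> (length \<open>gamma_in/2\<close>), \<open>[t3,t4]\<close> (kept),
    \<open>[t4,t5]\<close> (length \<open>gamma_out/2\<close>), \<open>[t5,t6]\<close> (kept), \<open>[t6,t7]\<close> (length \<open>gamma_in/2\<close>), \<open>[t7,t8]\<close> (kept),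
  and \<open>t8 = t0 + 2 * pi\<close>.  In the transversal case \<open>gamma_out + gamma_in = 2 * pi\<close>, the kept arcs
  are single points.
\<close>

definition rearrangement :: "plane set \<Rightarrow> plane set \<Rightarrow> plane set \<Rightarrow> bool" where
  "rearrangement B \<Omega> S \<longleftrightarrow>
     (\<exists>c t0 t1 t2 t3 t4 t5 t6 t7 t8 \<tau>12 \<tau>23 \<tau>34 \<tau>41.
        let gout = gamma_out B \<Omega>; gin = gamma_in B \<Omega>; s = (2 * pi - gin - gout) / 4;
            aout = measure lborel (\<Omega> - B); ain = measure lborel (B - \<Omega>)
        in
        B = ball c 1 \<and>
        t1 = t0 + gout / 2 \<and> t2 = t1 + s \<and> t3 = t2 + gin / 2 \<and> t4 = t3 + s \<and>
        t5 = t4 + gout / 2 \<and> t6 = t5 + s \<and> t7 = t6 + gin / 2 \<and> t8 = t7 + s \<and>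
        outer_replacement c t0 t1 (aout / 2) \<tau>12 \<and>
        inner_replacement c t2 t3 (ain / 2) \<tau>23 \<and>
        outer_replacement c t4 t5 (aout / 2) \<tau>34 \<and>
        inner_replacement c t6 t7 (ain / 2) \<tau>41 \<and>
        S = inside (\<tau>12 \<union> circ_arc c 1 t1 t2 \<union> \<tau>23 \<union> circ_arc c 1 t3 t4 \<union>
                    \<tau>34 \<union> circ_arc c 1 t5 t6 \<union> \<tau>41 \<union> circ_arc c 1 t7 t8))"

end

theory Submission
  imports Defs
begin

text \<open>
  The perimeter of the rearranged set is bounded from below by calibration.  On each lune between
  the unit circle and a replacing arc take the unit vector field that is invariant under translations along the
  axis of the lune and normal to the circular arcs of a fixed curvature \<open>\<kappa>\<close>; its divergence is the
  constant \<open>\<kappa>\<close>.  With curvature 1 on the kept arcs, these fields are glued together away from small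
  neighbourhoods of the corners, which cost nothing in the limit.  If the four arcs subtend the angles
  \<open>2a, 2b, 2a, 2b\<close>, the divergence theorem on the disc gives
  \<open>P \<ge> 2pi + 2((\<kappa>\<^sub>1 - \<kappa>\<^sub>2)\<epsilon> + (F\<^sub>a(\<kappa>\<^sub>1) - 2a) + (F\<^sub>b(\<kappa>\<^sub>2) - 2b))\<close>,
  where \<open>F\<^sub>a(\<kappa>)\<close> is the flux of the field through an arc of the circle and
  \<open>2a - F\<^sub>a(1 + h) = (tan a - a) h\<^sup>2 + O(h\<^sup>3)\<close>.
  Optimising in the curvatures leaves the excess \<open>\<epsilon>\<^sup>2/2 * (1/(tan a - a) + 1/(tan b - b))\<close>.  Since \<open>a + b \<le> pi/2\<close>
  and \<open>1/(tan x - x)\<close> is convex and decreasing, this is smallest at \<open>a = b = pi/4\<close>, where it equals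
  \<open>4\<epsilon>\<^sup>2/(4 - pi)\<close>.  Testing the asymmetry with the original disc gives at most \<open>4\<epsilon>/pi\<close>.
\<close>

subsection \<open>Continuously differentiable cutoffs\<close>

text \<open>Each admissible field bounds a De Giorgi perimeter from below, so no regularity theory
  for the rearranged set enters. Inside the disc, away from the inner lunes, the field is an
  arbitrary interpolation: the divergence theorem is applied to the disc alone, where only boundary
  values count, and each lune contributes its area times the constant divergence. No flux through a
  replacing arc is ever computed.

  Three obstacles shape the rest. The set is given as \<open>inside\<close> of a closed curve, so
  its decomposition into disc and lunes has to be extracted from theorems on theta curves. A
  replacing arc may be longer than a half circle, so its area must be used to keep it in the strip
  where the square root in the field is smooth. Finally the angles depend on \<epsilon> and may
  degenerate to 0 or \<open>pi/2\<close>, while the remainder must be of order \<epsilon>^3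
  uniformly in them; this forces the case distinction in the choice of the curvatures.\<close>

definition C1_on :: "'a::euclidean_space set \<Rightarrow> ('a \<Rightarrow> 'b::real_normed_vector) \<Rightarrow> bool" where
  "C1_on V f \<longleftrightarrow> (\<forall>x\<in>V. f differentiable (at x)) \<and>
     (\<forall>v. continuous_on V (\<lambda>x. frechet_derivative f (at x) v))"

lemma C1_onI:
  assumes "\<And>x. x \<in> V \<Longrightarrow> (f has_derivative f' x) (at x)" "\<And>v. continuous_on V (\<lambda>x. f' x v)"
  shows "C1_on V f"
  unfolding C1_on_def
proof (intro conjI ballI allI)
  show "f differentiable at x" if "x \<in> V" for x
    using assms(1)[OF that] by (auto simp: differentiable_def)
  show "continuous_on V (\<lambda>x. frechet_derivative f (at x) v)" for v
    by (rule continuous_on_eq[OF assms(2)[of v]]) (simp add: frechet_derivative_at[OF assms(1)])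
qed

lemma C1_on_has_derivative:
  "C1_on V f \<Longrightarrow> x \<in> V \<Longrightarrow> (f has_derivative frechet_derivative f (at x)) (at x)"
  by (simp add: C1_on_def frechet_derivative_works)

lemma C1_on_frechet_continuous:
  "C1_on V f \<Longrightarrow> continuous_on V (\<lambda>x. frechet_derivative f (at x) v)"
  by (simp add: C1_on_def)

lemma C1_on_continuous_on: "C1_on V f \<Longrightarrow> continuous_on V f"
  by (meson C1_on_has_derivative continuous_at_imp_continuous_on has_derivative_continuous)

lemma C1_on_subset: "C1_on V f \<Longrightarrow> U \<subseteq> V \<Longrightarrow> C1_on U f"
  unfolding C1_on_def by (meson continuous_on_subset subsetD)

lemma C1_on_const: "C1_on V (\<lambda>x. c)"
  by (rule C1_onI[where f'="\<lambda>x v. 0"]) (auto)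

lemma C1_on_scaleR:
  assumes "C1_on V f" "C1_on V g"
  shows "C1_on V (\<lambda>x. f x *\<^sub>R g x)"
proof (rule C1_onI)
  show "((\<lambda>x. f x *\<^sub>R g x) has_derivative
      (\<lambda>h. f x *\<^sub>R frechet_derivative g (at x) h + frechet_derivative f (at x) h *\<^sub>R g x)) (at x)"
    if "x \<in> V" for x
    using assms that by (intro has_derivative_scaleR C1_on_has_derivative)
  show "continuous_on V (\<lambda>x. f x *\<^sub>R frechet_derivative g (at x) v + frechet_derivative f (at x) v *\<^sub>R g x)" for v
    using assms by (intro continuous_intros C1_on_continuous_on C1_on_frechet_continuous)
qed

lemma C1_on_mult:
  fixes f g :: "'a::euclidean_space \<Rightarrow> real"
  shows "C1_on V f \<Longrightarrow> C1_on V g \<Longrightarrow> C1_on V (\<lambda>x. f x * g x)"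
  using C1_on_scaleR[of V f g] by simp

lemma C1_on_add:
  assumes "C1_on V f" "C1_on V g"
  shows "C1_on V (\<lambda>x. f x + g x)"
proof (rule C1_onI)
  show "((\<lambda>x. f x + g x) has_derivative
      (\<lambda>h. frechet_derivative f (at x) h + frechet_derivative g (at x) h)) (at x)"
    if "x \<in> V" for x
    using assms that by (intro has_derivative_add C1_on_has_derivative)
  show "continuous_on V (\<lambda>x. frechet_derivative f (at x) v + frechet_derivative g (at x) v)" for v
    using assms by (intro continuous_intros C1_on_frechet_continuous)
qed

lemma C1_on_diff_const:
  fixes f :: "'a::euclidean_space \<Rightarrow> real"
  assumes "C1_on V f"
  shows "C1_on V (\<lambda>x. c - f x)"
  using C1_on_add[OF C1_on_const[of V c] C1_on_scaleR[OF C1_on_const[of V "-1"] assms]] by simp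

lemma C1_on_sum:
  "finite I \<Longrightarrow> (\<And>i. i \<in> I \<Longrightarrow> C1_on V (f i)) \<Longrightarrow> C1_on V (\<lambda>x. \<Sum>i\<in>I. f i x)"
  by (induction I rule: finite_induct) (auto intro: C1_on_const C1_on_add)

lemma C1_on_prod:
  fixes f :: "'i \<Rightarrow> 'a::euclidean_space \<Rightarrow> real"
  shows "finite I \<Longrightarrow> (\<And>i. i \<in> I \<Longrightarrow> C1_on V (f i)) \<Longrightarrow> C1_on V (\<lambda>x. \<Prod>i\<in>I. f i x)"
  by (induction I rule: finite_induct) (auto intro: C1_on_const C1_on_mult)

lemma C1_on_compose_real:
  fixes s :: "real \<Rightarrow> real"
  assumes f: "C1_on V f" and s: "\<And>t. (s has_real_derivative s' t) (at t)" and s': "continuous_on UNIV s'"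
  shows "C1_on V (\<lambda>x. s (f x))"
proof (rule C1_onI)
  show "((\<lambda>x. s (f x)) has_derivative (\<lambda>h. s' (f x) * frechet_derivative f (at x) h)) (at x)"
    if "x \<in> V" for x
    using diff_chain_at[OF C1_on_has_derivative[OF f that] s[of "f x", unfolded has_field_derivative_def]]
    by (simp add: o_def)
  show "continuous_on V (\<lambda>x. s' (f x) * frechet_derivative f (at x) v)" for v
    using assms
    by (intro continuous_on_mult continuous_on_compose2[OF s'] C1_on_continuous_on C1_on_frechet_continuous) auto
qed

lemma has_derivative_sqdist:
  "((\<lambda>x. (norm (x - p))\<^sup>2) has_derivative (\<lambda>h. 2 * ((x - p) \<bullet> h))) (at x)"
  unfolding power2_norm_eq_inner
  by (auto intro!: derivative_eq_intros simp: inner_commute)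

lemma C1_on_sqdist: "C1_on V (\<lambda>x. (norm (x - p))\<^sup>2)"
  by (rule C1_onI[OF has_derivative_sqdist]) (intro continuous_intros)

lemma C1_on_transform:
  assumes "open V" "\<And>x. x \<in> V \<Longrightarrow> f x = g x" "C1_on V f"
  shows "C1_on V g"
proof (rule C1_onI)
  show "(g has_derivative frechet_derivative f (at x)) (at x)" if "x \<in> V" for x
    using has_derivative_transform_within_open[OF C1_on_has_derivative[OF assms(3) that] assms(1) that] assms(2)
    by auto
  show "continuous_on V (\<lambda>x. frechet_derivative f (at x) v)" for v
    by (intro C1_on_frechet_continuous assms)
qed

lemma C1_on_Un:
  assumes "open U" "open V" "C1_on U f" "C1_on V f"
  shows "C1_on (U \<union> V) f"
  using assms unfolding C1_on_def by (auto intro: continuous_on_open_Un)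

text \<open>Off the closed support the function is locally 0, hence C1; the two open sets cover the
  space.\<close>

lemma C1_on_extend_zero:
  assumes "open V" "C1_on V f" "closure {x. f x \<noteq> 0} \<subseteq> V"
  shows "C1_on UNIV f"
proof -
  have "C1_on (- closure {x. f x \<noteq> 0}) f"
    by (rule C1_on_transform[OF _ _ C1_on_const[of _ 0]]) (use closure_subset[of "{x. f x \<noteq> 0}"] in \<open>auto simp: open_Compl\<close>)
  then have "C1_on (V \<union> - closure {x. f x \<noteq> 0}) f"
    by (intro C1_on_Un assms) auto
  moreover have "V \<union> - closure {x. f x \<noteq> 0} = UNIV" using assms(3) by auto
  ultimately show ?thesis by metis
qed

text \<open>Test fields are only C1, so squares of positive parts replace the usual exponentials.
  The bound \<open>M\<close> on the derivative is what the shrinking point cutoffs consume.\<close>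

lemma C1_step_exists:
  obtains s s' :: "real \<Rightarrow> real" and M where
    "\<And>t. (s has_real_derivative s' t) (at t)" "continuous_on UNIV s'"
    "\<And>t. 0 \<le> s t" "\<And>t. s t \<le> 1" "\<And>t. t \<le> 0 \<Longrightarrow> s t = 0" "\<And>t. 1 \<le> t \<Longrightarrow> s t = 1"
    "\<And>t. \<bar>s' t\<bar> \<le> M" "\<And>t. t \<notin> {0..1} \<Longrightarrow> s' t = 0"
proof -
  define q where "q = (\<lambda>t::real. (max 0 t)\<^sup>2)"
  have dq: "(q has_real_derivative 2 * max 0 t) (at t)" for t
  proof (cases "t = 0")
    case True
    \<comment> \<open>At 0 the difference quotient of \<open>q\<close> is \<open>max 0 h\<close>,
      which tends to 0.\<close>
    have "((\<lambda>h. max 0 h) \<longlongrightarrow> max 0 0) (at (0::real))"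
      by (intro tendsto_intros)
    moreover have "eventually (\<lambda>h. (q (0 + h) - q 0) / h = max 0 h) (at (0::real))"
      by (auto simp: eventually_at_filter q_def power2_eq_square max_def)
    ultimately have "((\<lambda>h. (q (0 + h) - q 0) / h) \<longlongrightarrow> 0) (at 0)"
      using tendsto_cong by fastforce
    then show ?thesis by (simp add: True DERIV_def)
  next
    case False
    show ?thesis
    proof (cases "t > 0")
      case True
      have "((\<lambda>t. t\<^sup>2) has_real_derivative 2 * max 0 t) (at t)"
        using True by (auto intro!: derivative_eq_intros)
      then show ?thesis
        by (rule has_field_derivative_transform_within_open[where S="{0<..}"]) (use True in \<open>auto simp: q_def\<close>)
    next
      case F: False
      have "((\<lambda>t. 0) has_real_derivative 2 * max 0 t) (at t)"
        using F by (auto intro!: derivative_eq_intros)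
      then show ?thesis
        by (rule has_field_derivative_transform_within_open[where S="{..<0}"]) (use F False in \<open>auto simp: q_def\<close>)
    qed
  qed
  \<comment> \<open>\<open>t\<close> and \<open>1 - t\<close> cannot both be nonpositive.\<close>
  have pos: "q t + q (1 - t) > 0" for t
    by (cases "t > 0") (auto simp: q_def max_def add_pos_nonneg add_nonneg_pos)
  define s where "s = (\<lambda>t. q t / (q t + q (1 - t)))"
  define s' where "s' = (\<lambda>t. (2 * max 0 t * q (1 - t) + q t * (2 * max 0 (1 - t))) / (q t + q (1 - t))\<^sup>2)"
  have cq: "continuous_on A q" for A unfolding q_def by (intro continuous_intros)
  have cs': "continuous_on A s'" for A
    unfolding s'_def
    by (intro continuous_intros continuous_on_compose2[OF cq[of UNIV]])
       (use pos in \<open>auto simp: less_le\<close>)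
  have ds: "(s has_real_derivative s' t) (at t)" for t
  proof -
    have "((\<lambda>t. 1 - t) has_real_derivative - 1) (at t)" by (auto intro!: derivative_eq_intros)
    from DERIV_chain2[where f=q and g="\<lambda>t. 1 - t", OF dq this]
    have d1: "((\<lambda>t. q (1 - t)) has_real_derivative - (2 * max 0 (1 - t))) (at t)" by simp
    have "(s has_real_derivative ((2 * max 0 t) * (q t + q (1 - t)) - q t * (2 * max 0 t + - (2 * max 0 (1 - t))))
        / ((q t + q (1 - t)) * (q t + q (1 - t)))) (at t)"
      unfolding s_def by (rule DERIV_divide[OF dq DERIV_add[OF dq d1]]) (use pos[of t] in auto)
    moreover have "(2 * max 0 t) * (q t + q (1 - t)) - q t * (2 * max 0 t + - (2 * max 0 (1 - t)))
       = 2 * max 0 t * q (1 - t) + q t * (2 * max 0 (1 - t))"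
      by (simp add: algebra_simps)
    ultimately show ?thesis unfolding s'_def power2_eq_square by simp
  qed
  have z: "s' t = 0" if "t \<notin> {0..1}" for t
    using that by (auto simp: s'_def q_def)
  obtain M where M: "\<And>t. t \<in> {0..1} \<Longrightarrow> \<bar>s' t\<bar> \<le> M"
    using compact_imp_bounded[OF compact_continuous_image[OF cs'[of "{0..1}"] compact_Icc]]
    unfolding bounded_iff by (metis imageI real_norm_def)
  have M': "\<bar>s' t\<bar> \<le> M" for t
  proof (cases "t \<in> {0..1}")
    case False
    then show ?thesis using z[of t] M[of 0] by simp
  qed (use M in auto)
  have q0: "q t \<ge> 0" for t by (simp add: q_def)
  have "0 \<le> s t" "s t \<le> 1" for t
    using pos[of t] q0 by (auto simp: s_def divide_simps)
  moreover have "s t = 0" if "t \<le> 0" for t using that by (simp add: s_def q_def)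
  moreover have "s t = 1" if "t \<ge> 1" for t using that pos[of t] by (simp add: s_def q_def)
  ultimately show ?thesis
    using M' z cs'[of UNIV] ds by (intro that[of s s' M])
qed

text \<open>Finitely many balls cover \<open>K\<close> while their doubles stay in \<open>W\<close>.
  With a bump \<open>h p\<close> for each ball, \<open>1 - (\<Prod>p\<in>F. 1 - h p x)\<close> is 1
  as soon as one bump is 1 and vanishes where all of them do; no distance function, which would not
  be C1, is involved.\<close>

lemma C1_Urysohn:
  fixes K W :: "'a::euclidean_space set"
  assumes "compact K" "open W" "K \<subseteq> W"
  obtains \<eta> :: "'a \<Rightarrow> real" where "C1_on UNIV \<eta>" "\<And>x. 0 \<le> \<eta> x" "\<And>x. \<eta> x \<le> 1"
    "\<And>x. x \<in> K \<Longrightarrow> \<eta> x = 1" "compact (closure {x. \<eta> x \<noteq> 0})" "closure {x. \<eta> x \<noteq> 0} \<subseteq> W"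
proof -
  obtain s s' :: "real \<Rightarrow> real" and M where s: "\<And>t. (s has_real_derivative s' t) (at t)" "continuous_on UNIV s'"
    "\<And>t. 0 \<le> s t" "\<And>t. s t \<le> 1" "\<And>t. t \<le> 0 \<Longrightarrow> s t = 0" "\<And>t. 1 \<le> t \<Longrightarrow> s t = 1"
    by (rule C1_step_exists) blast
  have "\<forall>x\<in>K. \<exists>r>0. cball x (2 * r) \<subseteq> W"
  proof
    fix x assume "x \<in> K"
    then obtain e where "e > 0" "cball x e \<subseteq> W" using assms open_contains_cball by blast
    then show "\<exists>r>0. cball x (2 * r) \<subseteq> W" by (intro exI[of _ "e/2"]) auto
  qed
  then obtain r where r: "\<And>x. x \<in> K \<Longrightarrow> r x > 0" "\<And>x. x \<in> K \<Longrightarrow> cball x (2 * r x) \<subseteq> W" by metis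
  have "K \<subseteq> (\<Union>x\<in>K. ball x (r x))" using r(1) by force
  then obtain F where F: "F \<subseteq> K" "finite F" "K \<subseteq> (\<Union>x\<in>F. ball x (r x))"
    using compactE_image[OF assms(1), of K "\<lambda>x. ball x (r x)"] by (metis open_ball)
  \<comment> \<open>The argument of \<open>s\<close> is at least 1 for
    \<open>norm (x - p) \<le> r p\<close> and at most 0 from \<open>sqrt 2 * r p\<close> on, hence
    outside the ball of radius \<open>2 * r p\<close>.\<close>
  define h where "h = (\<lambda>p x. s (2 + - 1 / (r p)\<^sup>2 * (norm (x - p))\<^sup>2))"
  define \<eta> where "\<eta> = (\<lambda>x. 1 - (\<Prod>p\<in>F. 1 - h p x))"
  have h1: "h p x = 1" if "p \<in> F" "x \<in> ball p (r p)" for p x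
  proof -
    have "norm (x - p) \<le> r p" using that by (simp add: dist_norm norm_minus_commute)
    then have "(norm (x - p))\<^sup>2 \<le> (r p)\<^sup>2" by (simp add: power_mono)
    moreover have "r p > 0" using r F that by auto
    ultimately show ?thesis unfolding h_def by (intro s(6)) (simp add: divide_simps)
  qed
  have h0: "h p x = 0" if "p \<in> F" "x \<notin> cball p (2 * r p)" for p x
  proof -
    have rp: "r p > 0" using r F that by auto
    have "2 * r p \<le> norm (x - p)" using that by (simp add: dist_norm norm_minus_commute)
    then have "(2 * r p)\<^sup>2 \<le> (norm (x - p))\<^sup>2" using rp by (intro power_mono) auto
    moreover have "(r p)\<^sup>2 > 0" using rp by simp
    moreover have "(2 * r p)\<^sup>2 = 4 * (r p)\<^sup>2" by (simp add: power_mult_distrib)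
    ultimately have "2 * (r p)\<^sup>2 \<le> (norm (x - p))\<^sup>2" by linarith
    then show ?thesis unfolding h_def using rp by (intro s(5)) (simp add: divide_simps)
  qed
  have h01: "0 \<le> h p x" "h p x \<le> 1" for p x by (auto simp: h_def s)
  have ch: "C1_on V (h p)" for V p
    unfolding h_def
    by (rule C1_on_compose_real[OF _ s(1,2)])
       (intro C1_on_add C1_on_const C1_on_mult C1_on_sqdist)
  have sub: "closure {x. \<eta> x \<noteq> 0} \<subseteq> (\<Union>p\<in>F. cball p (2 * r p))"
  proof (rule closure_minimal)
    show "{x. \<eta> x \<noteq> 0} \<subseteq> (\<Union>p\<in>F. cball p (2 * r p))"
    proof
      fix x assume x: "x \<in> {x. \<eta> x \<noteq> 0}"
      show "x \<in> (\<Union>p\<in>F. cball p (2 * r p))"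
      proof (rule ccontr)
        assume "x \<notin> (\<Union>p\<in>F. cball p (2 * r p))"
        then have "\<And>p. p \<in> F \<Longrightarrow> h p x = 0" using h0 by blast
        then show False using x by (simp add: \<eta>_def)
      qed
    qed
    show "closed (\<Union>p\<in>F. cball p (2 * r p))" using F by auto
  qed
  have cpt: "compact (\<Union>p\<in>F. cball p (2 * r p))" using F by auto
  show ?thesis
  proof (rule that[of \<eta>])
    show "C1_on UNIV \<eta>" unfolding \<eta>_def
      by (intro C1_on_diff_const C1_on_prod F ch)
    show "0 \<le> \<eta> x" for x
      using prod_le_1[of F "\<lambda>p. 1 - h p x"] h01 by (simp add: \<eta>_def)
    show "\<eta> x \<le> 1" for x
      using prod_nonneg[of F "\<lambda>p. 1 - h p x"] h01 by (simp add: \<eta>_def)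
    show "\<eta> x = 1" if "x \<in> K" for x
    proof -
      obtain p where "p \<in> F" "x \<in> ball p (r p)" using F(3) \<open>x \<in> K\<close> by blast
      then have "(\<Prod>p\<in>F. 1 - h p x) = 0" using h1[of p x] F by (intro prod_zero) auto
      then show ?thesis by (simp add: \<eta>_def)
    qed
    show "compact (closure {x. \<eta> x \<noteq> 0})"
      using bounded_subset[OF compact_imp_bounded[OF cpt] sub] by (simp add: compact_eq_bounded_closed)
    show "closure {x. \<eta> x \<noteq> 0} \<subseteq> W"
      using sub r F by fastforce
  qed
qed

text \<open>A corner costs nothing in the plane: a gradient of order \<open>n\<close> on a disc of
  area of order \<open>1/n^2\<close> has integral of order \<open>1/n\<close>. The majorant
  \<open>G\<close> is kept apart from the gradient so that its integral can be computed
  exactly.\<close>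

lemma point_cutoff_single:
  fixes p :: plane
  obtains z :: "nat \<Rightarrow> plane \<Rightarrow> real" and G :: "nat \<Rightarrow> plane \<Rightarrow> real" where
    "\<And>n. C1_on UNIV (z n)" "\<And>n x. 0 \<le> z n x" "\<And>n x. z n x \<le> 1"
    "\<And>n. \<exists>U. open U \<and> p \<in> U \<and> (\<forall>x\<in>U. z n x = 0)"
    "\<And>x. x \<noteq> p \<Longrightarrow> (\<lambda>n. z n x) \<longlonglongrightarrow> 1"
    "\<And>n x v. \<bar>frechet_derivative (z n) (at x) v\<bar> \<le> G n x * norm v"
    "\<And>n x. 0 \<le> G n x"
    "\<And>n. integrable lborel (G n)" "(\<lambda>n. \<integral>x. G n x \<partial>lborel) \<longlonglongrightarrow> 0"
proof -
  obtain s s' :: "real \<Rightarrow> real" and M where s: "\<And>t. (s has_real_derivative s' t) (at t)" "continuous_on UNIV s'"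
    "\<And>t. 0 \<le> s t" "\<And>t. s t \<le> 1" "\<And>t. t \<le> 0 \<Longrightarrow> s t = 0" "\<And>t. 1 \<le> t \<Longrightarrow> s t = 1"
    "\<And>t. \<bar>s' t\<bar> \<le> M" "\<And>t. t \<notin> {0..1} \<Longrightarrow> s' t = 0"
    by (rule C1_step_exists) blast
  have M0: "M \<ge> 0" using s(7)[of 0] by linarith
  \<comment> \<open>With \<open>k = Suc n\<close> the cutoff is 0 for
    \<open>norm (x - p) \<le> 1/k\<close> and 1 from \<open>sqrt 2 / k\<close> on. On the transition
    \<open>k * norm (x - p) \<le> 2\<close>, so the gradient is at most
    \<open>M * k^2 * 2 * norm (x - p) \<le> 4 * M * k\<close>, the height of
    \<open>G\<close>.\<close>
  define z where "z = (\<lambda>n x. s (-1 + (real (Suc n))\<^sup>2 * (norm (x - p))\<^sup>2))"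
  define G where "G = (\<lambda>n x. 4 * M * real (Suc n) * indicator (cball p (2 / real (Suc n))) x :: real)"
  have der: "(z n has_derivative (\<lambda>v. s' (-1 + (real (Suc n))\<^sup>2 * (norm (x - p))\<^sup>2) *
        ((real (Suc n))\<^sup>2 * (2 * ((x - p) \<bullet> v))))) (at x)" for n x
  proof -
    have "((\<lambda>x. -1 + (real (Suc n))\<^sup>2 * (norm (x - p))\<^sup>2) has_derivative
       (\<lambda>v. (real (Suc n))\<^sup>2 * (2 * ((x - p) \<bullet> v)))) (at x)"
      by (rule has_derivative_eq_rhs[OF has_derivative_add[OF has_derivative_const
            has_derivative_mult_right[OF has_derivative_sqdist]]]) auto
    from diff_chain_at[OF this s(1)[unfolded has_field_derivative_def]]
    show ?thesis by (simp add: o_def z_def)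
  qed
  have lim: "(\<lambda>n. z n x) \<longlonglongrightarrow> 1" if "x \<noteq> p" for x
  proof -
    have "filterlim (\<lambda>n. real (Suc n)) at_top sequentially"
      by (rule filterlim_compose[OF filterlim_real_sequentially filterlim_Suc])
    then have "eventually (\<lambda>n. real (Suc n) \<ge> 2 / norm (x - p)) sequentially"
      by (simp add: filterlim_at_top)
    then have "eventually (\<lambda>n. z n x = 1) sequentially"
    proof eventually_elim
      case (elim n)
      have "2 \<le> real (Suc n) * norm (x - p)" using elim that by (simp add: divide_simps)
      then have "2\<^sup>2 \<le> (real (Suc n) * norm (x - p))\<^sup>2" by (intro power_mono) auto
      then show ?case unfolding z_def by (intro s(6)) (simp add: power_mult_distrib)
    qed
    then show ?thesis by (simp add: tendsto_eventually)
  qed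
  have bnd: "\<bar>frechet_derivative (z n) (at x) v\<bar> \<le> G n x * norm v" for n x v
  proof -
    let ?k = "real (Suc n)" let ?t = "-1 + ?k\<^sup>2 * (norm (x - p))\<^sup>2"
    have eq: "frechet_derivative (z n) (at x) v = s' ?t * (?k\<^sup>2 * (2 * ((x - p) \<bullet> v)))"
      using frechet_derivative_at[OF der, of n x] by metis
    show ?thesis
    proof (cases "?t \<in> {0..1}")
      case False
      then show ?thesis using s(8) eq M0 by (simp add: G_def)
    next
      case True
      then have "(?k * norm (x - p))\<^sup>2 \<le> 2\<^sup>2" by (simp add: power_mult_distrib)
      then have k: "?k * norm (x - p) \<le> 2" by (rule power2_le_imp_le) auto
      then have x: "x \<in> cball p (2 / ?k)" by (simp add: dist_norm norm_minus_commute divide_simps mult.commute)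
      have "\<bar>s' ?t * (?k\<^sup>2 * (2 * ((x - p) \<bullet> v)))\<bar> = \<bar>s' ?t\<bar> * (?k\<^sup>2 * (2 * \<bar>(x - p) \<bullet> v\<bar>))"
        by (simp add: abs_mult)
      also have "\<dots> \<le> M * (?k\<^sup>2 * (2 * (norm (x - p) * norm v)))"
        by (intro mult_mono s(7) mult_left_mono Cauchy_Schwarz_ineq2 M0) auto
      also have "\<dots> = 2 * M * ?k * (?k * norm (x - p)) * norm v" by (simp add: power2_eq_square)
      also have "\<dots> \<le> 2 * M * ?k * 2 * norm v"
        using M0 k by (intro mult_right_mono mult_left_mono) auto
      finally show ?thesis using eq x by (simp add: G_def)
    qed
  qed
  have Gint: "(\<integral>x. G n x \<partial>lborel) = 16 * M * pi * (1 / real (Suc n))" for n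
  proof -
    have "measure lborel (cball p (2 / real (Suc n))) = pi * (2 / real (Suc n))\<^sup>2"
      by (simp add: content_cball unit_ball_vol_2 eval_nat_numeral(3)[symmetric] power2_eq_square)
    then have "(\<integral>x. G n x \<partial>lborel) = 4 * M * real (Suc n) * (pi * (2 / real (Suc n))\<^sup>2)"
      unfolding G_def by simp
    then show ?thesis by (simp add: power2_eq_square del: of_nat_Suc)
  qed
  show ?thesis
  proof (rule that[of z G])
    show "C1_on UNIV (z n)" for n unfolding z_def
      by (rule C1_on_compose_real[OF _ s(1,2)]) (intro C1_on_add C1_on_mult C1_on_const C1_on_sqdist)
    show "0 \<le> z n x" "z n x \<le> 1" for n x by (auto simp: z_def s)
    show "\<exists>U. open U \<and> p \<in> U \<and> (\<forall>x\<in>U. z n x = 0)" for n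
    proof (intro exI[of _ "ball p (1 / real (Suc n))"] conjI ballI)
      fix x assume "x \<in> ball p (1 / real (Suc n))"
      then have "real (Suc n) * norm (x - p) \<le> 1"
        by (simp add: dist_norm norm_minus_commute divide_simps mult.commute)
      then have "(real (Suc n) * norm (x - p))\<^sup>2 \<le> 1" by (simp add: power_le_one)
      then show "z n x = 0" unfolding z_def by (intro s(5)) (simp add: power_mult_distrib)
    qed auto
    show "integrable lborel (G n)" for n unfolding G_def
      by (intro integrable_mult_right integrable_real_indicator) (use emeasure_bounded_finite[OF bounded_cball] in \<open>auto simp: less_top[symmetric]\<close>)
    show "(\<lambda>n. \<integral>x. G n x \<partial>lborel) \<longlonglongrightarrow> 0"
      unfolding Gint using tendsto_mult_right_zero[OF LIMSEQ_inverse_real_of_nat, of "16 * M * pi"]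
      by (simp add: inverse_eq_divide)
    show "0 \<le> G n x" for n x using M0 by (simp add: G_def)
  qed (use lim bnd in auto)
qed

text \<open>A product of cutoffs at single points; by the Leibniz rule and \<open>z \<le> 1\<close>
  the gradient majorants add.\<close>

lemma point_cutoff:
  fixes P :: "plane set"
  assumes "finite P"
  obtains z :: "nat \<Rightarrow> plane \<Rightarrow> real" and G :: "nat \<Rightarrow> plane \<Rightarrow> real" where
    "\<And>n. C1_on UNIV (z n)" "\<And>n x. 0 \<le> z n x" "\<And>n x. z n x \<le> 1"
    "\<And>n. \<exists>U. open U \<and> P \<subseteq> U \<and> (\<forall>x\<in>U. z n x = 0)"
    "\<And>x. x \<notin> P \<Longrightarrow> (\<lambda>n. z n x) \<longlonglongrightarrow> 1"
    "\<And>n x v. \<bar>frechet_derivative (z n) (at x) v\<bar> \<le> G n x * norm v"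
    "\<And>n x. 0 \<le> G n x"
    "\<And>n. integrable lborel (G n)" "(\<lambda>n. \<integral>x. G n x \<partial>lborel) \<longlonglongrightarrow> 0"
  using assms
proof (induction P arbitrary: thesis rule: finite_induct)
  case empty
  have "frechet_derivative (\<lambda>x. 1::real) (at x) v = 0" for x v :: plane
    using frechet_derivative_at[OF has_derivative_const, of "1::real" x] by metis
  then show ?case
    by (intro empty[of "\<lambda>n x. 1" "\<lambda>n x. 0"]) (auto intro: C1_on_const)
next
  case (insert p P)
  obtain z G where 1: "\<And>n. C1_on UNIV (z n)" "\<And>n x. 0 \<le> z n x" "\<And>n x. z n x \<le> 1"
    "\<And>n. \<exists>U. open U \<and> P \<subseteq> U \<and> (\<forall>x\<in>U. z n x = 0)"
    "\<And>x. x \<notin> P \<Longrightarrow> (\<lambda>n. z n x) \<longlonglongrightarrow> 1"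
    "\<And>n x v. \<bar>frechet_derivative (z n) (at x) v\<bar> \<le> G n x * norm v"
    "\<And>n x. 0 \<le> G n x"
    "\<And>n. integrable lborel (G n)" "(\<lambda>n. \<integral>x. G n x \<partial>lborel) \<longlonglongrightarrow> 0"
    by (rule insert.IH) blast
  obtain z' G' where 2: "\<And>n. C1_on UNIV (z' n)" "\<And>n x. 0 \<le> z' n x" "\<And>n x. z' n x \<le> 1"
    "\<And>n. \<exists>U. open U \<and> p \<in> U \<and> (\<forall>x\<in>U. z' n x = 0)"
    "\<And>x. x \<noteq> p \<Longrightarrow> (\<lambda>n. z' n x) \<longlonglongrightarrow> 1"
    "\<And>n x v. \<bar>frechet_derivative (z' n) (at x) v\<bar> \<le> G' n x * norm v"
    "\<And>n x. 0 \<le> G' n x"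
    "\<And>n. integrable lborel (G' n)" "(\<lambda>n. \<integral>x. G' n x \<partial>lborel) \<longlonglongrightarrow> 0"
    by (rule point_cutoff_single[of p]) blast
  show ?case
  proof (rule insert.prems[of "\<lambda>n x. z n x * z' n x" "\<lambda>n x. G n x + G' n x"])
    show "C1_on UNIV (\<lambda>x. z n x * z' n x)" for n by (intro C1_on_mult 1 2)
    show "0 \<le> z n x * z' n x" "z n x * z' n x \<le> 1" for n x
      using 1(2,3)[of n x] 2(2,3)[of n x] by (auto intro: mult_le_one)
    show "\<exists>U. open U \<and> insert p P \<subseteq> U \<and> (\<forall>x\<in>U. z n x * z' n x = 0)" for n
    proof -
      obtain U U' where "open U" "P \<subseteq> U" "\<forall>x\<in>U. z n x = 0" "open U'" "p \<in> U'" "\<forall>x\<in>U'. z' n x = 0"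
        using 1(4) 2(4) by metis
      then show ?thesis by (intro exI[of _ "U \<union> U'"]) auto
    qed
    show "(\<lambda>n. z n x * z' n x) \<longlonglongrightarrow> 1" if "x \<notin> insert p P" for x
      using tendsto_mult[OF 1(5) 2(5), of x x] that by simp
    show "\<bar>frechet_derivative (\<lambda>x. z n x * z' n x) (at x) v\<bar> \<le> (G n x + G' n x) * norm v" for n x v
    proof -
      have "((\<lambda>x. z n x * z' n x) has_derivative (\<lambda>v. z n x * frechet_derivative (z' n) (at x) v
         + frechet_derivative (z n) (at x) v * z' n x)) (at x)"
        by (rule has_derivative_mult[OF C1_on_has_derivative[OF 1(1) UNIV_I] C1_on_has_derivative[OF 2(1) UNIV_I]])
      from fun_cong[OF frechet_derivative_at[OF this], of v] have eq: "frechet_derivative (\<lambda>x. z n x * z' n x) (at x) v = z n x * frechet_derivative (z' n) (at x) v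
         + frechet_derivative (z n) (at x) v * z' n x" by (rule sym)
      have "\<bar>z n x * frechet_derivative (z' n) (at x) v\<bar> \<le> 1 * (G' n x * norm v)"
        unfolding abs_mult using 1(2,3) 2(6) by (intro mult_mono) auto
      moreover have "\<bar>frechet_derivative (z n) (at x) v * z' n x\<bar> \<le> (G n x * norm v) * 1"
        unfolding abs_mult using 2(2,3) 1(6,7) by (intro mult_mono) auto
      ultimately show ?thesis unfolding eq by (simp add: algebra_simps abs_le_iff)
    qed
    show "0 \<le> G n x + G' n x" for n x using 1(7) 2(7) by auto
    show "integrable lborel (\<lambda>x. G n x + G' n x)" for n using 1 2 by auto
    show "(\<lambda>n. \<integral>x. G n x + G' n x \<partial>lborel) \<longlonglongrightarrow> 0"
      using tendsto_add[OF 1(9) 2(9)] by (simp add: 1 2)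
  qed
qed

subsection \<open>Gluing calibrating fields\<close>

text \<open>\<open>C1_on\<close> asks for continuity of the derivative direction by direction
  precisely so that it matches the clause in \<open>test_fields\<close>.\<close>

lemma C1_imp_test_field:
  assumes "C1_on UNIV \<phi>" "compact (closure {x. \<phi> x \<noteq> 0})" "\<And>x. norm (\<phi> x) \<le> 1"
  shows "\<phi> \<in> test_fields"
  using assms by (auto simp: test_fields_def C1_on_def)

lemma disjoint_open_nbhds:
  fixes K :: "'i \<Rightarrow> 'a::euclidean_space set"
  assumes "finite I" "\<And>i. i \<in> I \<Longrightarrow> compact (K i)"
    "\<And>i j. i \<in> I \<Longrightarrow> j \<in> I \<Longrightarrow> i \<noteq> j \<Longrightarrow> K i \<inter> K j = {}"
  obtains W where "\<And>i. i \<in> I \<Longrightarrow> open (W i)" "\<And>i. i \<in> I \<Longrightarrow> K i \<subseteq> W i"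
    "\<And>i j. i \<in> I \<Longrightarrow> j \<in> I \<Longrightarrow> i \<noteq> j \<Longrightarrow> W i \<inter> W j = {}"
proof -
  have "\<forall>i j. \<exists>U V. i \<in> I \<longrightarrow> j \<in> I \<longrightarrow> i \<noteq> j \<longrightarrow>
      open U \<and> open V \<and> K i \<subseteq> U \<and> K j \<subseteq> V \<and> U \<inter> V = {}"
  proof (intro allI)
    fix i j
    show "\<exists>U V. i \<in> I \<longrightarrow> j \<in> I \<longrightarrow> i \<noteq> j \<longrightarrow>
      open U \<and> open V \<and> K i \<subseteq> U \<and> K j \<subseteq> V \<and> U \<inter> V = {}"
      using separation_normal_compact[of "K i" "K j"] assms(2,3) compact_imp_closed by metis
  qed
  then obtain U V where UV: "\<And>i j. i \<in> I \<Longrightarrow> j \<in> I \<Longrightarrow> i \<noteq> j \<Longrightarrow>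
      open (U i j) \<and> open (V i j) \<and> K i \<subseteq> U i j \<and> K j \<subseteq> V i j \<and> U i j \<inter> V i j = {}"
    by metis
  define W where "W i = (\<Inter>j\<in>I - {i}. U i j \<inter> V j i)" for i
  show ?thesis
  proof (rule that[of W])
    show "open (W i)" if "i \<in> I" for i
      unfolding W_def using UV that assms(1) by (intro open_INT) auto
    show "K i \<subseteq> W i" if "i \<in> I" for i
      unfolding W_def using UV that by blast
    show "W i \<inter> W j = {}" if "i \<in> I" "j \<in> I" "i \<noteq> j" for i j
    proof -
      have "W i \<subseteq> U i j" "W j \<subseteq> V i j" using that by (auto simp: W_def)
      then show ?thesis using UV[OF that] by blast
    qed
  qed
qed

text \<open>Outside \<open>U\<close> the compact sets \<open>K i\<close> are disjoint, so each field
  can be cut off inside its own neighbourhood, all neighbourhoods being disjoint; inside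
  \<open>U\<close>, where the pieces touch, the factor \<open>z\<close> removes everything. Hence
  the glued field agrees with \<open>z\<close> times the local field on the whole of each
  \<open>K i\<close>, and its norm never exceeds 1.\<close>

lemma glue_fields:
  fixes K V :: "'i \<Rightarrow> 'a::euclidean_space set" and n :: "'i \<Rightarrow> 'a \<Rightarrow> 'a" and z :: "'a \<Rightarrow> real"
  assumes I: "finite I" and K: "\<And>i. i \<in> I \<Longrightarrow> compact (K i)"
    and V: "\<And>i. i \<in> I \<Longrightarrow> open (V i)" "\<And>i. i \<in> I \<Longrightarrow> K i \<subseteq> V i"
    and n: "\<And>i. i \<in> I \<Longrightarrow> C1_on (V i) (n i)" "\<And>i x. i \<in> I \<Longrightarrow> x \<in> V i \<Longrightarrow> norm (n i x) \<le> 1"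
    and KU: "\<And>i j. i \<in> I \<Longrightarrow> j \<in> I \<Longrightarrow> i \<noteq> j \<Longrightarrow> K i \<inter> K j \<subseteq> U"
    and U: "open U" "\<And>x. x \<in> U \<Longrightarrow> z x = 0"
    and z: "C1_on UNIV z" "\<And>x. 0 \<le> z x" "\<And>x. z x \<le> 1"
  obtains \<phi> where "\<phi> \<in> test_fields" "\<And>i x. i \<in> I \<Longrightarrow> x \<in> K i \<Longrightarrow> \<phi> x = z x *\<^sub>R n i x"
proof -
  obtain W where W: "\<And>i. i \<in> I \<Longrightarrow> open (W i)" "\<And>i. i \<in> I \<Longrightarrow> K i - U \<subseteq> W i"
    "\<And>i j. i \<in> I \<Longrightarrow> j \<in> I \<Longrightarrow> i \<noteq> j \<Longrightarrow> W i \<inter> W j = {}"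
  proof (rule disjoint_open_nbhds[OF I, of "\<lambda>i. K i - U"])
    show "compact (K i - U)" if "i \<in> I" for i using K[OF that] U(1) by (rule compact_diff)
    show "(K i - U) \<inter> (K j - U) = {}" if "i \<in> I" "j \<in> I" "i \<noteq> j" for i j using KU[OF that] by blast
  qed blast
  have "\<forall>i\<in>I. \<exists>\<eta>::'a \<Rightarrow> real. C1_on UNIV \<eta> \<and> (\<forall>x. 0 \<le> \<eta> x) \<and> (\<forall>x. \<eta> x \<le> 1) \<and>
    (\<forall>x\<in>K i - U. \<eta> x = 1) \<and> compact (closure {x. \<eta> x \<noteq> 0}) \<and> closure {x. \<eta> x \<noteq> 0} \<subseteq> W i \<inter> V i"
  proof
    fix i assume i: "i \<in> I"
    have "K i - U \<subseteq> W i \<inter> V i" using V(2)[OF i] W(2)[OF i] by blast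
    from C1_Urysohn[OF compact_diff[OF K[OF i] U(1)] open_Int[OF W(1)[OF i] V(1)[OF i]] this]
    obtain \<eta> :: "'a \<Rightarrow> real" where "C1_on UNIV \<eta>" "\<And>x. 0 \<le> \<eta> x" "\<And>x. \<eta> x \<le> 1"
      "\<And>x. x \<in> K i - U \<Longrightarrow> \<eta> x = 1" "compact (closure {x. \<eta> x \<noteq> 0})" "closure {x. \<eta> x \<noteq> 0} \<subseteq> W i \<inter> V i"
      by blast
    then show "\<exists>\<eta>::'a \<Rightarrow> real. C1_on UNIV \<eta> \<and> (\<forall>x. 0 \<le> \<eta> x) \<and> (\<forall>x. \<eta> x \<le> 1) \<and>
      (\<forall>x\<in>K i - U. \<eta> x = 1) \<and> compact (closure {x. \<eta> x \<noteq> 0}) \<and> closure {x. \<eta> x \<noteq> 0} \<subseteq> W i \<inter> V i"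
      by (intro exI[of _ \<eta>]) auto
  qed
  from bchoice[OF this] obtain \<eta> :: "'i \<Rightarrow> 'a \<Rightarrow> real" where
    *: "\<forall>i\<in>I. C1_on UNIV (\<eta> i) \<and> (\<forall>x. 0 \<le> \<eta> i x) \<and> (\<forall>x. \<eta> i x \<le> 1) \<and>
      (\<forall>x\<in>K i - U. \<eta> i x = 1) \<and> compact (closure {x. \<eta> i x \<noteq> 0}) \<and> closure {x. \<eta> i x \<noteq> 0} \<subseteq> W i \<inter> V i"
    by blast
  have \<eta>: "\<And>i. i \<in> I \<Longrightarrow> C1_on UNIV (\<eta> i)" "\<And>i x. i \<in> I \<Longrightarrow> 0 \<le> \<eta> i x" "\<And>i x. i \<in> I \<Longrightarrow> \<eta> i x \<le> 1"
    "\<And>i x. i \<in> I \<Longrightarrow> x \<in> K i - U \<Longrightarrow> \<eta> i x = 1" "\<And>i. i \<in> I \<Longrightarrow> compact (closure {x. \<eta> i x \<noteq> 0})"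
    "\<And>i. i \<in> I \<Longrightarrow> closure {x. \<eta> i x \<noteq> 0} \<subseteq> W i \<inter> V i"
    using * by blast+
  have \<eta>0: "\<eta> i x = 0" if "i \<in> I" "x \<notin> W i \<inter> V i" for i x
    using \<eta>(6)[OF that(1)] closure_subset[of "{x. \<eta> i x \<noteq> 0}"] that(2) by auto
  \<comment> \<open>At most one summand is nonzero at any point because the \<open>W i\<close> are
    disjoint; a convex combination would not be needed for the norm bound.\<close>
  define \<psi> where "\<psi> x = (\<Sum>i\<in>I. \<eta> i x *\<^sub>R n i x)" for x
  have single: "\<psi> x = \<eta> i x *\<^sub>R n i x" if "i \<in> I" "x \<in> W i" for i x
  proof -
    have "\<psi> x = \<eta> i x *\<^sub>R n i x + (\<Sum>j\<in>I - {i}. \<eta> j x *\<^sub>R n j x)"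
      unfolding \<psi>_def using I that by (simp add: sum.remove)
    moreover have "\<eta> j x *\<^sub>R n j x = 0" if "j \<in> I - {i}" for j
      using \<eta>0[of j x] W(3)[of i j] that \<open>i \<in> I\<close> \<open>x \<in> W i\<close> by auto
    ultimately show ?thesis by simp
  qed
  have C\<psi>: "C1_on UNIV \<psi>" unfolding \<psi>_def
  proof (intro C1_on_sum I)
    fix i assume i: "i \<in> I"
    show "C1_on UNIV (\<lambda>x. \<eta> i x *\<^sub>R n i x)"
    proof (rule C1_on_extend_zero[OF V(1)[OF i]])
      show "C1_on (V i) (\<lambda>x. \<eta> i x *\<^sub>R n i x)"
        by (intro C1_on_scaleR n i C1_on_subset[OF \<eta>(1)]) auto
      have "closure {x. \<eta> i x *\<^sub>R n i x \<noteq> 0} \<subseteq> closure {x. \<eta> i x \<noteq> 0}" by (rule closure_mono) auto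
      then show "closure {x. \<eta> i x *\<^sub>R n i x \<noteq> 0} \<subseteq> V i" using \<eta>(6)[OF i] by blast
    qed
  qed
  have n\<psi>: "norm (\<psi> x) \<le> 1" for x
  proof (cases "\<exists>i\<in>I. x \<in> W i \<inter> V i")
    case True
    then obtain i where i: "i \<in> I" "x \<in> W i" "x \<in> V i" by blast
    then show ?thesis using single[OF i(1,2)] n(2)[OF i(1,3)] \<eta>(2,3)[OF i(1), of x]
      by (simp add: mult_le_one)
  next
    case False
    then have "\<psi> x = 0" unfolding \<psi>_def using \<eta>0 by (intro sum.neutral) auto
    then show ?thesis by simp
  qed
  have cpt: "compact (\<Union>i\<in>I. closure {x. \<eta> i x \<noteq> 0})" using \<eta>(5) I by auto
  show ?thesis
  proof (rule that[of "\<lambda>x. z x *\<^sub>R \<psi> x"])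
    show "(\<lambda>x. z x *\<^sub>R \<psi> x) \<in> test_fields"
    proof (rule C1_imp_test_field)
      show "C1_on UNIV (\<lambda>x. z x *\<^sub>R \<psi> x)" by (intro C1_on_scaleR z C\<psi>)
      have "{x. z x *\<^sub>R \<psi> x \<noteq> 0} \<subseteq> (\<Union>i\<in>I. closure {x. \<eta> i x \<noteq> 0})"
      proof
        fix x assume "x \<in> {x. z x *\<^sub>R \<psi> x \<noteq> 0}"
        then have "\<psi> x \<noteq> 0" by auto
        then obtain i where "i \<in> I" "\<eta> i x \<noteq> 0" unfolding \<psi>_def
          by (metis (mono_tags, lifting) scale_zero_left sum.neutral)
        then show "x \<in> (\<Union>i\<in>I. closure {x. \<eta> i x \<noteq> 0})"
          using closure_subset[of "{x. \<eta> i x \<noteq> 0}"] by blast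
      qed
      then show "compact (closure {x. z x *\<^sub>R \<psi> x \<noteq> 0})"
        using bounded_subset[OF compact_imp_bounded[OF cpt]] by simp
      show "norm (z x *\<^sub>R \<psi> x) \<le> 1" for x using z(2,3)[of x] n\<psi>[of x] by (simp add: mult_le_one)
    qed
    show "z x *\<^sub>R \<psi> x = z x *\<^sub>R n i x" if "i \<in> I" "x \<in> K i" for i x
    proof (cases "x \<in> U")
      case False
      then show ?thesis using single[of i x] \<eta>(4)[of i x] W(2)[of i] that by auto
    qed (simp add: U)
  qed
qed

lemma divergence_scaleR:
  fixes w :: "'a::euclidean_space \<Rightarrow> 'a" and z :: "'a \<Rightarrow> real"
  assumes "open S" "x \<in> S" "\<And>y. y \<in> S \<Longrightarrow> \<phi> y = z y *\<^sub>R w y" "C1_on S z" "C1_on S w"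
  shows "divergence \<phi> x = z x * divergence w x + frechet_derivative z (at x) (w x)"
proof -
  have dz: "(z has_derivative frechet_derivative z (at x)) (at x)" by (rule C1_on_has_derivative[OF assms(4,2)])
  have "((\<lambda>y. z y *\<^sub>R w y) has_derivative (\<lambda>h. z x *\<^sub>R frechet_derivative w (at x) h
      + frechet_derivative z (at x) h *\<^sub>R w x)) (at x)"
    by (intro has_derivative_scaleR C1_on_has_derivative[OF assms(4,2)] C1_on_has_derivative[OF assms(5,2)])
  then have "(\<phi> has_derivative (\<lambda>h. z x *\<^sub>R frechet_derivative w (at x) h
      + frechet_derivative z (at x) h *\<^sub>R w x)) (at x)"
    by (rule has_derivative_transform_within_open[OF _ assms(1,2)]) (simp add: assms(3))
  then have eq: "frechet_derivative \<phi> (at x) = (\<lambda>h. z x *\<^sub>R frechet_derivative w (at x) h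
      + frechet_derivative z (at x) h *\<^sub>R w x)" by (metis frechet_derivative_at)
  interpret dz: linear "frechet_derivative z (at x)" using dz has_derivative_linear by blast
  have "frechet_derivative z (at x) (w x) = (\<Sum>b\<in>Basis. (w x \<bullet> b) * frechet_derivative z (at x) b)"
    by (subst euclidean_representation[of "w x", symmetric]) (simp add: dz.sum dz.scaleR)
  then show ?thesis
    unfolding divergence_def eq
    by (simp add: inner_add_left sum.distrib sum_distrib_left mult_ac)
qed

subsection \<open>The divergence theorem on a disc\<close>

lemma integral_periodic_shift:
  fixes f :: "real \<Rightarrow> real"
  assumes f: "continuous_on UNIV f" "\<And>x. f (x + p) = f x" and p: "0 \<le> p"
  shows "integral {a..a+p} f = integral {b..b+p} f"
proof -
  have int: "f integrable_on {x..y}" for x y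
    by (intro integrable_continuous_real continuous_on_subset[OF f(1)]) auto
  have "integral {a..a+p} f = integral {b..b+p} f" if "a \<le> b" for a b
  proof -
    have "((\<lambda>x. 1 *\<^sub>R f (x + p)) has_integral integral {a+p..b+p} f) {a..b}"
    proof (rule has_integral_substitution[where c="a+p" and d="b+p"])
      show "continuous_on {a + p..b + p} f" by (rule continuous_on_subset[OF f(1)]) auto
      show "((\<lambda>x. x + p) has_field_derivative 1) (at x within {a..b})" for x
        by (auto intro!: derivative_eq_intros)
    qed (use that in auto)
    then have "((\<lambda>x. f x) has_integral integral {a+p..b+p} f) {a..b}" unfolding f(2) by simp
    then have "integral {a+p..b+p} f = integral {a..b} f" by (simp add: integral_unique)
    moreover have "integral {a..b} f + integral {b..b+p} f = integral {a..b+p} f"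
      by (rule Henstock_Kurzweil_Integration.integral_combine) (use that p int in simp_all)
    moreover have "integral {a..a+p} f + integral {a+p..b+p} f = integral {a..b+p} f"
      by (rule Henstock_Kurzweil_Integration.integral_combine) (use that p int in simp_all)
    ultimately show ?thesis by linarith
  qed
  then show ?thesis by (metis linear)
qed

lemma circ_point_simps [simp]:
  "fst (circ_point c r t) = fst c + r * cos t" "snd (circ_point c r t) = snd c + r * sin t"
  by (auto simp: circ_point_def)

lemma continuous_on_circ_point [continuous_intros]:
  fixes f :: "'a::t2_space \<Rightarrow> real"
  shows "continuous_on A f \<Longrightarrow> continuous_on A (\<lambda>x. circ_point c r (f x))"
  unfolding circ_point_def by (intro continuous_intros)

lemma circ_point_periodic: "circ_point c r (t + 2 * pi) = circ_point c r t"
  by (simp add: circ_point_def)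

lemma disc_iff: "(x, y) \<in> ball c 1 \<longleftrightarrow> (x - fst c)\<^sup>2 + (y - snd c)\<^sup>2 < 1" for c :: plane
proof -
  have "dist c (x, y) = sqrt ((x - fst c)\<^sup>2 + (y - snd c)\<^sup>2)"
    by (cases c) (simp add: dist_Pair_Pair dist_real_def power2_commute)
  then show ?thesis by simp
qed

lemma frechet_bounded_integrable:
  fixes g :: "plane \<Rightarrow> real"
  assumes "C1_on UNIV g"
  shows "set_integrable lborel (ball c 1) (\<lambda>z. frechet_derivative g (at z) v)"
proof -
  have "set_integrable lborel (cball c 1) (\<lambda>z. frechet_derivative g (at z) v)"
    unfolding set_integrable_def
    by (intro borel_integrable_compact compact_cball continuous_on_subset[OF C1_on_frechet_continuous[OF assms]]) auto
  then show ?thesis by (rule set_integrable_subset) auto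
qed

text \<open>Fubini over horizontal lines and the fundamental theorem of calculus on each chord leave
  the values of \<open>g\<close> at the two ends; the substitution \<open>y = snd c + sin t\<close>
  turns them into integrals over the right and the left half of the circle.\<close>

lemma disc_gauss_fst:
  fixes g :: "plane \<Rightarrow> real"
  assumes g: "C1_on UNIV g"
  shows "(LINT z:ball c 1|lborel. frechet_derivative g (at z) (1, 0))
    = integral {-pi/2..3*pi/2} (\<lambda>t. cos t * g (circ_point c 1 t))"
proof -
  obtain c1 c2 where c: "c = (c1, c2)" by (cases c)
  define D where "D z = frechet_derivative g (at z) (1, 0)" for z
  define w where "w y = sqrt (1 - (y - c2)\<^sup>2)" for y
  have cD: "continuous_on UNIV D" unfolding D_def by (rule C1_on_frechet_continuous[OF g])
  have cg: "continuous_on UNIV g" by (rule C1_on_continuous_on[OF g])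
  have cw: "continuous_on A w" for A unfolding w_def by (intro continuous_intros)
  have dg: "((\<lambda>x. g (x, y)) has_vector_derivative D (x, y)) (at x within S)" for x y S
  proof -
    have gd: "(g has_derivative frechet_derivative g (at (x, y))) (at (x, y))"
      by (rule C1_on_has_derivative[OF g UNIV_I])
    have "((\<lambda>x. (x, y)) has_derivative (\<lambda>h. (h, 0))) (at x)"
      by (auto intro!: derivative_eq_intros)
    from diff_chain_at[OF this gd]
    have "((\<lambda>x. g (x, y)) has_derivative (\<lambda>h. frechet_derivative g (at (x, y)) (h, 0))) (at x)"
      by (simp add: o_def)
    moreover have "frechet_derivative g (at (x, y)) (h, 0) = h *\<^sub>R D (x, y)" for h
    proof -
      interpret linear "frechet_derivative g (at (x, y))" using gd has_derivative_linear by blast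
      show ?thesis using scaleR[of h "(1, 0)"] by (simp add: D_def)
    qed
    ultimately show ?thesis
      using has_derivative_at_withinI by (fastforce simp: has_vector_derivative_def)
  qed
  have s01: "0 \<le> 1 + sin x" for x :: real using sin_ge_minus_one[of x] by linarith
  define F where "F y = g (c1 + w y, y) - g (c1 - w y, y)" for y
  have int: "integrable (lborel \<Otimes>\<^sub>M lborel) (\<lambda>(x, y). indicator (ball c 1) (x, y) *\<^sub>R D (x, y))"
    using frechet_bounded_integrable[OF g, of c "(1, 0)"]
    unfolding lborel_prod set_integrable_def D_def by (simp add: case_prod_unfold)
  \<comment> \<open>At \<open>\<bar>y - c2\<bar> = 1\<close> the chord degenerates and
    \<open>F y = 0\<close>, so the closed interval may be used on the right.\<close>
  have inner: "(\<integral>x. indicator (ball c 1) (x, y) *\<^sub>R D (x, y) \<partial>lborel) = indicator {c2-1..c2+1} y *\<^sub>R F y" for y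
  proof (cases "\<bar>y - c2\<bar> < 1")
    case True
    then have y2: "(y - c2)\<^sup>2 < 1" by (simp add: abs_square_less_1)
    then have wp: "w y > 0" by (simp add: w_def)
    have "indicator (ball c 1) (x, y) = (indicator {c1 - w y<..<c1 + w y} x :: real)" for x
    proof -
      have "(x, y) \<in> ball c 1 \<longleftrightarrow> (x - c1)\<^sup>2 < (w y)\<^sup>2"
        unfolding disc_iff using y2 by (auto simp: c w_def)
      also have "\<dots> \<longleftrightarrow> \<bar>x - c1\<bar> < w y"
        using wp abs_square_less_1 by (metis abs_le_square_iff abs_of_pos not_less)
      also have "\<dots> \<longleftrightarrow> x \<in> {c1 - w y<..<c1 + w y}" by (auto simp: abs_less_iff)
      finally show ?thesis by (simp add: indicator_def)
    qed
    then have "(\<integral>x. indicator (ball c 1) (x, y) *\<^sub>R D (x, y) \<partial>lborel)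
      = (LINT x:{c1 - w y<..<c1 + w y}|lborel. D (x, y))"
      by (simp add: set_lebesgue_integral_def)
    also have "\<dots> = integral {c1 - w y<..<c1 + w y} (\<lambda>x. D (x, y))"
    proof (rule set_borel_integral_eq_integral(2))
      have "set_integrable lborel {c1 - w y..c1 + w y} (\<lambda>x. D (x, y))"
        unfolding set_integrable_def
        by (intro borel_integrable_compact compact_Icc continuous_on_compose2[OF cD] continuous_intros) auto
      then show "set_integrable lborel {c1 - w y<..<c1 + w y} (\<lambda>x. D (x, y))"
        by (rule set_integrable_subset) auto
    qed
    also have "\<dots> = integral {c1 - w y..c1 + w y} (\<lambda>x. D (x, y))"
      by (simp add: integral_open_interval_real)
    also have "\<dots> = F y"
      unfolding F_def using wp
      by (intro integral_unique fundamental_theorem_of_calculus dg) auto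
    finally show ?thesis using True by (auto simp: indicator_def)
  next
    case False
    then have y2: "(y - c2)\<^sup>2 \<ge> 1" using abs_square_less_1 not_less by blast
    then have "(x, y) \<notin> ball c 1" for x
      unfolding disc_iff by (simp add: c not_less add_increasing)
    moreover have "indicator {c2-1..c2+1} y *\<^sub>R F y = 0"
    proof (cases "y = c2 - 1 \<or> y = c2 + 1")
      case True
      then have "w y = 0" by (auto simp: w_def)
      then show ?thesis by (simp add: F_def)
    qed (use False in \<open>auto simp: indicator_def\<close>)
    ultimately show ?thesis by simp
  qed
  have cF1: "continuous_on {c2-1..c2+1} (\<lambda>y. g (c1 + w y, y))"
    and cF2: "continuous_on {c2-1..c2+1} (\<lambda>y. g (c1 - w y, y))"
    by (intro continuous_on_compose2[OF cg] continuous_intros cw; simp)+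
  have "(LINT z:ball c 1|lborel. D z) = integral\<^sup>L (lborel \<Otimes>\<^sub>M lborel) (\<lambda>(x, y). indicator (ball c 1) (x, y) *\<^sub>R D (x, y))"
    by (simp add: set_lebesgue_integral_def lborel_prod case_prod_unfold)
  also have "\<dots> = (\<integral>y. (\<integral>x. indicator (ball c 1) (x, y) *\<^sub>R D (x, y) \<partial>lborel) \<partial>lborel)"
    using lborel_pair.integral_snd[OF int] by simp
  also have "\<dots> = (LINT y:{c2-1..c2+1}|lborel. F y)"
    by (simp only: inner set_lebesgue_integral_def)
  also have "\<dots> = integral {c2-1..c2+1} F"
  proof (rule set_borel_integral_eq_integral(2))
    show "set_integrable lborel {c2-1..c2+1} F"
      unfolding set_integrable_def F_def
      by (intro borel_integrable_compact compact_Icc continuous_on_diff cF1 cF2)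
  qed
  also have "\<dots> = integral {c2-1..c2+1} (\<lambda>y. g (c1 + w y, y)) - integral {c2-1..c2+1} (\<lambda>y. g (c1 - w y, y))"
    unfolding F_def by (intro Henstock_Kurzweil_Integration.integral_diff integrable_continuous_real cF1 cF2)
  also have "integral {c2-1..c2+1} (\<lambda>y. g (c1 + w y, y)) = integral {-pi/2..pi/2} (\<lambda>t. cos t * g (circ_point c 1 t))"
  proof -
    have "((\<lambda>t. cos t *\<^sub>R g (c1 + w (c2 + sin t), c2 + sin t)) has_integral
        integral {c2 + sin (-pi/2)..c2 + sin (pi/2)} (\<lambda>y. g (c1 + w y, y))
        - integral {c2 + sin (pi/2)..c2 + sin (-pi/2)} (\<lambda>y. g (c1 + w y, y))) {-pi/2..pi/2}"
      by (rule has_integral_substitution_general[where c="c2-1" and d="c2+1" and s="{}"])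
         (use s01 sin_le_one cF1 in \<open>auto intro!: derivative_eq_intros continuous_intros simp: algebra_simps\<close>)
    then have *: "((\<lambda>t. cos t *\<^sub>R g (c1 + w (c2 + sin t), c2 + sin t)) has_integral
        integral {c2 - 1..c2 + 1} (\<lambda>y. g (c1 + w y, y))) {-pi/2..pi/2}" by simp
    have "((\<lambda>t. cos t * g (circ_point c 1 t)) has_integral
        integral {c2 - 1..c2 + 1} (\<lambda>y. g (c1 + w y, y))) {-pi/2..pi/2}"
    proof (rule has_integral_eq[OF _ *])
      fix t :: real assume "t \<in> {-pi/2..pi/2}"
      then have "cos t \<ge> 0" by (intro cos_ge_zero) auto
      then have "w (c2 + sin t) = cos t" by (simp add: w_def cos_squared_eq[symmetric])
      then show "cos t *\<^sub>R g (c1 + w (c2 + sin t), c2 + sin t) = cos t * g (circ_point c 1 t)"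
        by (simp add: circ_point_def c)
    qed
    then show ?thesis by (simp add: integral_unique)
  qed
  \<comment> \<open>On \<open>{pi/2..3*pi/2}\<close> the ordinate runs downwards and
    \<open>w = - cos t\<close>; the reversed orientation gives the minus sign that turns the
    difference of the two halves into a sum.\<close>
  also have "integral {c2-1..c2+1} (\<lambda>y. g (c1 - w y, y)) = - integral {pi/2..3*pi/2} (\<lambda>t. cos t * g (circ_point c 1 t))"
  proof -
    have s3: "sin (3*pi/2) = -1" using sin_periodic_pi[of "pi/2"] by (simp add: algebra_simps)
    have "((\<lambda>t. cos t *\<^sub>R g (c1 - w (c2 + sin t), c2 + sin t)) has_integral
        integral {c2 + sin (pi/2)..c2 + sin (3*pi/2)} (\<lambda>y. g (c1 - w y, y))
        - integral {c2 + sin (3*pi/2)..c2 + sin (pi/2)} (\<lambda>y. g (c1 - w y, y))) {pi/2..3*pi/2}"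
      by (rule has_integral_substitution_general[where c="c2-1" and d="c2+1" and s="{}"])
         (use s01 sin_le_one cF2 in \<open>auto intro!: derivative_eq_intros continuous_intros simp: algebra_simps\<close>)
    then have *: "((\<lambda>t. cos t *\<^sub>R g (c1 - w (c2 + sin t), c2 + sin t)) has_integral
        - integral {c2 - 1..c2 + 1} (\<lambda>y. g (c1 - w y, y))) {pi/2..3*pi/2}" by (simp add: s3)
    have "((\<lambda>t. cos t * g (circ_point c 1 t)) has_integral
        - integral {c2 - 1..c2 + 1} (\<lambda>y. g (c1 - w y, y))) {pi/2..3*pi/2}"
    proof (rule has_integral_eq[OF _ *])
      fix t :: real assume "t \<in> {pi/2..3*pi/2}"
      then have "cos (t - pi) \<ge> 0" by (intro cos_ge_zero) auto
      then have "cos t \<le> 0" by simp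
      then have "w (c2 + sin t) = - cos t" by (simp add: w_def cos_squared_eq[symmetric])
      then show "cos t *\<^sub>R g (c1 - w (c2 + sin t), c2 + sin t) = cos t * g (circ_point c 1 t)"
        by (simp add: circ_point_def c)
    qed
    then show ?thesis by (simp add: integral_unique)
  qed
  also have "integral {-pi/2..pi/2} (\<lambda>t. cos t * g (circ_point c 1 t)) - - integral {pi/2..3*pi/2} (\<lambda>t. cos t * g (circ_point c 1 t))
     = integral {-pi/2..3*pi/2} (\<lambda>t. cos t * g (circ_point c 1 t))"
    using Henstock_Kurzweil_Integration.integral_combine[of "-pi/2" "pi/2" "3*pi/2" "\<lambda>t. cos t * g (circ_point c 1 t)"]
    by (simp add: integrable_continuous_real continuous_intros continuous_on_compose2[OF cg])
  finally show ?thesis by (simp add: D_def)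
qed

text \<open>The first-coordinate case after exchanging the axes; the substitution
  \<open>pi/2 - t\<close> undoes the exchange on the circle and maps \<open>{-pi..pi}\<close> onto
  \<open>{-pi/2..3*pi/2}\<close>.\<close>

lemma disc_gauss_snd:
  fixes g :: "plane \<Rightarrow> real"
  assumes g: "C1_on UNIV g"
  shows "(LINT z:ball c 1|lborel. frechet_derivative g (at z) (0, 1))
    = integral {-pi..pi} (\<lambda>t. sin t * g (circ_point c 1 t))"
proof -
  define sw :: "plane \<Rightarrow> plane" where "sw z = (snd z, fst z)" for z
  have dsw: "(sw has_derivative sw) (at z)" for z
    unfolding sw_def by (auto intro!: derivative_eq_intros)
  have der: "((\<lambda>z. g (sw z)) has_derivative (\<lambda>v. frechet_derivative g (at (sw z)) (sw v))) (at z)" for z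
    using diff_chain_at[OF dsw C1_on_has_derivative[OF g UNIV_I]] by (simp add: o_def)
  have cg: "continuous_on UNIV g" by (rule C1_on_continuous_on[OF g])
  have "C1_on UNIV (\<lambda>z. g (sw z))"
  proof (rule C1_onI[OF der])
    show "continuous_on UNIV (\<lambda>x. frechet_derivative g (at (sw x)) (sw v))" for v
      by (rule continuous_on_compose2[OF C1_on_frechet_continuous[OF g]]) (auto simp: sw_def intro!: continuous_intros)
  qed
  from disc_gauss_fst[OF this, of "sw c"]
  have 1: "(LINT z:ball (sw c) 1|lborel. frechet_derivative g (at (sw z)) (0, 1))
    = integral {-pi/2..3*pi/2} (\<lambda>t. cos t * g (sw (circ_point (sw c) 1 t)))"
  proof -
    have "frechet_derivative (\<lambda>z. g (sw z)) (at z) (1, 0) = frechet_derivative g (at (sw z)) (0, 1)" for z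
      using fun_cong[OF frechet_derivative_at[OF der[of z]], of "(1, 0)"] by (simp add: sw_def)
    then show "(LINT z:ball (sw c) 1|lborel. frechet_derivative (\<lambda>z. g (sw z)) (at z) (1, 0))
      = integral {-pi/2..3*pi/2} (\<lambda>t. cos t * g (sw (circ_point (sw c) 1 t))) \<Longrightarrow> ?thesis" by simp
  qed
  define f where "f z = indicator (ball c 1) z *\<^sub>R frechet_derivative g (at z) (0, 1)" for z
  have "f \<in> borel_measurable (lborel \<Otimes>\<^sub>M lborel)"
    using frechet_bounded_integrable[OF g, of c "(0, 1)"] unfolding lborel_prod set_integrable_def f_def by auto
  from lborel_pair.integral_product_swap[OF this]
  have "(LINT z|lborel. f (sw z)) = integral\<^sup>L lborel f"
    unfolding lborel_prod by (simp add: case_prod_unfold sw_def)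
  moreover have fsw: "f (sw z) = indicator (ball (sw c) 1) z *\<^sub>R frechet_derivative g (at (sw z)) (0, 1)" for z
  proof -
    have "sw z \<in> ball c 1 \<longleftrightarrow> z \<in> ball (sw c) 1"
      using disc_iff[of "snd z" "fst z" c] disc_iff[of "fst z" "snd z" "sw c"] by (simp add: sw_def add.commute)
    then show ?thesis by (simp add: f_def indicator_def)
  qed
  ultimately have "integral\<^sup>L lborel f = (LINT z:ball (sw c) 1|lborel. frechet_derivative g (at (sw z)) (0, 1))"
    by (simp only: set_lebesgue_integral_def)
  then have "(LINT z:ball c 1|lborel. frechet_derivative g (at z) (0, 1))
    = integral {-pi/2..3*pi/2} (\<lambda>t. cos t * g (sw (circ_point (sw c) 1 t)))"
    unfolding 1 by (simp add: set_lebesgue_integral_def f_def[abs_def])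
  also have "\<dots> = integral {-pi..pi} (\<lambda>t. sin t * g (circ_point c 1 t))"
  proof -
    let ?f = "\<lambda>t. cos t * g (sw (circ_point (sw c) 1 t))"
    have eq: "?f (pi/2 - t) = sin t * g (circ_point c 1 t)" for t
      by (cases c) (simp add: sw_def circ_point_def cos_diff sin_diff)
    have "((\<lambda>t. (-1) *\<^sub>R ?f (pi/2 - t)) has_integral
        integral {pi/2 - (-pi)..pi/2 - pi} ?f - integral {pi/2 - pi..pi/2 - (-pi)} ?f) {-pi..pi}"
      by (rule has_integral_substitution_general[where c="-pi/2" and d="3*pi/2" and s="{}"])
         (auto intro!: derivative_eq_intros continuous_intros continuous_on_compose2[OF cg] simp: sw_def)
    then have "((\<lambda>t. - (sin t * g (circ_point c 1 t))) has_integral - integral {-pi/2..3*pi/2} ?f) {-pi..pi}"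
      unfolding eq by simp
    from has_integral_neg[OF this] show ?thesis by (simp add: integral_unique)
  qed
  finally show ?thesis .
qed

lemma C1_on_fst_snd:
  fixes \<phi> :: "'a::euclidean_space \<Rightarrow> plane"
  assumes "C1_on V \<phi>"
  shows "C1_on V (\<lambda>z. fst (\<phi> z))" "C1_on V (\<lambda>z. snd (\<phi> z))"
    and "\<And>z. z \<in> V \<Longrightarrow> frechet_derivative (\<lambda>z. fst (\<phi> z)) (at z) = (\<lambda>v. fst (frechet_derivative \<phi> (at z) v))"
    and "\<And>z. z \<in> V \<Longrightarrow> frechet_derivative (\<lambda>z. snd (\<phi> z)) (at z) = (\<lambda>v. snd (frechet_derivative \<phi> (at z) v))"
proof -
  have d: "((\<lambda>z. fst (\<phi> z)) has_derivative (\<lambda>v. fst (frechet_derivative \<phi> (at z) v))) (at z)"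
    "((\<lambda>z. snd (\<phi> z)) has_derivative (\<lambda>v. snd (frechet_derivative \<phi> (at z) v))) (at z)" if "z \<in> V" for z
    using C1_on_has_derivative[OF assms that] by (auto intro: has_derivative_fst has_derivative_snd)
  show "\<And>z. z \<in> V \<Longrightarrow> frechet_derivative (\<lambda>z. fst (\<phi> z)) (at z) = (\<lambda>v. fst (frechet_derivative \<phi> (at z) v))"
    "\<And>z. z \<in> V \<Longrightarrow> frechet_derivative (\<lambda>z. snd (\<phi> z)) (at z) = (\<lambda>v. snd (frechet_derivative \<phi> (at z) v))"
    using d[THEN frechet_derivative_at] by auto
  show "C1_on V (\<lambda>z. fst (\<phi> z))" "C1_on V (\<lambda>z. snd (\<phi> z))"
    by (rule C1_onI[OF d(1)], assumption, intro continuous_intros C1_on_frechet_continuous[OF assms])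
       (rule C1_onI[OF d(2)], assumption, intro continuous_intros C1_on_frechet_continuous[OF assms])
qed

text \<open>The starting angle is left free so that the circle can be cut at the first corner of the
  rearrangement; periodicity moves it there.\<close>

lemma disc_gauss:
  fixes \<phi> :: "plane \<Rightarrow> plane"
  assumes "C1_on UNIV \<phi>"
  shows "(LINT z:ball c 1|lborel. divergence \<phi> z) = integral {t0..t0+2*pi} (\<lambda>t. \<phi> (circ_point c 1 t) \<bullet> (cos t, sin t))"
proof -
  note f = C1_on_fst_snd[OF assms]
  define g1 where "g1 = (\<lambda>z. fst (\<phi> z))"
  define g2 where "g2 = (\<lambda>z. snd (\<phi> z))"
  have g: "C1_on UNIV g1" "C1_on UNIV g2" unfolding g1_def g2_def by (rule f)+
  have cg: "continuous_on UNIV g1" "continuous_on UNIV g2" by (rule g[THEN C1_on_continuous_on])+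
  have div: "divergence \<phi> z = frechet_derivative g1 (at z) (1, 0) + frechet_derivative g2 (at z) (0, 1)" for z
    unfolding divergence_def Basis_prod_def g1_def g2_def f(3,4)[OF UNIV_I]
    by (subst sum.union_disjoint) (auto simp: inner_prod_def)
  have cont: "continuous_on A (\<lambda>t. cos t * g1 (circ_point c 1 t))" "continuous_on A (\<lambda>t. sin t * g2 (circ_point c 1 t))" for A
    by (intro continuous_intros continuous_on_compose2[OF cg(1)] continuous_on_compose2[OF cg(2)]; simp)+
  have "(LINT z:ball c 1|lborel. divergence \<phi> z) = (LINT z:ball c 1|lborel. frechet_derivative g1 (at z) (1, 0))
      + (LINT z:ball c 1|lborel. frechet_derivative g2 (at z) (0, 1))"
    unfolding div by (intro set_integral_add frechet_bounded_integrable g)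
  also have "(LINT z:ball c 1|lborel. frechet_derivative g1 (at z) (1, 0)) = integral {t0..t0+2*pi} (\<lambda>t. cos t * g1 (circ_point c 1 t))"
    using disc_gauss_fst[OF g(1), of c] integral_periodic_shift[OF cont(1), of "2*pi" "-pi/2" t0]
    by (simp add: circ_point_periodic)
  also have "(LINT z:ball c 1|lborel. frechet_derivative g2 (at z) (0, 1)) = integral {t0..t0+2*pi} (\<lambda>t. sin t * g2 (circ_point c 1 t))"
    using disc_gauss_snd[OF g(2), of c] integral_periodic_shift[OF cont(2), of "2*pi" "-pi" t0]
    by (simp add: circ_point_periodic)
  also have "integral {t0..t0+2*pi} (\<lambda>t. cos t * g1 (circ_point c 1 t)) + integral {t0..t0+2*pi} (\<lambda>t. sin t * g2 (circ_point c 1 t))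
     = integral {t0..t0+2*pi} (\<lambda>t. cos t * g1 (circ_point c 1 t) + sin t * g2 (circ_point c 1 t))"
    by (intro Henstock_Kurzweil_Integration.integral_add[symmetric] integrable_continuous_real cont)
  also have "\<dots> = integral {t0..t0+2*pi} (\<lambda>t. \<phi> (circ_point c 1 t) \<bullet> (cos t, sin t))"
    by (intro integral_cong) (simp add: g1_def g2_def inner_prod_def mult.commute)
  finally show ?thesis .
qed

section \<open>The perimeter of the disc\<close>

lemma test_fieldsD:
  assumes "\<phi> \<in> test_fields"
  shows "C1_on UNIV \<phi>" "norm (\<phi> x) \<le> 1"
  using assms by (auto simp: test_fields_def C1_on_def)

text \<open>Divergence theorem and Cauchy-Schwarz. An upper bound is the useful direction, since the
  deficit decreases when the perimeter of the comparison ball grows.\<close>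

lemma perimeter_disc_le: "perimeter (ball c 1 :: plane set) \<le> ereal (2 * pi)"
  unfolding perimeter_def
proof (rule SUP_least)
  fix \<phi> :: "plane \<Rightarrow> plane" assume \<phi>: "\<phi> \<in> test_fields"
  note C = test_fieldsD(1)[OF \<phi>]
  have "(LINT z:ball c 1|lborel. divergence \<phi> z) = integral {0..0+2*pi} (\<lambda>t. \<phi> (circ_point c 1 t) \<bullet> (cos t, sin t))"
    by (rule disc_gauss[OF C])
  also have "\<dots> \<le> integral {0..0+2*pi} (\<lambda>t. 1)"
  proof (rule integral_le)
    show "(\<lambda>t. \<phi> (circ_point c 1 t) \<bullet> (cos t, sin t)) integrable_on {0..0 + 2 * pi}"
      by (intro integrable_continuous_real continuous_intros continuous_on_compose2[OF C1_on_continuous_on[OF C]]) auto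
    show "\<phi> (circ_point c 1 t) \<bullet> (cos t, sin t) \<le> 1" for t
    proof -
      have "\<phi> (circ_point c 1 t) \<bullet> (cos t, sin t) \<le> norm (\<phi> (circ_point c 1 t)) * norm (cos t, sin t)"
        by (rule norm_cauchy_schwarz)
      then show ?thesis using test_fieldsD(2)[OF \<phi>, of "circ_point c 1 t"] by (simp add: norm_Pair)
    qed
  qed auto
  finally show "ereal (LINT z:ball c 1|lborel. divergence \<phi> z) \<le> ereal (2 * pi)" by simp
qed

lemma perimeter_nonneg: "0 \<le> perimeter E"
proof -
  have "(\<lambda>x. 0) \<in> test_fields" by (auto simp: test_fields_def)
  moreover have "divergence (\<lambda>x. 0) y = 0" for y :: 'a
    by (simp add: divergence_def)
  ultimately show ?thesis
    unfolding perimeter_def by (intro SUP_upper2[of "\<lambda>x. 0"]) (auto simp: set_lebesgue_integral_def)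
qed

subsection \<open>Hausdorff measure of subsets of the unit circle\<close>

lemma hausdorff1_content_UN:
  fixes A :: "nat \<Rightarrow> 'a::metric_space set"
  shows "hausdorff1_content d (\<Union>n. A n) \<le> (\<Sum>n. hausdorff1_content d (A n))"
proof (rule ennreal_le_epsilon)
  fix e :: real assume fin: "(\<Sum>n. hausdorff1_content d (A n)) < top" and e: "0 < e"
  define adm where "adm X = {U :: nat \<Rightarrow> 'a set. X \<subseteq> (\<Union>n. U n) \<and> (\<forall>n. bounded (U n) \<and> diameter (U n) \<le> d)}" for X
  have content: "hausdorff1_content d X = (INF U\<in>adm X. \<Sum>n. ennreal (diameter (U n)))" for X :: "'a set"
    by (simp add: hausdorff1_content_def adm_def)
  have "\<forall>n. \<exists>U. U \<in> adm (A n) \<and> (\<Sum>k. ennreal (diameter (U k))) \<le> hausdorff1_content d (A n) + ennreal (e * (1/2)^Suc n)"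
  proof
    fix n
    have "hausdorff1_content d (A n) < top"
      using fin ennreal_suminf_lessD by blast
    then have "hausdorff1_content d (A n) < hausdorff1_content d (A n) + ennreal (e * (1/2)^Suc n)"
      using e by (simp add: ennreal_add_left_cancel_less less_top)
    then show "\<exists>U. U \<in> adm (A n) \<and> (\<Sum>k. ennreal (diameter (U k))) \<le> hausdorff1_content d (A n) + ennreal (e * (1/2)^Suc n)"
      using content[of "A n"] by (metis (no_types, lifting) INF_less_iff order_less_imp_le)
  qed
  then obtain U where U: "\<And>n. U n \<in> adm (A n)"
    "\<And>n. (\<Sum>k. ennreal (diameter (U n k))) \<le> hausdorff1_content d (A n) + ennreal (e * (1/2)^Suc n)"
    by metis
  define W where "W i = case_prod U (prod_decode i)" for i
  have "W \<in> adm (\<Union>n. A n)"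
  proof -
    have "x \<in> (\<Union>i. W i)" if x: "x \<in> A n" for x n
    proof -
      obtain k where "x \<in> U n k" using U(1)[of n] x by (auto simp: adm_def)
      then have "x \<in> W (prod_encode (n, k))" by (simp add: W_def)
      then show ?thesis by blast
    qed
    then show ?thesis using U(1) by (auto simp: adm_def W_def split: prod.splits)
  qed
  then have "hausdorff1_content d (\<Union>n. A n) \<le> (\<Sum>i. ennreal (diameter (W i)))"
    unfolding content by (rule INF_lower)
  also have "\<dots> = (\<Sum>n. \<Sum>k. ennreal (diameter (U n k)))"
    using suminf_ennreal_2dimen[of "\<lambda>n. \<Sum>k. ennreal (diameter (U n k))" "\<lambda>(n, k). ennreal (diameter (U n k))"]
    by (simp add: W_def case_prod_unfold)
  also have "\<dots> \<le> (\<Sum>n. hausdorff1_content d (A n) + ennreal (e * (1/2)^Suc n))"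
    by (intro suminf_le U(2)) auto
  also have "\<dots> = (\<Sum>n. hausdorff1_content d (A n)) + (\<Sum>n. ennreal (e * (1/2)^Suc n))"
    by (rule suminf_add[symmetric]) auto
  also have "(\<Sum>n. ennreal (e * (1/2)^Suc n)) = ennreal e"
    using sums_mult[OF power_half_series, of e] e by (intro suminf_ennreal_eq) auto
  finally show "hausdorff1_content d (\<Union>n. A n) \<le> (\<Sum>n. hausdorff1_content d (A n)) + ennreal e" .
qed

lemma hausdorff1_content_mono: "A \<subseteq> B \<Longrightarrow> hausdorff1_content d A \<le> hausdorff1_content d B"
  unfolding hausdorff1_content_def by (rule INF_superset_mono) auto

lemma hausdorff1_content_empty: "0 < d \<Longrightarrow> hausdorff1_content d {} = 0"
  unfolding hausdorff1_content_def
  by (intro antisym INF_lower2[of "\<lambda>_. {}"]) (auto simp: diameter_def)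

lemma hausdorff1_content_Un:
  fixes A B :: "'a::metric_space set"
  assumes "0 < d"
  shows "hausdorff1_content d (A \<union> B) \<le> hausdorff1_content d A + hausdorff1_content d B"
proof -
  define F where "F n = (if n = 0 then A else if n = Suc 0 then B else {})" for n :: nat
  have "(\<Union>n. F n) = A \<union> B" by (auto simp: F_def split: if_splits)
  then have "hausdorff1_content d (A \<union> B) \<le> (\<Sum>n. hausdorff1_content d (F n))"
    using hausdorff1_content_UN[of d F] by simp
  also have "\<dots> = (\<Sum>n\<in>{0, Suc 0}. hausdorff1_content d (F n))"
    by (rule suminf_finite) (auto simp: F_def hausdorff1_content_empty assms)
  also have "\<dots> = hausdorff1_content d A + hausdorff1_content d B" by (simp add: F_def)
  finally show ?thesis .
qed

lemma dist_circ_point_le: "dist (circ_point c 1 s) (circ_point c 1 t) \<le> \<bar>s - t\<bar>"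
proof -
  have "(dist (circ_point c 1 s) (circ_point c 1 t))\<^sup>2 = (cos s - cos t)\<^sup>2 + (sin s - sin t)\<^sup>2"
    by (cases c) (simp add: circ_point_def dist_Pair_Pair dist_real_def)
  also have "\<dots> = 2 - 2 * cos (s - t)"
    by (simp add: cos_diff power2_diff algebra_simps)
  also have "\<dots> = (2 * sin ((s - t) / 2))\<^sup>2"
  proof -
    have "2 * ((s - t) / 2) = s - t" by simp
    from cos_double_sin[of "(s - t)/2", unfolded this] show ?thesis by (simp add: power_mult_distrib)
  qed
  also have "\<dots> \<le> \<bar>s - t\<bar>\<^sup>2"
    using abs_sin_x_le_abs_x[of "(s - t)/2"] by (intro power2_le_iff_abs_le[THEN iffD2]) (auto simp: abs_mult)
  finally show ?thesis by (rule power2_le_imp_le) simp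
qed

text \<open>Chords are no longer than the angles they subtend, so \<open>N\<close> equal pieces of
  angle at most \<open>d\<close> form an admissible cover of total diameter at most
  \<open>b - a\<close>.\<close>

lemma hausdorff1_content_arc_le:
  assumes "0 < d" "a \<le> b"
  shows "hausdorff1_content d (circ_point c 1 ` {a..b}) \<le> ennreal (b - a)"
proof -
  obtain N where N: "real N > (b - a) / d" using reals_Archimedean2 by blast
  then have N0: "N > 0" using assms by (metis divide_nonneg_pos diff_ge_0_iff_ge gr_zeroI not_less of_nat_0)
  define h where "h = (b - a) / real N"
  have h: "0 \<le> h" "h \<le> d" "real N * h = b - a"
    using assms N N0 by (auto simp: h_def field_simps)
  define U where "U k = (if k < N then circ_point c 1 ` {a + real k * h..a + real (Suc k) * h} else {})" for k
  have dia: "bounded (U k) \<and> diameter (U k) \<le> h" for k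
  proof (cases "k < N")
    case True
    have "compact (U k)" using True
      by (auto simp: U_def intro!: compact_continuous_image continuous_intros)
    moreover have "diameter (U k) \<le> h"
    proof (rule diameter_le)
      show "norm (x - y) \<le> h" if xy: "x \<in> U k" "y \<in> U k" for x y
      proof -
        obtain s t where st: "x = circ_point c 1 s" "y = circ_point c 1 t"
          "s \<in> {a + real k * h..a + real (Suc k) * h}" "t \<in> {a + real k * h..a + real (Suc k) * h}"
          using xy unfolding U_def if_P[OF True] by blast
        then have "\<bar>s - t\<bar> \<le> h" by (auto simp: algebra_simps)
        then show ?thesis using dist_circ_point_le[of c s t] st by (simp add: dist_norm)
      qed
    qed (use h in auto)
    ultimately show ?thesis by (simp add: compact_imp_bounded)
  qed (use h in \<open>auto simp: U_def diameter_def\<close>)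
  have cov: "circ_point c 1 ` {a..b} \<subseteq> (\<Union>k. U k)"
  proof (rule image_subsetI)
    fix t assume t: "t \<in> {a..b}"
    show "circ_point c 1 t \<in> (\<Union>k. U k)"
    proof (cases "h = 0")
      case True
      then have "t = a" using t h by simp
      then have "circ_point c 1 t \<in> U 0" using N0 True by (auto simp: U_def)
      then show ?thesis by blast
    next
      case False
      then have h0: "h > 0" using h by simp
      define k where "k = nat \<lfloor>(t - a) / h\<rfloor>"
      have nn: "(t - a) / h \<ge> 0" using t h0 by simp
      have k: "real k \<le> (t - a) / h" "(t - a) / h < real (Suc k)"
        using nn by (auto simp: k_def) linarith
      then have kh: "a + real k * h \<le> t" "t \<le> a + real (Suc k) * h"
        using h0 by (auto simp: field_simps)
      show ?thesis
      proof (cases "k < N")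
        case True
        then show ?thesis using kh by (auto simp: U_def intro!: exI[of _ k])
      next
        \<comment> \<open>Only the right end \<open>t = b\<close> reaches \<open>k \<ge> N\<close>;
          it belongs to the last piece.\<close>
        case F: False
        have "real N * h \<le> real k * h" using F h0 by simp
        then have "t = b" using kh t h by simp
        moreover have "b = a + real (Suc (N - 1)) * h" using h N0 by simp
        moreover have "a + real (N - 1) * h \<le> b" using h N0 calculation(2) by (simp add: algebra_simps)
        ultimately have "circ_point c 1 t \<in> U (N - 1)" using N0
          by (auto simp: U_def)
        then show ?thesis by blast
      qed
    qed
  qed
  have "hausdorff1_content d (circ_point c 1 ` {a..b}) \<le> (\<Sum>k. ennreal (diameter (U k)))"
    unfolding hausdorff1_content_def
    using cov dia h(2) by (intro INF_lower) (auto intro: order_trans)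
  also have "\<dots> = (\<Sum>k<N. ennreal (diameter (U k)))"
    by (rule suminf_finite) (auto simp: U_def diameter_def)
  also have "\<dots> \<le> (\<Sum>k<N. ennreal h)" by (intro sum_mono ennreal_leI) (use dia in auto)
  also have "\<dots> = ennreal (real N * h)" using h(1) by (simp add: ennreal_mult ennreal_of_nat_eq_real_of_nat)
  finally show ?thesis using h by simp
qed

text \<open>An open set of reals is a countable disjoint union of intervals, its components; the
  estimate for arcs is summed over them.\<close>

lemma hausdorff1_content_open_le:
  assumes d: "0 < d" and U: "open U" "bounded U"
  shows "hausdorff1_content d (circ_point c 1 ` U) \<le> emeasure lborel U"
proof -
  let ?X = "components U"
  have cnt: "countable ?X"
  proof (rule countable_disjoint_open_subsets)
    show "pairwise disjnt ?X"
      unfolding pairwise_def disjnt_def using components_nonoverlap by blast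
  qed (rule open_components[OF U(1)])
  \<comment> \<open>Each component sits at its own index and all other indices hold the empty set,
    which keeps the sequence disjoint.\<close>
  define A where "A n = (if n \<in> to_nat_on ?X ` ?X then from_nat_into ?X n else {})" for n
  have A_in: "A n \<noteq> {} \<Longrightarrow> A n \<in> ?X" for n
  proof -
    assume "A n \<noteq> {}"
    then have "n \<in> to_nat_on ?X ` ?X" unfolding A_def by presburger
    then obtain C where C: "C \<in> ?X" "n = to_nat_on ?X C" by blast
    then have "A n = C" unfolding A_def using from_nat_into_to_nat_on[OF cnt C(1)] by simp
    then show "A n \<in> ?X" using C by simp
  qed
  have UA: "(\<Union>n. A n) = U"
  proof -
    have "C \<subseteq> (\<Union>n. A n)" if "C \<in> ?X" for C
    proof -
      have "A (to_nat_on ?X C) = C" using that cnt by (simp add: A_def)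
      then show ?thesis by blast
    qed
    then have "\<Union>?X \<subseteq> (\<Union>n. A n)" by (rule Union_least)
    moreover have "A n \<subseteq> U" for n
      using in_components_subset[OF A_in[of n]] by (cases "A n = {}") simp_all
    ultimately show ?thesis by (intro equalityI UN_least) (simp_all add: Union_components[symmetric])
  qed
  have dis: "disjoint_family A"
    unfolding disjoint_family_on_def
  proof (intro ballI impI)
    fix m n :: nat assume mn: "m \<noteq> n"
    show "A m \<inter> A n = {}"
    proof (rule ccontr)
      assume ne: "A m \<inter> A n \<noteq> {}"
      then have "m \<in> to_nat_on ?X ` ?X" "n \<in> to_nat_on ?X ` ?X" unfolding A_def by fastforce+
      then obtain C D where CD: "C \<in> ?X" "m = to_nat_on ?X C" "D \<in> ?X" "n = to_nat_on ?X D" by blast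
      then have "A m = C" "A n = D"
        unfolding A_def using from_nat_into_to_nat_on[OF cnt] by simp_all
      then have "C = D" using ne components_nonoverlap[OF CD(1,3)] by blast
      then show False using CD mn by simp
    qed
  qed
  have opA: "open (A n)" for n
    using A_in[of n] open_components[OF U(1)] by (cases "A n = {}") auto
  have le: "hausdorff1_content d (circ_point c 1 ` A n) \<le> emeasure lborel (A n)" for n
  proof (cases "A n = {}")
    case False
    let ?C = "A n"
    have C: "?C \<in> ?X" using A_in False by blast
    have conn: "connected ?C" and bdd: "bounded ?C"
      using C in_components_connected in_components_subset bounded_subset[OF U(2)] by blast+
    have bb: "bdd_below ?C" "bdd_above ?C" using bdd by (simp_all add: bounded_imp_bdd_below bounded_imp_bdd_above)
    define a where "a = Inf ?C" define b where "b = Sup ?C"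
    have sub: "?C \<subseteq> {a..b}" using bb by (auto simp: a_def b_def intro: cInf_lower cSup_upper)
    have ab: "a \<le> b" using sub False by fastforce
    have sup: "{a<..<b} \<subseteq> ?C"
    proof
      fix x assume x: "x \<in> {a<..<b}"
      then obtain y z where "y \<in> ?C" "y < x" "z \<in> ?C" "x < z"
        using cInf_less_iff[OF False bb(1), of x] less_cSup_iff[OF False bb(2), of x]
        by (auto simp: a_def b_def)
      then show "x \<in> ?C" using conn connected_contains_Icc[of ?C y z] by auto
    qed
    have "hausdorff1_content d (circ_point c 1 ` ?C) \<le> hausdorff1_content d (circ_point c 1 ` {a..b})"
      by (intro hausdorff1_content_mono image_mono sub)
    also have "\<dots> \<le> ennreal (b - a)" by (rule hausdorff1_content_arc_le[OF d ab])
    also have "\<dots> = emeasure lborel {a<..<b}" using ab by simp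
    also have "\<dots> \<le> emeasure lborel ?C" using sup opA by (intro emeasure_mono) auto
    finally show ?thesis .
  qed (simp add: hausdorff1_content_empty d)
  have "hausdorff1_content d (circ_point c 1 ` U) = hausdorff1_content d (\<Union>n. circ_point c 1 ` A n)"
    by (simp add: UA[symmetric] image_UN)
  also have "\<dots> \<le> (\<Sum>n. hausdorff1_content d (circ_point c 1 ` A n))" by (rule hausdorff1_content_UN)
  also have "\<dots> \<le> (\<Sum>n. emeasure lborel (A n))" by (intro suminf_le le) auto
  also have "\<dots> = emeasure lborel U"
  proof -
    have "range A \<subseteq> sets lborel" using opA by auto
    from suminf_emeasure[OF this dis] show ?thesis unfolding UA .
  qed
  finally show ?thesis .
qed

lemma hausdorff1_circle_open_le:
  assumes "open S" "A \<subseteq> S \<inter> sphere c 1"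
  shows "hausdorff1 A \<le> emeasure lborel {t \<in> {0<..<2*pi}. circ_point c 1 t \<in> S}"
proof -
  let ?U = "{t \<in> {0<..<2*pi}. circ_point c 1 t \<in> S}"
  have "?U = (circ_point c 1 -` S) \<inter> {0<..<2*pi}" by auto
  then have U: "open ?U"
    using open_vimage[OF assms(1), of "circ_point c 1"] continuous_on_circ_point[OF continuous_on_id]
    by (auto intro!: open_Int)
  have bU: "bounded ?U" by (rule bounded_subset[of "{0<..<2*pi}"]) auto
  \<comment> \<open>The angle 0 is left out of \<open>?U\<close> to make it open; the point it
    represents is restored as an arc of length 0.\<close>
  have sub: "A \<subseteq> circ_point c 1 ` ?U \<union> circ_point c 1 ` {0..0}"
  proof
    fix x assume "x \<in> A"
    then have x: "x \<in> S" "dist c x = 1" using assms(2) by auto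
    obtain c1 c2 where c: "c = (c1, c2)" by (cases c)
    obtain x1 x2 where xx: "x = (x1, x2)" by (cases x)
    have "(x1 - c1)\<^sup>2 + (x2 - c2)\<^sup>2 = 1"
      using x(2) by (simp add: c xx dist_Pair_Pair dist_real_def power2_commute)
    then obtain t where t: "0 \<le> t" "t < 2*pi" "x1 - c1 = cos t" "x2 - c2 = sin t"
      using sincos_total_2pi by metis
    then have "x = circ_point c 1 t" by (simp add: circ_point_def c xx)
    then show "x \<in> circ_point c 1 ` ?U \<union> circ_point c 1 ` {0..0}"
      using t x by (cases "t = 0") auto
  qed
  show ?thesis unfolding hausdorff1_def
  proof (rule SUP_least)
    fix d :: real assume "d \<in> {0<..}"
    then have d: "0 < d" by simp
    have "hausdorff1_content d A \<le> hausdorff1_content d (circ_point c 1 ` ?U) + hausdorff1_content d (circ_point c 1 ` {0..0})"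
      using hausdorff1_content_mono[OF sub] hausdorff1_content_Un[OF d] by (rule order_trans)
    also have "\<dots> \<le> emeasure lborel ?U + ennreal (0 - 0)"
      by (intro add_mono hausdorff1_content_open_le hausdorff1_content_arc_le U bU d) auto
    finally show "hausdorff1_content d A \<le> emeasure lborel ?U" by simp
  qed
qed

text \<open>Both sets lie on the circle, the first in the interior and the second in the exterior of
  \<Omega>. Their angles therefore lie in disjoint open subsets of \<open>{0<..<2*pi}\<close>, up to
  the angle 0, and Lebesgue measure of angles bounds \<open>hausdorff1\<close>. The outcome is that
  the kept arcs have nonnegative length.\<close>

lemma gamma_sum_le:
  assumes B: "B = ball c 1"
  shows "gamma_out B \<Omega> + gamma_in B \<Omega> \<le> 2 * pi"
proof -
  let ?Ao = "frontier (\<Omega> - B) - frontier \<Omega>" and ?Ai = "frontier (B - \<Omega>) - frontier \<Omega>"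
  have fB: "frontier B = sphere c 1" by (simp add: B)
  have "?Ao \<subseteq> sphere c 1"
    using frontier_Int_subset[of \<Omega> "- B"] fB by (auto simp: Diff_eq)
  moreover have "?Ao \<subseteq> closure \<Omega>"
    using closure_mono[of "\<Omega> - B" \<Omega>] by (auto simp: frontier_def)
  ultimately have Ao: "?Ao \<subseteq> interior \<Omega> \<inter> sphere c 1" by (auto simp: frontier_def)
  have "?Ai \<subseteq> sphere c 1"
    using frontier_Int_subset[of B "- \<Omega>"] fB by (auto simp: Diff_eq)
  moreover have "?Ai \<subseteq> closure (- \<Omega>)"
    using closure_mono[of "B - \<Omega>" "- \<Omega>"] by (auto simp: frontier_def)
  ultimately have Ai: "?Ai \<subseteq> - closure \<Omega> \<inter> sphere c 1"
    by (auto simp: frontier_def closure_complement)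
  let ?U1 = "{t \<in> {0<..<2*pi}. circ_point c 1 t \<in> interior \<Omega>}"
  let ?U2 = "{t \<in> {0<..<2*pi}. circ_point c 1 t \<in> - closure \<Omega>}"
  have op: "open (circ_point c 1 -` S)" if "open S" for S
    using open_vimage[OF that, of "circ_point c 1"] continuous_on_circ_point[OF continuous_on_id] by auto
  have m: "?U1 \<in> sets lborel" "?U2 \<in> sets lborel"
  proof -
    have "?U1 = (circ_point c 1 -` interior \<Omega>) \<inter> {0<..<2*pi}" "?U2 = (circ_point c 1 -` (- closure \<Omega>)) \<inter> {0<..<2*pi}" by auto
    then show "?U1 \<in> sets lborel" "?U2 \<in> sets lborel"
      using op[of "interior \<Omega>"] op[of "- closure \<Omega>"] by (auto intro!: borel_open open_Int simp del: vimage_Compl)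
  qed
  have "?U1 \<inter> ?U2 = {}" using interior_subset closure_subset by blast
  then have "emeasure lborel ?U1 + emeasure lborel ?U2 = emeasure lborel (?U1 \<union> ?U2)"
    using m by (intro plus_emeasure)
  also have "\<dots> \<le> emeasure lborel {0<..<2*pi}" by (intro emeasure_mono) auto
  also have "\<dots> = ennreal (2 * pi)" by simp
  finally have "hausdorff1 ?Ao + hausdorff1 ?Ai \<le> ennreal (2 * pi)"
    using add_mono[OF hausdorff1_circle_open_le[OF open_interior Ao] hausdorff1_circle_open_le[OF open_Compl[OF closed_closure] Ai]]
    by (rule order_trans[rotated])
  note sum_le = this
  then have "enn2real (hausdorff1 ?Ao + hausdorff1 ?Ai) \<le> 2 * pi"
    by (simp add: enn2real_leI)
  moreover have "hausdorff1 ?Ao < top" "hausdorff1 ?Ai < top"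
    by (rule le_less_trans[OF order_trans[OF _ sum_le] ennreal_less_top], simp)+
  ultimately show ?thesis by (simp add: gamma_out_def gamma_in_def enn2real_plus)
qed

lemma gamma_nonneg: "0 \<le> gamma_out B \<Omega>" "0 \<le> gamma_in B \<Omega>"
  by (auto simp: gamma_out_def gamma_in_def)

subsection \<open>Theta curves in the plane\<close>

text \<open>The theorems on split curves and on unions of continua used below concern
  \<open>complex\<close>; this linear bijection carries them to \<open>plane\<close>.\<close>

definition plane_to_complex :: "plane \<Rightarrow> complex" where
  "plane_to_complex z = Complex (fst z) (snd z)"

definition complex_to_plane :: "complex \<Rightarrow> plane" where
  "complex_to_plane z = (Re z, Im z)"

lemma plane_complex_inverse [simp]:
  "complex_to_plane (plane_to_complex z) = z" "plane_to_complex (complex_to_plane w) = w"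
  by (auto simp: plane_to_complex_def complex_to_plane_def)

lemma bounded_linear_plane_to_complex: "bounded_linear plane_to_complex"
proof -
  have "plane_to_complex = (\<lambda>z. of_real (fst z) + \<i> * of_real (snd z))"
    by (auto simp: plane_to_complex_def complex_eq_iff)
  moreover have "bounded_linear (\<lambda>z::plane. complex_of_real (fst z) + \<i> * complex_of_real (snd z))"
    by (intro bounded_linear_add bounded_linear_const_mult bounded_linear_compose[OF bounded_linear_of_real]
        bounded_linear_fst bounded_linear_snd)
  ultimately show ?thesis by simp
qed

lemma bounded_linear_complex_to_plane: "bounded_linear complex_to_plane"
  unfolding complex_to_plane_def by (intro bounded_linear_Pair bounded_linear_Re bounded_linear_Im)

lemma inj_plane_to_complex: "inj plane_to_complex"
  by (metis injI plane_complex_inverse(1))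

lemma plane_to_complex_image_eqI:
  assumes "\<And>w. w \<in> X \<longleftrightarrow> complex_to_plane w \<in> Y"
  shows "X = plane_to_complex ` Y"
proof (intro set_eqI iffI)
  fix w assume "w \<in> X"
  then have "complex_to_plane w \<in> Y" by (rule iffD1[OF assms])
  then show "w \<in> plane_to_complex ` Y" by (metis imageI plane_complex_inverse(2))
next
  fix w assume "w \<in> plane_to_complex ` Y"
  then have "complex_to_plane w \<in> Y" by (metis imageE plane_complex_inverse(1))
  then show "w \<in> X" by (rule iffD2[OF assms])
qed

lemma connected_component_image:
  assumes "connected_component S x y" "continuous_on UNIV f"
  shows "connected_component (f ` S) (f x) (f y)"
proof -
  obtain T where "connected T" "T \<subseteq> S" "x \<in> T" "y \<in> T"
    using assms(1) unfolding connected_component_def by blast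
  then show ?thesis
    unfolding connected_component_def
    by (intro exI[of _ "f ` T"]) (auto intro!: connected_continuous_image continuous_on_subset[OF assms(2)])
qed

lemma connected_component_plane_to_complex:
  "connected_component (plane_to_complex ` S) (plane_to_complex x) (plane_to_complex y) \<longleftrightarrow> connected_component S x y"
proof
  assume "connected_component (plane_to_complex ` S) (plane_to_complex x) (plane_to_complex y)"
  from connected_component_image[OF this, of complex_to_plane]
  show "connected_component S x y"
    by (simp add: image_image linear_continuous_on bounded_linear_complex_to_plane)
next
  assume "connected_component S x y"
  from connected_component_image[OF this, of plane_to_complex]
  show "connected_component (plane_to_complex ` S) (plane_to_complex x) (plane_to_complex y)"
    by (simp add: linear_continuous_on bounded_linear_plane_to_complex)
qed

lemma plane_to_complex_Compl: "- plane_to_complex ` S = plane_to_complex ` (- S)"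
proof -
  have "surj plane_to_complex" by (metis plane_complex_inverse(2) surjI)
  then show ?thesis using inj_plane_to_complex by (simp add: bij_image_Compl_eq bij_def)
qed

lemma inside_plane_to_complex: "inside (plane_to_complex ` S) = plane_to_complex ` inside S"
proof -
  have cc: "connected_component_set (- plane_to_complex ` S) (plane_to_complex x)
     = plane_to_complex ` connected_component_set (- S) x" for x
  proof -
    have "w \<in> connected_component_set (- plane_to_complex ` S) (plane_to_complex x)
      \<longleftrightarrow> complex_to_plane w \<in> connected_component_set (- S) x" for w
      using connected_component_plane_to_complex[of "- S" x "complex_to_plane w"]
      by (simp add: plane_to_complex_Compl)
    then show ?thesis by (rule plane_to_complex_image_eqI)
  qed
  have bd: "bounded (plane_to_complex ` T) \<longleftrightarrow> bounded T" for T
  proof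
    assume "bounded (plane_to_complex ` T)"
    from bounded_linear_image[OF this bounded_linear_complex_to_plane]
    show "bounded T" by (simp add: image_image)
  qed (intro bounded_linear_image bounded_linear_plane_to_complex)
  have "w \<in> inside (plane_to_complex ` S) \<longleftrightarrow> complex_to_plane w \<in> inside S" for w
  proof -
    have "w \<in> plane_to_complex ` S \<longleftrightarrow> complex_to_plane w \<in> S"
      by (metis image_iff plane_complex_inverse)
    moreover have "bounded (connected_component_set (- plane_to_complex ` S) w)
      \<longleftrightarrow> bounded (connected_component_set (- S) (complex_to_plane w))"
      using cc[of "complex_to_plane w"] bd by simp
    ultimately show ?thesis unfolding inside_def by simp
  qed
  then show ?thesis by (rule plane_to_complex_image_eqI)
qed

text \<open>The degenerate alternative \<open>A = {p}\<close> lets kept arcs that are single points,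
  as in the transversal case, be joined like all others.\<close>

definition arc_from_to :: "plane set \<Rightarrow> plane \<Rightarrow> plane \<Rightarrow> bool" where
  "arc_from_to A p q \<longleftrightarrow> (p = q \<and> A = {p}) \<or>
     (\<exists>g. arc g \<and> path_image g = A \<and> pathstart g = p \<and> pathfinish g = q)"

lemma arc_from_to_sym: "arc_from_to A p q \<Longrightarrow> arc_from_to A q p"
  unfolding arc_from_to_def
  by (metis arc_reversepath path_image_reversepath pathfinish_reversepath pathstart_reversepath)

lemma arc_from_to_compact: "arc_from_to A p q \<Longrightarrow> compact A"
  unfolding arc_from_to_def using compact_arc_image by auto

lemma arc_from_to_connected: "arc_from_to A p q \<Longrightarrow> connected A"
  unfolding arc_from_to_def using connected_arc_image by auto

lemma arc_from_to_ends: "arc_from_to A p q \<Longrightarrow> p \<in> A \<and> q \<in> A"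
  unfolding arc_from_to_def by (metis insertI1 pathfinish_in_path_image pathstart_in_path_image)

lemma arc_from_to_join:
  assumes "arc_from_to A p q" "arc_from_to B q r" "A \<inter> B \<subseteq> {q}"
  shows "arc_from_to (A \<union> B) p r"
proof (cases "p = q \<and> A = {p} \<or> q = r \<and> B = {q}")
  case True
  then show ?thesis using assms arc_from_to_ends by (metis Un_absorb1 Un_absorb2 empty_subsetI insert_subset)
next
  case False
  then obtain g h where "arc g" "path_image g = A" "pathstart g = p" "pathfinish g = q"
    "arc h" "path_image h = B" "pathstart h = q" "pathfinish h = r"
    using assms unfolding arc_from_to_def by metis
  moreover from this have "arc (g +++ h)" using assms(3) by (intro arc_join) auto
  ultimately show ?thesis unfolding arc_from_to_def
    by (metis path_image_join pathfinish_join pathstart_join)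
qed

lemma arc_from_to_path:
  assumes "arc_from_to A p q" "p \<noteq> q"
  obtains g where "simple_path (plane_to_complex \<circ> g)" "path_image (plane_to_complex \<circ> g) = plane_to_complex ` A"
    "pathstart (plane_to_complex \<circ> g) = plane_to_complex p" "pathfinish (plane_to_complex \<circ> g) = plane_to_complex q"
proof -
  obtain g where g: "arc g" "path_image g = A" "pathstart g = p" "pathfinish g = q"
    using assms unfolding arc_from_to_def by auto
  have "linear plane_to_complex" by (simp add: bounded_linear.linear bounded_linear_plane_to_complex)
  then have "simple_path (plane_to_complex \<circ> g)"
    using g inj_plane_to_complex arc_imp_simple_path by (simp add: simple_path_linear_image_eq)
  then show ?thesis
    using g by (intro that[of g]) (auto simp: path_image_compose pathstart_compose pathfinish_compose)
qed

text \<open>\<open>split_inside_simple_closed_curve\<close> for arcs given as sets: \<open>A\<close>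
  is a cross-cut of the closed curve \<open>A1 \<union> A2\<close>. Additivity of areas over lunes
  rests on it.\<close>

lemma theta_split:
  assumes arcs: "arc_from_to A1 p q" "arc_from_to A2 p q" "arc_from_to A p q" and "p \<noteq> q"
    and int: "A1 \<inter> A2 = {p, q}" "A1 \<inter> A = {p, q}" "A2 \<inter> A = {p, q}"
    and ne: "A \<inter> inside (A1 \<union> A2) \<noteq> {}"
  shows "inside (A1 \<union> A) \<inter> inside (A2 \<union> A) = {}"
    and "inside (A1 \<union> A) \<union> inside (A2 \<union> A) \<union> (A - {p, q}) = inside (A1 \<union> A2)"
proof -
  let ?f = plane_to_complex
  obtain g1 where g1: "simple_path (?f \<circ> g1)" "path_image (?f \<circ> g1) = ?f ` A1"
    "pathstart (?f \<circ> g1) = ?f p" "pathfinish (?f \<circ> g1) = ?f q" by (rule arc_from_to_path[OF arcs(1) \<open>p \<noteq> q\<close>])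
  obtain g2 where g2: "simple_path (?f \<circ> g2)" "path_image (?f \<circ> g2) = ?f ` A2"
    "pathstart (?f \<circ> g2) = ?f p" "pathfinish (?f \<circ> g2) = ?f q" by (rule arc_from_to_path[OF arcs(2) \<open>p \<noteq> q\<close>])
  obtain g where g: "simple_path (?f \<circ> g)" "path_image (?f \<circ> g) = ?f ` A"
    "pathstart (?f \<circ> g) = ?f p" "pathfinish (?f \<circ> g) = ?f q" by (rule arc_from_to_path[OF arcs(3) \<open>p \<noteq> q\<close>])
  note inj = inj_plane_to_complex
  have img: "?f ` (inside (A1 \<union> A) \<inter> inside (A2 \<union> A)) = {} \<and>
    ?f ` (inside (A1 \<union> A) \<union> inside (A2 \<union> A) \<union> (A - {p, q})) = ?f ` inside (A1 \<union> A2)"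
  proof (rule split_inside_simple_closed_curve[OF g1(1,3,4) g2(1,3,4) g(1,3,4)])
    show "?f p \<noteq> ?f q" using \<open>p \<noteq> q\<close> by (metis plane_complex_inverse(1))
    show "path_image (?f \<circ> g1) \<inter> path_image (?f \<circ> g2) = {?f p, ?f q}"
      "path_image (?f \<circ> g1) \<inter> path_image (?f \<circ> g) = {?f p, ?f q}"
      "path_image (?f \<circ> g2) \<inter> path_image (?f \<circ> g) = {?f p, ?f q}"
      unfolding g1 g2 g image_Int[OF inj, symmetric] int by auto
    show "path_image (?f \<circ> g) \<inter> inside (path_image (?f \<circ> g1) \<union> path_image (?f \<circ> g2)) \<noteq> {}"
      unfolding g1 g2 g image_Un[symmetric] inside_plane_to_complex image_Int[OF inj, symmetric]
      using ne by simp
  qed (unfold g1 g2 g image_Un[symmetric] inside_plane_to_complex image_Int[OF inj, symmetric],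
       simp add: image_Un image_set_diff[OF inj])
  show "inside (A1 \<union> A) \<inter> inside (A2 \<union> A) = {}"
    by (rule image_is_empty[THEN iffD1, OF conjunct1[OF img]])
  show "inside (A1 \<union> A) \<union> inside (A2 \<union> A) \<union> (A - {p, q}) = inside (A1 \<union> A2)"
    by (rule inj_image_eq_iff[OF inj, THEN iffD1, OF conjunct2[OF img]])
qed

lemma plane_Janiszewski:
  fixes S T :: "plane set"
  assumes "compact S" "compact T" "connected (S \<inter> T)"
    "connected_component (- S) a b" "connected_component (- T) a b"
  shows "connected_component (- (S \<union> T)) a b"
proof -
  let ?f = plane_to_complex
  have cl: "continuous_on A ?f" for A by (intro linear_continuous_on bounded_linear_plane_to_complex)
  have "connected_component (- (?f ` S \<union> ?f ` T)) (?f a) (?f b)"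
  proof (rule Janiszewski)
    show "compact (?f ` S)" "closed (?f ` T)"
      using assms cl by (auto intro!: compact_continuous_image compact_imp_closed)
    show "connected (?f ` S \<inter> ?f ` T)"
      unfolding image_Int[OF inj_plane_to_complex, symmetric] by (intro connected_continuous_image cl assms)
    show "connected_component (- ?f ` S) (?f a) (?f b)" "connected_component (- ?f ` T) (?f a) (?f b)"
      using assms by (simp_all add: plane_to_complex_Compl connected_component_plane_to_complex)
  qed
  then show ?thesis
    by (simp add: image_Un[symmetric] plane_to_complex_Compl connected_component_plane_to_complex)
qed

text \<open>Otherwise \<open>z\<close> could be joined to points far away both off
  \<open>A \<union> D\<close> and off \<open>A' \<union> D\<close>. As these two compact sets have
  connected intersection, Janiszewski's theorem joins \<open>z\<close> to far points off their
  union, so \<open>z\<close> would not be inside \<open>A \<union> A'\<close>.\<close>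

lemma theta_inside:
  fixes A A' D :: "plane set"
  assumes "compact A" "compact A'" "compact D" "connected ((A \<union> D) \<inter> (A' \<union> D))"
    and z: "z \<in> inside (A \<union> A')" "z \<notin> inside (A' \<union> D)" "z \<notin> D"
  shows "z \<in> inside (A \<union> D)"
proof (rule ccontr)
  assume nz: "z \<notin> inside (A \<union> D)"
  let ?S = "A \<union> D" and ?T = "A' \<union> D"
  have cpt: "compact ?S" "compact ?T" using assms by auto
  have zA: "z \<notin> A" "z \<notin> A'" using z(1) by (auto simp: inside_def)
  have dim: "2 \<le> DIM(plane)" by simp
  obtain R where R: "?S \<union> ?T \<subseteq> ball 0 R"
    using cpt by (meson bounded_Un bounded_subset_ballD compact_imp_bounded)
  \<comment> \<open>The outside of a bounded plane set is connected and contains the complement of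
    every ball around it.\<close>
  have far: "connected_component (- X) z w" if X: "X \<subseteq> ball 0 R" and "z \<notin> inside X" "z \<notin> X" "norm w \<ge> R" "compact X" for X w
  proof -
    have "z \<in> outside X" using that by (simp add: outside_inside)
    moreover have "w \<in> outside X"
    proof -
      have "- ball 0 R \<subseteq> outside X"
        by (rule outside_subset_convex[OF convex_ball X])
      then show ?thesis using that by auto
    qed
    moreover have "connected (outside X)"
      using connected_outside[OF _ dim] compact_imp_bounded[OF \<open>compact X\<close>] by blast
    moreover have "outside X \<subseteq> - X" by (auto simp: outside_def)
    ultimately show ?thesis unfolding connected_component_def by blast
  qed
  have unb: "\<forall>w. norm w \<ge> R \<longrightarrow> connected_component (- (A \<union> A')) z w"
  proof (intro allI impI)
    fix w :: plane assume w: "norm w \<ge> R"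
    have "connected_component (- (?S \<union> ?T)) z w"
    proof (rule plane_Janiszewski[OF cpt assms(4)])
      show "connected_component (- ?S) z w" "connected_component (- ?T) z w"
        using R zA z nz w cpt by (intro far; simp)+
    qed
    then show "connected_component (- (A \<union> A')) z w"
      by (rule connected_component_of_subset) auto
  qed
  have "- ball 0 R \<subseteq> connected_component_set (- (A \<union> A')) z" using unb by auto
  then have "\<not> bounded (connected_component_set (- (A \<union> A')) z)"
    by (meson bounded_ball bounded_subset cobounded_imp_unbounded)
  then show False using z(1) by (simp add: inside_def)
qed

text \<open>The ray is an unbounded connected part of the component of \<open>z\<close>. Locating an
  \<open>inside\<close> below mostly means choosing such a ray.\<close>

lemma not_inside_ray:
  fixes z e :: plane
  assumes "e \<noteq> 0" "\<And>s. 0 \<le> s \<Longrightarrow> z + s *\<^sub>R e \<notin> S"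
  shows "z \<notin> inside S"
proof
  assume "z \<in> inside S"
  then have b: "bounded (connected_component_set (- S) z)" by (simp add: inside_def)
  let ?R = "(\<lambda>s. z + s *\<^sub>R e) ` {0..}"
  have "?R \<subseteq> connected_component_set (- S) z"
  proof (rule connected_component_maximal)
    show "z \<in> ?R" by (rule image_eqI[of _ _ 0]) auto
    show "connected ?R" by (intro connected_continuous_image continuous_intros) auto
    show "?R \<subseteq> - S" using assms(2) by auto
  qed
  with b have "bounded ?R" by (rule bounded_subset)
  then obtain M where M: "\<And>s. s \<ge> 0 \<Longrightarrow> norm (z + s *\<^sub>R e) \<le> M" by (auto simp: bounded_iff)
  define s where "s = (\<bar>M\<bar> + norm z + 1) / norm e"
  have s: "s \<ge> 0" "norm (s *\<^sub>R e) = \<bar>M\<bar> + norm z + 1" using assms(1) by (auto simp: s_def)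
  have "norm (s *\<^sub>R e) \<le> norm (z + s *\<^sub>R e) + norm z" by (metis add_diff_cancel_left' norm_triangle_ineq4 add.commute)
  then show False using M[OF s(1)] s(2) by linarith
qed

subsection \<open>Coordinates adapted to an arc\<close>

text \<open>Here \<open>m\<close> will be the direction of the midpoint of an arc, so that the arc
  is symmetric under a change of sign of the lateral coordinate.\<close>

definition axial :: "plane \<Rightarrow> real \<Rightarrow> plane \<Rightarrow> real" where
  "axial c m z = (z - c) \<bullet> (cos m, sin m)"

definition lateral :: "plane \<Rightarrow> real \<Rightarrow> plane \<Rightarrow> real" where
  "lateral c m z = (z - c) \<bullet> (- sin m, cos m)"

definition frame_point :: "plane \<Rightarrow> real \<Rightarrow> real \<Rightarrow> real \<Rightarrow> plane" where
  "frame_point c m x y = c + x *\<^sub>R (cos m, sin m) + y *\<^sub>R (- sin m, cos m)"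

lemma frame_point_simps [simp]:
  "axial c m (frame_point c m x y) = x" "lateral c m (frame_point c m x y) = y"
proof -
  have "axial c m (frame_point c m x y) = x * (cos m * cos m + sin m * sin m)"
    by (simp add: axial_def frame_point_def inner_prod_def algebra_simps del: sin_cos_squared_add3)
  then show "axial c m (frame_point c m x y) = x" by simp
  have "lateral c m (frame_point c m x y) = y * (cos m * cos m + sin m * sin m)"
    by (simp add: lateral_def frame_point_def inner_prod_def algebra_simps del: sin_cos_squared_add3)
  then show "lateral c m (frame_point c m x y) = y" by simp
qed

lemma frame_point_inverse [simp]: "frame_point c m (axial c m z) (lateral c m z) = z"
proof -
  obtain c1 c2 where c: "c = (c1, c2)" by (cases c)
  obtain z1 z2 where z: "z = (z1, z2)" by (cases z)
  have "frame_point c m (axial c m z) (lateral c m z)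
    = (c1 + (z1 - c1) * (cos m * cos m + sin m * sin m), c2 + (z2 - c2) * (cos m * cos m + sin m * sin m))"
    by (simp add: c z axial_def lateral_def frame_point_def inner_prod_def algebra_simps del: sin_cos_squared_add3)
  then show ?thesis by (simp add: c z)
qed

lemma plane_eq_iff_coords: "z = w \<longleftrightarrow> axial c m z = axial c m w \<and> lateral c m z = lateral c m w"
  by (metis frame_point_inverse)

lemma dist_squared_coords: "(dist z w)\<^sup>2 = (axial c m z - axial c m w)\<^sup>2 + (lateral c m z - lateral c m w)\<^sup>2"
proof -
  have "(axial c m z - axial c m w)\<^sup>2 + (lateral c m z - lateral c m w)\<^sup>2
    = ((fst z - fst w)\<^sup>2 + (snd z - snd w)\<^sup>2) * (cos m * cos m + sin m * sin m)"
    by (simp add: axial_def lateral_def inner_prod_def power2_eq_square algebra_simps del: sin_cos_squared_add3)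
  then show ?thesis by (simp add: dist_prod_def dist_real_def)
qed

lemma ball_coords: "0 < r \<Longrightarrow> z \<in> ball (frame_point c m d 0) r \<longleftrightarrow> (axial c m z - d)\<^sup>2 + (lateral c m z)\<^sup>2 < r\<^sup>2"
  and cball_coords: "0 < r \<Longrightarrow> z \<in> cball (frame_point c m d 0) r \<longleftrightarrow> (axial c m z - d)\<^sup>2 + (lateral c m z)\<^sup>2 \<le> r\<^sup>2"
  and sphere_coords: "0 < r \<Longrightarrow> z \<in> sphere (frame_point c m d 0) r \<longleftrightarrow> (axial c m z - d)\<^sup>2 + (lateral c m z)\<^sup>2 = r\<^sup>2"
proof -
  let ?w = "frame_point c m d 0"
  have *: "(axial c m z - d)\<^sup>2 + (lateral c m z)\<^sup>2 = (dist ?w z)\<^sup>2"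
    using dist_squared_coords[of z ?w c m] by (simp add: dist_commute)
  assume r: "0 < r"
  show "z \<in> ball ?w r \<longleftrightarrow> (axial c m z - d)\<^sup>2 + (lateral c m z)\<^sup>2 < r\<^sup>2"
    unfolding * using r power_mono_iff[of r "dist ?w z" 2] by (simp add: not_le[symmetric])
  show "z \<in> cball ?w r \<longleftrightarrow> (axial c m z - d)\<^sup>2 + (lateral c m z)\<^sup>2 \<le> r\<^sup>2"
    unfolding * using r power_mono_iff[of "dist ?w z" r 2] by simp
  show "z \<in> sphere ?w r \<longleftrightarrow> (axial c m z - d)\<^sup>2 + (lateral c m z)\<^sup>2 = r\<^sup>2"
    unfolding * using r power2_eq_iff_nonneg[of "dist ?w z" r] by simp
qed

lemma frame_point_origin [simp]: "frame_point c m 0 0 = c"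
  by (simp add: frame_point_def zero_prod_def[symmetric])

lemma frame_vector_nonzero: "(cos m, sin m) \<noteq> (0::plane)"
proof
  assume "(cos m, sin m) = (0::plane)"
  then have "cos m = 0" "sin m = 0" by (auto simp: zero_prod_def)
  then have "(sin m)\<^sup>2 + (cos m)\<^sup>2 = 0" by simp
  then show False unfolding sin_cos_squared_add by simp
qed

lemmas unit_disc_coords = ball_coords[of 1 _ c m 0 for c m, simplified]
  cball_coords[of 1 _ c m 0 for c m, simplified] sphere_coords[of 1 _ c m 0 for c m, simplified]

lemma continuous_on_axial [continuous_intros]: "continuous_on A (axial c m)"
  unfolding axial_def by (intro continuous_intros)

lemma continuous_on_lateral [continuous_intros]: "continuous_on A (lateral c m)"
  unfolding lateral_def by (intro continuous_intros)

lemma axial_circ_point [simp]: "axial c m (circ_point c r t) = r * cos (t - m)"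
  and lateral_circ_point [simp]: "lateral c m (circ_point c r t) = r * sin (t - m)"
  by (simp_all add: axial_def lateral_def circ_point_def inner_prod_def cos_diff sin_diff algebra_simps)

lemma halfplane_axial_eq: "{z. s * t \<le> s * axial c m z} = {z. (s *\<^sub>R (cos m, sin m)) \<bullet> z \<ge> s * t + (s *\<^sub>R (cos m, sin m)) \<bullet> c}"
  by (cases c) (auto simp: axial_def inner_prod_def algebra_simps)

lemma interior_halfplane_axial:
  assumes "s \<noteq> 0" shows "interior {z. s * t \<le> s * axial c m z} = {z. s * t < s * axial c m z}"
proof -
  have "s *\<^sub>R (cos m, sin m) \<noteq> 0" using assms frame_vector_nonzero[of m] by (simp del: scaleR_Pair)
  from interior_halfspace_ge[OF this, of "s * t + (s *\<^sub>R (cos m, sin m)) \<bullet> c"]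
  show ?thesis unfolding halfplane_axial_eq
    by (cases c) (auto simp: axial_def inner_prod_def algebra_simps)
qed

lemma convex_halfplane_axial: "convex {z. s * t \<le> s * axial c m z}"
  unfolding halfplane_axial_eq by (rule convex_halfspace_ge)

lemma negligible_axial_line: "negligible {z. axial c m z = t}"
proof -
  have "negligible {z. (cos m, sin m) \<bullet> z = t + (cos m, sin m) \<bullet> c}"
    by (intro negligible_hyperplane disjI1 frame_vector_nonzero)
  moreover have "{z. (cos m, sin m) \<bullet> z = t + (cos m, sin m) \<bullet> c} = {z. axial c m z = t}"
    by (cases c) (auto simp: axial_def inner_prod_def algebra_simps)
  ultimately show ?thesis by simp
qed

lemma axial_translate: "axial c m (t *\<^sub>R (cos m, sin m) + z) = t + axial c m z"
  "lateral c m (t *\<^sub>R (cos m, sin m) + z) = lateral c m z"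
proof -
  have "t *\<^sub>R (cos m, sin m) + z = frame_point c m (t + axial c m z) (lateral c m z)"
  proof -
    have "frame_point c m (t + x) y = t *\<^sub>R (cos m, sin m) + frame_point c m x y" for x y
      unfolding frame_point_def scaleR_add_left by (simp only: ac_simps)
    then show ?thesis by simp
  qed
  then show "axial c m (t *\<^sub>R (cos m, sin m) + z) = t + axial c m z"
    "lateral c m (t *\<^sub>R (cos m, sin m) + z) = lateral c m z" by simp_all
qed

subsection \<open>Areas of half-discs and slabs\<close>

lemma open_bounded_fmeasurable: "open S \<Longrightarrow> bounded S \<Longrightarrow> S \<in> fmeasurable lborel" for S :: "'a::euclidean_space set"
  by (rule fmeasurableI) (simp add: borel_open, rule emeasure_bounded_finite)

lemma measure_lborel_mono:
  "S \<subseteq> T \<Longrightarrow> open S \<Longrightarrow> open T \<Longrightarrow> bounded T \<Longrightarrow> measure lborel S \<le> measure lborel T" for S :: "'a::euclidean_space set"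
  by (rule measure_mono_fmeasurable) (auto simp: open_bounded_fmeasurable)

lemma measure_lborel_Un_null:
  fixes S T :: "'a::euclidean_space set"
  assumes "open S" "bounded S" "open T" "bounded T" "S \<inter> T = {}" "S \<union> T \<union> N = U" "N \<in> null_sets lborel"
  shows "measure lborel U = measure lborel S + measure lborel T"
proof -
  have "measure lborel U = measure lborel (S \<union> T)"
    unfolding assms(6)[symmetric] using assms by (intro measure_Un_null_set) auto
  also have "\<dots> = measure lborel S + measure lborel T"
    using assms by (intro measure_Un_AE) (auto simp: open_bounded_fmeasurable)
  finally show ?thesis .
qed

lemma negligible_borel_null: "negligible N \<Longrightarrow> N \<in> sets borel \<Longrightarrow> N \<in> null_sets lborel"
  by (simp add: negligible_iff_null_sets null_sets_completion_iff)

lemma measure_ball_plane: "0 \<le> r \<Longrightarrow> measure lborel (ball (x::plane) r) = pi * r\<^sup>2"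
  by (simp add: content_ball unit_ball_vol_2 eval_nat_numeral(3)[symmetric] power2_eq_square)

definition half_disc :: "plane \<Rightarrow> real \<Rightarrow> real \<Rightarrow> real \<Rightarrow> plane set" where
  "half_disc c m d r = {z. (axial c m z - d)\<^sup>2 + (lateral c m z)\<^sup>2 < r\<^sup>2 \<and> d < axial c m z}"

lemma open_coords:
  "open {z. (axial c m z - d)\<^sup>2 + (lateral c m z)\<^sup>2 < r\<^sup>2}" "open {z. t < axial c m z}" "open {z. axial c m z < t}"
  by (auto intro!: open_Collect_less continuous_intros)

lemma disc_coords_eq: "0 < r \<Longrightarrow> {z. (axial c m z - d)\<^sup>2 + (lateral c m z)\<^sup>2 < r\<^sup>2} = ball (frame_point c m d 0) r"
  using ball_coords by blast

lemma bounded_disc_part: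
  assumes "0 < r"
  shows "bounded {z. (axial c m z - d)\<^sup>2 + (lateral c m z)\<^sup>2 < r\<^sup>2 \<and> P z}"
  by (rule bounded_subset[OF bounded_ball[of "frame_point c m d 0" r]], rule subsetI)
     (simp only: mem_Collect_eq ball_coords[OF assms])

lemma open_disc_above: "open {z. (axial c m z - d)\<^sup>2 + (lateral c m z)\<^sup>2 < r\<^sup>2 \<and> t < axial c m z}"
  and open_disc_below: "open {z. (axial c m z - d)\<^sup>2 + (lateral c m z)\<^sup>2 < r\<^sup>2 \<and> axial c m z < t}"
  and open_disc_between: "open {z. (axial c m z - d)\<^sup>2 + (lateral c m z)\<^sup>2 < r\<^sup>2 \<and> s < axial c m z \<and> axial c m z < t}"
  by (auto intro!: open_Collect_conj open_coords)

lemma null_axial_line: "{z \<in> S. axial c m z = t} \<in> null_sets lborel" if "open S"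
proof (rule negligible_borel_null)
  show "negligible {z \<in> S. axial c m z = t}" by (rule negligible_subset[OF negligible_axial_line[of c m t]]) auto
  have "closed {z. axial c m z = t}" by (intro closed_Collect_eq continuous_intros)
  then have "S \<inter> {z. axial c m z = t} \<in> sets borel" using that by auto
  then show "{z \<in> S. axial c m z = t} \<in> sets borel" by (simp add: Int_def)
qed

text \<open>Point reflection in the centre exchanges the two halves, and the line between them is a
  null set.\<close>

lemma measure_half_disc:
  assumes r: "0 < r"
  shows "measure lborel (half_disc c m d r) = pi * r\<^sup>2 / 2"
proof -
  let ?D = "{z. (axial c m z - d)\<^sup>2 + (lateral c m z)\<^sup>2 < r\<^sup>2}"
  let ?L = "{z. (axial c m z - d)\<^sup>2 + (lateral c m z)\<^sup>2 < r\<^sup>2 \<and> axial c m z < d}"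
  let ?q = "frame_point c m d 0"
  let ?T = "\<lambda>z. (-1) *\<^sub>R z + 2 *\<^sub>R ?q"
  have T: "axial c m (?T z) = 2 * d - axial c m z" "lateral c m (?T z) = - lateral c m z" for z
  proof -
    have "?T z = frame_point c m (2 * d - axial c m z) (- lateral c m z)"
      by (subst (1) frame_point_inverse[of c m z, symmetric]) (simp add: frame_point_def algebra_simps scaleR_2)
    then show "axial c m (?T z) = 2 * d - axial c m z" "lateral c m (?T z) = - lateral c m z" by simp_all
  qed
  have TT: "?T (?T z) = z" for z by simp
  have "?L = ?T ` half_disc c m d r"
  proof (intro set_eqI iffI)
    fix z assume "z \<in> ?L"
    then have "?T z \<in> half_disc c m d r"
      unfolding half_disc_def mem_Collect_eq T by (simp add: power2_commute)
    then show "z \<in> ?T ` half_disc c m d r" using TT[of z] by (metis image_eqI)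
  next
    fix z assume "z \<in> ?T ` half_disc c m d r"
    then show "z \<in> ?L" unfolding half_disc_def mem_Collect_eq
      by (auto simp only: T image_iff mem_Collect_eq) (simp_all add: power2_commute)
  qed
  then have "measure lebesgue ?L = measure lebesgue (half_disc c m d r)"
    using measure_lebesgue_affine[of "-1" "2 *\<^sub>R ?q" "half_disc c m d r"] by (simp add: add.commute)
  moreover have op: "open (half_disc c m d r)" "open ?L"
    unfolding half_disc_def by (rule open_disc_above open_disc_below)+
  ultimately have eq: "measure lborel ?L = measure lborel (half_disc c m d r)"
    by (simp add: measure_completion borel_open)
  have "measure lborel ?D = measure lborel (half_disc c m d r) + measure lborel ?L"
  proof (rule measure_lborel_Un_null[OF _ _ _ _ _ _ null_axial_line[OF open_coords(1)]])
    show "half_disc c m d r \<union> ?L \<union> {z \<in> ?D. axial c m z = d} = ?D" by (auto simp: half_disc_def)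
    show "open (half_disc c m d r)" "open ?L" by (rule op)+
    show "bounded (half_disc c m d r)" "bounded ?L" unfolding half_disc_def by (rule bounded_disc_part[OF r])+
    show "half_disc c m d r \<inter> ?L = {}" by (auto simp: half_disc_def)
  qed
  then show ?thesis using eq r by (simp add: disc_coords_eq measure_ball_plane)
qed

text \<open>At most \<open>r / t + 1 \<le> 2 * r / t\<close> translates of the slab cover the
  half-disc of area \<open>pi * r^2 / 2\<close>; dividing gives \<open>pi * r * t / 4\<close>
  without computing a circular segment.\<close>

lemma measure_slab_ge:
  assumes r: "0 < r" and t: "0 < t" "t \<le> r"
  shows "pi * r * t / 4 \<le> measure lborel {z. (axial c m z - d)\<^sup>2 + (lateral c m z)\<^sup>2 < r\<^sup>2 \<and> d < axial c m z \<and> axial c m z < d + t}"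
    (is "_ \<le> measure lborel ?S")
proof -
  define N where "N = nat \<lceil>r / t\<rceil>"
  have rt: "r / t \<ge> 1" using t by simp
  have N: "r / t \<le> real N" "real N \<le> r / t + 1"
    using rt by (auto simp: N_def)
  have N0: "real N > 0" using N rt by linarith
  define e where "e = (cos m, sin m)"
  let ?S' = "\<lambda>k::nat. (+) ((real k * t) *\<^sub>R e) ` ?S"
  have opS: "open ?S" by (rule open_disc_between)
  have bS: "bounded ?S" by (rule bounded_disc_part[OF r])
  have fS: "?S' k \<in> fmeasurable lborel" for k
    using opS bS by (intro open_bounded_fmeasurable open_translation bounded_translation)
  have mS: "measure lborel (?S' k) = measure lborel ?S" for k
  proof -
    have "measure lebesgue (?S' k) = measure lebesgue ?S"
      using measure_lebesgue_affine[of 1 "(real k * t) *\<^sub>R e" ?S] by (simp add: add.commute del: scaleR_Pair)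
    then show ?thesis using opS open_translation[OF opS] by (simp add: measure_completion borel_open)
  qed
  define Z where "Z = (\<Union>k<N. {z \<in> half_disc c m d r. axial c m z = d + real k * t})"
  have hd: "open (half_disc c m d r)" unfolding half_disc_def by (rule open_disc_above)
  have Z: "Z \<in> null_sets lborel" unfolding Z_def by (intro null_sets_UN' null_axial_line hd) auto
  \<comment> \<open>Slices farther from the centre are narrower, so each fits into a translate of
    the first slab; \<open>Z\<close> collects the lines that the open slabs miss.\<close>
  have sub: "half_disc c m d r - Z \<subseteq> (\<Union>k<N. ?S' k)"
  proof
    fix z assume z: "z \<in> half_disc c m d r - Z"
    let ?x = "axial c m z - d"
    have zz: "?x\<^sup>2 + (lateral c m z)\<^sup>2 < r\<^sup>2" "0 < ?x" using z by (auto simp: half_disc_def)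
    have "?x\<^sup>2 < r\<^sup>2" using zz zero_le_power2[of "lateral c m z"] by linarith
    then have xr: "?x < r" using r power2_less_imp_less by fastforce
    define k where "k = nat \<lfloor>?x / t\<rfloor>"
    have k: "real k \<le> ?x / t" "?x / t < real k + 1"
      using zz(2) t by (auto simp: k_def)
    have kN: "k < N"
    proof -
      have "?x / t < r / t" using xr t by (intro divide_strict_right_mono)
      then have "real k < real N" using k N by linarith
      then show ?thesis by simp
    qed
    have k': "real k * t \<le> ?x" "?x < real k * t + t" using k t by (auto simp: field_simps)
    have ne: "?x \<noteq> real k * t"
    proof
      assume "?x = real k * t"
      then have "axial c m z = d + real k * t" by simp
      then show False using z kN by (auto simp: Z_def)
    qed
    let ?w = "(- real k * t) *\<^sub>R e + z"
    have w: "axial c m ?w = axial c m z - real k * t" "lateral c m ?w = lateral c m z"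
      using axial_translate[of c m "- real k * t" z] unfolding e_def[symmetric] by simp_all
    have "?w \<in> ?S"
    proof -
      have "(axial c m z - real k * t - d)\<^sup>2 \<le> ?x\<^sup>2" using k' t by (intro power_mono) auto
      then have "(axial c m z - real k * t - d)\<^sup>2 + (lateral c m z)\<^sup>2 < r\<^sup>2" using zz by linarith
      then show ?thesis unfolding mem_Collect_eq w using zz k' ne by auto
    qed
    moreover have "z = (real k * t) *\<^sub>R e + ?w" by (simp del: scaleR_Pair)
    ultimately have "z \<in> ?S' k" by (rule rev_image_eqI)
    then show "z \<in> (\<Union>k<N. ?S' k)" using kN by blast
  qed
  have "pi * r\<^sup>2 / 2 = measure lborel (half_disc c m d r - Z)"
    using measure_half_disc[OF r] measure_Diff_null_set[OF _ Z, of "half_disc c m d r"] hd by (simp add: borel_open)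
  also have "\<dots> \<le> measure lborel (\<Union>k<N. ?S' k)"
  proof (rule measure_mono_fmeasurable[OF sub])
    show "half_disc c m d r - Z \<in> sets lborel"
      using hd null_setsD2[OF Z] by (intro sets.Diff) auto
    show "(\<Union>k<N. ?S' k) \<in> fmeasurable lborel" using fS by (intro fmeasurable.finite_UN) auto
  qed
  also have "\<dots> \<le> (\<Sum>k<N. measure lborel (?S' k))"
    using fS by (intro measure_UNION_le) (auto simp only: fmeasurableD finite_lessThan)
  also have "\<dots> = real N * measure lborel ?S" by (simp add: mS)
  also have "\<dots> \<le> (2 * r / t) * measure lborel ?S"
    using N rt by (intro mult_right_mono) auto
  finally show ?thesis using r t by (simp add: field_simps power2_eq_square)
qed

subsection \<open>Estimates for the flux through an arc\<close>

text \<open>Half the integral of \<open>(tan t)^2\<close> over \<open>{-a..a}\<close>; in this form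
  it enters the second-order expansion of the flux.\<close>

definition tan_excess :: "real \<Rightarrow> real" where
  "tan_excess a = tan a - a"

text \<open>Flux of \<open>strip_field\<close> with curvature \<open>k\<close> through a unit arc of
  half-angle \<open>a\<close>, in the angle measured from the midpoint.\<close>

definition arc_flux :: "real \<Rightarrow> real \<Rightarrow> real" where
  "arc_flux a k = integral {-a..a} (\<lambda>t. cos t * sqrt (1 - k\<^sup>2 * (sin t)\<^sup>2) + k * (sin t)\<^sup>2)"

lemma DERIV_tan_excess:
  assumes "\<bar>a\<bar> < pi/2" shows "(tan_excess has_real_derivative (tan a)\<^sup>2) (at a)"
proof -
  have c: "cos a \<noteq> 0" using assms cos_gt_zero_pi[of a] by fastforce
  have "(tan_excess has_real_derivative inverse ((cos a)\<^sup>2) - 1) (at a)"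
    unfolding tan_excess_def using c by (auto intro!: derivative_eq_intros)
  moreover have "inverse ((cos a)\<^sup>2) - 1 = (tan a)\<^sup>2"
    using c by (simp add: tan_def power_divide divide_simps sin_squared_eq)
  ultimately show ?thesis by simp
qed

lemma tan_excess_mono:
  assumes "0 \<le> a" "a \<le> b" "b < pi/2" shows "tan_excess a \<le> tan_excess b"
  by (rule DERIV_nonneg_imp_nondecreasing[OF assms(2)])
     (use assms DERIV_tan_excess in \<open>force intro!: exI[of _ "(tan _)\<^sup>2"]\<close>)

lemma tan_excess_pos:
  assumes "0 < a" "a < pi/2" shows "0 < tan_excess a"
proof -
  have "tan_excess 0 < tan_excess a"
  proof (rule DERIV_pos_imp_increasing_open[OF assms(1)])
    show "\<exists>y. DERIV tan_excess x :> y \<and> y > 0" if "0 < x" "x < a" for x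
      using DERIV_tan_excess[of x] tan_gt_zero[of x] that assms
      by (intro exI[of _ "(tan x)\<^sup>2"]) auto
    show "continuous_on {0..a} tan_excess"
      using assms by (intro continuous_at_imp_continuous_on ballI DERIV_isCont[OF DERIV_tan_excess]) auto
  qed
  then show ?thesis by (simp add: tan_excess_def)
qed

section \<open>Second-order expansion of the flux in the curvature\<close>

lemma integral_tan_squared:
  assumes "0 \<le> a" "a < pi/2"
  shows "((\<lambda>t. (tan t)\<^sup>2) has_integral 2 * tan_excess a) {-a..a}"
proof -
  have "((\<lambda>t. (tan t)\<^sup>2) has_integral tan_excess a - tan_excess (-a)) {-a..a}"
    using assms
    by (intro fundamental_theorem_of_calculus has_field_derivative_at_within[THEN has_real_derivative_iff_has_vector_derivative[THEN iffD1]] DERIV_tan_excess) auto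
  then show ?thesis by (simp add: tan_excess_def)
qed

text \<open>Squaring the Taylor polynomial of degree 2 reproduces \<open>1 - u\<close> up to terms
  of third and higher order; for small \<open>u\<close> these are dominated by the
  \<open>2 * q * \<bar>u\<bar>^3\<close> that the extra cubic term takes away.\<close>

lemma sqrt_one_minus_ge:
  fixes u :: real assumes "\<bar>u\<bar> \<le> 1/2"
  shows "1 - u/2 - u\<^sup>2/8 - \<bar>u\<bar>^3 \<le> sqrt (1 - u)"
proof (rule real_le_rsqrt)
  define v where "v = \<bar>u\<bar>"
  have v: "0 \<le> v" "v \<le> 1/2" "u\<^sup>2 = v\<^sup>2" using assms by (auto simp: v_def)
  have v2: "v\<^sup>2 \<le> 1/4" using power_mono[OF v(2,1), of 2] by (simp add: power_divide)
  define q where "q = 1 - u/2 - u\<^sup>2/8"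
  have q: "q \<ge> 7/10" using assms v v2 by (simp add: q_def abs_le_iff)
  have qsq: "q\<^sup>2 = 1 - u + u * v\<^sup>2 / 8 + v\<^sup>2 * v\<^sup>2 / 64"
    unfolding q_def v(3)[symmetric] by (simp add: power2_eq_square algebra_simps)
  have v3: "v^3 = v * v\<^sup>2" by (simp add: power2_eq_square power3_eq_cube)
  have "(q - v^3)\<^sup>2 = q\<^sup>2 - 2 * q * v^3 + v^3 * v^3" by (simp add: power2_eq_square algebra_simps)
  also have "\<dots> \<le> 1 - u"
  proof -
    have a1: "u * v\<^sup>2 \<le> v^3" unfolding v3 by (intro mult_right_mono) (auto simp: v_def)
    have a2: "v\<^sup>2 * v\<^sup>2 \<le> 1/2 * v^3"
      using mult_right_mono[OF v(2), of "v^3"] v(1) by (simp add: power2_eq_square power3_eq_cube mult_ac)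
    have a3: "v^3 * v^3 \<le> 1/8 * v^3"
      using mult_right_mono[OF power_mono[OF v(2,1), of 3], of "v^3"] v(1) by (simp add: power_divide)
    have a4: "7/10 * v^3 \<le> q * v^3" using q v(1) by (intro mult_right_mono) auto
    have "0 \<le> v^3" using v(1) by simp
    with a1 a2 a3 a4 show ?thesis unfolding qsq by linarith
  qed
  finally show "(1 - u/2 - u\<^sup>2/8 - \<bar>u\<bar>^3)\<^sup>2 \<le> 1 - u" by (simp add: q_def v_def)
qed

text \<open>Factoring out \<open>(cos t)^2\<close> leaves \<open>sqrt (1 - u)\<close> with
  \<open>u = (2 * x + x^2) * (tan t)^2\<close>. In the expansion the terms linear in
  \<open>x\<close> cancel and the quadratic ones combine to \<open>- x^2 / 2 * (tan t)^2\<close>,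
  using \<open>(cos t)^2 * (1 + (tan t)^2) = 1\<close>.\<close>

lemma flux_integrand_ge:
  fixes x t :: real
  assumes c: "cos t > 0" and tan: "\<bar>tan t\<bar> \<le> 4" and x: "\<bar>x\<bar> \<le> 1/100"
  shows "1 - x\<^sup>2 / 2 * (tan t)\<^sup>2 - 40000 * \<bar>x\<bar>^3
    \<le> cos t * sqrt (1 - (1 + x)\<^sup>2 * (sin t)\<^sup>2) + (1 + x) * (sin t)\<^sup>2"
proof -
  define p where "p = (tan t)\<^sup>2"
  define C where "C = (cos t)\<^sup>2"
  define u where "u = (2 * x + x\<^sup>2) * p"
  have p: "0 \<le> p" "p \<le> 16" using power_mono[OF tan, of 2] by (auto simp: p_def)
  have C: "0 < C" "C \<le> 1" using c by (auto simp: C_def power_le_one)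
  have s: "(sin t)\<^sup>2 = p * C" using c by (simp add: p_def C_def tan_def power_divide)
  have Cp: "C + p * C = 1" using sin_cos_squared_add[of t] s unfolding C_def by linarith
  \<comment> \<open>From \<open>\<bar>2 + x\<bar> \<le> 33/16\<close> and
    \<open>(tan t)^2 \<le> 16\<close>.\<close>
  have u33: "\<bar>u\<bar> \<le> 33 * \<bar>x\<bar>"
  proof -
    have "\<bar>2 * x + x\<^sup>2\<bar> = \<bar>x\<bar> * \<bar>2 + x\<bar>" by (simp add: abs_mult[symmetric] power2_eq_square algebra_simps)
    also have "\<dots> \<le> \<bar>x\<bar> * (33/16)" using x by (intro mult_left_mono) auto
    finally have "\<bar>2 * x + x\<^sup>2\<bar> * p \<le> (\<bar>x\<bar> * (33/16)) * 16" using p by (intro mult_mono) auto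
    then show ?thesis using p by (simp add: u_def abs_mult)
  qed
  then have u2: "\<bar>u\<bar> \<le> 1/2" using x by linarith
  have "1 - (1 + x)\<^sup>2 * (sin t)\<^sup>2 = C * (1 - u)"
    unfolding s u_def using Cp by (simp add: power2_eq_square algebra_simps)
  then have "cos t * sqrt (1 - (1 + x)\<^sup>2 * (sin t)\<^sup>2) = C * sqrt (1 - u)"
    using c by (simp add: C_def real_sqrt_mult power2_eq_square)
  also have "\<dots> \<ge> C * (1 - u/2 - u\<^sup>2/8 - \<bar>u\<bar>^3)"
    using C sqrt_one_minus_ge[OF u2] by (intro mult_left_mono) auto
  finally have 1: "C * (1 - u/2 - u\<^sup>2/8 - \<bar>u\<bar>^3) \<le> cos t * sqrt (1 - (1 + x)\<^sup>2 * (sin t)\<^sup>2)" .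
  have 2: "C * (1 - u/2 - u\<^sup>2/8 - \<bar>u\<bar>^3) + (1 + x) * (sin t)\<^sup>2
    = (C + p * C) - x\<^sup>2/2 * p * (C + p * C) - C * ((x^3/2 + x^4/8) * p\<^sup>2 + \<bar>u\<bar>^3)"
    unfolding s u_def by (simp add: power2_eq_square power3_eq_cube power4_eq_xxxx field_simps)
  \<comment> \<open>\<open>16^2 + 33^3 = 36193\<close>, rounded up to 40000.\<close>
  have 3: "C * ((x^3/2 + x^4/8) * p\<^sup>2 + \<bar>u\<bar>^3) \<le> 40000 * \<bar>x\<bar>^3"
  proof -
    have x4: "x^4 \<le> \<bar>x\<bar>^3"
    proof -
      have "x^4 = \<bar>x\<bar>^3 * \<bar>x\<bar>" by (simp add: power4_eq_xxxx power3_eq_cube)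
      also have "\<dots> \<le> \<bar>x\<bar>^3 * 1" using x by (intro mult_left_mono) auto
      finally show ?thesis by simp
    qed
    have x3: "x^3 \<le> \<bar>x\<bar>^3" by (metis abs_ge_self power_abs)
    have "(x^3/2 + x^4/8) * p\<^sup>2 \<le> \<bar>x\<bar>^3 * 16\<^sup>2"
    proof (intro mult_mono power_mono p)
      show "x^3/2 + x^4/8 \<le> \<bar>x\<bar>^3" using x3 x4 zero_le_power[of "\<bar>x\<bar>" 3] by linarith
    qed auto
    moreover have "\<bar>u\<bar>^3 \<le> (33 * \<bar>x\<bar>)^3" using u33 by (intro power_mono) auto
    ultimately have "(x^3/2 + x^4/8) * p\<^sup>2 + \<bar>u\<bar>^3 \<le> \<bar>x\<bar>^3 * 16\<^sup>2 + (33 * \<bar>x\<bar>)^3" by (rule add_mono)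
    also have "\<dots> \<le> 40000 * \<bar>x\<bar>^3" by (simp add: power_mult_distrib)
    finally have "(x^3/2 + x^4/8) * p\<^sup>2 + \<bar>u\<bar>^3 \<le> 40000 * \<bar>x\<bar>^3" .
    then have "C * ((x^3/2 + x^4/8) * p\<^sup>2 + \<bar>u\<bar>^3) \<le> C * (40000 * \<bar>x\<bar>^3)" using C by (intro mult_left_mono) auto
    also have "\<dots> \<le> 1 * (40000 * \<bar>x\<bar>^3)" using C by (intro mult_right_mono) auto
    finally show ?thesis by simp
  qed
  show ?thesis using 1 2 3 unfolding Cp p_def[symmetric] by linarith
qed

lemma arc_flux_integrable:
  assumes "0 \<le> a"
  shows "(\<lambda>t. cos t * sqrt (1 - k\<^sup>2 * (sin t)\<^sup>2) + k * (sin t)\<^sup>2) integrable_on {-a..a}"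
  by (intro integrable_continuous_real continuous_intros)

text \<open>The pointwise bound integrated. The condition \<open>tan a \<le> 4\<close> makes the
  remainder uniform in \<open>a\<close>; 160000 is \<open>40000 * 4\<close>, since
  \<open>2 * a < pi < 4\<close>.\<close>

lemma arc_flux_ge:
  assumes a: "0 \<le> a" "a < pi/2" "tan a \<le> 4" and x: "\<bar>x\<bar> \<le> 1/100"
  shows "2 * a - x\<^sup>2 * tan_excess a - 160000 * \<bar>x\<bar>^3 \<le> arc_flux a (1 + x)"
proof -
  have c: "((\<lambda>t. 1 - x\<^sup>2 / 2 * (tan t)\<^sup>2 - 40000 * \<bar>x\<bar>^3) has_integral
     1 * (a - (-a)) - x\<^sup>2 / 2 * (2 * tan_excess a) - 40000 * \<bar>x\<bar>^3 * (a - (-a))) {-a..a}"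
    using a has_integral_const_real[of "1::real" "-a" a] has_integral_const_real[of "40000 * \<bar>x\<bar>^3" "-a" a]
    by (intro has_integral_diff has_integral_mult_right integral_tan_squared) (auto simp: mult.commute)
  have "1 * (a - (-a)) - x\<^sup>2 / 2 * (2 * tan_excess a) - 40000 * \<bar>x\<bar>^3 * (a - (-a)) \<le> arc_flux a (1 + x)"
    unfolding arc_flux_def
  proof (rule has_integral_le[OF c integrable_integral[OF arc_flux_integrable[OF a(1)]]])
    fix t assume t: "t \<in> {-a..a}"
    have "\<bar>tan t\<bar> \<le> tan a"
    proof (cases "0 \<le> t")
      case True
      then have "tan t \<le> tan a" using t a by (intro tan_mono_le) auto
      moreover have "0 \<le> tan t" using True t a tan_pos_pi2_le by auto
      ultimately show ?thesis by simp
    next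
      case False
      then have "tan (-t) \<le> tan a" using t a by (intro tan_mono_le) auto
      moreover have "0 \<le> tan (-t)" using False t a tan_pos_pi2_le[of "-t"] by auto
      ultimately show ?thesis by simp
    qed
    then show "1 - x\<^sup>2 / 2 * (tan t)\<^sup>2 - 40000 * \<bar>x\<bar>^3
      \<le> cos t * sqrt (1 - (1 + x)\<^sup>2 * (sin t)\<^sup>2) + (1 + x) * (sin t)\<^sup>2"
      using t a x by (intro flux_integrand_ge cos_gt_zero_pi) auto
  qed
  moreover have "40000 * \<bar>x\<bar>^3 * (2 * a) \<le> 40000 * \<bar>x\<bar>^3 * 4"
    using a pi_less_4 by (intro mult_left_mono) auto
  ultimately show ?thesis by (simp add: mult_ac)
qed

text \<open>For curvature at most 1 the integrand is at least \<open>k\<close> pointwise, whatever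
  the size of \<open>tan a\<close>; this covers angles close to \<open>pi/2\<close>.\<close>

lemma arc_flux_ge_crude:
  assumes a: "0 \<le> a" "a < pi/2" and k: "0 \<le> k" "k \<le> 1"
  shows "2 * a - (1 - k) * pi \<le> arc_flux a k"
proof -
  have c: "((\<lambda>t::real. k) has_integral (k * (a - (-a)))) {-a..a}"
    using has_integral_const_real[of k "-a" a] a by (simp add: mult.commute)
  have "k * (a - (-a)) \<le> arc_flux a k"
    unfolding arc_flux_def
  proof (rule has_integral_le[OF c integrable_integral[OF arc_flux_integrable[OF a(1)]]])
    fix t assume t: "t \<in> {-a..a}"
    have c0: "cos t > 0" using t a by (intro cos_gt_zero_pi) auto
    have k2: "k\<^sup>2 \<le> 1" using k by (simp add: power_le_one)
    have "k\<^sup>2 * (sin t)\<^sup>2 \<le> 1 * (sin t)\<^sup>2" using k2 by (intro mult_right_mono) auto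
    then have "(cos t)\<^sup>2 \<le> 1 - k\<^sup>2 * (sin t)\<^sup>2" by (simp add: cos_squared_eq)
    then have "cos t \<le> sqrt (1 - k\<^sup>2 * (sin t)\<^sup>2)" by (rule real_le_rsqrt)
    then have "cos t * cos t \<le> cos t * sqrt (1 - k\<^sup>2 * (sin t)\<^sup>2)" using c0 by (intro mult_left_mono) auto
    moreover have "k * (cos t)\<^sup>2 \<le> 1 * (cos t)\<^sup>2" using k by (intro mult_right_mono) auto
    moreover have "k * (cos t)\<^sup>2 + k * (sin t)\<^sup>2 = k" by (simp flip: distrib_left)
    ultimately show "k \<le> cos t * sqrt (1 - k\<^sup>2 * (sin t)\<^sup>2) + k * (sin t)\<^sup>2" by (simp add: power2_eq_square)
  qed
  moreover have "(1 - k) * (2 * a) \<le> (1 - k) * pi" using a k by (intro mult_left_mono) auto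
  ultimately show ?thesis by (simp add: algebra_simps)
qed

text \<open>Multiplied by \<open>(cos a)^2\<close> this reduces to
  \<open>sin a * cos a \<le> a\<close>. It is the inequality behind the convexity of
  \<open>1 / tan_excess\<close>.\<close>

lemma tan_squared_times_ge:
  assumes "0 < a" "a < pi/2"
  shows "tan_excess a * (1 + (tan a)\<^sup>2) \<le> (tan a)^3"
proof -
  let ?h = "\<lambda>x::real. x - sin x * cos x"
  have "?h 0 \<le> ?h a"
  proof (rule DERIV_nonneg_imp_nondecreasing[where f="?h"])
    show "\<exists>y. DERIV ?h x :> y \<and> 0 \<le> y" for x
      by (rule exI[of _ "2 * (sin x)\<^sup>2"])
         (auto intro!: derivative_eq_intros simp: power2_eq_square[symmetric] cos_squared_eq)
  qed (use assms in auto)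
  then have h: "sin a * cos a \<le> a" by simp
  have c: "cos a > 0" using assms by (intro cos_gt_zero) auto
  have "1 + (tan a)\<^sup>2 = 1 / (cos a)\<^sup>2"
    using tan_sec[of a] c by (simp add: power_inverse divide_inverse)
  then have "tan_excess a * (1 + (tan a)\<^sup>2) = (tan a - a) / (cos a)\<^sup>2"
    by (simp add: tan_excess_def)
  also have "\<dots> \<le> (tan a - sin a * cos a) / (cos a)\<^sup>2" using h by (intro divide_right_mono) auto
  also have "\<dots> = (tan a)^3"
  proof -
    have "tan a - sin a * cos a = sin a * (1 - (cos a)\<^sup>2) / cos a"
      using c by (simp add: tan_def field_simps power2_eq_square)
    then have "tan a - sin a * cos a = sin a * (sin a)\<^sup>2 / cos a"
      unfolding sin_squared_eq .
    then show ?thesis using c by (simp add: tan_def power_divide power2_eq_square power3_eq_cube)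
  qed
  finally show ?thesis .
qed

text \<open>Convexity compares the pair \<open>a\<close>, \<open>pi/2 - a\<close> with its midpoint;
  monotonicity then passes from \<open>pi/2 - a\<close> to the possibly smaller angle
  \<open>b\<close>.\<close>

lemma inverse_tan_excess_sum_ge:
  assumes "0 < a" "0 < b" "a + b \<le> pi/2"
  shows "8 / (4 - pi) \<le> 1 / tan_excess a + 1 / tan_excess b"
proof -
  let ?I = "{0<..<pi/2}"
  let ?f = "\<lambda>x. 1 / tan_excess x"
  have conv: "convex_on ?I ?f"
  proof (rule f''_ge0_imp_convex)
    fix x assume x: "x \<in> ?I"
    have T: "tan_excess x > 0" using x tan_excess_pos by auto
    have c: "cos x \<noteq> 0" using x cos_gt_zero[of x] by auto
    have dT: "(tan_excess has_real_derivative (tan x)\<^sup>2) (at x)" using x by (intro DERIV_tan_excess) auto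
    have dt: "(tan has_real_derivative 1 + (tan x)\<^sup>2) (at x)"
      using DERIV_tan[OF c] by (simp add: tan_sec[OF c] power_inverse)
    show "(?f has_real_derivative - ((tan x)\<^sup>2 / (tan_excess x)\<^sup>2)) (at x)"
      by (rule derivative_eq_intros dT refl)+ (use T in \<open>auto simp: power2_eq_square\<close>)
    show "((\<lambda>x. - ((tan x)\<^sup>2 / (tan_excess x)\<^sup>2)) has_real_derivative
      - ((2 * tan x * (1 + (tan x)\<^sup>2) * (tan_excess x)\<^sup>2 - (tan x)\<^sup>2 * (2 * tan_excess x * (tan x)\<^sup>2))
         / ((tan_excess x)\<^sup>2 * (tan_excess x)\<^sup>2))) (at x)"
      by (rule derivative_eq_intros dT dt refl)+ (use T in auto)
    have tx: "tan x > 0" using x by (intro tan_gt_zero) auto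
    \<comment> \<open>The numerator of the second derivative is
      \<open>2 * tan x * tan_excess x\<close> times
      \<open>(tan x)^3 - tan_excess x * (1 + (tan x)^2)\<close>.\<close>
    have "2 * tan x * tan_excess x * (tan_excess x * (1 + (tan x)\<^sup>2)) \<le> 2 * tan x * tan_excess x * (tan x)^3"
      using x T tx by (intro mult_left_mono tan_squared_times_ge) auto
    then have "2 * tan x * (1 + (tan x)\<^sup>2) * (tan_excess x)\<^sup>2 \<le> (tan x)\<^sup>2 * (2 * tan_excess x * (tan x)\<^sup>2)"
      by (simp add: power2_eq_square power3_eq_cube mult_ac)
    then show "0 \<le> - ((2 * tan x * (1 + (tan x)\<^sup>2) * (tan_excess x)\<^sup>2 - (tan x)\<^sup>2 * (2 * tan_excess x * (tan x)\<^sup>2))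
         / ((tan_excess x)\<^sup>2 * (tan_excess x)\<^sup>2))"
      by (simp add: divide_nonpos_nonneg)
  qed auto
  have a: "a \<in> ?I" "pi/2 - a \<in> ?I" using assms by auto
  have "?f ((1 - 1/2) *\<^sub>R a + (1/2) *\<^sub>R (pi/2 - a)) \<le> (1 - 1/2) * ?f a + (1/2) * ?f (pi/2 - a)"
    by (rule convex_onD[OF conv]) (use a in auto)
  moreover have mid: "(1 - 1/2) *\<^sub>R a + (1/2) *\<^sub>R (pi/2 - a) = pi/4" by (simp add: field_simps)
  moreover have "?f (pi/4) = 4 / (4 - pi)" by (simp add: tan_excess_def tan_45 field_simps)
  ultimately have "4 / (4 - pi) \<le> (1 - 1/2) * ?f a + (1/2) * ?f (pi/2 - a)" by metis
  then have "2 * (4 / (4 - pi)) \<le> 2 * ((1 - 1/2) * ?f a + (1/2) * ?f (pi/2 - a))"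
    by (rule mult_left_mono) simp
  also have "\<dots> = ?f a + ?f (pi/2 - a)" unfolding distrib_left by simp
  finally have "2 * (4 / (4 - pi)) \<le> ?f a + ?f (pi/2 - a)" .
  moreover have "?f (pi/2 - a) \<le> ?f b"
    using assms tan_excess_mono[of b "pi/2 - a"] tan_excess_pos[of b]
    by (intro divide_left_mono) (auto intro!: mult_pos_pos tan_excess_pos)
  ultimately show ?thesis by simp
qed

text \<open>The threshold \<open>3/10\<close> separates small angles, where
  \<open>tan_excess\<close> is at most \<open>1/60\<close>, from angles whose complement is at least
  \<open>3/10\<close>, where the tangent stays below 4 and the quadratic expansion applies.\<close>

lemma tan_three_tenths:
  "tan_excess (3/10) \<le> 1/60" "tan (pi/2 - 3/10) \<le> 4"
proof -
  have p: "(3/10::real) < pi/2" using pi_gt3 by simp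
  have s: "sin (3/10::real) \<le> 3/10" by (rule sin_x_le_x) auto
  have "(sin (3/20::real))\<^sup>2 \<le> (3/20)\<^sup>2"
    by (intro power_mono sin_x_le_x sin_ge_zero) (use pi_gt3 in auto)
  then have c: "cos (3/10::real) \<ge> 955/1000"
    using cos_double_sin[of "3/20::real"] by (simp add: power2_eq_square)
  have "tan (3/10::real) \<le> (3/10) / (955/1000)"
    unfolding tan_def using s c sin_ge_zero[of "3/10"] p by (intro frac_le) auto
  then show "tan_excess (3/10) \<le> 1/60" by (simp add: tan_excess_def)
  have t: "tan (3/10::real) > 3/10" using tan_excess_pos[of "3/10"] p by (simp add: tan_excess_def)
  have "tan (pi/2 - 3/10) = inverse (tan (3/10::real))"
    by (simp add: tan_cot)
  also have "\<dots> \<le> inverse (3/10)" using t by (intro le_imp_inverse_le) auto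
  finally show "tan (pi/2 - 3/10) \<le> 4" by simp
qed

text \<open>The choices \<open>k1 = 1 + \<epsilon> / (2 * tan_excess a)\<close> and \<open>k2 = 1 - \<epsilon> / (2 * tan_excess b)\<close> maximise the
  right-hand side to second order in \<open>\<epsilon>\<close>.  They are not uniformly close to 1 when an angle tends to 0;
  if \<open>a < 3/10\<close> or \<open>b < 3/10\<close>, shifting that curvature by \<open>7 * \<epsilon>\<close> already gains enough, and the
  other one stays at \<open>1 - \<epsilon>\<^sup>2\<close>, since the other angle may be close to \<open>pi/2\<close>.\<close>

lemma calibration_parameters:
  obtains C \<epsilon>1 :: real where "0 < \<epsilon>1" "\<epsilon>1 \<le> 1/100"
    "\<And>\<epsilon> a b. 0 < \<epsilon> \<Longrightarrow> \<epsilon> < \<epsilon>1 \<Longrightarrow> 0 < a \<Longrightarrow> 0 < b \<Longrightarrow> a + b \<le> pi/2 \<Longrightarrow>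
      \<exists>k1 k2. 0 < k2 \<and> k2 < 1 \<and> 0 < k1 \<and> (k1 = 1 - \<epsilon>\<^sup>2 \<or> a \<le> pi/2 - 3/10 \<and> k1 \<le> 101/100) \<and>
        2 / (4 - pi) * \<epsilon>\<^sup>2 - C * \<epsilon>^3 \<le> (k1 - k2) * \<epsilon> + (arc_flux a k1 - 2 * a) + (arc_flux b k2 - 2 * b)"
proof -
  define T0 where "T0 = tan_excess (3/10)"
  have p: "(3/10::real) < pi/2" using pi_gt3 by simp
  have T0: "T0 > 0" "T0 \<le> 1/60" using tan_excess_pos[of "3/10"] p tan_three_tenths by (auto simp: T0_def)
  \<comment> \<open>The first term collects the two cubic remainders at shifts of at most
    \<open>\<epsilon> / (2 * T0)\<close>, the second is the remainder at a shift of
    \<open>7 * \<epsilon>\<close>, and the final 1 absorbs the cubic term of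
    \<open>(k1 - k2) * \<epsilon>\<close> when \<open>b\<close> is small.\<close>
  define C where "C = 320000 / (2 * T0)^3 + 160000 * 343 + 1"
  \<comment> \<open>Both bounds keep the shifts below \<open>1/100\<close>:
    \<open>7 * \<epsilon>\<close> in the small-angle cases, \<open>\<epsilon> / (2 * T0)\<close>
    otherwise.\<close>
  define \<epsilon>1 where "\<epsilon>1 = min (1/1000) (2 * T0 / 100)"
  have C0: "320000 / (2 * T0)^3 > 0" using T0 by simp
  have tan4: "tan x \<le> 4" if "0 \<le> x" "x \<le> pi/2 - 3/10" for x
    using tan_mono_le[of x "pi/2 - 3/10"] tan_three_tenths(2) that p by simp
  \<comment> \<open>Net gain per \<open>\<epsilon>\<^sup>2\<close> when one angle is small: 7 from
    \<open>(k1 - k2) * \<epsilon>\<close>, minus \<open>49/60\<close> for the squared shift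
    \<open>7 * \<epsilon>\<close> times \<open>tan_excess\<close>, minus \<open>pi\<close> for the
    crude bound at the other curvature.\<close>
  have num: "2 / (4 - pi) \<le> (7 - 49/60 - pi)"
  proof -
    have "pi < 32/10" using pi_approx(2) by simp
    then have "2 / (4 - pi) \<le> 2 / (8/10)" by (intro divide_left_mono) auto
    then show ?thesis using \<open>pi < 32/10\<close> by simp
  qed
  show ?thesis
  proof (rule that[of \<epsilon>1 C])
    show "0 < \<epsilon>1" "\<epsilon>1 \<le> 1/100" using T0 by (auto simp: \<epsilon>1_def)
    fix \<epsilon> a b :: real
    assume \<epsilon>: "0 < \<epsilon>" "\<epsilon> < \<epsilon>1" and ab: "0 < a" "0 < b" "a + b \<le> pi/2"
    have e: "\<epsilon> < 1/1000" "\<epsilon> < 2 * T0 / 100" using \<epsilon> by (auto simp: \<epsilon>1_def)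
    have e2: "\<epsilon>\<^sup>2 < 1" "0 < \<epsilon>\<^sup>2" using \<epsilon> e by (auto simp: power_less_one_iff abs_square_less_1)
    have e3: "0 < \<epsilon>^3" using \<epsilon> by simp
    have abp: "a < pi/2" "b < pi/2" using ab by auto
    consider "a < 3/10" | "b < 3/10" | "a \<ge> 3/10" "b \<ge> 3/10" by linarith
    then show "\<exists>k1 k2. 0 < k2 \<and> k2 < 1 \<and> 0 < k1 \<and> (k1 = 1 - \<epsilon>\<^sup>2 \<or> a \<le> pi/2 - 3/10 \<and> k1 \<le> 101/100) \<and>
        2 / (4 - pi) * \<epsilon>\<^sup>2 - C * \<epsilon>^3 \<le> (k1 - k2) * \<epsilon> + (arc_flux a k1 - 2 * a) + (arc_flux b k2 - 2 * b)"
    proof cases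
      case 1
      have f1: "2 * a - (7 * \<epsilon>)\<^sup>2 * tan_excess a - 160000 * \<bar>7 * \<epsilon>\<bar>^3 \<le> arc_flux a (1 + 7 * \<epsilon>)"
        using 1 ab abp e \<epsilon> pi_gt3 by (intro arc_flux_ge tan4) auto
      have f2: "2 * b - (1 - (1 - \<epsilon>\<^sup>2)) * pi \<le> arc_flux b (1 - \<epsilon>\<^sup>2)"
        using e2 ab abp by (intro arc_flux_ge_crude) auto
      have "\<epsilon>\<^sup>2 * (49 * tan_excess a) \<le> \<epsilon>\<^sup>2 * (49/60)"
        using tan_excess_mono[of a "3/10"] 1 ab p T0 e2 by (intro mult_left_mono) (auto simp: T0_def)
      then have Ta: "49 * \<epsilon>\<^sup>2 * tan_excess a \<le> 49/60 * \<epsilon>\<^sup>2" by (simp add: mult_ac)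
      have "2 / (4 - pi) * \<epsilon>\<^sup>2 \<le> (7 - 49/60 - pi) * \<epsilon>\<^sup>2" using num e2 by (intro mult_right_mono) auto
      then have n: "2 / (4 - pi) * \<epsilon>\<^sup>2 \<le> 7 * \<epsilon>\<^sup>2 - 49/60 * \<epsilon>\<^sup>2 - \<epsilon>\<^sup>2 * pi" by (simp add: algebra_simps)
      have f2': "2 * b - \<epsilon>\<^sup>2 * pi \<le> arc_flux b (1 - \<epsilon>\<^sup>2)" using f2 by simp
      have C': "160000 * 343 * \<epsilon>^3 \<le> C * \<epsilon>^3"
        using C0 e3 by (intro mult_right_mono) (auto simp: C_def)
      have abs: "\<bar>7 * \<epsilon>\<bar>^3 = 343 * \<epsilon>^3" "(7 * \<epsilon>)\<^sup>2 = 49 * \<epsilon>\<^sup>2" using \<epsilon> by (auto simp: power_mult_distrib)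
      have prod: "(1 + 7 * \<epsilon> - (1 - \<epsilon>\<^sup>2)) * \<epsilon> = 7 * \<epsilon>\<^sup>2 + \<epsilon>^3" by (simp add: power2_eq_square power3_eq_cube algebra_simps)
      show ?thesis
      proof (intro exI conjI)
        show "2 / (4 - pi) * \<epsilon>\<^sup>2 - C * \<epsilon>^3 \<le> (1 + 7 * \<epsilon> - (1 - \<epsilon>\<^sup>2)) * \<epsilon>
            + (arc_flux a (1 + 7 * \<epsilon>) - 2 * a) + (arc_flux b (1 - \<epsilon>\<^sup>2) - 2 * b)"
          using f1 f2' Ta n C' e3 unfolding abs prod by linarith
        show "1 + 7 * \<epsilon> = 1 - \<epsilon>\<^sup>2 \<or> a \<le> pi/2 - 3/10 \<and> 1 + 7 * \<epsilon> \<le> 101/100" using 1 e pi_gt3 by auto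
      qed (use e2 \<epsilon> in auto)
    next
      case 2
      have f1: "2 * b - (-7 * \<epsilon>)\<^sup>2 * tan_excess b - 160000 * \<bar>-7 * \<epsilon>\<bar>^3 \<le> arc_flux b (1 + -7 * \<epsilon>)"
        using 2 ab abp e \<epsilon> pi_gt3 by (intro arc_flux_ge tan4) auto
      have f2: "2 * a - (1 - (1 - \<epsilon>\<^sup>2)) * pi \<le> arc_flux a (1 - \<epsilon>\<^sup>2)"
        using e2 ab abp by (intro arc_flux_ge_crude) auto
      have "\<epsilon>\<^sup>2 * (49 * tan_excess b) \<le> \<epsilon>\<^sup>2 * (49/60)"
        using tan_excess_mono[of b "3/10"] 2 ab p T0 e2 by (intro mult_left_mono) (auto simp: T0_def)
      then have Tb: "49 * \<epsilon>\<^sup>2 * tan_excess b \<le> 49/60 * \<epsilon>\<^sup>2" by (simp add: mult_ac)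
      have "2 / (4 - pi) * \<epsilon>\<^sup>2 \<le> (7 - 49/60 - pi) * \<epsilon>\<^sup>2" using num e2 by (intro mult_right_mono) auto
      then have n: "2 / (4 - pi) * \<epsilon>\<^sup>2 \<le> 7 * \<epsilon>\<^sup>2 - 49/60 * \<epsilon>\<^sup>2 - \<epsilon>\<^sup>2 * pi" by (simp add: algebra_simps)
      have f2': "2 * a - \<epsilon>\<^sup>2 * pi \<le> arc_flux a (1 - \<epsilon>\<^sup>2)" using f2 by simp
      have C': "(160000 * 343 + 1) * \<epsilon>^3 \<le> C * \<epsilon>^3"
        using C0 e3 by (intro mult_right_mono) (auto simp: C_def)
      have abs: "\<bar>-7 * \<epsilon>\<bar>^3 = 343 * \<epsilon>^3" "(-7 * \<epsilon>)\<^sup>2 = 49 * \<epsilon>\<^sup>2" using \<epsilon> by (auto simp: power_mult_distrib abs_mult)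
      have prod: "(1 - \<epsilon>\<^sup>2 - (1 + -7 * \<epsilon>)) * \<epsilon> = 7 * \<epsilon>\<^sup>2 - \<epsilon>^3" by (simp add: power2_eq_square power3_eq_cube algebra_simps)
      show ?thesis
      proof (intro exI conjI)
        show "2 / (4 - pi) * \<epsilon>\<^sup>2 - C * \<epsilon>^3 \<le> (1 - \<epsilon>\<^sup>2 - (1 + -7 * \<epsilon>)) * \<epsilon>
            + (arc_flux a (1 - \<epsilon>\<^sup>2) - 2 * a) + (arc_flux b (1 + -7 * \<epsilon>) - 2 * b)"
        proof -
          define F where "F = arc_flux b (1 + -7 * \<epsilon>)"
          have "160000 * (343 * \<epsilon>^3) + \<epsilon>^3 \<le> C * \<epsilon>^3" using C' by (simp add: distrib_right)
          moreover have "2 * b - 49 * \<epsilon>\<^sup>2 * tan_excess b - 160000 * (343 * \<epsilon>^3) \<le> F"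
            using f1 unfolding abs F_def .
          ultimately show ?thesis using f2' Tb n unfolding prod F_def[symmetric] by linarith
        qed
      qed (use e2 \<epsilon> e in auto)
    next
      case 3
      define x where "x = \<epsilon> / (2 * tan_excess a)"
      define y where "y = \<epsilon> / (2 * tan_excess b)"
      have T: "T0 \<le> tan_excess a" "T0 \<le> tan_excess b"
        unfolding T0_def using 3 ab abp by (auto intro!: tan_excess_mono)
      then have Tp: "tan_excess a > 0" "tan_excess b > 0" using T0 by auto
      have xy0: "0 < x" "0 < y" using \<epsilon> Tp by (auto simp: x_def y_def)
      have xyl: "x \<le> \<epsilon> / (2 * T0)" "y \<le> \<epsilon> / (2 * T0)"
        unfolding x_def y_def using T T0 \<epsilon> Tp by (auto intro!: divide_left_mono mult_pos_pos)
      have "\<epsilon> / (2 * T0) < 1/100" using e T0 by (simp add: field_simps)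
      then have xys: "x < 1/100" "y < 1/100" using xyl by auto
      have f1: "2 * a - x\<^sup>2 * tan_excess a - 160000 * \<bar>x\<bar>^3 \<le> arc_flux a (1 + x)"
        using 3 ab abp xy0 xys by (intro arc_flux_ge tan4) auto
      have f2: "2 * b - (-y)\<^sup>2 * tan_excess b - 160000 * \<bar>-y\<bar>^3 \<le> arc_flux b (1 + -y)"
        using 3 ab abp xy0 xys by (intro arc_flux_ge tan4) auto
      have cub: "\<bar>x\<bar>^3 \<le> \<epsilon>^3 / (2 * T0)^3" "\<bar>-y\<bar>^3 \<le> \<epsilon>^3 / (2 * T0)^3"
        using power_mono[OF xyl(1), of 3] power_mono[OF xyl(2), of 3] xy0 by (auto simp: power_divide)
      have quad: "x * \<epsilon> - x\<^sup>2 * tan_excess a = \<epsilon>\<^sup>2 / 4 * (1 / tan_excess a)"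
        "y * \<epsilon> - (-y)\<^sup>2 * tan_excess b = \<epsilon>\<^sup>2 / 4 * (1 / tan_excess b)"
        using Tp by (auto simp: x_def y_def power2_eq_square field_simps)
      have conv: "\<epsilon>\<^sup>2 / 4 * (8 / (4 - pi)) \<le> \<epsilon>\<^sup>2 / 4 * (1 / tan_excess a + 1 / tan_excess b)"
        by (intro mult_left_mono inverse_tan_excess_sum_ge ab) auto
      have Ce: "320000 * (\<epsilon>^3 / (2 * T0)^3) \<le> C * \<epsilon>^3"
      proof -
        have "320000 / (2 * T0)^3 * \<epsilon>^3 \<le> C * \<epsilon>^3" using e3 by (intro mult_right_mono) (auto simp: C_def)
        then show ?thesis by simp
      qed
      have prod: "(1 + x - (1 + -y)) * \<epsilon> = x * \<epsilon> + y * \<epsilon>" by (simp add: algebra_simps)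
      have e8: "\<epsilon>\<^sup>2 / 4 * (8 / (4 - pi)) = 2 / (4 - pi) * \<epsilon>\<^sup>2" by simp
      show ?thesis
      proof (intro exI conjI)
        show "2 / (4 - pi) * \<epsilon>\<^sup>2 - C * \<epsilon>^3 \<le> (1 + x - (1 + -y)) * \<epsilon>
            + (arc_flux a (1 + x) - 2 * a) + (arc_flux b (1 + -y) - 2 * b)"
          using f1 f2 cub quad conv Ce unfolding prod distrib_left e8 by linarith
        show "1 + x = 1 - \<epsilon>\<^sup>2 \<or> a \<le> pi/2 - 3/10 \<and> 1 + x \<le> 101/100" using 3 ab xys by auto
      qed (use xy0 xys in auto)
    qed
  qed
qed

subsection \<open>Circular arcs\<close>

lemma circle_point_exists:
  assumes r: "0 < r" and z: "(axial c m z)\<^sup>2 + (lateral c m z)\<^sup>2 = r\<^sup>2"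
  obtains t where "\<bar>t\<bar> \<le> pi" "z = circ_point c r (m + t)"
proof -
  have "(axial c m z / r)\<^sup>2 + (lateral c m z / r)\<^sup>2 = 1"
    using z r by (simp add: power_divide add_divide_distrib[symmetric])
  then obtain s where s: "0 \<le> s" "s < 2*pi" "axial c m z / r = cos s" "lateral c m z / r = sin s"
    by (rule sincos_total_2pi)
  define t where "t = (if s \<le> pi then s else s - 2*pi)"
  have t: "\<bar>t\<bar> \<le> pi" "cos t = cos s" "sin t = sin s" using s by (auto simp: t_def cos_diff sin_diff)
  have "z = circ_point c r (m + t)"
    unfolding plane_eq_iff_coords[of z _ c m] using t s r by (simp add: field_simps)
  then show ?thesis using t that by blast
qed

text \<open>Cosine is decreasing on \<open>{0..pi}\<close>, so the range of angles becomes one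
  linear inequality in the axial coordinate, also for arcs longer than a half circle.\<close>

lemma circ_arc_coords:
  assumes r: "0 < r" and uv: "u \<le> v" "v \<le> u + 2*pi" and m: "m = (u + v)/2" and w: "w = (v - u)/2"
  shows "circ_arc c r u v = {z. (axial c m z)\<^sup>2 + (lateral c m z)\<^sup>2 = r\<^sup>2 \<and> r * cos w \<le> axial c m z}"
proof (intro set_eqI iffI)
  fix z assume "z \<in> circ_arc c r u v"
  then obtain t where t: "u \<le> t" "t \<le> v" "z = circ_point c r t" by (auto simp: circ_arc_def)
  have "\<bar>t - m\<bar> \<le> w" using t m w by (auto simp: abs_le_iff field_simps)
  then have "cos w \<le> cos \<bar>t - m\<bar>" using uv w by (intro cos_monotone_0_pi_le) auto
  then have "cos w \<le> cos (t - m)" by simp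
  moreover have "(r * cos (t - m))\<^sup>2 + (r * sin (t - m))\<^sup>2 = r\<^sup>2"
    by (simp add: power_mult_distrib flip: distrib_left)
  ultimately show "z \<in> {z. (axial c m z)\<^sup>2 + (lateral c m z)\<^sup>2 = r\<^sup>2 \<and> r * cos w \<le> axial c m z}"
    using r by (simp add: t)
next
  fix z assume "z \<in> {z. (axial c m z)\<^sup>2 + (lateral c m z)\<^sup>2 = r\<^sup>2 \<and> r * cos w \<le> axial c m z}"
  then have z: "(axial c m z)\<^sup>2 + (lateral c m z)\<^sup>2 = r\<^sup>2" "r * cos w \<le> axial c m z" by auto
  obtain t where t: "\<bar>t\<bar> \<le> pi" "z = circ_point c r (m + t)" by (rule circle_point_exists[OF r z(1)])
  have "cos w \<le> cos \<bar>t\<bar>" using z(2) r t by simp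
  then have "\<bar>t\<bar> \<le> w" using cos_mono_le_eq[of w "\<bar>t\<bar>"] t(1) uv w by auto
  then have "m + t \<in> {u..v}" using m w by (auto simp: abs_le_iff field_simps)
  then show "z \<in> circ_arc c r u v" using t by (auto simp: circ_arc_def)
qed

lemma circ_point_inj:
  assumes "0 < r" "circ_point c r s = circ_point c r t" "\<bar>s - t\<bar> < 2*pi"
  shows "s = t"
proof -
  have "axial c t (circ_point c r s) = axial c t (circ_point c r t)" by (rule arg_cong[OF assms(2)])
  then have "cos (s - t) = 1" unfolding axial_circ_point using assms(1) by simp
  then obtain n :: int where n: "s - t = of_int n * 2 * pi" using cos_one_2pi_int by auto
  have "\<bar>of_int n\<bar> * (2*pi) < 1 * (2*pi)" using assms(3) n by (simp add: abs_mult)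
  then have "\<bar>of_int n :: real\<bar> < 1" by (rule mult_right_less_imp_less) simp
  then have "n = 0" by linarith
  then show ?thesis using n by simp
qed

lemma circ_point_eq_iff:
  assumes "0 < r" "\<bar>s - t\<bar> \<le> 2*pi"
  shows "circ_point c r s = circ_point c r t \<longleftrightarrow> s = t \<or> \<bar>s - t\<bar> = 2*pi"
proof
  assume "circ_point c r s = circ_point c r t"
  then show "s = t \<or> \<bar>s - t\<bar> = 2*pi" using circ_point_inj[OF assms(1), of c s t] assms(2) by linarith
next
  assume "s = t \<or> \<bar>s - t\<bar> = 2*pi"
  then consider "s = t" | "s = t + 2*pi" | "t = s + 2*pi" by linarith
  then show "circ_point c r s = circ_point c r t" by cases (auto simp: circ_point_periodic)
qed

lemma arc_from_to_circ_arc: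
  assumes "0 < r" "u \<le> v" "v < u + 2*pi"
  shows "arc_from_to (circ_arc c r u v) (circ_point c r u) (circ_point c r v)"
proof (cases "u = v")
  case False
  then have uv: "u < v" using assms by simp
  define g where "g = (\<lambda>s. circ_point c r (u + s * (v - u)))"
  have "arc g" unfolding arc_def path_def
  proof
    show "continuous_on {0..1} g" unfolding g_def by (intro continuous_intros)
    show "inj_on g {0..1}"
    proof (rule inj_onI)
      fix s t assume st: "s \<in> {0..1}" "t \<in> {0..1}" "g s = g t"
      have "\<bar>s - t\<bar> * (v - u) \<le> 1 * (v - u)" using st uv by (intro mult_right_mono) auto
      moreover have "(u + s * (v - u)) - (u + t * (v - u)) = (s - t) * (v - u)" by (simp add: algebra_simps)
      ultimately have "\<bar>(u + s * (v - u)) - (u + t * (v - u))\<bar> \<le> v - u" using uv by (simp only: abs_mult abs_of_pos diff_gt_0_iff_gt mult_1)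
      then have "\<bar>(u + s * (v - u)) - (u + t * (v - u))\<bar> < 2*pi" using assms(3) by linarith
      from circ_point_inj[OF assms(1) _ this] st(3) have "u + s * (v - u) = u + t * (v - u)" by (simp add: g_def)
      then show "s = t" using uv by simp
    qed
  qed
  moreover have "path_image g = circ_arc c r u v"
  proof -
    have "(\<lambda>s. u + s * (v - u)) ` {0..1} = {u..v}"
    proof (intro set_eqI iffI)
      fix x assume "x \<in> {u..v}"
      then have "(x - u)/(v - u) \<in> {0..1}" "x = u + (x - u)/(v - u) * (v - u)" using uv by (auto simp: divide_simps)
      then show "x \<in> (\<lambda>s. u + s * (v - u)) ` {0..1}" by blast
    next
      fix x assume "x \<in> (\<lambda>s. u + s * (v - u)) ` {0..1}"
      then obtain s where s: "0 \<le> s" "s \<le> 1" "x = u + s * (v - u)" by auto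
      then have "s * (v - u) \<le> 1 * (v - u)" "0 \<le> s * (v - u)" using uv by (auto intro: mult_right_mono)
      then show "x \<in> {u..v}" using s by auto
    qed
    then have "circ_arc c r u v = circ_point c r ` (\<lambda>s. u + s * (v - u)) ` {0..1}" by (simp add: circ_arc_def)
    then show ?thesis by (simp add: path_image_def g_def image_image)
  qed
  ultimately show ?thesis unfolding arc_from_to_def
    by (intro disjI2 exI[of _ g]) (simp add: g_def pathstart_def pathfinish_def)
qed (simp add: arc_from_to_def circ_arc_def)

lemma arc_from_to_segment: "arc_from_to (closed_segment p q) p q"
proof (cases "p = q")
  case False
  then show ?thesis unfolding arc_from_to_def
    by (intro disjI2 exI[of _ "linepath p q"]) (simp add: arc_linepath)
qed (simp add: arc_from_to_def)

lemma inside_arc_from_to: "arc_from_to A p q \<Longrightarrow> inside A = {}"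
  unfolding arc_from_to_def using inside_arc_empty by auto

subsection \<open>The replacing arcs\<close>

definition chord :: "plane \<Rightarrow> real \<Rightarrow> real \<Rightarrow> plane set" where
  "chord c m a = {z. axial c m z = cos a \<and> (lateral c m z)\<^sup>2 \<le> (sin a)\<^sup>2}"

text \<open>Axial symmetry of the configuration forces the centre of the replacing arc onto the axis,
  at signed distance \<open>d\<close> from \<open>c\<close>.\<close>

definition big_arc :: "plane \<Rightarrow> real \<Rightarrow> real \<Rightarrow> real \<Rightarrow> real \<Rightarrow> real \<Rightarrow> plane set" where
  "big_arc c m a s d r = {z. (axial c m z - d)\<^sup>2 + (lateral c m z)\<^sup>2 = r\<^sup>2 \<and> s * cos a \<le> s * axial c m z}"

definition cap :: "plane \<Rightarrow> real \<Rightarrow> real \<Rightarrow> real \<Rightarrow> real \<Rightarrow> real \<Rightarrow> plane set" where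
  "cap c m a s d r = {z. (axial c m z - d)\<^sup>2 + (lateral c m z)\<^sup>2 < r\<^sup>2 \<and> s * cos a < s * axial c m z}"

lemma closed_segment_vertical:
  assumes h: "0 \<le> h"
  shows "closed_segment (frame_point c m x (- h)) (frame_point c m x h)
    = {z. axial c m z = x \<and> (lateral c m z)\<^sup>2 \<le> h\<^sup>2}"
proof (cases "h = 0")
  case True
  show ?thesis unfolding True
  proof (intro set_eqI iffI)
    fix z assume "z \<in> {z. axial c m z = x \<and> (lateral c m z)\<^sup>2 \<le> 0\<^sup>2}"
    then have "axial c m z = x" "lateral c m z = 0" by auto
    then have "z = frame_point c m x 0" using frame_point_inverse[of c m z] by simp
    then show "z \<in> closed_segment (frame_point c m x (- 0)) (frame_point c m x 0)" by simp
  qed simp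
next
  case False
  then have h0: "h > 0" using h by simp
  have seg: "(1 - k) *\<^sub>R frame_point c m x (- h) + k *\<^sub>R frame_point c m x h = frame_point c m x ((2 * k - 1) * h)" for k
    by (cases c) (simp add: frame_point_def algebra_simps)
  show ?thesis
  proof (intro set_eqI iffI)
    fix z assume "z \<in> closed_segment (frame_point c m x (- h)) (frame_point c m x h)"
    then obtain k where k: "0 \<le> k" "k \<le> 1" "z = frame_point c m x ((2 * k - 1) * h)"
      unfolding closed_segment_def seg by auto
    have "\<bar>(2 * k - 1) * h\<bar> \<le> 1 * h" unfolding abs_mult using k h by (intro mult_mono) auto
    then have "((2 * k - 1) * h)\<^sup>2 \<le> h\<^sup>2" using h by (simp add: abs_le_square_iff[symmetric])
    then show "z \<in> {z. axial c m z = x \<and> (lateral c m z)\<^sup>2 \<le> h\<^sup>2}" using k by simp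
  next
    fix z assume "z \<in> {z. axial c m z = x \<and> (lateral c m z)\<^sup>2 \<le> h\<^sup>2}"
    then have z: "axial c m z = x" "\<bar>lateral c m z\<bar> \<le> h" using h by (auto simp: abs_le_square_iff[symmetric])
    define k where "k = (lateral c m z / h + 1)/2"
    have "0 \<le> k" "k \<le> 1" using z h0 by (auto simp: k_def abs_le_iff field_simps)
    moreover have "(2 * k - 1) * h = lateral c m z" using h0 by (simp add: k_def field_simps)
    then have "z = frame_point c m x ((2 * k - 1) * h)" using z(1) frame_point_inverse[of c m z] by simp
    ultimately show "z \<in> closed_segment (frame_point c m x (- h)) (frame_point c m x h)"
      unfolding closed_segment_def seg by auto
  qed
qed

text \<open>A unit arc shorter than a half circle, with midpoint direction \<open>m\<close> and
  half-angle \<open>a < pi/2\<close>. The replaced arcs are of this kind: two adjacent ones and the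
  kept arcs that go with them fill half the circle.\<close>

locale arc_frame =
  fixes c :: plane and u v m a :: real
  assumes uv: "u < v" "v < u + pi" and m_def: "m = (u + v)/2" and a_def: "a = (v - u)/2"
begin

lemma a_pos: "0 < a" and a_less: "a < pi/2"
  using uv by (auto simp: a_def)

lemma cos_pos: "0 < cos a" and sin_pos: "0 < sin a" and cos_less: "cos a < 1" and sin_less: "sin a < 1"
proof -
  show 1: "0 < cos a" "0 < sin a" using a_pos a_less by (auto intro!: cos_gt_zero sin_gt_zero)
  have "(cos a)\<^sup>2 < 1" "(sin a)\<^sup>2 < 1" using sin_cos_squared_add[of a] zero_less_power[OF 1(1), of 2] zero_less_power[OF 1(2), of 2] by linarith+
  then show "cos a < 1" "sin a < 1" using 1 by (simp_all add: abs_square_less_1)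
qed

abbreviation "p \<equiv> circ_point c 1 u"
abbreviation "q \<equiv> circ_point c 1 v"

lemma p_eq: "p = frame_point c m (cos a) (- sin a)" and q_eq: "q = frame_point c m (cos a) (sin a)"
proof -
  have "u - m = - a" "v - m = a" by (simp_all add: m_def a_def field_simps)
  then show "p = frame_point c m (cos a) (- sin a)" "q = frame_point c m (cos a) (sin a)"
    by (simp_all add: plane_eq_iff_coords[of _ _ c m])
qed

lemma p_neq_q: "p \<noteq> q"
  unfolding p_eq q_eq plane_eq_iff_coords[of _ _ c m] using sin_pos by simp

lemma end_points_eq: "{p, q} = {z. axial c m z = cos a \<and> (lateral c m z)\<^sup>2 = (sin a)\<^sup>2}"
proof -
  have "z \<in> {p, q} \<longleftrightarrow> axial c m z = cos a \<and> (lateral c m z = - sin a \<or> lateral c m z = sin a)" for z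
    unfolding p_eq q_eq insert_iff plane_eq_iff_coords[of z _ c m] by auto
  then show ?thesis by (auto simp: power2_eq_iff)
qed

lemma chord_eq: "chord c m a = closed_segment p q"
  unfolding chord_def p_eq q_eq using closed_segment_vertical[of "sin a"] sin_pos by simp

lemma sigma_eq: "circ_arc c 1 u v = big_arc c m a 1 0 1"
  using circ_arc_coords[of 1 u v m a c] uv by (simp add: big_arc_def m_def a_def)

text \<open>The endpoints agree only as an unordered pair. Their difference makes the arc's own axis
  parallel to the axis of the frame, their sum puts its centre on that axis; what remains is the
  signed position \<open>d\<close> of the centre and the side \<open>s\<close> of the chord.\<close>

lemma arc_between_cases:
  assumes "arc_between \<tau> p q"
  shows "arc_from_to \<tau> p q"
    and "\<tau> = chord c m a \<or> (\<exists>s d r. s \<in> {1, -1} \<and> 0 < r \<and> r\<^sup>2 = (cos a - d)\<^sup>2 + (sin a)\<^sup>2 \<and> \<tau> = big_arc c m a s d r)"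
proof -
  have "arc_from_to \<tau> p q \<and> (\<tau> = chord c m a \<or> (\<exists>s d r. s \<in> {1, -1} \<and> 0 < r \<and> r\<^sup>2 = (cos a - d)\<^sup>2 + (sin a)\<^sup>2 \<and> \<tau> = big_arc c m a s d r))"
  proof (cases "\<tau> = closed_segment p q")
    case True
    then show ?thesis using chord_eq arc_from_to_segment by auto
  next
    case False
    then obtain c' r u' v' where r: "0 < r" and uv': "u' < v'" "v' < u' + 2*pi" and
      \<tau>: "\<tau> = circ_arc c' r u' v'" and pq: "{p, q} = {circ_point c' r u', circ_point c' r v'}"
      using assms unfolding arc_between_def by blast
    let ?p = "circ_point c' r u'" and ?q = "circ_point c' r v'"
    have arc: "arc_from_to \<tau> p q"
    proof -
      have "arc_from_to \<tau> ?p ?q" unfolding \<tau> using r uv' by (intro arc_from_to_circ_arc) auto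
      moreover from this have "arc_from_to \<tau> ?q ?p" by (rule arc_from_to_sym)
      ultimately show ?thesis using pq p_neq_q by (metis doubleton_eq_iff)
    qed
    define m' where "m' = (u' + v')/2"
    define w where "w = (v' - u')/2"
    have w: "0 < w" "w < pi" using uv' by (auto simp: w_def)
    have sw: "sin w > 0" using w by (intro sin_gt_zero) auto
    let ?E = "(cos m, sin m) :: plane" and ?F = "(- sin m, cos m) :: plane"
    let ?E' = "(cos m', sin m') :: plane" and ?F' = "(- sin m', cos m') :: plane"
    have ang: "u' - m' = - w" "v' - m' = w" by (simp_all add: m'_def w_def field_simps)
    have p': "?p = frame_point c' m' (r * cos w) (- (r * sin w))" "?q = frame_point c' m' (r * cos w) (r * sin w)"
      by (simp_all add: plane_eq_iff_coords[of _ _ c' m'] ang)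
    \<comment> \<open>The sign records whether the arc runs from \<open>p\<close> to
      \<open>q\<close> or back, and thereby the side of the chord on which it lies.\<close>
    obtain \<sigma> :: real where \<sigma>: "\<sigma> = 1 \<or> \<sigma> = -1" and diff: "q - p = \<sigma> *\<^sub>R (?q - ?p)" and sum: "p + q = ?p + ?q"
    proof -
      consider "p = ?p" "q = ?q" | "p = ?q" "q = ?p" using pq by (metis doubleton_eq_iff)
      then show ?thesis
      proof cases
        case 1 then show ?thesis by (intro that[of 1]) auto
      next
        case 2 then show ?thesis by (intro that[of "-1"]) (auto simp: add.commute)
      qed
    qed
    have "(2 * sin a) *\<^sub>R ?F = q - p" unfolding p_eq q_eq frame_point_def
      by (simp add: algebra_simps)
    also have "\<dots> = (\<sigma> * (2 * (r * sin w))) *\<^sub>R ?F'" unfolding diff p' frame_point_def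
      by (cases c') (simp add: algebra_simps)
    finally have F: "(2 * sin a) *\<^sub>R ?F = (\<sigma> * (2 * (r * sin w))) *\<^sub>R ?F'" .
    have "norm ((2 * sin a) *\<^sub>R ?F) = norm ((\<sigma> * (2 * (r * sin w))) *\<^sub>R ?F')" by (simp only: F)
    then have rs: "r * sin w = sin a"
      using \<sigma> sin_pos sw r by (auto simp: norm_Pair abs_mult simp del: scaleR_Pair)
    have FF: "?F = \<sigma> *\<^sub>R ?F'"
    proof -
      have "(2 * sin a) *\<^sub>R ?F = (2 * sin a) *\<^sub>R (\<sigma> *\<^sub>R ?F')" using F by (simp add: rs mult_ac del: scaleR_Pair)
      then show ?thesis by (rule scaleR_left_imp_eq[rotated]) (use sin_pos in simp)
    qed
    then have EE: "?E = \<sigma> *\<^sub>R ?E'" by auto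
    define d where "d = cos a - \<sigma> * (r * cos w)"
    have c': "c' = frame_point c m d 0"
    proof -
      have "2 *\<^sub>R (c + cos a *\<^sub>R ?E) = p + q" unfolding p_eq q_eq frame_point_def
        by (cases c) (simp add: algebra_simps)
      also have "\<dots> = 2 *\<^sub>R (c' + (r * cos w) *\<^sub>R ?E')" unfolding sum p' frame_point_def
        by (cases c') (simp add: algebra_simps)
      finally have "c + cos a *\<^sub>R ?E = c' + (r * cos w) *\<^sub>R ?E'" by (simp del: scaleR_Pair)
      moreover have "?E' = \<sigma> *\<^sub>R ?E" using EE \<sigma> by auto
      ultimately show ?thesis unfolding frame_point_def d_def
        by (simp add: algebra_simps del: scaleR_Pair)
    qed
    have ax: "axial c' m' z = \<sigma> * (axial c m z - d)" and lat: "(lateral c' m' z)\<^sup>2 = (lateral c m z)\<^sup>2" for z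
    proof -
      have E': "?E' = \<sigma> *\<^sub>R ?E" "?F' = \<sigma> *\<^sub>R ?F" using EE FF \<sigma> by auto
      have z: "z - c' = (axial c m z - d) *\<^sub>R ?E + lateral c m z *\<^sub>R ?F"
        by (subst (1) frame_point_inverse[of c m z, symmetric])
           (simp add: c' frame_point_def algebra_simps del: scaleR_Pair frame_point_inverse)
      have in1: "?E \<bullet> ?E = 1" "?F \<bullet> ?F = 1" "?E \<bullet> ?F = 0" "?F \<bullet> ?E = 0"
        by (simp_all add: inner_prod_def power2_eq_square[symmetric])
      show "axial c' m' z = \<sigma> * (axial c m z - d)"
        unfolding axial_def[of c'] z E' inner_scaleR_right inner_add_left inner_scaleR_left in1 by simp
      have "lateral c' m' z = \<sigma> * lateral c m z"
        unfolding lateral_def[of c'] z E' inner_scaleR_right inner_add_left inner_scaleR_left in1 by simp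
      then show "(lateral c' m' z)\<^sup>2 = (lateral c m z)\<^sup>2" using \<sigma> by auto
    qed
    have "\<tau> = {z. (axial c' m' z)\<^sup>2 + (lateral c' m' z)\<^sup>2 = r\<^sup>2 \<and> r * cos w \<le> axial c' m' z}"
      unfolding \<tau> using r uv' by (intro circ_arc_coords) (auto simp: m'_def w_def)
    also have "\<dots> = big_arc c m a \<sigma> d r"
    proof -
      have "(\<sigma> * x)\<^sup>2 = x\<^sup>2" for x using \<sigma> by auto
      moreover have "r * cos w \<le> \<sigma> * (x - d) \<longleftrightarrow> \<sigma> * cos a \<le> \<sigma> * x" for x
        using \<sigma> by (auto simp: d_def)
      ultimately show ?thesis unfolding big_arc_def ax lat by simp
    qed
    finally have "\<tau> = big_arc c m a \<sigma> d r" .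
    moreover have "r\<^sup>2 = (cos a - d)\<^sup>2 + (sin a)\<^sup>2"
    proof -
      have "(cos a - d)\<^sup>2 = (r * cos w)\<^sup>2" using \<sigma> by (auto simp: d_def)
      then have "(cos a - d)\<^sup>2 + (sin a)\<^sup>2 = r\<^sup>2 * ((cos w)\<^sup>2 + (sin w)\<^sup>2)"
        unfolding rs[symmetric] power_mult_distrib distrib_left by (rule arg_cong)
      then show ?thesis by simp
    qed
    ultimately show ?thesis using arc \<sigma> r by auto
  qed
  then show "arc_from_to \<tau> p q" "\<tau> = chord c m a \<or> (\<exists>s d r. s \<in> {1, -1} \<and> 0 < r \<and> r\<^sup>2 = (cos a - d)\<^sup>2 + (sin a)\<^sup>2 \<and> \<tau> = big_arc c m a s d r)"
    by blast+
qed

lemma end_points_in_big_arc: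
  assumes "r\<^sup>2 = (cos a - d)\<^sup>2 + (sin a)\<^sup>2"
  shows "p \<in> big_arc c m a s d r" "q \<in> big_arc c m a s d r"
  using assms by (auto simp: big_arc_def p_eq q_eq)

lemma compact_big_arc: "0 < r \<Longrightarrow> compact (big_arc c m a s d r)"
proof -
  assume r: "0 < r"
  have "closed (big_arc c m a s d r)" unfolding big_arc_def
    by (intro closed_Collect_conj closed_Collect_eq closed_Collect_le continuous_intros)
  moreover have "big_arc c m a s d r \<subseteq> cball (frame_point c m d 0) r"
    unfolding big_arc_def by (rule subsetI) (simp only: cball_coords[OF r] mem_Collect_eq)
  ultimately show ?thesis by (meson bounded_cball bounded_subset compact_eq_bounded_closed)
qed

text \<open>Subtracting the equations of two circles with different centres on the axis leaves a
  linear equation that fixes the axial coordinate.\<close>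

lemma big_arc_trace:
  assumes r2: "r\<^sup>2 = (cos a - d)\<^sup>2 + (sin a)\<^sup>2" and "d \<noteq> d'" "r'\<^sup>2 = (cos a - d')\<^sup>2 + (sin a)\<^sup>2"
  shows "{z. (axial c m z - d)\<^sup>2 + (lateral c m z)\<^sup>2 = r\<^sup>2} \<inter> {z. (axial c m z - d')\<^sup>2 + (lateral c m z)\<^sup>2 = r'\<^sup>2} = {p, q}"
proof -
  have "axial c m z = cos a \<and> (lateral c m z)\<^sup>2 = (sin a)\<^sup>2"
    if z: "(axial c m z - d)\<^sup>2 + (lateral c m z)\<^sup>2 = r\<^sup>2" "(axial c m z - d')\<^sup>2 + (lateral c m z)\<^sup>2 = r'\<^sup>2" for z
  proof -
    have "(axial c m z - d)\<^sup>2 - (axial c m z - d')\<^sup>2 = (cos a - d)\<^sup>2 - (cos a - d')\<^sup>2" using z assms by linarith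
    then have "(d' - d) * (axial c m z - cos a) = 0" by (simp add: power2_eq_square algebra_simps)
    then have "axial c m z = cos a" using assms(2) by simp
    moreover from this have "(lateral c m z)\<^sup>2 = (sin a)\<^sup>2" using z(1) r2 by simp
    ultimately show ?thesis by simp
  qed
  moreover have "(axial c m z - d)\<^sup>2 + (lateral c m z)\<^sup>2 = r\<^sup>2 \<and> (axial c m z - d')\<^sup>2 + (lateral c m z)\<^sup>2 = r'\<^sup>2"
    if "axial c m z = cos a" "(lateral c m z)\<^sup>2 = (sin a)\<^sup>2" for z
    using that assms by simp
  ultimately show ?thesis unfolding end_points_eq by blast
qed

lemma unit_radius: "1\<^sup>2 = (cos a - 0)\<^sup>2 + (sin a)\<^sup>2"
  by simp

lemma big_arc_chord_Int:
  assumes "r\<^sup>2 = (cos a - d)\<^sup>2 + (sin a)\<^sup>2"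
  shows "big_arc c m a s d r \<inter> chord c m a = {p, q}"
  unfolding end_points_eq big_arc_def chord_def using assms by auto

text \<open>Arc and chord together form the frontier of a bounded convex set, a disc cut by a
  half-plane, and the inside of such a frontier is the interior.\<close>

lemma frontier_cap:
  assumes r: "0 < r" "r\<^sup>2 = (cos a - d)\<^sup>2 + (sin a)\<^sup>2" and s: "s \<noteq> 0"
  shows "inside (big_arc c m a s d r \<union> chord c m a) = cap c m a s d r"
proof -
  let ?S = "cball (frame_point c m d 0) r \<inter> {z. s * cos a \<le> s * axial c m z}"
  have int: "interior ?S = cap c m a s d r"
    unfolding interior_Int interior_cball interior_halfplane_axial[OF s] cap_def
    using ball_coords[OF r(1)] by blast
  have cl: "closed ?S" by (intro closed_Int closed_cball closed_Collect_le continuous_intros)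
  have "frontier ?S = ?S - cap c m a s d r"
    using int cl by (simp add: frontier_def closure_closed)
  also have "\<dots> = big_arc c m a s d r \<union> chord c m a"
  proof (intro set_eqI iffI)
    fix z assume "z \<in> ?S - cap c m a s d r"
    then have z: "(axial c m z - d)\<^sup>2 + (lateral c m z)\<^sup>2 \<le> r\<^sup>2" "s * cos a \<le> s * axial c m z" "z \<notin> cap c m a s d r"
      using cball_coords[OF r(1)] by blast+
    show "z \<in> big_arc c m a s d r \<union> chord c m a"
    proof (cases "axial c m z = cos a")
      case True
      then show ?thesis using z r by (auto simp: chord_def)
    next
      case False
      then have "s * cos a < s * axial c m z" using z(2) s by (simp add: less_le)
      then show ?thesis using z by (auto simp: big_arc_def cap_def)
    qed
  next
    fix z assume "z \<in> big_arc c m a s d r \<union> chord c m a"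
    then have "(axial c m z - d)\<^sup>2 + (lateral c m z)\<^sup>2 \<le> r\<^sup>2" "s * cos a \<le> s * axial c m z"
      "(axial c m z - d)\<^sup>2 + (lateral c m z)\<^sup>2 = r\<^sup>2 \<or> axial c m z = cos a"
      using r by (auto simp: big_arc_def chord_def)
    then show "z \<in> ?S - cap c m a s d r"
      using cball_coords[OF r(1)] by (auto simp: cap_def)
  qed
  finally have fr: "frontier ?S = big_arc c m a s d r \<union> chord c m a" .
  have "bounded ?S" "convex ?S" by (auto intro: bounded_Int convex_Int convex_halfplane_axial)
  from inside_frontier_eq_interior[OF this] show ?thesis unfolding fr int .
qed

lemma inside_unit_circle:
  "inside (big_arc c m a 1 0 1 \<union> big_arc c m a (-1) 0 1) = ball c 1"
proof -
  have "big_arc c m a 1 0 1 \<union> big_arc c m a (-1) 0 1 = {z. (axial c m z)\<^sup>2 + (lateral c m z)\<^sup>2 = 1}"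
    by (auto simp: big_arc_def)
  also have "\<dots> = sphere c 1" by (auto simp: unit_disc_coords(3)[where c=c and m=m])
  also have "\<dots> = frontier (ball c 1)" by simp
  finally show ?thesis using inside_frontier_eq_interior[of "ball c 1"] by simp
qed

end

lemma abs_less_of_square: "x\<^sup>2 < y\<^sup>2 \<Longrightarrow> 0 \<le> y \<Longrightarrow> \<bar>x\<bar> < y" for x y :: real
  by (rule power2_less_imp_less) simp_all

lemma measure_le_inside:
  fixes S :: "plane set"
  assumes "compact S" "open G" "G \<subseteq> inside S"
  shows "measure lborel G \<le> measure lborel (inside S)"
  using assms by (intro measure_lborel_mono) (auto simp: open_inside compact_imp_closed bounded_inside compact_imp_bounded)

lemma null_sphere_subset:
  fixes A :: "plane set"
  assumes "A \<subseteq> sphere x r" "A \<in> sets borel"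
  shows "A \<in> null_sets lborel"
proof (rule negligible_borel_null[OF _ assms(2)])
  have "frontier (cball x r) = sphere x r" by simp
  then have "negligible (sphere x r)" using negligible_convex_frontier[OF convex_cball] by metis
  then show "negligible A" using assms(1) by (rule negligible_subset)
qed

lemma arc_from_to_other_point:
  assumes "arc_from_to A x y" "x \<noteq> y"
  obtains z where "z \<in> A" "z \<noteq> x" "z \<noteq> y"
proof -
  have "A \<noteq> {x, y}"
  proof
    assume "A = {x, y}"
    then have "connected {x, y}" using arc_from_to_connected[OF assms(1)] by simp
    then show False using connected_finite_iff_sing[of "{x, y}"] assms(2) by auto
  qed
  then show ?thesis using arc_from_to_ends[OF assms(1)] that by blast
qed

section \<open>What the area of a lune says about the replacing arc\<close>

context arc_frame
begin

lemma compact_chord: "compact (chord c m a)"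
  unfolding chord_eq by simp

text \<open>An arc bent to the far side of the chord takes the part of \<open>D\<close> in
  \<open>theta_inside\<close>, with the two unit arcs as \<open>A\<close> and \<open>A'\<close>. The
  ray along the axis avoids the far arcs: up to the chord by the hypothesis on \<open>x0\<close>,
  beyond it because they lie behind it.\<close>

lemma inside_beyond_circle:
  assumes r: "0 < r" "r\<^sup>2 = (cos a - d)\<^sup>2 + (sin a)\<^sup>2" and arc: "arc_from_to (big_arc c m a (-1) d r) p q"
    and x: "0 \<le> x0" "x0 \<le> cos a" "\<And>x. x0 \<le> x \<Longrightarrow> x \<le> cos a \<Longrightarrow> (x - d)\<^sup>2 \<noteq> r\<^sup>2"
  shows "frame_point c m x0 0 \<in> inside (big_arc c m a 1 0 1 \<union> big_arc c m a (-1) d r)"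
proof (rule theta_inside[where A' = "big_arc c m a (-1) 0 1"])
  let ?z = "frame_point c m x0 0"
  show "compact (big_arc c m a 1 0 1)" "compact (big_arc c m a (-1) 0 1)" "compact (big_arc c m a (-1) d r)"
    using r by (simp_all add: compact_big_arc)
  have "big_arc c m a 1 0 1 \<inter> big_arc c m a (-1) 0 1 \<subseteq> {p, q}"
    unfolding end_points_eq big_arc_def by (auto simp: sin_squared_eq)
  then have "(big_arc c m a 1 0 1 \<union> big_arc c m a (-1) d r) \<inter> (big_arc c m a (-1) 0 1 \<union> big_arc c m a (-1) d r)
    = big_arc c m a (-1) d r"
    using arc_from_to_ends[OF arc] by auto
  then show "connected ((big_arc c m a 1 0 1 \<union> big_arc c m a (-1) d r) \<inter> (big_arc c m a (-1) 0 1 \<union> big_arc c m a (-1) d r))"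
    using arc_from_to_connected[OF arc] by simp
  have "x0\<^sup>2 < 1" using x cos_less by (simp add: abs_square_less_1)
  then show "?z \<in> inside (big_arc c m a 1 0 1 \<union> big_arc c m a (-1) 0 1)"
    unfolding inside_unit_circle using unit_disc_coords(1)[where c=c and m=m] by simp
  show "?z \<notin> inside (big_arc c m a (-1) 0 1 \<union> big_arc c m a (-1) d r)"
  proof (rule not_inside_ray[OF frame_vector_nonzero[of m]])
    fix s :: real assume s: "0 \<le> s"
    have eq: "?z + s *\<^sub>R (cos m, sin m) = frame_point c m (x0 + s) 0"
      by (simp add: frame_point_def algebra_simps)
    show "?z + s *\<^sub>R (cos m, sin m) \<notin> big_arc c m a (-1) 0 1 \<union> big_arc c m a (-1) d r"
    proof (cases "x0 + s \<le> cos a")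
      case True
      then have "(x0 + s)\<^sup>2 < 1" using x s cos_less by (simp add: abs_square_less_1)
      then show ?thesis unfolding eq using x(3)[of "x0 + s"] s True by (simp add: big_arc_def)
    qed (unfold eq, simp add: big_arc_def)
  qed
  show "?z \<notin> big_arc c m a (-1) d r" using x(3)[of x0] x by (simp add: big_arc_def)
qed

text \<open>The other shapes are excluded one by one. The chord passes through the disc; a far-side
  arc avoiding the disc would enclose all of it, so its area would be at least \<open>pi\<close>;
  \<open>d = 0\<close> gives the replaced arc itself and area 0; for \<open>d < 0\<close> the tip at
  \<open>d + r\<close> would enter the disc.\<close>

lemma outer_shape:
  assumes "outer_replacement c u v \<epsilon> \<tau>" and \<epsilon>: "0 < \<epsilon>" "\<epsilon> < pi"
  obtains d r where "0 < d" "0 < r" "r\<^sup>2 = (cos a - d)\<^sup>2 + (sin a)\<^sup>2" "\<tau> = big_arc c m a 1 d r"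
    "arc_from_to \<tau> p q"
proof -
  have ab: "arc_between \<tau> p q" and dis: "\<tau> \<inter> ball c 1 = {}"
    and area: "measure lborel (inside (big_arc c m a 1 0 1 \<union> \<tau>)) = \<epsilon>"
    using assms(1) unfolding outer_replacement_def sigma_eq by auto
  note arc = arc_between_cases(1)[OF ab]
  have inball: "frame_point c m x 0 \<in> ball c 1 \<longleftrightarrow> x\<^sup>2 < 1" for x
    using unit_disc_coords(1)[where c=c and m=m and z="frame_point c m x 0"] by simp
  have "\<tau> \<noteq> chord c m a"
  proof
    assume "\<tau> = chord c m a"
    then have "frame_point c m (cos a) 0 \<in> \<tau>" by (simp add: chord_def)
    moreover have "(cos a)\<^sup>2 < 1" using cos_pos cos_less by (simp add: abs_square_less_1)
    ultimately show False using dis inball by blast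
  qed
  then obtain s d r where s: "s \<in> {1, -1::real}" and r: "0 < r" "r\<^sup>2 = (cos a - d)\<^sup>2 + (sin a)\<^sup>2"
    and \<tau>: "\<tau> = big_arc c m a s d r" using arc_between_cases(2)[OF ab] by blast
  have r2: "r\<^sup>2 = 1 - 2 * d * cos a + d\<^sup>2" using r(2) by (simp add: power2_diff)
  have rge: "\<bar>cos a - d\<bar> \<le> r"
  proof -
    have "(cos a - d)\<^sup>2 \<le> r\<^sup>2" using r(2) by simp
    then show ?thesis using r(1) by (simp add: abs_le_square_iff[symmetric])
  qed
  have s1: "s = 1"
  proof (rule ccontr)
    assume "s \<noteq> 1"
    then have \<tau>': "\<tau> = big_arc c m a (-1) d r" using s \<tau> by auto
    have notin: "(x - d)\<^sup>2 \<noteq> r\<^sup>2" if "0 \<le> x" "x \<le> cos a" for x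
    proof
      assume "(x - d)\<^sup>2 = r\<^sup>2"
      then have "frame_point c m x 0 \<in> \<tau>" unfolding \<tau>' using that by (simp add: big_arc_def)
      moreover have "x\<^sup>2 < 1" using that cos_less by (simp add: abs_square_less_1)
      ultimately show False using dis inball by blast
    qed
    have "frame_point c m 0 0 \<in> inside (big_arc c m a 1 0 1 \<union> \<tau>)"
      unfolding \<tau>' using r arc notin cos_pos by (intro inside_beyond_circle) (auto simp: \<tau>')
    then have c_in: "c \<in> inside (big_arc c m a 1 0 1 \<union> \<tau>)" by simp
    have "big_arc c m a 1 0 1 \<inter> ball c 1 = {}"
    proof -
      have False if "z \<in> big_arc c m a 1 0 1" "z \<in> ball c 1" for z
        using that unit_disc_coords(1)[where c=c and m=m and z=z] by (simp add: big_arc_def)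
      then show ?thesis by blast
    qed
    then have sub: "ball c 1 \<subseteq> - (big_arc c m a 1 0 1 \<union> \<tau>)" using dis by blast
    have "ball c 1 \<subseteq> inside (big_arc c m a 1 0 1 \<union> \<tau>)"
    proof
      fix z assume z: "z \<in> ball c 1"
      have "connected_component (- (big_arc c m a 1 0 1 \<union> \<tau>)) c z"
        unfolding connected_component_def using sub z by (intro exI[of _ "ball c 1"]) auto
      from inside_same_component[OF this c_in] show "z \<in> inside (big_arc c m a 1 0 1 \<union> \<tau>)" .
    qed
    then have "measure lborel (ball c 1) \<le> \<epsilon>"
      unfolding area[symmetric] using r by (intro measure_le_inside) (auto simp: \<tau>' compact_big_arc)
    then show False using \<epsilon> by (simp add: measure_ball_plane)
  qed
  have "d + r \<ge> 1"
  proof -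
    have "frame_point c m (d + r) 0 \<in> \<tau>" unfolding \<tau> s1 using rge by (simp add: big_arc_def)
    then have "\<not> (d + r)\<^sup>2 < 1" using dis inball by blast
    moreover have "0 < d + r" using rge cos_pos by linarith
    ultimately show ?thesis by (simp add: abs_square_less_1)
  qed
  moreover have "d \<noteq> 0"
  proof
    assume "d = 0"
    then have "r\<^sup>2 = 1" using r2 by simp
    then have "r = 1" using r(1) by (simp add: power2_eq_1_iff)
    then have "big_arc c m a 1 0 1 \<union> \<tau> = \<tau>" unfolding \<tau> s1 \<open>d = 0\<close> by simp
    then show False using area inside_arc_from_to[OF arc] \<epsilon> by simp
  qed
  moreover have "\<not> d < 0"
  proof
    assume d: "d < 0"
    have "1 - d \<le> r" using calculation(1) by simp
    then have "(1 - d)\<^sup>2 \<le> r\<^sup>2" using d by (intro power_mono) auto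
    then have "d * (1 - cos a) \<ge> 0" unfolding r2 by (simp add: power2_eq_square algebra_simps)
    then show False using d cos_less by (simp add: zero_le_mult_iff)
  qed
  ultimately show ?thesis using that[of d r] r \<tau> s1 arc by auto
qed

text \<open>Comparing the equation of the arc with the inequality of the unit disc gives
  \<open>axial c m z \<le> cos a\<close>, while the arc satisfies the opposite inequality.\<close>

lemma outer_arc_facts:
  assumes d: "0 < d" and r: "0 < r" "r\<^sup>2 = (cos a - d)\<^sup>2 + (sin a)\<^sup>2" and \<tau>: "\<tau> = big_arc c m a 1 d r"
  shows "\<tau> \<inter> cball c 1 = {p, q}" "\<And>z. z \<in> \<tau> \<Longrightarrow> 0 < axial c m z"
proof -
  show "0 < axial c m z" if "z \<in> \<tau>" for z using that cos_pos by (auto simp: \<tau> big_arc_def)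
  have "{p, q} \<subseteq> \<tau> \<inter> cball c 1"
    using end_points_in_big_arc[OF r(2), of 1] by (auto simp: \<tau> circ_point_def dist_norm norm_Pair)
  moreover have "\<tau> \<inter> cball c 1 \<subseteq> {p, q}"
  proof
    fix z assume "z \<in> \<tau> \<inter> cball c 1"
    then have z: "(axial c m z - d)\<^sup>2 + (lateral c m z)\<^sup>2 = r\<^sup>2" "cos a \<le> axial c m z"
      "(axial c m z)\<^sup>2 + (lateral c m z)\<^sup>2 \<le> 1"
      using unit_disc_coords(2)[where c=c and m=m and z=z] by (auto simp: \<tau> big_arc_def)
    have r2: "r\<^sup>2 = 1 - 2 * d * cos a + d\<^sup>2" using r(2) by (simp add: power2_diff)
    have "2 * d * axial c m z \<le> 2 * d * cos a" using z(1,3) unfolding r2 by (simp add: power2_diff algebra_simps)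
    then have ax: "axial c m z = cos a" using d z(2) by simp
    then have "(lateral c m z)\<^sup>2 = (sin a)\<^sup>2" using z(1) r(2) by simp
    then show "z \<in> {p, q}" unfolding end_points_eq using ax by simp
  qed
  ultimately show "\<tau> \<inter> cball c 1 = {p, q}" by blast
qed

lemma big_arc_Int_arcs:
  assumes "0 < d" "r\<^sup>2 = (cos a - d)\<^sup>2 + (sin a)\<^sup>2"
  shows "big_arc c m a s d r \<inter> big_arc c m a s' 0 1 = {p, q}"
proof -
  have "big_arc c m a s d r \<inter> big_arc c m a s' 0 1 \<subseteq> {p, q}"
    using big_arc_trace[OF assms(2) _ unit_radius] assms(1) unfolding big_arc_def by blast
  then show ?thesis
    using end_points_in_big_arc[OF assms(2), of s] end_points_in_big_arc[OF unit_radius, of s'] by auto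
qed

text \<open>The unit arc is a cross-cut of the cap between \<tau> and the chord; it separates the
  lune from the unit cap.\<close>

lemma outer_cap_measure:
  assumes d: "0 < d" and r: "0 < r" "r\<^sup>2 = (cos a - d)\<^sup>2 + (sin a)\<^sup>2" and \<tau>: "\<tau> = big_arc c m a 1 d r"
    and arc: "arc_from_to \<tau> p q" and area: "measure lborel (inside (big_arc c m a 1 0 1 \<union> \<tau>)) = \<epsilon>"
  shows "measure lborel (cap c m a 1 d r) = \<epsilon> + measure lborel (cap c m a 1 0 1)"
proof -
  let ?\<sigma> = "big_arc c m a 1 0 1" and ?K = "chord c m a"
  have arcs: "arc_from_to ?K p q" "arc_from_to ?\<sigma> p q"
    using arc_from_to_segment[of p q] arc_from_to_circ_arc[of 1 u v c] uv by (simp_all add: chord_eq sigma_eq)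
  have r2: "r\<^sup>2 = 1 - 2 * d * cos a + d\<^sup>2" using r(2) by (simp add: power2_diff)
  have caps: "inside (\<tau> \<union> ?K) = cap c m a 1 d r" "inside (?\<sigma> \<union> ?K) = cap c m a 1 0 1"
    unfolding \<tau> using r frontier_cap[of r d 1] frontier_cap[of 1 0 1] by auto
  \<comment> \<open>The tip of the unit arc lies in the larger cap, since \<open>d > 0\<close> makes
    the larger disc reach beyond it.\<close>
  have "frame_point c m 1 0 \<in> ?\<sigma> \<inter> inside (\<tau> \<union> ?K)"
  proof -
    have "(1 - d)\<^sup>2 < r\<^sup>2" unfolding r2 using d cos_less by (simp add: power2_diff)
    then show ?thesis unfolding caps using cos_less by (simp add: big_arc_def cap_def)
  qed
  then have ne: "?\<sigma> \<inter> inside (\<tau> \<union> ?K) \<noteq> {}" by blast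
  have ints: "\<tau> \<inter> ?K = {p, q}" "\<tau> \<inter> ?\<sigma> = {p, q}" "?K \<inter> ?\<sigma> = {p, q}"
    using big_arc_chord_Int[OF r(2), of 1] big_arc_Int_arcs[OF d r(2), of 1 1] big_arc_chord_Int[OF unit_radius, of 1]
    by (auto simp: \<tau> Int_commute)
  note th = theta_split[OF arc arcs p_neq_q ints ne]
  have c1: "compact (\<tau> \<union> ?\<sigma>)" "compact (?K \<union> ?\<sigma>)" using r by (auto simp: \<tau> compact_big_arc compact_chord)
  have "measure lborel (inside (\<tau> \<union> ?K)) = measure lborel (inside (\<tau> \<union> ?\<sigma>)) + measure lborel (inside (?K \<union> ?\<sigma>))"
  proof (rule measure_lborel_Un_null[OF _ _ _ _ th])
    show "?\<sigma> - {p, q} \<in> null_sets lborel"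
    proof (rule null_sphere_subset)
      show "?\<sigma> - {p, q} \<subseteq> sphere c 1"
        by (auto simp: big_arc_def unit_disc_coords(3)[where c=c and m=m])
      show "?\<sigma> - {p, q} \<in> sets borel" using compact_big_arc[of 1 1 0] by (intro sets.Diff) (auto simp: borel_compact)
    qed
  qed (intro open_inside bounded_inside c1[THEN compact_imp_closed] c1[THEN compact_imp_bounded])+
  then show ?thesis using caps area by (simp add: Un_commute)
qed

text \<open>If the centre lies before the chord, the arc is widest at its ends, where the lateral
  coordinate is \<open>sin a\<close>. Otherwise its width can reach the radius, and \<open>r\<close>
  is bounded through areas: the cap then contains half of its disc, yet exceeds the unit cap only by
  \<epsilon>.\<close>

lemma outer_strip:
  assumes d: "0 < d" and r: "0 < r" "r\<^sup>2 = (cos a - d)\<^sup>2 + (sin a)\<^sup>2" and \<tau>: "\<tau> = big_arc c m a 1 d r"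
    and meas: "measure lborel (cap c m a 1 d r) = \<epsilon> + measure lborel (cap c m a 1 0 1)"
    and \<epsilon>: "0 < \<epsilon>" "\<epsilon> \<le> 1/100" and k: "0 < k" "k = 1 - \<epsilon>\<^sup>2 \<or> 28/100 \<le> cos a \<and> k \<le> 101/100"
    and z: "z \<in> \<tau>"
  shows "k * \<bar>lateral c m z\<bar> < 1"
proof -
  have zz: "(axial c m z - d)\<^sup>2 + (lateral c m z)\<^sup>2 = r\<^sup>2" "cos a \<le> axial c m z" using z by (auto simp: \<tau> big_arc_def)
  have e2: "0 < \<epsilon>\<^sup>2" "\<epsilon>\<^sup>2 \<le> 1/100"
  proof -
    show "0 < \<epsilon>\<^sup>2" using \<epsilon> by simp
    have "\<epsilon> * \<epsilon> \<le> 1/100 * 1" using \<epsilon> by (intro mult_mono) auto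
    then show "\<epsilon>\<^sup>2 \<le> 1/100" by (simp add: power2_eq_square)
  qed
  have goal: "k * \<bar>lateral c m z\<bar> < 1" if "k\<^sup>2 * (lateral c m z)\<^sup>2 < 1"
  proof -
    have "(k * \<bar>lateral c m z\<bar>)\<^sup>2 < 1\<^sup>2" using that by (simp add: power_mult_distrib)
    then show ?thesis by (rule power2_less_imp_less) simp
  qed
  have "k \<le> 101/100" using k(2) e2(1) by (elim disjE) linarith+
  then have k101: "k\<^sup>2 \<le> (101/100)\<^sup>2" using k(1) by (intro power_mono) auto
  have small: "k\<^sup>2 * Y < 1" if "Y \<le> 98/100" "0 \<le> Y" for Y
  proof -
    have "k\<^sup>2 * Y \<le> (101/100)\<^sup>2 * (98/100)" using k101 that by (intro mult_mono) auto
    also have "\<dots> < 1" by (simp add: power2_eq_square)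
    finally show ?thesis .
  qed
  have cos28: "(28/100)\<^sup>2 \<le> (cos a)\<^sup>2" if "28/100 \<le> cos a" using that by (intro power_mono) auto
  have lat_le: "(lateral c m z)\<^sup>2 \<le> r\<^sup>2" using zz(1) zero_le_power2[of "axial c m z - d"] by linarith
  have lat0: "0 \<le> (lateral c m z)\<^sup>2" by simp
  have half: "measure lborel (half_disc c m 0 1) = pi/2" "measure lborel (half_disc c m d r) = pi * r\<^sup>2 / 2"
    using measure_half_disc r by auto
  show ?thesis
  proof (cases "d < cos a")
    case True
    have "(cos a - d)\<^sup>2 \<le> (axial c m z - d)\<^sup>2" using True zz(2) by (intro power_mono) auto
    then have Y: "(lateral c m z)\<^sup>2 \<le> (sin a)\<^sup>2" using zz(1) r(2) by linarith
    show ?thesis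
    proof (rule goal)
      from k(2) show "k\<^sup>2 * (lateral c m z)\<^sup>2 < 1"
      proof
        assume k1: "k = 1 - \<epsilon>\<^sup>2"
        have "k\<^sup>2 * (lateral c m z)\<^sup>2 \<le> 1 * (sin a)\<^sup>2" using Y k1 e2 by (intro mult_mono) (auto simp: power_le_one)
        also have "\<dots> < 1" using sin_pos sin_less by (simp add: abs_square_less_1)
        finally show ?thesis .
      next
        assume "28/100 \<le> cos a \<and> k \<le> 101/100"
        then have "(sin a)\<^sup>2 \<le> 1 - (28/100)\<^sup>2" using cos28 by (simp add: sin_squared_eq)
        then have "(lateral c m z)\<^sup>2 \<le> 98/100" using Y by (simp add: power2_eq_square)
        then show ?thesis using small lat0 by blast
      qed
    qed
  next
    case False
    then have dc: "cos a \<le> d" by simp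
    have capb: "open (cap c m a 1 t \<rho>)" for t \<rho> unfolding cap_def by (simp add: open_disc_above)
    have bcap: "bounded (cap c m a 1 t \<rho>)" if "0 < \<rho>" for t \<rho> unfolding cap_def by (rule bounded_disc_part[OF that])
    have bhd: "bounded (half_disc c m t \<rho>)" if "0 < \<rho>" for t \<rho> unfolding half_disc_def by (rule bounded_disc_part[OF that])
    have hd: "open (half_disc c m t \<rho>)" for t \<rho> unfolding half_disc_def by (rule open_disc_above)
    show ?thesis
    proof (rule goal)
      from k(2) show "k\<^sup>2 * (lateral c m z)\<^sup>2 < 1"
      proof
        assume k1: "k = 1 - \<epsilon>\<^sup>2"
        \<comment> \<open>For \<open>r > 1\<close> two slabs sharpen the comparison: one of width
          \<open>cos a\<close> is missing from the unit cap, one of width \<open>d - cos a\<close>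
          is added to the half-disc in the larger cap. Together they give
          \<open>pi * d \<le> 4 * \<epsilon>\<close>, and \<open>r^2 \<le> 1 + d^2\<close>.\<close>
        have r2: "r\<^sup>2 \<le> 1 + 2 * \<epsilon>\<^sup>2"
        proof (cases "r \<le> 1")
          case True
          then have "r\<^sup>2 \<le> 1" using r(1) by (simp add: power_le_one)
          then show ?thesis using e2 by linarith
        next
          case False
          then have r1: "r > 1" by simp
          let ?S1 = "{z. (axial c m z - 0)\<^sup>2 + (lateral c m z)\<^sup>2 < 1\<^sup>2 \<and> 0 < axial c m z \<and> axial c m z < 0 + cos a}"
          have s1: "pi * 1 * cos a / 4 \<le> measure lborel ?S1"
            using cos_pos cos_less by (intro measure_slab_ge) auto
          have h1: "measure lborel ?S1 + measure lborel (cap c m a 1 0 1) \<le> pi/2"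
          proof -
            have "measure lborel ?S1 + measure lborel (cap c m a 1 0 1) = measure lborel (?S1 \<union> cap c m a 1 0 1)"
            proof (rule measure_lborel_Un_null[symmetric])
              show "open ?S1" by (rule open_disc_between)
              show "bounded ?S1" by (rule bounded_disc_part) simp
              show "?S1 \<inter> cap c m a 1 0 1 = {}" by (auto simp: cap_def)
              show "?S1 \<union> cap c m a 1 0 1 \<union> {} = ?S1 \<union> cap c m a 1 0 1" by simp
            qed (auto simp: capb bcap)
            also have "\<dots> \<le> measure lborel (half_disc c m 0 1)"
            proof (rule measure_lborel_mono)
              show "?S1 \<union> cap c m a 1 0 1 \<subseteq> half_disc c m 0 1" using cos_pos by (auto simp: cap_def half_disc_def)
              show "open (?S1 \<union> cap c m a 1 0 1)" by (intro open_Un open_disc_between capb)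
            qed (auto simp: hd bhd)
            finally show ?thesis using half by simp
          qed
          have h2: "pi * r\<^sup>2 / 2 + pi * (d - cos a) / 4 \<le> measure lborel (cap c m a 1 d r)"
          proof (cases "d = cos a")
            case True
            have "half_disc c m d r = cap c m a 1 d r" using True by (auto simp: cap_def half_disc_def)
            then show ?thesis using half True by simp
          next
            case False
            then have dc': "cos a < d" using dc by simp
            \<comment> \<open>The slab between chord and centre, read in the frame turned by
              \<open>pi\<close>, where the centre has axial coordinate \<open>- d\<close> and the
              slab starts there.\<close>
            let ?S2 = "{z. (axial c (m + pi) z - (- d))\<^sup>2 + (lateral c (m + pi) z)\<^sup>2 < r\<^sup>2 \<and> - d < axial c (m + pi) z \<and> axial c (m + pi) z < - d + (d - cos a)}"
            have ax: "axial c (m + pi) z = - axial c m z" "lateral c (m + pi) z = - lateral c m z" for z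
              by (simp_all add: axial_def lateral_def inner_prod_def)
            have dr: "d - cos a \<le> r"
            proof (rule power2_le_imp_le)
              show "(d - cos a)\<^sup>2 \<le> r\<^sup>2" using r(2) by (simp add: power2_commute)
            qed (use r in simp)
            have "pi * r * (d - cos a) / 4 \<le> measure lborel ?S2"
              using r dc' dr by (intro measure_slab_ge) auto
            moreover have "pi * 1 * (d - cos a) / 4 \<le> pi * r * (d - cos a) / 4"
              using r1 dc' by (intro divide_right_mono mult_right_mono mult_left_mono) auto
            ultimately have s2: "pi * (d - cos a) / 4 \<le> measure lborel ?S2" by (simp only: mult_1_right)
            have S2: "?S2 \<union> half_disc c m d r \<subseteq> cap c m a 1 d r"
              unfolding ax cap_def half_disc_def using dc' by (auto simp: power2_commute)
            have "measure lborel ?S2 + measure lborel (half_disc c m d r) = measure lborel (?S2 \<union> half_disc c m d r)"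
            proof (rule measure_lborel_Un_null[symmetric])
              show "open ?S2" by (rule open_disc_between)
              show "bounded ?S2" by (rule bounded_disc_part[OF r(1)])
              show "?S2 \<inter> half_disc c m d r = {}" by (auto simp: half_disc_def ax)
              show "?S2 \<union> half_disc c m d r \<union> {} = ?S2 \<union> half_disc c m d r" by simp
            qed (auto simp: hd bhd r)
            also have "\<dots> \<le> measure lborel (cap c m a 1 d r)"
              by (rule measure_lborel_mono[OF S2]) (intro open_Un open_disc_between hd capb bcap r)+
            finally show ?thesis using s2 half by simp
          qed
          have "pi * r\<^sup>2 / 2 + pi * (d - cos a) / 4 \<le> \<epsilon> + (pi/2 - pi * cos a / 4)"
            using h1 h2 s1 meas by linarith
          then have main: "pi * r\<^sup>2 / 2 + pi * d / 4 \<le> \<epsilon> + pi/2"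
            unfolding right_diff_distrib diff_divide_distrib by linarith
          have "pi * 1 \<le> pi * r\<^sup>2" using r1 by (intro mult_left_mono) (auto simp: one_le_power)
          then have "pi * d \<le> 4 * \<epsilon>" using main by linarith
          moreover have "3 * d \<le> pi * d" using pi_gt3 d by (intro mult_right_mono) auto
          ultimately have "d \<le> 4/3 * \<epsilon>" by linarith
          then have "d\<^sup>2 \<le> (4/3 * \<epsilon>)\<^sup>2" using d by (intro power_mono) auto
          then have "d\<^sup>2 \<le> 16/9 * \<epsilon>\<^sup>2" by (simp add: power_mult_distrib power_divide)
          then have "d\<^sup>2 \<le> 2 * \<epsilon>\<^sup>2" using e2(1) by linarith
          moreover have "r\<^sup>2 \<le> 1 + d\<^sup>2"
          proof -
            have "r\<^sup>2 = 1 - 2 * d * cos a + d\<^sup>2" using r(2) by (simp add: power2_diff)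
            then show ?thesis using d cos_pos by simp
          qed
          ultimately show ?thesis by linarith
        qed
        have "k\<^sup>2 * (lateral c m z)\<^sup>2 \<le> k\<^sup>2 * (1 + 2 * \<epsilon>\<^sup>2)" using r2 lat_le by (intro mult_left_mono) auto
        \<comment> \<open>\<open>(1 - x)^2 * (1 + 2 * x) = 1 - 3 * x^2 + 2 * x^3\<close> at
          \<open>x = \<epsilon>\<^sup>2\<close>; the linear terms cancel, which is why
          \<open>1 - \<epsilon>\<^sup>2\<close> is small enough a curvature.\<close>
        also have "\<dots> = 1 - 3 * (\<epsilon>\<^sup>2)\<^sup>2 + 2 * (\<epsilon>\<^sup>2)^3" unfolding k1 by (simp add: power2_eq_square power3_eq_cube algebra_simps)
        also have "\<dots> < 1"
        proof -
          have "2 * (\<epsilon>\<^sup>2)^3 = (2 * \<epsilon>\<^sup>2) * (\<epsilon>\<^sup>2)\<^sup>2" by (simp add: power2_eq_square power3_eq_cube)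
          also have "\<dots> < 3 * (\<epsilon>\<^sup>2)\<^sup>2" using e2 by (intro mult_strict_right_mono) auto
          finally show ?thesis by simp
        qed
        finally show ?thesis .
      next
        assume kk: "28/100 \<le> cos a \<and> k \<le> 101/100"
        \<comment> \<open>A disc that fits between the centre line and the chord because
          \<open>28/100 \<le> cos a\<close>. Its area is missing from the unit cap, which pushes
          \<open>r^2\<close> below \<open>98/100\<close>, and
          \<open>(101/100)^2 * (98/100) < 1\<close>.\<close>
        let ?b = "ball (frame_point c m (14/100) 0) (14/100)"
        have b: "z \<in> ?b \<longleftrightarrow> (axial c m z - 14/100)\<^sup>2 + (lateral c m z)\<^sup>2 < (14/100)\<^sup>2" for z by (rule ball_coords) simp
        have bsub: "0 < axial c m z \<and> axial c m z < 28/100 \<and> (axial c m z)\<^sup>2 + (lateral c m z)\<^sup>2 < 1" if "z \<in> ?b" for z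
        proof -
          have 1: "(axial c m z - 14/100)\<^sup>2 + (lateral c m z)\<^sup>2 < (14/100)\<^sup>2" using that b by blast
          then have "(axial c m z - 14/100)\<^sup>2 < (14/100)\<^sup>2" using zero_le_power2[of "lateral c m z"] by linarith
          then have "\<bar>axial c m z - 14/100\<bar> < 14/100" by (rule abs_less_of_square) simp
          then have 2: "0 < axial c m z" "axial c m z < 28/100" by linarith+
          have "(axial c m z)\<^sup>2 \<le> (28/100)\<^sup>2" using 2 by (intro power_mono) auto
          moreover have "(lateral c m z)\<^sup>2 < (14/100)\<^sup>2" using 1 zero_le_power2[of "axial c m z - 14/100"] by linarith
          ultimately show ?thesis using 2 by (simp add: power2_eq_square)
        qed
        have h1: "measure lborel ?b + measure lborel (cap c m a 1 0 1) \<le> pi/2"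
        proof -
          have "measure lborel ?b + measure lborel (cap c m a 1 0 1) = measure lborel (?b \<union> cap c m a 1 0 1)"
          proof (rule measure_lborel_Un_null[symmetric])
            show "?b \<inter> cap c m a 1 0 1 = {}" using bsub kk by (force simp: cap_def)
            show "?b \<union> cap c m a 1 0 1 \<union> {} = ?b \<union> cap c m a 1 0 1" by simp
          qed (auto simp: capb bcap)
          also have "\<dots> \<le> measure lborel (half_disc c m 0 1)"
          proof (rule measure_lborel_mono)
            show "?b \<union> cap c m a 1 0 1 \<subseteq> half_disc c m 0 1"
              using cos_pos bsub unfolding half_disc_def cap_def by (auto simp del: mem_ball)
            show "open (?b \<union> cap c m a 1 0 1)" by (intro open_Un open_ball capb)
          qed (auto simp: hd bhd)
          finally show ?thesis using half by simp
        qed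
        have "half_disc c m d r \<subseteq> cap c m a 1 d r" using dc by (auto simp: half_disc_def cap_def)
        then have h2: "pi * r\<^sup>2 / 2 \<le> measure lborel (cap c m a 1 d r)"
          unfolding half(2)[symmetric] by (rule measure_lborel_mono) (intro hd capb bcap r)+
        have "measure lborel ?b = pi * (14/100)\<^sup>2" by (rule measure_ball_plane) simp
        then have "pi * r\<^sup>2 / 2 \<le> \<epsilon> + pi/2 - pi * (14/100)\<^sup>2" using h1 h2 meas by linarith
        then have "pi * r\<^sup>2 \<le> 2 * \<epsilon> + pi * (1 - 2 * (14/100)\<^sup>2)" by (simp add: algebra_simps)
        also have "\<dots> \<le> pi * (98/100)"
          using \<epsilon> pi_gt3 by (simp add: power2_eq_square)
        finally have "r\<^sup>2 \<le> 98/100" by simp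
        then show ?thesis using lat_le lat0 by (intro small) auto
      qed
    qed
  qed
qed

text \<open>Only an arc bulging towards the centre could leave the half-plane
  \<open>0 < axial\<close>. Its lune contains both the unit cap and the far cap of \<tau>, so the
  small area first forces the chord away from the centre and then keeps the whole circle of \<tau>
  on the positive side.\<close>

lemma inner_shape:
  assumes "inner_replacement c u v \<epsilon> \<tau>" and \<epsilon>: "0 < \<epsilon>" "\<epsilon> < 1/20"
  shows "arc_from_to \<tau> p q" "\<tau> \<subseteq> cball c 1" "\<tau> \<inter> sphere c 1 = {p, q}" "\<And>z. z \<in> \<tau> \<Longrightarrow> 0 < axial c m z"
proof -
  have ab: "arc_between \<tau> p q" and sub: "\<tau> \<subseteq> cball c 1"
    and area: "measure lborel (inside (big_arc c m a 1 0 1 \<union> \<tau>)) = \<epsilon>"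
    using assms(1) unfolding inner_replacement_def sigma_eq by auto
  note arc = arc_between_cases(1)[OF ab]
  show "arc_from_to \<tau> p q" "\<tau> \<subseteq> cball c 1" by (rule arc sub)+
  have pq_sphere: "{p, q} \<subseteq> sphere c 1" by (auto simp: circ_point_def dist_norm norm_Pair)
  have incball: "frame_point c m x 0 \<in> cball c 1 \<longleftrightarrow> x\<^sup>2 \<le> 1" for x
    using unit_disc_coords(2)[where c=c and m=m and z="frame_point c m x 0"] by simp
  have "\<tau> \<inter> sphere c 1 = {p, q} \<and> (\<forall>z\<in>\<tau>. 0 < axial c m z)"
  proof (cases "\<tau> = chord c m a")
    case True
    have "z \<in> {p, q}" if "z \<in> chord c m a" "z \<in> sphere c 1" for z
    proof -
      have "(axial c m z)\<^sup>2 + (lateral c m z)\<^sup>2 = 1" "axial c m z = cos a"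
        using that unit_disc_coords(3)[where c=c and m=m and z=z] by (auto simp: chord_def)
      then show ?thesis unfolding end_points_eq using sin_squared_eq[of a] by simp
    qed
    then have "\<tau> \<inter> sphere c 1 = {p, q}"
      using True arc_from_to_ends[OF arc] pq_sphere by blast
    moreover have "\<forall>z\<in>\<tau>. 0 < axial c m z" using True cos_pos by (simp add: chord_def)
    ultimately show ?thesis by blast
  next
    case False
    then obtain s d r where s: "s \<in> {1, -1::real}" and r: "0 < r" "r\<^sup>2 = (cos a - d)\<^sup>2 + (sin a)\<^sup>2"
      and \<tau>: "\<tau> = big_arc c m a s d r" using arc_between_cases(2)[OF ab] by blast
    have r2: "r\<^sup>2 = 1 - 2 * d * cos a + d\<^sup>2" using r(2) by (simp add: power2_diff)
    have rge: "\<bar>cos a - d\<bar> \<le> r"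
    proof -
      have "(cos a - d)\<^sup>2 \<le> r\<^sup>2" using r(2) by simp
      then show ?thesis using r(1) by (simp add: abs_le_square_iff[symmetric])
    qed
    have d0: "d \<noteq> 0"
    proof
      assume d: "d = 0"
      then have "r\<^sup>2 = 1" using r2 by simp
      then have r1: "r = 1" using r(1) by (simp add: power2_eq_1_iff)
      show False
      proof (cases "s = 1")
        case True
        then have "big_arc c m a 1 0 1 \<union> \<tau> = \<tau>" unfolding \<tau> d r1 by simp
        then show False using area inside_arc_from_to[OF arc] \<epsilon> by simp
      next
        case False
        then have "s = -1" using s by simp
        then have "measure lborel (ball c 1) = \<epsilon>"
          using area inside_unit_circle unfolding \<tau> d r1 by simp
        then show False using \<epsilon> pi_gt3 by (simp add: measure_ball_plane)
      qed
    qed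
    have "z \<in> {p, q}" if "z \<in> \<tau>" "z \<in> sphere c 1" for z
    proof -
      have "(axial c m z)\<^sup>2 + (lateral c m z)\<^sup>2 = 1" "(axial c m z - d)\<^sup>2 + (lateral c m z)\<^sup>2 = r\<^sup>2"
        using that unit_disc_coords(3)[where c=c and m=m and z=z] by (auto simp: \<tau> big_arc_def)
      then show ?thesis using big_arc_trace[OF r(2) d0 unit_radius] by auto
    qed
    then have trace: "\<tau> \<inter> sphere c 1 = {p, q}" using arc_from_to_ends[OF arc] pq_sphere by blast
    have "0 < axial c m z" if z: "z \<in> \<tau>" for z
    proof (cases "s = 1")
      case True
      then show ?thesis using z cos_pos by (auto simp: \<tau> big_arc_def)
    next
      case False
      then have \<tau>': "\<tau> = big_arc c m a (-1) d r" using s \<tau> by auto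
      let ?\<sigma> = "big_arc c m a 1 0 1" and ?K = "chord c m a"
      have arcs: "arc_from_to ?K p q" "arc_from_to ?\<sigma> p q"
        using arc_from_to_segment[of p q] arc_from_to_circ_arc[of 1 u v c] uv by (simp_all add: chord_eq sigma_eq)
      have mid: "frame_point c m (cos a) 0 \<in> inside (?\<sigma> \<union> \<tau>)"
        unfolding \<tau>'
      proof (rule inside_beyond_circle)
        show "(x - d)\<^sup>2 \<noteq> r\<^sup>2" if "cos a \<le> x" "x \<le> cos a" for x
          using that r(2) sin_pos by simp
      qed (use r arc cos_pos \<tau>' in auto)
      have "frame_point c m (cos a) 0 \<in> ?K" by (simp add: chord_def)
      then have ne: "?K \<inter> inside (?\<sigma> \<union> \<tau>) \<noteq> {}" using mid by blast
      have "?\<sigma> \<inter> \<tau> \<subseteq> {p, q}"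
        using big_arc_trace[OF unit_radius d0[symmetric] r(2)] unfolding \<tau> big_arc_def by blast
      then have ints: "?\<sigma> \<inter> \<tau> = {p, q}" "?\<sigma> \<inter> ?K = {p, q}" "\<tau> \<inter> ?K = {p, q}"
        using arc_from_to_ends[OF arc] arc_from_to_ends[OF arcs(2)] big_arc_chord_Int[OF r(2), of s] big_arc_chord_Int[OF unit_radius, of 1]
        by (auto simp: \<tau>)
      have "inside (?\<sigma> \<union> ?K) \<subseteq> inside (?\<sigma> \<union> \<tau>)" "inside (\<tau> \<union> ?K) \<subseteq> inside (?\<sigma> \<union> \<tau>)"
        using theta_split(2)[OF arcs(2) arc arcs(1) p_neq_q ints ne] by blast+
      moreover have "inside (?\<sigma> \<union> ?K) = cap c m a 1 0 1" "inside (\<tau> \<union> ?K) = cap c m a (-1) d r"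
        unfolding \<tau>' using frontier_cap[of r d "-1"] frontier_cap[of 1 0 1] r by auto
      ultimately have G: "cap c m a 1 0 1 \<subseteq> inside (?\<sigma> \<union> \<tau>)" "cap c m a (-1) d r \<subseteq> inside (?\<sigma> \<union> \<tau>)" by simp_all
      have cpt: "compact (?\<sigma> \<union> \<tau>)" using r by (auto simp: \<tau> compact_big_arc)
      have small: "pi * \<rho>\<^sup>2 \<le> \<epsilon>" if "0 < \<rho>" "ball x \<rho> \<subseteq> inside (?\<sigma> \<union> \<tau>)" for x \<rho>
        using measure_le_inside[OF cpt open_ball that(2)] that(1) by (simp add: area measure_ball_plane)
      have cosbig: "71/100 < cos a"
      proof (rule ccontr)
        assume n: "\<not> 71/100 < cos a"
        \<comment> \<open>On the axis this disc reaches from \<open>715/1000\<close> to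
          \<open>995/1000\<close>; for \<open>cos a \<le> 71/100\<close> it would lie in the unit
          cap, but its area exceeds \<open>1/20\<close>.\<close>
        let ?b = "ball (frame_point c m (855/1000) 0) (14/100)"
        have "?b \<subseteq> cap c m a 1 0 1"
        proof
          fix z assume "z \<in> ?b"
          then have 1: "(axial c m z - 855/1000)\<^sup>2 + (lateral c m z)\<^sup>2 < (14/100)\<^sup>2" using ball_coords[of "14/100" z c m "855/1000"] by simp
          then have "(axial c m z - 855/1000)\<^sup>2 < (14/100)\<^sup>2" using zero_le_power2[of "lateral c m z"] by linarith
          then have "\<bar>axial c m z - 855/1000\<bar> < 14/100" by (rule abs_less_of_square) simp
          then have 2: "715/1000 < axial c m z" "axial c m z < 995/1000" by linarith+
          have "(axial c m z)\<^sup>2 + (lateral c m z)\<^sup>2 = (axial c m z - 855/1000)\<^sup>2 + (lateral c m z)\<^sup>2 + 2 * (855/1000) * axial c m z - (855/1000)\<^sup>2"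
            by (simp add: power2_eq_square algebra_simps)
          also have "\<dots> < (14/100)\<^sup>2 + 2 * (855/1000) * (995/1000) - (855/1000)\<^sup>2" using 1 2 by linarith
          also have "\<dots> < 1" by (simp add: power2_eq_square)
          finally show "z \<in> cap c m a 1 0 1" using 2 n by (simp add: cap_def)
        qed
        then have "pi * (14/100)\<^sup>2 \<le> \<epsilon>" using G(1) by (intro small) auto
        then show False using \<epsilon> pi_gt3 by (simp add: power2_eq_square)
      qed
      \<comment> \<open>If \<open>d \<le> r\<close>, the centre lies before the chord, because
        \<open>(71/100)^2 > 1/2\<close>, and \<open>r\<close> is at least \<open>1/2\<close>; then a
        disc of radius \<open>r/2\<close> behind the centre lies in the far cap and is too
        large.\<close>
      have "d - r > 0"
      proof (rule ccontr)
        assume "\<not> d - r > 0"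
        then have dr: "d \<le> r" by simp
        have dcos: "d < cos a"
        proof (rule ccontr)
          assume "\<not> d < cos a"
          then have dc: "cos a \<le> d" by simp
          then have "d\<^sup>2 \<le> r\<^sup>2" using dr cos_pos by (intro power_mono) auto
          then have "2 * d * cos a \<le> 1" unfolding r2 by simp
          moreover have "(71/100) * (71/100) < d * cos a" using dc cosbig by (intro mult_strict_mono) auto
          ultimately show False by simp
        qed
        have rhalf: "r \<ge> 1/2"
        proof (rule ccontr)
          assume "\<not> 1/2 \<le> r"
          then have "r < 1/2" "d < 1/2" using dr by auto
          then have "r\<^sup>2 < (1/2)\<^sup>2" using r(1) by (intro power_strict_mono) auto
          moreover have "r\<^sup>2 \<ge> (1/2)\<^sup>2"
          proof (cases "d \<ge> 0")
            case True
            have "(1/2)\<^sup>2 \<le> (1 - d)\<^sup>2" using \<open>d < 1/2\<close> by (intro power_mono) auto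
            also have "\<dots> \<le> r\<^sup>2" unfolding r2 using True cos_less by (simp add: power2_diff mult_left_le)
            finally show ?thesis .
          next
            case False
            then have "d * cos a \<le> 0" using cos_pos by (simp add: mult_nonpos_nonneg)
            then have "1 \<le> r\<^sup>2" unfolding r2 using zero_le_power2[of d] by linarith
            then show ?thesis by (simp add: power2_eq_square)
          qed
          ultimately show False by simp
        qed
        let ?b = "ball (frame_point c m (d - r/2) 0) (r/2)"
        have "?b \<subseteq> cap c m a (-1) d r"
        proof
          fix z assume "z \<in> ?b"
          then have 1: "(axial c m z - (d - r/2))\<^sup>2 + (lateral c m z)\<^sup>2 < (r/2)\<^sup>2" using ball_coords[of "r/2" z c m "d - r/2"] r by simp
          then have "(axial c m z - (d - r/2))\<^sup>2 < (r/2)\<^sup>2" using zero_le_power2[of "lateral c m z"] by linarith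
          then have "\<bar>axial c m z - (d - r/2)\<bar> < r/2" by (rule abs_less_of_square) (use r(1) in simp)
          then have 2: "d - r < axial c m z" "axial c m z < d" by linarith+
          have "(axial c m z - d)\<^sup>2 + (lateral c m z)\<^sup>2 = (axial c m z - (d - r/2))\<^sup>2 + (lateral c m z)\<^sup>2 - r * (axial c m z - d) - (r/2)\<^sup>2"
            by (simp add: power2_eq_square algebra_simps)
          also have "\<dots> < - r * (axial c m z - d)" using 1 by simp
          also have "\<dots> \<le> r\<^sup>2"
          proof -
            have "r * (d - axial c m z) \<le> r * r" using 2 r by (intro mult_left_mono) auto
            then show ?thesis by (simp add: power2_eq_square algebra_simps)
          qed
          finally show "z \<in> cap c m a (-1) d r" using 2 dcos by (simp add: cap_def)
        qed
        then have "pi * (r/2)\<^sup>2 \<le> \<epsilon>" using G(2) r by (intro small) auto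
        moreover have "3 * (1/4)\<^sup>2 \<le> pi * (r/2)\<^sup>2" using rhalf pi_gt3 by (intro mult_mono power_mono) auto
        ultimately show False using \<epsilon> by (simp add: power2_eq_square)
      qed
      moreover have "\<bar>axial c m z - d\<bar> \<le> r"
      proof -
        have "(axial c m z - d)\<^sup>2 + (lateral c m z)\<^sup>2 = r\<^sup>2" using z by (simp add: \<tau> big_arc_def)
        then have "(axial c m z - d)\<^sup>2 \<le> r\<^sup>2" using zero_le_power2[of "lateral c m z"] by linarith
        then show ?thesis using r(1) by (simp add: abs_le_square_iff[symmetric])
      qed
      ultimately show ?thesis by linarith
    qed
    then show ?thesis using trace by blast
  qed
  then show "\<tau> \<inter> sphere c 1 = {p, q}" "\<And>z. z \<in> \<tau> \<Longrightarrow> 0 < axial c m z" by blast+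
qed

end

subsection \<open>The lunes cut off by the replacing arcs\<close>

lemma inside_subset_halfplane:
  assumes S: "\<And>z. z \<in> S \<Longrightarrow> 0 < axial c m z" and z: "z \<in> inside S"
  shows "0 < axial c m z"
proof (rule ccontr)
  assume n: "\<not> 0 < axial c m z"
  have "z \<notin> inside S"
  proof (rule not_inside_ray[of "- (cos m, sin m)"])
    show "- (cos m, sin m) \<noteq> (0::plane)" using frame_vector_nonzero[of m] by (metis neg_equal_0_iff_equal)
    show "z + s *\<^sub>R - (cos m, sin m) \<notin> S" if "0 \<le> s" for s
    proof -
      have "z + s *\<^sub>R - (cos m, sin m) = (- s) *\<^sub>R (cos m, sin m) + z" by (simp add: algebra_simps)
      then have "axial c m (z + s *\<^sub>R - (cos m, sin m)) = - s + axial c m z" by (simp only: axial_translate)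
      then have "axial c m (z + s *\<^sub>R - (cos m, sin m)) \<le> 0" using n that by linarith
      then show ?thesis using S not_less by blast
    qed
  qed
  then show False using z by blast
qed

lemma axial_quarter: "axial c (m + pi/2) z = lateral c m z"
  by (simp add: axial_def lateral_def cos_add sin_add)

text \<open>From a point outside the strip, the lateral ray pointing away from the axis stays
  outside.\<close>

lemma inside_subset_strip:
  assumes S: "\<And>z. z \<in> S \<Longrightarrow> k * \<bar>lateral c m z\<bar> < 1" and k: "0 < k" and z: "z \<in> inside S"
  shows "k * \<bar>lateral c m z\<bar> < 1"
proof (rule ccontr)
  assume n: "\<not> k * \<bar>lateral c m z\<bar> < 1"
  define s :: real where "s = (if 0 \<le> lateral c m z then 1 else -1)"
  have s: "s * lateral c m z = \<bar>lateral c m z\<bar>" "\<bar>s\<bar> = 1" "s * s = 1" by (auto simp: s_def)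
  let ?e = "s *\<^sub>R (cos (m + pi/2), sin (m + pi/2)) :: plane"
  have "z \<notin> inside S"
  proof (rule not_inside_ray[of ?e])
    show "?e \<noteq> 0" using frame_vector_nonzero[of "m + pi/2"] s by (auto simp del: scaleR_Pair)
    show "z + t *\<^sub>R ?e \<notin> S" if "0 \<le> t" for t
    proof -
      have ze: "z + t *\<^sub>R ?e = (t * s) *\<^sub>R (cos (m + pi/2), sin (m + pi/2)) + z" by (simp add: algebra_simps del: scaleR_Pair)
      then have "lateral c m (z + t *\<^sub>R ?e) = t * s + lateral c m z"
        unfolding ze using axial_translate(1)[of c "m + pi/2" "t * s" z] unfolding axial_quarter by (simp only:)
      then have "s * lateral c m (z + t *\<^sub>R ?e) = t + \<bar>lateral c m z\<bar>"
        using s by (simp add: distrib_left)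
      moreover have "s * lateral c m (z + t *\<^sub>R ?e) \<le> \<bar>lateral c m (z + t *\<^sub>R ?e)\<bar>"
        by (auto simp: s_def)
      ultimately have "\<bar>lateral c m z\<bar> \<le> \<bar>lateral c m (z + t *\<^sub>R ?e)\<bar>" using that by linarith
      then have "k * \<bar>lateral c m z\<bar> \<le> k * \<bar>lateral c m (z + t *\<^sub>R ?e)\<bar>" using k by (intro mult_left_mono) auto
      then show ?thesis using n S[of "z + t *\<^sub>R ?e"] by linarith
    qed
  qed
  then show False using z by blast
qed

text \<open>By \<open>theta_inside\<close> the point \<open>c\<close> stays inside when \<sigma> is
  exchanged for \<tau>. A third point of \<sigma> is connected to \<open>c\<close> through the open
  disc, which the new curve avoids; so \<sigma> is a cross-cut of the enlarged region.\<close>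

lemma theta_outer:
  assumes arcs: "arc_from_to \<tau> x y" "arc_from_to R x y" "arc_from_to \<sigma> x y" and "x \<noteq> y"
    and ints: "\<tau> \<inter> R = {x, y}" "\<tau> \<inter> \<sigma> = {x, y}" "R \<inter> \<sigma> = {x, y}"
    and out: "\<tau> \<inter> ball c 1 = {}" "R \<inter> ball c 1 = {}" and \<sigma>: "\<sigma> \<subseteq> sphere c 1"
    and c: "c \<in> inside (R \<union> \<sigma>)" "c \<notin> inside (\<sigma> \<union> \<tau>)"
  shows "inside (\<tau> \<union> \<sigma>) \<inter> inside (R \<union> \<sigma>) = {}"
    "inside (\<tau> \<union> \<sigma>) \<union> inside (R \<union> \<sigma>) \<union> (\<sigma> - {x, y}) = inside (\<tau> \<union> R)"
proof -
  have "c \<in> inside (R \<union> \<tau>)"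
  proof (rule theta_inside[where A' = \<sigma>])
    show "compact R" "compact \<sigma>" "compact \<tau>" by (rule arc_from_to_compact arcs)+
    have "(R \<union> \<tau>) \<inter> (\<sigma> \<union> \<tau>) = \<tau>" using ints by blast
    then show "connected ((R \<union> \<tau>) \<inter> (\<sigma> \<union> \<tau>))" using arc_from_to_connected[OF arcs(1)] by simp
    show "c \<notin> \<tau>" using out by auto
  qed (use c in auto)
  then have cin: "c \<in> inside (\<tau> \<union> R)" by (simp add: Un_commute)
  obtain w where w: "w \<in> \<sigma>" "w \<noteq> x" "w \<noteq> y" by (rule arc_from_to_other_point[OF arcs(3) \<open>x \<noteq> y\<close>])
  have wn: "w \<notin> \<tau> \<union> R" using w ints by blast
  have "connected_component (- (\<tau> \<union> R)) c w"
    unfolding connected_component_def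
  proof (intro exI[of _ "insert w (ball c 1)"] conjI)
    have "w \<in> sphere c 1" using w(1) \<sigma> by blast
    then have "w \<in> closure (ball c 1)" by simp
    then have "insert w (ball c 1) \<subseteq> closure (ball c 1)" using closure_subset by blast
    then show "connected (insert w (ball c 1))"
      by (rule connected_intermediate_closure[OF convex_connected[OF convex_ball] subset_insertI])
    show "insert w (ball c 1) \<subseteq> - (\<tau> \<union> R)" using out wn by blast
  qed auto
  then have "w \<in> inside (\<tau> \<union> R)" by (rule inside_same_component[OF _ cin])
  then have ne: "\<sigma> \<inter> inside (\<tau> \<union> R) \<noteq> {}" using w by blast
  show "inside (\<tau> \<union> \<sigma>) \<inter> inside (R \<union> \<sigma>) = {}"
    "inside (\<tau> \<union> \<sigma>) \<union> inside (R \<union> \<sigma>) \<union> (\<sigma> - {x, y}) = inside (\<tau> \<union> R)"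
    by (rule theta_split[OF arcs \<open>x \<noteq> y\<close> ints ne])+
qed

section \<open>Lunes on either side of the circle\<close>

context arc_frame
begin

lemma complement_arc: "circ_arc c 1 v (u + 2*pi) = big_arc c m a (-1) 0 1"
  "arc_from_to (big_arc c m a (-1) 0 1) p q"
proof -
  have eq: "(v + (u + 2*pi))/2 = m + pi" "(u + 2*pi - v)/2 = pi - a" by (simp_all add: m_def a_def field_simps)
  have "circ_arc c 1 v (u + 2*pi) = {z. (axial c (m + pi) z)\<^sup>2 + (lateral c (m + pi) z)\<^sup>2 = 1\<^sup>2 \<and> 1 * cos (pi - a) \<le> axial c (m + pi) z}"
    using uv eq by (intro circ_arc_coords) (simp_all add: pi_ge_zero)
  also have "\<dots> = big_arc c m a (-1) 0 1"
  proof -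
    have "axial c (m + pi) z = - axial c m z" "lateral c (m + pi) z = - lateral c m z" for z
      by (simp_all add: axial_def lateral_def inner_prod_def)
    then show ?thesis by (simp add: big_arc_def)
  qed
  finally show eq2: "circ_arc c 1 v (u + 2*pi) = big_arc c m a (-1) 0 1" .
  have "arc_from_to (circ_arc c 1 v (u + 2*pi)) (circ_point c 1 v) (circ_point c 1 (u + 2*pi))"
    using uv by (intro arc_from_to_circ_arc) auto
  then show "arc_from_to (big_arc c m a (-1) 0 1) p q"
    unfolding eq2 circ_point_periodic by (rule arc_from_to_sym)
qed

lemma unit_arcs_Int: "big_arc c m a 1 0 1 \<inter> big_arc c m a (-1) 0 1 = {p, q}"
  unfolding end_points_eq big_arc_def by (auto simp: sin_squared_eq)

lemma unit_arcs_Un: "big_arc c m a 1 0 1 \<union> big_arc c m a (-1) 0 1 = sphere c 1"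
  by (auto simp: big_arc_def unit_disc_coords(3)[where c=c and m=m])

lemma sigma_arc: "arc_from_to (big_arc c m a 1 0 1) p q"
  using arc_from_to_circ_arc[of 1 u v c] uv by (simp add: sigma_eq)

lemma sigma_axial_pos: "z \<in> big_arc c m a 1 0 1 \<Longrightarrow> 0 < axial c m z"
  using cos_pos by (auto simp: big_arc_def)

text \<open>The centre is not in the lune, which lies in the open half-plane
  \<open>0 < axial\<close>; so \<open>theta_outer\<close> applies with the complementary unit arc as
  \<open>R\<close> and separates the lune from the disc.\<close>

lemma outer_lune:
  assumes \<tau>: "arc_from_to \<tau> p q" "\<tau> \<inter> cball c 1 = {p, q}" "\<And>z. z \<in> \<tau> \<Longrightarrow> 0 < axial c m z"
  shows "inside (big_arc c m a 1 0 1 \<union> \<tau>) \<inter> cball c 1 = {}" "c \<notin> inside (big_arc c m a 1 0 1 \<union> \<tau>)"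
proof -
  let ?\<sigma> = "big_arc c m a 1 0 1" and ?R = "big_arc c m a (-1) 0 1"
  have sub: "?\<sigma> \<subseteq> sphere c 1" "?R \<subseteq> sphere c 1" using unit_arcs_Un by blast+
  have sc: "sphere c 1 \<subseteq> cball c 1" "sphere c 1 \<inter> ball c 1 = {}" "ball c 1 \<subseteq> cball c 1" by auto
  have pqs: "p \<in> ?\<sigma>" "q \<in> ?\<sigma>" "p \<in> ?R" "q \<in> ?R" using unit_arcs_Int by blast+
  show cn: "c \<notin> inside (?\<sigma> \<union> \<tau>)"
  proof
    assume "c \<in> inside (?\<sigma> \<union> \<tau>)"
    then have "0 < axial c m c" by (rule inside_subset_halfplane[rotated]) (use \<tau>(3) sigma_axial_pos in blast)
    then show False by (simp add: axial_def)
  qed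
  have in1: "inside (?R \<union> ?\<sigma>) = ball c 1" using inside_unit_circle by (simp add: Un_commute)
  have th: "inside (\<tau> \<union> ?\<sigma>) \<inter> inside (?R \<union> ?\<sigma>) = {}"
    "inside (\<tau> \<union> ?\<sigma>) \<union> inside (?R \<union> ?\<sigma>) \<union> (?\<sigma> - {p, q}) = inside (\<tau> \<union> ?R)"
  proof -
    have pqn: "p \<notin> ball c 1" "q \<notin> ball c 1" using pqs sub sc by blast+
    have a1: "\<tau> \<inter> ?R = {p, q}" using \<tau>(2) sub sc pqs by blast
    have a2: "\<tau> \<inter> ?\<sigma> = {p, q}" using \<tau>(2) sub sc pqs by blast
    have a3: "?R \<inter> ?\<sigma> = {p, q}" by (subst Int_commute) (rule unit_arcs_Int)
    have "\<tau> \<inter> ball c 1 \<subseteq> \<tau> \<inter> cball c 1" by (rule Int_mono[OF order_refl sc(3)])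
    then have a4: "\<tau> \<inter> ball c 1 = {}" unfolding \<tau>(2) using pqn by fastforce
    have a5: "?R \<inter> ball c 1 = {}" using Int_mono[OF sub(2) order_refl, of "ball c 1"] unfolding sc(2) by (rule subset_empty[THEN iffD1])
    have a6: "c \<in> inside (?R \<union> ?\<sigma>)" unfolding in1 by simp
    note th = theta_outer[OF \<tau>(1) complement_arc(2) sigma_arc p_neq_q a1 a2 a3 a4 a5 sub(1) a6 cn]
    show "inside (\<tau> \<union> ?\<sigma>) \<inter> inside (?R \<union> ?\<sigma>) = {}"
      "inside (\<tau> \<union> ?\<sigma>) \<union> inside (?R \<union> ?\<sigma>) \<union> (?\<sigma> - {p, q}) = inside (\<tau> \<union> ?R)" by (rule th)+
  qed
  have "inside (\<tau> \<union> ?\<sigma>) \<inter> ball c 1 = {}" using th(1) in1 by simp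
  moreover have "inside (\<tau> \<union> ?\<sigma>) \<inter> ?\<sigma> = {}" using inside_no_overlap[of "\<tau> \<union> ?\<sigma>"] by blast
  moreover have "inside (\<tau> \<union> ?\<sigma>) \<inter> ?R = {}" using th(2) inside_no_overlap[of "\<tau> \<union> ?R"] by blast
  moreover have "cball c 1 = ball c 1 \<union> (?\<sigma> \<union> ?R)" unfolding unit_arcs_Un by auto
  ultimately show "inside (?\<sigma> \<union> \<tau>) \<inter> cball c 1 = {}" by (simp add: Un_commute) blast
qed

text \<open>Here \<tau> is a cross-cut of the disc, and the lune is one of the two pieces.\<close>

lemma inner_lune:
  assumes \<tau>: "arc_from_to \<tau> p q" "\<tau> \<subseteq> cball c 1" "\<tau> \<inter> sphere c 1 = {p, q}"
  shows "inside (big_arc c m a 1 0 1 \<union> \<tau>) \<subseteq> ball c 1"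
proof -
  let ?\<sigma> = "big_arc c m a 1 0 1" and ?R = "big_arc c m a (-1) 0 1"
  obtain w where w: "w \<in> \<tau>" "w \<noteq> p" "w \<noteq> q" by (rule arc_from_to_other_point[OF \<tau>(1) p_neq_q])
  have "w \<notin> sphere c 1" using w \<tau>(3) by blast
  then have "w \<in> ball c 1" using w(1) \<tau>(2) by (auto simp: less_le)
  then have ne: "\<tau> \<inter> inside (?\<sigma> \<union> ?R) \<noteq> {}" using w inside_unit_circle by blast
  have sub: "?\<sigma> \<subseteq> sphere c 1" "?R \<subseteq> sphere c 1" using unit_arcs_Un by blast+
  have ints: "?\<sigma> \<inter> \<tau> = {p, q}" "?R \<inter> \<tau> = {p, q}" using \<tau>(3) sub unit_arcs_Int by blast+
  from theta_split(2)[OF sigma_arc complement_arc(2) \<tau>(1) p_neq_q unit_arcs_Int ints ne]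
  show ?thesis unfolding inside_unit_circle by blast
qed

end

subsection \<open>The rearranged region\<close>

lemma continuous_set_integrable:
  fixes f :: "'a::euclidean_space \<Rightarrow> real"
  assumes "continuous_on UNIV f" "bounded X" "X \<in> sets borel"
  shows "set_integrable lborel X f"
proof -
  obtain e where "X \<subseteq> ball 0 e" using bounded_subset_ballD[OF assms(2)] by metis
  then have sub: "X \<subseteq> cball 0 e" using ball_subset_cball by blast
  have int: "set_integrable lborel (cball 0 e) f"
    unfolding set_integrable_def
    by (intro borel_integrable_compact compact_cball continuous_on_subset[OF assms(1)]) auto
  show ?thesis by (rule set_integrable_subset[OF int _ sub]) (simp add: assms(3))
qed

lemma set_integral_split:
  fixes f :: "'a::euclidean_space \<Rightarrow> real"
  assumes f: "continuous_on UNIV f" and Y: "open Y" "bounded Y" and Z: "open Z" "bounded Z"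
    and YZ: "Y \<inter> Z = {}" "Y \<union> Z \<union> N = X" and N: "N \<in> null_sets lborel"
  shows "(LINT z:X|lborel. f z) = (LINT z:Y|lborel. f z) + (LINT z:Z|lborel. f z)"
proof -
  have bor: "Y \<in> sets borel" "Z \<in> sets borel" "N \<in> sets borel" using Y Z N by auto
  have "(LINT z:X|lborel. f z) = (LINT z:Y \<union> Z|lborel. f z)"
    unfolding set_lebesgue_integral_def
  proof (rule integral_cong_AE)
    have fm: "f \<in> borel_measurable borel" by (rule borel_measurable_continuous_onI[OF f])
    show "(\<lambda>z. indicat_real X z *\<^sub>R f z) \<in> borel_measurable lborel" "(\<lambda>z. indicat_real (Y \<union> Z) z *\<^sub>R f z) \<in> borel_measurable lborel"
      using bor fm unfolding YZ(2)[symmetric] by (auto intro!: borel_measurable_scaleR borel_measurable_indicator)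
    show "AE z in lborel. indicat_real X z *\<^sub>R f z = indicat_real (Y \<union> Z) z *\<^sub>R f z"
      using AE_not_in[OF N] unfolding YZ(2)[symmetric] by eventually_elim (auto simp: indicator_def)
  qed
  also have "\<dots> = (LINT z:Y|lborel. f z) + (LINT z:Z|lborel. f z)"
    by (intro set_integral_Un YZ(1) continuous_set_integrable f Y Z bor)
  finally show ?thesis .
qed

text \<open>The interface between the geometry of single arcs and the surgery on the circle. Kept
  arcs may shrink to points, hence the weak inequalities. The facts \<open>centre\<close> and
  \<open>apart\<close> ensure that each arc is still a cross-cut after the replacements made before
  it.\<close>

locale lune_chain =
  fixes c :: plane and t0 t1 t2 t3 t4 t5 t6 t7 t8 :: real and \<tau>1 \<tau>2 \<tau>3 \<tau>4 :: "plane set"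
  assumes t: "t0 < t1" "t1 \<le> t2" "t2 < t3" "t3 \<le> t4" "t4 < t5" "t5 \<le> t6" "t6 < t7" "t7 \<le> t8" "t8 = t0 + 2 * pi"
    and arcs: "arc_from_to \<tau>1 (circ_point c 1 t0) (circ_point c 1 t1)" "arc_from_to \<tau>2 (circ_point c 1 t2) (circ_point c 1 t3)"
      "arc_from_to \<tau>3 (circ_point c 1 t4) (circ_point c 1 t5)" "arc_from_to \<tau>4 (circ_point c 1 t6) (circ_point c 1 t7)"
    and outer: "\<tau>1 \<inter> cball c 1 = {circ_point c 1 t0, circ_point c 1 t1}" "\<tau>3 \<inter> cball c 1 = {circ_point c 1 t4, circ_point c 1 t5}"
    and inner: "\<tau>2 \<subseteq> cball c 1" "\<tau>2 \<inter> sphere c 1 = {circ_point c 1 t2, circ_point c 1 t3}"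
      "\<tau>4 \<subseteq> cball c 1" "\<tau>4 \<inter> sphere c 1 = {circ_point c 1 t6, circ_point c 1 t7}"
    and disjoint: "\<tau>1 \<inter> \<tau>3 = {}" "\<tau>2 \<inter> \<tau>4 = {}"
    and centre: "c \<notin> inside (circ_arc c 1 t0 t1 \<union> \<tau>1)" "c \<notin> inside (circ_arc c 1 t4 t5 \<union> \<tau>3)"
    and apart: "inside (circ_arc c 1 t2 t3 \<union> \<tau>2) \<inter> \<tau>4 = {}"
    and null: "\<tau>1 \<in> null_sets lborel" "\<tau>2 \<in> null_sets lborel" "\<tau>3 \<in> null_sets lborel" "\<tau>4 \<in> null_sets lborel"
begin

abbreviation P where "P \<equiv> circ_point c 1"
abbreviation U where "U \<equiv> circ_arc c 1"

lemma P8: "P t8 = P t0"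
  unfolding t(9) by (rule circ_point_periodic)

lemma U_sphere: "U x y \<subseteq> sphere c 1"
  by (auto simp: circ_arc_def circ_point_def dist_norm norm_Pair)

lemma traces: "U x y \<inter> cball c 1 \<subseteq> P ` {x..y}" "\<tau>1 \<inter> cball c 1 \<subseteq> P ` {t0, t1}" "\<tau>3 \<inter> cball c 1 \<subseteq> P ` {t4, t5}"
  using outer by (auto simp: circ_arc_def)

lemma inner_traces: "\<tau>2 \<inter> sphere c 1 \<subseteq> P ` {t2, t3}" "\<tau>4 \<inter> sphere c 1 \<subseteq> P ` {t6, t7}" "U x y \<inter> sphere c 1 \<subseteq> P ` {x..y}"
  using inner by (auto simp: circ_arc_def)

lemma P_eqD:
  assumes "P x = P y" "x \<in> {t0..t8}" "y \<in> {t0..t8}"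
  shows "x = y \<or> x = t0 \<and> y = t8 \<or> x = t8 \<and> y = t0"
proof -
  have "\<bar>x - y\<bar> \<le> 2*pi" using assms t(9) by (auto simp: abs_le_iff)
  then have "x = y \<or> \<bar>x - y\<bar> = 2*pi" using circ_point_eq_iff[of 1 x y c] assms(1) by simp
  then show ?thesis using assms t(9) by (auto simp: abs_if split: if_splits)
qed

text \<open>A common point lies in the closed disc because of \<open>Y\<close>, hence on the circle
  because of \<open>X\<close>, hence has an angle in \<open>A\<close> and one in \<open>B\<close>.
  Intersections thus reduce to comparing angles, with \<open>t0\<close> and \<open>t8\<close>
  identified.\<close>

lemma isect:
  assumes X: "X \<inter> cball c 1 \<subseteq> P ` A" and Y: "Y \<inter> sphere c 1 \<subseteq> P ` B" "Y \<subseteq> cball c 1"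
    and AB: "A \<subseteq> {t0..t8}" "B \<subseteq> {t0..t8}"
    and Q: "\<And>x y. x \<in> A \<Longrightarrow> y \<in> B \<Longrightarrow> x = y \<or> x = t0 \<and> y = t8 \<or> x = t8 \<and> y = t0 \<Longrightarrow> P x \<in> Q"
  shows "X \<inter> Y \<subseteq> Q" "Y \<inter> X \<subseteq> Q"
proof -
  have "z \<in> Q" if z: "z \<in> X" "z \<in> Y" for z
  proof -
    obtain x where x: "x \<in> A" "z = P x" using z X Y(2) by blast
    have "z \<in> sphere c 1" unfolding x(2) by (simp add: circ_point_def dist_norm norm_Pair)
    then obtain y where y: "y \<in> B" "z = P y" using z Y(1) by blast
    have "P x = P y" using x y by simp
    then show ?thesis using Q[OF x(1) y(1) P_eqD] x y AB by blast
  qed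
  then show "X \<inter> Y \<subseteq> Q" "Y \<inter> X \<subseteq> Q" by blast+
qed

lemma U_cball: "U x y \<subseteq> cball c 1"
  using U_sphere by force

lemma P_sphere: "P x \<in> sphere c 1"
  using U_sphere[of x x] by (auto simp: circ_arc_def)

lemma outer_inner_Int:
  assumes "X \<inter> cball c 1 = {P w, P x}" "Y \<subseteq> cball c 1" "Y \<inter> sphere c 1 = {P y, P z}"
  shows "X \<inter> Y \<subseteq> {P w, P x} \<inter> {P y, P z}"
proof
  fix a assume a: "a \<in> X \<inter> Y"
  have "a \<in> X \<inter> cball c 1" by (rule IntI[OF IntD1[OF a] subsetD[OF assms(2) IntD2[OF a]]])
  then have 1: "a \<in> {P w, P x}" by (simp only: assms(1))
  then have "a = P w \<or> a = P x" by (simp only: insert_iff empty_iff simp_thms)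
  then have "a \<in> sphere c 1" by (elim disjE) (simp_all only: P_sphere)
  then have "a \<in> Y \<inter> sphere c 1" by (rule IntI[OF IntD2[OF a]])
  then have "a \<in> {P y, P z}" by (simp only: assms(3))
  then show "a \<in> {P w, P x} \<inter> {P y, P z}" using 1 by (rule IntI[rotated])
qed

lemma P_neq': "t0 \<le> x \<Longrightarrow> x < y \<Longrightarrow> y \<le> t8 \<Longrightarrow> t0 < x \<or> y < t8 \<Longrightarrow> P x \<noteq> P y"
  using P_eqD[of x y] by auto

lemma outer_inner_touch: "\<tau>1 \<inter> \<tau>2 \<subseteq> {P t2}" "\<tau>2 \<inter> \<tau>3 \<subseteq> {P t4}" "\<tau>1 \<inter> \<tau>4 \<subseteq> {P t6, P t7}" "\<tau>3 \<inter> \<tau>4 \<subseteq> {P t6, P t7}"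
proof -
  have n: "P t0 \<noteq> P t2" "P t0 \<noteq> P t3" "P t1 \<noteq> P t3" "P t2 \<noteq> P t4" "P t2 \<noteq> P t5" "P t3 \<noteq> P t5"
    by (rule P_neq'; use t(1-8) in linarith)+
  then have "{P t0, P t1} \<inter> {P t2, P t3} \<subseteq> {P t2}" "{P t4, P t5} \<inter> {P t2, P t3} \<subseteq> {P t4}" by auto
  then show "\<tau>1 \<inter> \<tau>2 \<subseteq> {P t2}" "\<tau>2 \<inter> \<tau>3 \<subseteq> {P t4}"
    using outer_inner_Int[OF outer(1) inner(1,2)] outer_inner_Int[OF outer(2) inner(1,2)] by blast+
  show "\<tau>1 \<inter> \<tau>4 \<subseteq> {P t6, P t7}" "\<tau>3 \<inter> \<tau>4 \<subseteq> {P t6, P t7}"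
    using outer_inner_Int[OF outer(1) inner(3,4)] outer_inner_Int[OF outer(2) inner(3,4)] by blast+
qed

lemmas isect_UU = isect[OF traces(1) inner_traces(3) U_cball]
lemmas isect_1U = isect[OF traces(2) inner_traces(3) U_cball]
lemmas isect_3U = isect[OF traces(3) inner_traces(3) U_cball]
lemmas isect_U2 = isect[OF traces(1) inner_traces(1) inner(1)]
lemmas isect_U4 = isect[OF traces(1) inner_traces(2) inner(3)]

lemma U_arc: "t0 \<le> x \<Longrightarrow> x \<le> y \<Longrightarrow> y \<le> t8 \<Longrightarrow> t0 < x \<or> y < t8 \<Longrightarrow> arc_from_to (U x y) (P x) (P y)"
  using t(9) by (intro arc_from_to_circ_arc) auto

lemma U_join: "x \<le> y \<Longrightarrow> y \<le> z \<Longrightarrow> U x y \<union> U y z = U x z"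
  unfolding circ_arc_def image_Un[symmetric] by (metis ivl_disj_un_two_touch(4))

lemma U_full: "U t0 t8 = sphere c 1"
proof
  show "sphere c 1 \<subseteq> U t0 t8"
  proof
    fix z assume "z \<in> sphere c 1"
    then have "(axial c (t0 + pi) z)\<^sup>2 + (lateral c (t0 + pi) z)\<^sup>2 = 1\<^sup>2"
      using unit_disc_coords(3)[where c=c and m="t0 + pi" and z=z] by simp
    then obtain t where "\<bar>t\<bar> \<le> pi" "z = P (t0 + pi + t)" by (rule circle_point_exists[rotated]) auto
    then show "z \<in> U t0 t8" unfolding circ_arc_def t(9) by (intro image_eqI[of _ _ "t0 + pi + t"]) (auto simp: abs_le_iff)
  qed
qed (rule U_sphere)

lemma P_in_U: "x \<le> z \<Longrightarrow> z \<le> y \<Longrightarrow> P z \<in> U x y"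
  by (auto simp: circ_arc_def)

lemma P_neq: "P t0 \<noteq> P t1" "P t2 \<noteq> P t3" "P t4 \<noteq> P t5" "P t6 \<noteq> P t7"
  using P_eqD[of t0 t1] P_eqD[of t2 t3] P_eqD[of t4 t5] P_eqD[of t6 t7] t(1-8) by auto

lemma ends: "P t0 \<in> \<tau>1" "P t1 \<in> \<tau>1" "P t2 \<in> \<tau>2" "P t3 \<in> \<tau>2" "P t4 \<in> \<tau>3" "P t5 \<in> \<tau>3" "P t6 \<in> \<tau>4" "P t7 \<in> \<tau>4"
  using arcs arc_from_to_ends by blast+

lemma U_disjoint_ball: "U x y \<inter> ball c 1 = {}"
  using U_sphere[of x y] by fastforce

lemma outer_disjoint_ball: "\<tau>1 \<inter> ball c 1 = {}" "\<tau>3 \<inter> ball c 1 = {}"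
proof -
  have *: "X \<inter> ball c 1 = {}" if "X \<inter> cball c 1 = {P x, P y}" for X x y
  proof -
    have "X \<inter> ball c 1 \<subseteq> {P x, P y}" unfolding that[symmetric] by auto
    moreover have "P s \<notin> ball c 1" for s using U_disjoint_ball[of s s] by (auto simp: circ_arc_def)
    ultimately show ?thesis by blast
  qed
  show "\<tau>1 \<inter> ball c 1 = {}" "\<tau>3 \<inter> ball c 1 = {}" using *[OF outer(1)] *[OF outer(2)] .
qed

text \<open>The arcs are exchanged one at a time. The outer ones come first: then the open disc
  stays inside the curve, and an inner arc, which has points in the disc, is visibly a
  cross-cut.\<close>

lemma region_split:
  defines "L1 \<equiv> inside (U t0 t1 \<union> \<tau>1)" and "L2 \<equiv> inside (U t2 t3 \<union> \<tau>2)"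
    and "L3 \<equiv> inside (U t4 t5 \<union> \<tau>3)" and "L4 \<equiv> inside (U t6 t7 \<union> \<tau>4)"
    and "S \<equiv> inside (\<tau>1 \<union> U t1 t2 \<union> \<tau>2 \<union> U t3 t4 \<union> \<tau>3 \<union> U t5 t6 \<union> \<tau>4 \<union> U t7 t8)"
  obtains C1 C2 C3 where "L1 \<inter> ball c 1 = {}" "L1 \<union> ball c 1 \<union> (U t0 t1 - {P t0, P t1}) = inside C1"
    "L3 \<inter> inside C1 = {}" "L3 \<union> inside C1 \<union> (U t4 t5 - {P t4, P t5}) = inside C2"
    "L2 \<inter> inside C3 = {}" "L2 \<union> inside C3 \<union> (\<tau>2 - {P t2, P t3}) = inside C2"
    "L4 \<inter> S = {}" "L4 \<union> S \<union> (\<tau>4 - {P t6, P t7}) = inside C3"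
    "compact C1" "compact C2" "compact C3"
proof -
  note ti = t(1-8)
  \<comment> \<open>The closed curves after one, two and three replacements, in the order \<tau>1,
    \<tau>3, \<tau>2.\<close>
  define C1 where "C1 = \<tau>1 \<union> U t1 t8"
  define C2 where "C2 = U t5 t8 \<union> \<tau>1 \<union> U t1 t4 \<union> \<tau>3"
  define C3 where "C3 = U t3 t4 \<union> \<tau>3 \<union> U t5 t8 \<union> \<tau>1 \<union> U t1 t2 \<union> \<tau>2"

  have in0: "inside (U t1 t8 \<union> U t0 t1) = ball c 1"
  proof -
    have "U t1 t8 \<union> U t0 t1 = frontier (ball c 1)" using U_join[of t0 t1 t8] U_full ti by (simp add: Un_commute)
    then show ?thesis using inside_frontier_eq_interior[of "ball c 1"] by simp
  qed
  have a1: "arc_from_to (U t1 t8) (P t0) (P t1)" "arc_from_to (U t0 t1) (P t0) (P t1)"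
    using U_arc[of t1 t8] U_arc[of t0 t1] ti arc_from_to_sym[of "U t1 t8"] by (auto simp: P8)
  have i1: "\<tau>1 \<inter> U t1 t8 = {P t0, P t1}" "\<tau>1 \<inter> U t0 t1 = {P t0, P t1}" "U t1 t8 \<inter> U t0 t1 = {P t0, P t1}"
  proof -
    have "\<tau>1 \<inter> U t1 t8 \<subseteq> {P t0, P t1}" "\<tau>1 \<inter> U t0 t1 \<subseteq> {P t0, P t1}" using outer(1) U_cball by blast+
    moreover have "U t1 t8 \<inter> U t0 t1 \<subseteq> {P t0, P t1}" by (rule isect_UU) (use ti in \<open>auto simp: P8\<close>)
    moreover have "P t0 \<in> U t1 t8" using P_in_U[of t1 t8 t8] ti P8 by simp
    ultimately show "\<tau>1 \<inter> U t1 t8 = {P t0, P t1}" "\<tau>1 \<inter> U t0 t1 = {P t0, P t1}" "U t1 t8 \<inter> U t0 t1 = {P t0, P t1}"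
      using ends P_in_U[of t1 t1 t8] P_in_U[of t0 t0 t1] P_in_U[of t0 t1 t1] ti by auto
  qed
  have c1: "c \<in> inside (U t1 t8 \<union> U t0 t1)" unfolding in0 by simp
  note s1 = theta_outer[OF arcs(1) a1 P_neq(1) i1 outer_disjoint_ball(1) U_disjoint_ball U_sphere c1 centre(1)]
  have e1: "L1 \<inter> ball c 1 = {}" "L1 \<union> ball c 1 \<union> (U t0 t1 - {P t0, P t1}) = inside C1"
    using s1 unfolding in0 C1_def L1_def by (simp_all add: Un_commute)
  have cC1: "ball c 1 \<subseteq> inside C1" using e1(2) by blast

  \<comment> \<open>The part of the current closed curve that stays when the next arc is exchanged;
    \<open>R3\<close> and \<open>R4\<close> play the same role.\<close>
  define R2 where "R2 = U t5 t8 \<union> \<tau>1 \<union> U t1 t4"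
  have j2: "U t5 t8 \<inter> \<tau>1 \<subseteq> {P t0}" "U t5 t8 \<inter> U t1 t4 \<subseteq> {P t1}" "\<tau>1 \<inter> U t1 t4 \<subseteq> {P t1}"
    by ((rule isect_1U isect_UU); use ti in \<open>auto simp: P8\<close>)+
  have a2: "arc_from_to R2 (P t4) (P t5)"
  proof -
    have "arc_from_to (U t5 t8) (P t5) (P t0)" using U_arc[of t5 t8] ti by (simp add: P8)
    from arc_from_to_join[OF this arcs(1) j2(1)] have "arc_from_to (U t5 t8 \<union> \<tau>1) (P t5) (P t1)" .
    moreover have "arc_from_to (U t1 t4) (P t1) (P t4)" using U_arc[of t1 t4] ti by auto
    ultimately have "arc_from_to R2 (P t5) (P t4)" unfolding R2_def
      by (rule arc_from_to_join) (use j2 in blast)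
    then show ?thesis by (rule arc_from_to_sym)
  qed
  have a2': "arc_from_to (U t4 t5) (P t4) (P t5)" using U_arc[of t4 t5] ti by auto
  have i2: "\<tau>3 \<inter> R2 = {P t4, P t5}" "\<tau>3 \<inter> U t4 t5 = {P t4, P t5}" "R2 \<inter> U t4 t5 = {P t4, P t5}"
  proof -
    have "\<tau>3 \<inter> R2 \<subseteq> {P t4, P t5}" "\<tau>3 \<inter> U t4 t5 \<subseteq> {P t4, P t5}"
      using outer(2) U_cball disjoint(1) unfolding R2_def by blast+
    moreover have "U t5 t8 \<inter> U t4 t5 \<subseteq> {P t4, P t5}" "U t1 t4 \<inter> U t4 t5 \<subseteq> {P t4, P t5}" "\<tau>1 \<inter> U t4 t5 \<subseteq> {P t4, P t5}"
      by ((rule isect_1U isect_UU); use ti in \<open>auto simp: P8\<close>)+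
    then have "R2 \<inter> U t4 t5 \<subseteq> {P t4, P t5}" unfolding R2_def by blast
    moreover have "P t4 \<in> R2" "P t5 \<in> R2" using P_in_U[of t5 t5 t8] P_in_U[of t1 t4 t4] ti unfolding R2_def by auto
    ultimately show "\<tau>3 \<inter> R2 = {P t4, P t5}" "\<tau>3 \<inter> U t4 t5 = {P t4, P t5}" "R2 \<inter> U t4 t5 = {P t4, P t5}"
      using ends P_in_U[of t4 t4 t5] P_in_U[of t4 t5 t5] ti by auto
  qed
  have R2C1: "R2 \<union> U t4 t5 = C1"
    unfolding R2_def C1_def using U_join[of t1 t4 t5] U_join[of t1 t5 t8] ti by auto
  have R2b: "R2 \<inter> ball c 1 = {}" unfolding R2_def using U_disjoint_ball outer_disjoint_ball by (simp add: Int_Un_distrib2)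
  have c2: "c \<in> inside (R2 \<union> U t4 t5)" unfolding R2C1 using cC1 by (rule subsetD) simp
  note s2 = theta_outer[OF arcs(3) a2 a2' P_neq(3) i2 outer_disjoint_ball(2) R2b U_sphere c2 centre(2)]
  have C2': "\<tau>3 \<union> R2 = C2" unfolding R2_def C2_def by auto
  have e2: "L3 \<inter> inside C1 = {}" "L3 \<union> inside C1 \<union> (U t4 t5 - {P t4, P t5}) = inside C2"
    using s2 unfolding R2C1 C2' L3_def by (simp_all add: Un_commute)
  have bC2: "ball c 1 \<subseteq> inside C2" using e2(2) cC1 by blast

  define R3 where "R3 = U t3 t4 \<union> \<tau>3 \<union> U t5 t8 \<union> \<tau>1 \<union> U t1 t2"
  have j3: "U t3 t4 \<inter> \<tau>3 \<subseteq> {P t4}" "U t3 t4 \<inter> U t5 t8 \<subseteq> {P t5}" "\<tau>3 \<inter> U t5 t8 \<subseteq> {P t5}"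
    "U t3 t4 \<inter> \<tau>1 \<subseteq> {P t0}" "U t5 t8 \<inter> \<tau>1 \<subseteq> {P t0}"
    "U t3 t4 \<inter> U t1 t2 \<subseteq> {P t1}" "\<tau>3 \<inter> U t1 t2 \<subseteq> {P t1}" "U t5 t8 \<inter> U t1 t2 \<subseteq> {P t1}" "\<tau>1 \<inter> U t1 t2 \<subseteq> {P t1}"
    by ((rule isect_1U isect_3U isect_UU); use ti in \<open>auto simp: P8\<close>)+
  have a3: "arc_from_to R3 (P t2) (P t3)"
  proof -
    have u: "arc_from_to (U t3 t4) (P t3) (P t4)" "arc_from_to (U t5 t8) (P t5) (P t0)" "arc_from_to (U t1 t2) (P t1) (P t2)"
      using U_arc[of t3 t4] U_arc[of t5 t8] U_arc[of t1 t2] ti by (auto simp: P8)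
    have 1: "arc_from_to (U t3 t4 \<union> \<tau>3) (P t3) (P t5)" by (rule arc_from_to_join[OF u(1) arcs(3) j3(1)])
    have 2: "arc_from_to (U t3 t4 \<union> \<tau>3 \<union> U t5 t8) (P t3) (P t0)" by (rule arc_from_to_join[OF 1 u(2)]) (use j3 in blast)
    have 3: "arc_from_to (U t3 t4 \<union> \<tau>3 \<union> U t5 t8 \<union> \<tau>1) (P t3) (P t1)"
      by (rule arc_from_to_join[OF 2 arcs(1)]) (use j3 disjoint(1) in blast)
    have "arc_from_to R3 (P t3) (P t2)" unfolding R3_def by (rule arc_from_to_join[OF 3 u(3)]) (use j3 in blast)
    then show ?thesis by (rule arc_from_to_sym)
  qed
  have a3': "arc_from_to (U t2 t3) (P t2) (P t3)" using U_arc[of t2 t3] ti by auto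
  have R3sph: "R3 \<inter> cball c 1 \<subseteq> sphere c 1"
  proof -
    have "P x \<in> sphere c 1" for x using U_sphere[of x x] by (auto simp: circ_arc_def)
    then have "\<tau>1 \<inter> cball c 1 \<subseteq> sphere c 1" "\<tau>3 \<inter> cball c 1 \<subseteq> sphere c 1" unfolding outer by blast+
    then show ?thesis unfolding R3_def using U_sphere by blast
  qed
  have i3: "U t2 t3 \<inter> R3 = {P t2, P t3}" "U t2 t3 \<inter> \<tau>2 = {P t2, P t3}" "R3 \<inter> \<tau>2 = {P t2, P t3}"
  proof -
    have "U t2 t3 \<inter> \<tau>2 \<subseteq> {P t2, P t3}" using inner(2) U_sphere by blast
    moreover have "R3 \<inter> \<tau>2 \<subseteq> {P t2, P t3}" using R3sph inner(1,2) by blast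
    moreover have "U t2 t3 \<inter> U t3 t4 \<subseteq> {P t2, P t3}" "U t2 t3 \<inter> \<tau>3 \<subseteq> {P t2, P t3}" "U t2 t3 \<inter> U t5 t8 \<subseteq> {P t2, P t3}"
      "U t2 t3 \<inter> \<tau>1 \<subseteq> {P t2, P t3}" "U t2 t3 \<inter> U t1 t2 \<subseteq> {P t2, P t3}"
      by ((rule isect_1U isect_3U isect_UU); use ti in \<open>auto simp: P8\<close>)+
    then have "U t2 t3 \<inter> R3 \<subseteq> {P t2, P t3}" unfolding R3_def by blast
    moreover have "P t2 \<in> R3" "P t3 \<in> R3" using P_in_U[of t1 t2 t2] P_in_U[of t3 t3 t4] ti unfolding R3_def by auto
    ultimately show "U t2 t3 \<inter> R3 = {P t2, P t3}" "U t2 t3 \<inter> \<tau>2 = {P t2, P t3}" "R3 \<inter> \<tau>2 = {P t2, P t3}"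
      using ends P_in_U[of t2 t2 t3] P_in_U[of t2 t3 t3] ti by auto
  qed
  have R3C2: "U t2 t3 \<union> R3 = C2"
    unfolding R3_def C2_def using U_join[of t1 t2 t3] U_join[of t1 t3 t4] ti by auto
  have inball: "\<exists>z. z \<in> \<tau> \<and> z \<noteq> x \<and> z \<noteq> y \<and> z \<in> ball c 1"
    if h: "arc_from_to \<tau> x y" "x \<noteq> y" "\<tau> \<subseteq> cball c 1" "\<tau> \<inter> sphere c 1 = {x, y}" for \<tau> x y
  proof -
    obtain w where w: "w \<in> \<tau>" "w \<noteq> x" "w \<noteq> y" by (rule arc_from_to_other_point[OF h(1,2)])
    have "w \<notin> sphere c 1" using w h(4) by blast
    moreover have "w \<in> cball c 1" using w(1) h(3) by blast
    ultimately show ?thesis using w by (intro exI[of _ w]) simp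
  qed
  have ne3: "\<tau>2 \<inter> inside (U t2 t3 \<union> R3) \<noteq> {}"
    unfolding R3C2 using inball[OF arcs(2) P_neq(2) inner(1,2)] bC2 by blast
  note s3 = theta_split[OF a3' a3 arcs(2) P_neq(2) i3 ne3]
  have C3': "R3 \<union> \<tau>2 = C3" by (simp add: R3_def C3_def)
  have e3: "L2 \<inter> inside C3 = {}" "L2 \<union> inside C3 \<union> (\<tau>2 - {P t2, P t3}) = inside C2"
    using s3 unfolding R3C2 C3' L2_def by simp_all

  define R4 where "R4 = U t7 t8 \<union> \<tau>1 \<union> U t1 t2 \<union> \<tau>2 \<union> U t3 t4 \<union> \<tau>3 \<union> U t5 t6"
  have j4_1: "U t7 t8 \<inter> \<tau>1 \<subseteq> {P t0}"
    by (rule isect_1U isect_3U isect_UU isect_U2; use ti in \<open>auto simp: P8\<close>)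
  have j4_2: "U t7 t8 \<inter> U t1 t2 \<subseteq> {P t1}"
    by (rule isect_1U isect_3U isect_UU isect_U2; use ti in \<open>auto simp: P8\<close>)
  have j4_3: "\<tau>1 \<inter> U t1 t2 \<subseteq> {P t1}"
    by (rule isect_1U isect_3U isect_UU isect_U2; use ti in \<open>auto simp: P8\<close>)
  have j4_4: "U t7 t8 \<inter> \<tau>2 \<subseteq> {P t2}"
    by (rule isect_1U isect_3U isect_UU isect_U2; use ti in \<open>auto simp: P8\<close>)
  have j4_5: "\<tau>1 \<inter> \<tau>2 \<subseteq> {P t2}"
    by (rule outer_inner_touch)
  have j4_6: "U t1 t2 \<inter> \<tau>2 \<subseteq> {P t2}"
    by (rule isect_1U isect_3U isect_UU isect_U2; use ti in \<open>auto simp: P8\<close>)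
  have j4_7: "U t7 t8 \<inter> U t3 t4 \<subseteq> {P t3}"
    by (rule isect_1U isect_3U isect_UU isect_U2; use ti in \<open>auto simp: P8\<close>)
  have j4_8: "\<tau>1 \<inter> U t3 t4 \<subseteq> {P t3}"
    by (rule isect_1U isect_3U isect_UU isect_U2; use ti in \<open>auto simp: P8\<close>)
  have j4_9: "U t1 t2 \<inter> U t3 t4 \<subseteq> {P t3}"
    by (rule isect_1U isect_3U isect_UU isect_U2; use ti in \<open>auto simp: P8\<close>)
  have j4_10: "\<tau>2 \<inter> U t3 t4 \<subseteq> {P t3}"
    by (rule isect_1U isect_3U isect_UU isect_U2; use ti in \<open>auto simp: P8\<close>)
  have j4_11: "U t7 t8 \<inter> \<tau>3 \<subseteq> {P t4}"
    by (rule isect_1U isect_3U isect_UU isect_U2; use ti in \<open>auto simp: P8\<close>)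
  have j4_12: "U t1 t2 \<inter> \<tau>3 \<subseteq> {P t4}"
    by (rule isect_1U isect_3U isect_UU isect_U2; use ti in \<open>auto simp: P8\<close>)
  have j4_13: "\<tau>2 \<inter> \<tau>3 \<subseteq> {P t4}"
    by (rule outer_inner_touch)
  have j4_14: "U t3 t4 \<inter> \<tau>3 \<subseteq> {P t4}"
    by (rule isect_1U isect_3U isect_UU isect_U2; use ti in \<open>auto simp: P8\<close>)
  have j4_15: "U t7 t8 \<inter> U t5 t6 \<subseteq> {P t5}"
    by (rule isect_1U isect_3U isect_UU isect_U2; use ti in \<open>auto simp: P8\<close>)
  have j4_16: "\<tau>1 \<inter> U t5 t6 \<subseteq> {P t5}"
    by (rule isect_1U isect_3U isect_UU isect_U2; use ti in \<open>auto simp: P8\<close>)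
  have j4_17: "U t1 t2 \<inter> U t5 t6 \<subseteq> {P t5}"
    by (rule isect_1U isect_3U isect_UU isect_U2; use ti in \<open>auto simp: P8\<close>)
  have j4_18: "\<tau>2 \<inter> U t5 t6 \<subseteq> {P t5}"
    by (rule isect_1U isect_3U isect_UU isect_U2; use ti in \<open>auto simp: P8\<close>)
  have j4_19: "U t3 t4 \<inter> U t5 t6 \<subseteq> {P t5}"
    by (rule isect_1U isect_3U isect_UU isect_U2; use ti in \<open>auto simp: P8\<close>)
  have j4_20: "\<tau>3 \<inter> U t5 t6 \<subseteq> {P t5}"
    by (rule isect_1U isect_3U isect_UU isect_U2; use ti in \<open>auto simp: P8\<close>)
  note j4 = j4_1 j4_2 j4_3 j4_4 j4_5 j4_6 j4_7 j4_8 j4_9 j4_10 j4_11 j4_12 j4_13 j4_14 j4_15 j4_16 j4_17 j4_18 j4_19 j4_20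
  have a4: "arc_from_to R4 (P t6) (P t7)"
  proof -
    have u: "arc_from_to (U t7 t8) (P t7) (P t0)" "arc_from_to (U t1 t2) (P t1) (P t2)" "arc_from_to (U t3 t4) (P t3) (P t4)"
      "arc_from_to (U t5 t6) (P t5) (P t6)"
      using U_arc[of t7 t8] U_arc[of t1 t2] U_arc[of t3 t4] U_arc[of t5 t6] ti by (auto simp: P8)
    have 1: "arc_from_to (U t7 t8 \<union> \<tau>1) (P t7) (P t1)" by (rule arc_from_to_join[OF u(1) arcs(1) j4(1)])
    have 2: "arc_from_to (U t7 t8 \<union> \<tau>1 \<union> U t1 t2) (P t7) (P t2)" by (rule arc_from_to_join[OF 1 u(2)]) (use j4(1-3) in blast)
    have 3: "arc_from_to (U t7 t8 \<union> \<tau>1 \<union> U t1 t2 \<union> \<tau>2) (P t7) (P t3)"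
      by (rule arc_from_to_join[OF 2 arcs(2)]) (use j4(4-6) in blast)
    have 4: "arc_from_to (U t7 t8 \<union> \<tau>1 \<union> U t1 t2 \<union> \<tau>2 \<union> U t3 t4) (P t7) (P t4)"
      by (rule arc_from_to_join[OF 3 u(3)]) (use j4(7-10) in blast)
    have 5: "arc_from_to (U t7 t8 \<union> \<tau>1 \<union> U t1 t2 \<union> \<tau>2 \<union> U t3 t4 \<union> \<tau>3) (P t7) (P t5)"
      by (rule arc_from_to_join[OF 4 arcs(3)]) (use j4(11-14) disjoint(1) in blast)
    have "arc_from_to R4 (P t7) (P t6)" unfolding R4_def
      by (rule arc_from_to_join[OF 5 u(4)]) (use j4(15-20) in blast)
    then show ?thesis by (rule arc_from_to_sym)
  qed
  have a4': "arc_from_to (U t6 t7) (P t6) (P t7)" using U_arc[of t6 t7] ti by auto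
  have i4: "U t6 t7 \<inter> R4 = {P t6, P t7}" "U t6 t7 \<inter> \<tau>4 = {P t6, P t7}" "R4 \<inter> \<tau>4 = {P t6, P t7}"
  proof -
    have i44: "U t6 t7 \<inter> \<tau>4 \<subseteq> {P t6, P t7}" using inner(4) U_sphere by blast
    have "\<tau>1 \<inter> \<tau>4 \<subseteq> {P t6, P t7}" "\<tau>3 \<inter> \<tau>4 \<subseteq> {P t6, P t7}"
      by (rule outer_inner_touch)+
    moreover have "U t7 t8 \<inter> \<tau>4 \<subseteq> {P t6, P t7}" "U t1 t2 \<inter> \<tau>4 \<subseteq> {P t6, P t7}"
      "U t3 t4 \<inter> \<tau>4 \<subseteq> {P t6, P t7}" "U t5 t6 \<inter> \<tau>4 \<subseteq> {P t6, P t7}"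
      by ((rule isect_U4); use ti in \<open>auto simp: P8\<close>)+
    ultimately have "R4 \<inter> \<tau>4 \<subseteq> {P t6, P t7}" unfolding R4_def using disjoint(2) by blast
    moreover have "U t6 t7 \<inter> U t7 t8 \<subseteq> {P t6, P t7}" "U t6 t7 \<inter> \<tau>1 \<subseteq> {P t6, P t7}" "U t6 t7 \<inter> U t1 t2 \<subseteq> {P t6, P t7}"
      "U t6 t7 \<inter> \<tau>2 \<subseteq> {P t6, P t7}" "U t6 t7 \<inter> U t3 t4 \<subseteq> {P t6, P t7}" "U t6 t7 \<inter> \<tau>3 \<subseteq> {P t6, P t7}" "U t6 t7 \<inter> U t5 t6 \<subseteq> {P t6, P t7}"
      by ((rule isect_1U isect_3U isect_UU isect_U2); use ti in \<open>auto simp: P8\<close>)+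
    then have "U t6 t7 \<inter> R4 \<subseteq> {P t6, P t7}" unfolding R4_def by blast
    moreover have "P t6 \<in> R4" "P t7 \<in> R4" using P_in_U[of t5 t6 t6] P_in_U[of t7 t7 t8] ti unfolding R4_def by auto
    ultimately show "U t6 t7 \<inter> R4 = {P t6, P t7}" "U t6 t7 \<inter> \<tau>4 = {P t6, P t7}" "R4 \<inter> \<tau>4 = {P t6, P t7}"
      using i44 ends P_in_U[of t6 t6 t7] P_in_U[of t6 t7 t7] ti by auto
  qed
  have R4C3: "U t6 t7 \<union> R4 = C3"
    unfolding R4_def C3_def using U_join[of t5 t6 t7] U_join[of t5 t7 t8] ti by auto
  \<comment> \<open>A point of \<tau>4 in the disc is inside \<open>C2\<close>; it survives the
    removal of the second lune by \<open>apart\<close> and by disjointness from \<tau>2.\<close>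
  have ne4: "\<tau>4 \<inter> inside (U t6 t7 \<union> R4) \<noteq> {}"
  proof -
    obtain z where z: "z \<in> \<tau>4" "z \<in> ball c 1" using inball[OF arcs(4) P_neq(4) inner(3,4)] by blast
    then have "z \<in> inside C2" "z \<notin> L2" "z \<notin> \<tau>2" using bC2 apart disjoint(2) unfolding L2_def by blast+
    then have "z \<in> inside C3" using e3(2) by blast
    then show ?thesis using z unfolding R4C3 by blast
  qed
  note s4 = theta_split[OF a4' a4 arcs(4) P_neq(4) i4 ne4]
  have S': "inside (R4 \<union> \<tau>4) = S" unfolding R4_def S_def by (rule arg_cong[where f=inside]) auto
  have e4: "L4 \<inter> S = {}" "L4 \<union> S \<union> (\<tau>4 - {P t6, P t7}) = inside C3"
    using s4 unfolding R4C3 S' L4_def by simp_all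
  have cU: "compact (U x y)" for x y unfolding circ_arc_def by (intro compact_continuous_image continuous_intros) auto
  have "compact C1" "compact C2" "compact C3"
    unfolding C1_def C2_def C3_def by (intro compact_Un cU arcs[THEN arc_from_to_compact])+
  then show ?thesis using that[OF e1 e2 e3 e4] by blast
qed

text \<open>The four splittings telescope up to null sets. Stated for continuous \<open>f\<close> so
  that a divergence gives the perimeter bound and \<open>f = 1\<close> the area.\<close>

lemma region_integral:
  fixes f :: "plane \<Rightarrow> real"
  defines "L1 \<equiv> inside (U t0 t1 \<union> \<tau>1)" and "L2 \<equiv> inside (U t2 t3 \<union> \<tau>2)"
    and "L3 \<equiv> inside (U t4 t5 \<union> \<tau>3)" and "L4 \<equiv> inside (U t6 t7 \<union> \<tau>4)"
    and "S \<equiv> inside (\<tau>1 \<union> U t1 t2 \<union> \<tau>2 \<union> U t3 t4 \<union> \<tau>3 \<union> U t5 t6 \<union> \<tau>4 \<union> U t7 t8)"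
  shows "continuous_on UNIV f \<Longrightarrow> (LINT z:S|lborel. f z) = (LINT z:ball c 1|lborel. f z)
     + (LINT z:L1|lborel. f z) + (LINT z:L3|lborel. f z) - (LINT z:L2|lborel. f z) - (LINT z:L4|lborel. f z)" (is "_ \<Longrightarrow> ?int")
    and "measure lborel (sym_diff S (ball c 1)) \<le> measure lborel L1 + measure lborel L3 + measure lborel L2 + measure lborel L4"
    and "open S" "bounded S"
    and "open L1" "bounded L1" "open L2" "bounded L2" "open L3" "bounded L3" "open L4" "bounded L4"
proof -
  obtain C1 C2 C3 where C: "L1 \<inter> ball c 1 = {}" "L1 \<union> ball c 1 \<union> (U t0 t1 - {P t0, P t1}) = inside C1"
    "L3 \<inter> inside C1 = {}" "L3 \<union> inside C1 \<union> (U t4 t5 - {P t4, P t5}) = inside C2"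
    "L2 \<inter> inside C3 = {}" "L2 \<union> inside C3 \<union> (\<tau>2 - {P t2, P t3}) = inside C2"
    "L4 \<inter> S = {}" "L4 \<union> S \<union> (\<tau>4 - {P t6, P t7}) = inside C3"
    "compact C1" "compact C2" "compact C3"
    unfolding L1_def L2_def L3_def L4_def S_def by (rule region_split)
  have ob: "open (inside X)" "bounded (inside X)" if "compact X" for X :: "plane set"
    using that by (simp_all add: open_inside compact_imp_closed bounded_inside compact_imp_bounded)
  have cU: "compact (U x y)" for x y unfolding circ_arc_def by (intro compact_continuous_image continuous_intros) auto
  note ca = arcs[THEN arc_from_to_compact]
  show S: "open S" "bounded S" unfolding S_def by (intro ob compact_Un ca cU)+
  show L: "open L1" "bounded L1" "open L2" "bounded L2" "open L3" "bounded L3" "open L4" "bounded L4"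
    unfolding L1_def L2_def L3_def L4_def by (intro ob compact_Un ca cU)+
  have nU: "U x y \<in> null_sets lborel" for x y
    by (rule null_sphere_subset[OF U_sphere]) (use cU in \<open>simp add: borel_compact\<close>)
  have nD: "N - {x, y} \<in> null_sets lborel" if "N \<in> null_sets lborel" for N :: "plane set" and x y
    using that by (intro null_set_Diff) auto
  show ?int if f: "continuous_on UNIV f"
  proof -
    have "(LINT z:inside C1|lborel. f z) = (LINT z:L1|lborel. f z) + (LINT z:ball c 1|lborel. f z)"
      by (rule set_integral_split[OF f L(1,2) _ _ C(1,2) nD[OF nU]]) auto
    moreover have "(LINT z:inside C2|lborel. f z) = (LINT z:L3|lborel. f z) + (LINT z:inside C1|lborel. f z)"
      by (rule set_integral_split[OF f L(5,6) ob[OF C(9)] C(3,4) nD[OF nU]])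
    moreover have "(LINT z:inside C2|lborel. f z) = (LINT z:L2|lborel. f z) + (LINT z:inside C3|lborel. f z)"
      by (rule set_integral_split[OF f L(3,4) ob[OF C(11)] C(5,6) nD[OF null(2)]])
    moreover have "(LINT z:inside C3|lborel. f z) = (LINT z:L4|lborel. f z) + (LINT z:S|lborel. f z)"
      by (rule set_integral_split[OF f L(7,8) S C(7,8) nD[OF null(4)]])
    ultimately show ?thesis by linarith
  qed
  define N where "N = U t0 t1 \<union> U t4 t5 \<union> \<tau>2 \<union> \<tau>4"
  have N: "N \<in> null_sets lborel" unfolding N_def by (intro null_sets.Un nU null)
  have sub: "sym_diff S (ball c 1) \<subseteq> (L1 \<union> L3 \<union> L2 \<union> L4) \<union> N"
    unfolding N_def using C(2,4,6,8) by blast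
  let ?L = "L1 \<union> L3 \<union> L2 \<union> L4"
  have fm: "L1 \<in> fmeasurable lborel" "L3 \<in> fmeasurable lborel" "L2 \<in> fmeasurable lborel" "L4 \<in> fmeasurable lborel"
    using L by (auto intro: open_bounded_fmeasurable)
  have fN: "N \<in> fmeasurable lborel" using N by (auto intro!: fmeasurableI)
  have "measure lborel (sym_diff S (ball c 1)) \<le> measure lborel (?L \<union> N)"
  proof (rule measure_mono_fmeasurable[OF sub])
    show "sym_diff S (ball c 1) \<in> sets lborel" using S by (auto intro!: sets.Un sets.Diff)
    show "?L \<union> N \<in> fmeasurable lborel" by (intro fmeasurable.Un fm fN)
  qed
  also have "\<dots> = measure lborel ?L"
  proof (rule measure_Un_null_set[OF _ N])
    show "?L \<in> sets lborel" using L by (simp add: borel_open open_Un)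
  qed
  also have "\<dots> \<le> measure lborel L1 + measure lborel L3 + measure lborel L2 + measure lborel L4"
  proof -
    have L': "L1 \<in> sets lborel" "L3 \<in> sets lborel" "L2 \<in> sets lborel" "L4 \<in> sets lborel"
      using L by (simp_all add: borel_open)
    show ?thesis
      using measure_Un_le[OF L'(1,2)] measure_Un_le[OF sets.Un[OF L'(1,2)] L'(3)]
        measure_Un_le[OF sets.Un[OF sets.Un[OF L'(1,2)] L'(3)] L'(4)] by linarith
  qed
  finally show "measure lborel (sym_diff S (ball c 1)) \<le> measure lborel L1 + measure lborel L3 + measure lborel L2 + measure lborel L4" .
qed

end

subsection \<open>The calibrating fields\<close>

text \<open>All unit normals of the circular arcs of curvature \<open>k\<close> with axis in direction \<open>m\<close>; it is invariant
  under translations along the axis, which makes its divergence constant.\<close>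

definition strip_field :: "plane \<Rightarrow> real \<Rightarrow> real \<Rightarrow> plane \<Rightarrow> plane" where
  "strip_field c m k z = sqrt (1 - k\<^sup>2 * (lateral c m z)\<^sup>2) *\<^sub>R (cos m, sin m) + (k * lateral c m z) *\<^sub>R (- sin m, cos m)"

definition strip :: "plane \<Rightarrow> real \<Rightarrow> real \<Rightarrow> plane set" where
  "strip c m k = {z. k * \<bar>lateral c m z\<bar> < 1}"

lemma open_strip: "open (strip c m k)"
  unfolding strip_def by (intro open_Collect_less continuous_intros)

lemma strip_pos: "0 < k \<Longrightarrow> z \<in> strip c m k \<Longrightarrow> 0 < 1 - k\<^sup>2 * (lateral c m z)\<^sup>2"
proof -
  assume "0 < k" "z \<in> strip c m k"
  then have "\<bar>k * lateral c m z\<bar> < 1" by (simp add: strip_def abs_mult)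
  then have "(k * lateral c m z)\<^sup>2 < 1" by (simp add: abs_square_less_1)
  then show ?thesis by (simp add: power_mult_distrib)
qed

lemma frame_inner:
  fixes m :: real
  shows "(cos m, sin m) \<bullet> (cos m, sin m) = 1" "(- sin m, cos m) \<bullet> (- sin m, cos m) = 1"
    "(cos m, sin m) \<bullet> (- sin m, cos m) = 0" "(- sin m, cos m) \<bullet> (cos m, sin m) = 0"
  by (simp_all add: inner_prod_def power2_eq_square[symmetric])

lemma norm_strip_field:
  assumes "0 < k" "z \<in> strip c m k"
  shows "norm (strip_field c m k z) = 1"
proof -
  have "(norm (strip_field c m k z))\<^sup>2 = (sqrt (1 - k\<^sup>2 * (lateral c m z)\<^sup>2))\<^sup>2 + (k * lateral c m z)\<^sup>2"
    unfolding strip_field_def power2_norm_eq_inner inner_add_left inner_add_right inner_scaleR_left inner_scaleR_right frame_inner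
    by (simp add: power2_eq_square)
  also have "\<dots> = 1" using strip_pos[OF assms] by (simp add: power_mult_distrib)
  finally show ?thesis by (simp add: power2_eq_1_iff) (metis norm_ge_zero neg_0_le_iff_le not_one_le_zero)
qed

text \<open>The field depends on the lateral coordinate alone, so its derivative is
  \<open>h \<mapsto> (h \<bullet> F) *\<^sub>R w\<close> with \<open>F\<close> the lateral unit
  vector, and the divergence is \<open>F \<bullet> w\<close>. The square root multiplies the axial
  vector and drops out.\<close>

lemma strip_field_C1:
  assumes k: "0 < k"
  shows "C1_on (strip c m k) (strip_field c m k)" "z \<in> strip c m k \<Longrightarrow> divergence (strip_field c m k) z = k"
proof -
  let ?E = "(cos m, sin m) :: plane" and ?F = "(- sin m, cos m) :: plane"
  let ?Y = "lateral c m"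
  define w where "w z = (- (k\<^sup>2 * ?Y z) / sqrt (1 - k\<^sup>2 * (?Y z)\<^sup>2)) *\<^sub>R ?E + k *\<^sub>R ?F" for z
  have dY: "(?Y has_derivative (\<lambda>h. h \<bullet> ?F)) (at z)" for z
    unfolding lateral_def by (auto intro!: derivative_eq_intros)
  have der: "(strip_field c m k has_derivative (\<lambda>h. (h \<bullet> ?F) *\<^sub>R w z)) (at z)" if z: "z \<in> strip c m k" for z
  proof -
    note p = strip_pos[OF k z]
    have "((\<lambda>y. sqrt (1 - k\<^sup>2 * y\<^sup>2)) has_real_derivative - (k\<^sup>2 * ?Y z) / sqrt (1 - k\<^sup>2 * (?Y z)\<^sup>2)) (at (?Y z))"
      using p by (auto intro!: derivative_eq_intros simp: field_simps)
    from diff_chain_at[OF dY this[unfolded has_field_derivative_def]]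
    have ds: "((\<lambda>z. sqrt (1 - k\<^sup>2 * (?Y z)\<^sup>2)) has_derivative (\<lambda>h. (- (k\<^sup>2 * ?Y z) / sqrt (1 - k\<^sup>2 * (?Y z)\<^sup>2)) * (h \<bullet> ?F))) (at z)"
      by (simp only: o_def)
    have "((\<lambda>z. sqrt (1 - k\<^sup>2 * (?Y z)\<^sup>2) *\<^sub>R ?E + (k * ?Y z) *\<^sub>R ?F) has_derivative
      (\<lambda>h. ((- (k\<^sup>2 * ?Y z) / sqrt (1 - k\<^sup>2 * (?Y z)\<^sup>2)) * (h \<bullet> ?F)) *\<^sub>R ?E + (k * (h \<bullet> ?F)) *\<^sub>R ?F)) (at z)"
      by (intro has_derivative_add has_derivative_scaleR_left has_derivative_mult_right ds dY)
    then show ?thesis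
      unfolding strip_field_def[abs_def] w_def scaleR_add_right scaleR_scaleR by (simp only: mult.commute)
  qed
  show "C1_on (strip c m k) (strip_field c m k)"
  proof (rule C1_onI[OF der])
    have "sqrt (1 - k\<^sup>2 * (?Y z)\<^sup>2) \<noteq> 0" if "z \<in> strip c m k" for z using strip_pos[OF k that] by simp
    then show "continuous_on (strip c m k) (\<lambda>z. (v \<bullet> ?F) *\<^sub>R w z)" for v
      unfolding w_def by (intro continuous_intros) auto
  qed
  show "divergence (strip_field c m k) z = k" if z: "z \<in> strip c m k"
  proof -
    have fr: "frechet_derivative (strip_field c m k) (at z) = (\<lambda>h. (h \<bullet> ?F) *\<^sub>R w z)"
      using frechet_derivative_at[OF der[OF z]] by (rule sym)
    have "divergence (strip_field c m k) z = (\<Sum>b\<in>Basis. (?F \<bullet> b) * (w z \<bullet> b))"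
      unfolding divergence_def fr by (simp add: inner_commute del: inner_Pair)
    also have "\<dots> = ?F \<bullet> w z" by (rule euclidean_inner[symmetric])
    also have "\<dots> = k" unfolding w_def inner_add_right inner_scaleR_right frame_inner by simp
    finally show ?thesis .
  qed
qed

lemma strip_field_flux:
  "strip_field c m k (circ_point c 1 t) \<bullet> (cos t, sin t) =
    cos (t - m) * sqrt (1 - k\<^sup>2 * (sin (t - m))\<^sup>2) + k * (sin (t - m))\<^sup>2"
proof -
  have "(cos m, sin m) \<bullet> (cos t, sin t) = cos (t - m)" "(- sin m, cos m) \<bullet> (cos t, sin t) = sin (t - m)"
    by (simp_all add: inner_prod_def cos_diff sin_diff mult.commute)
  then show ?thesis
    unfolding strip_field_def lateral_circ_point inner_add_left inner_scaleR_left
    by (simp add: power2_eq_square)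
qed

lemma flux_eq_arc_flux:
  assumes "u \<le> v" and m: "m = (u + v)/2" and a: "a = (v - u)/2"
  shows "integral {u..v} (\<lambda>t. strip_field c m k (circ_point c 1 t) \<bullet> (cos t, sin t)) = arc_flux a k"
proof -
  let ?f = "\<lambda>t. cos t * sqrt (1 - k\<^sup>2 * (sin t)\<^sup>2) + k * (sin t)\<^sup>2"
  have um: "u - m = - a" "v - m = a" using m a by (simp_all add: field_simps)
  have "((\<lambda>t. 1 *\<^sub>R ?f (t - m)) has_integral integral {u - m..v - m} ?f) {u..v}"
  proof (rule has_integral_substitution[where c="u - m" and d="v - m"])
    show "continuous_on {u - m..v - m} ?f" by (intro continuous_intros)
    show "((\<lambda>x. x - m) has_field_derivative 1) (at x within {u..v})" for x
      by (auto intro!: derivative_eq_intros)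
  qed (use assms in auto)
  then show ?thesis unfolding strip_field_flux arc_flux_def um by (simp add: integral_unique)
qed

lemma arc_flux_one:
  assumes "0 \<le> a" "a \<le> pi/2" shows "arc_flux a 1 = 2 * a"
proof -
  have "arc_flux a 1 = integral {-a..a} (\<lambda>t. 1)"
    unfolding arc_flux_def
  proof (rule integral_cong)
    fix t assume "t \<in> {-a..a}"
    then have "0 \<le> cos t" using assms by (intro cos_ge_zero) auto
    then show "cos t * sqrt (1 - 1\<^sup>2 * (sin t)\<^sup>2) + 1 * (sin t)\<^sup>2 = 1"
      by (simp add: cos_squared_eq[symmetric] power2_eq_square[symmetric])
  qed
  then show ?thesis using assms by simp
qed

subsection \<open>The perimeter of a region assembled from lunes\<close>

text \<open>The glued field times the corner cutoff is an admissible test field. Its divergence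
  integrated over \<open>S\<close> is the flux through the circle plus signed integrals over the
  lunes, where the field is known explicitly; its values elsewhere in the disc never appear. Only
  the limit of vanishing corners remains to be taken, term by term.\<close>

lemma perimeter_lower_bound:
  fixes T :: "nat \<Rightarrow> real" and K :: "nat \<Rightarrow> plane set" and m k :: "nat \<Rightarrow> real" and S :: "plane set"
  assumes N: "T N = T 0 + 2 * pi" and T: "\<And>i. i < N \<Longrightarrow> T i \<le> T (Suc i)" "\<And>i. i < N \<Longrightarrow> T (Suc i) < T i + 2 * pi"
    and Pts: "finite Pts" and K: "\<And>i. i < N \<Longrightarrow> compact (K i)" "\<And>i. i < N \<Longrightarrow> K i \<subseteq> strip c (m i) (k i)"
    and k: "\<And>i. i < N \<Longrightarrow> 0 < k i"
    and KK: "\<And>i j. i < N \<Longrightarrow> j < N \<Longrightarrow> i \<noteq> j \<Longrightarrow> K i \<inter> K j \<subseteq> Pts"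
    and UK: "\<And>i. i < N \<Longrightarrow> circ_arc c 1 (T i) (T (Suc i)) \<subseteq> K i"
    and J: "finite J" "\<And>i. i \<in> J \<Longrightarrow> i < N" "\<And>i. i \<in> J \<Longrightarrow> open (L i)" "\<And>i. i \<in> J \<Longrightarrow> bounded (L i)" "\<And>i. i \<in> J \<Longrightarrow> L i \<subseteq> K i"
    and int: "\<And>f :: plane \<Rightarrow> real. continuous_on UNIV f \<Longrightarrow>
      (LINT z:S|lborel. f z) = (LINT z:ball c 1|lborel. f z) + (\<Sum>i\<in>J. \<sigma> i * (LINT z:L i|lborel. f z))"
  shows "ereal ((\<Sum>i<N. integral {T i..T (Suc i)} (\<lambda>t. strip_field c (m i) (k i) (circ_point c 1 t) \<bullet> (cos t, sin t)))
     + (\<Sum>i\<in>J. \<sigma> i * (k i * measure lborel (L i)))) \<le> perimeter S"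
proof -
  let ?n = "\<lambda>i. strip_field c (m i) (k i)" and ?V = "\<lambda>i. strip c (m i) (k i)"
  let ?P = "circ_point c 1"
  obtain z :: "nat \<Rightarrow> plane \<Rightarrow> real" and G where z: "\<And>n. C1_on UNIV (z n)" "\<And>n x. 0 \<le> z n x" "\<And>n x. z n x \<le> 1"
    "\<And>n. \<exists>U. open U \<and> Pts \<subseteq> U \<and> (\<forall>x\<in>U. z n x = 0)"
    "\<And>x. x \<notin> Pts \<Longrightarrow> (\<lambda>n. z n x) \<longlonglongrightarrow> 1"
    "\<And>n x v. \<bar>frechet_derivative (z n) (at x) v\<bar> \<le> G n x * norm v" "\<And>n x. 0 \<le> G n x"
    "\<And>n. integrable lborel (G n)" "(\<lambda>n. \<integral>x. G n x \<partial>lborel) \<longlonglongrightarrow> 0"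
    by (rule point_cutoff[OF Pts]) blast
  have zc: "continuous_on UNIV (z n)" for n by (rule C1_on_continuous_on[OF z(1)])
  have z0: "z n x = 0" if "x \<in> Pts" for n x using z(4)[of n] that by blast
  have "\<exists>\<phi>. \<phi> \<in> test_fields \<and> (\<forall>i<N. \<forall>x\<in>K i. \<phi> x = z n x *\<^sub>R ?n i x)" for n
  proof -
    obtain U where U: "open U" "Pts \<subseteq> U" "\<And>x. x \<in> U \<Longrightarrow> z n x = 0" using z(4)[of n] by blast
    obtain \<phi> where "\<phi> \<in> test_fields" "\<And>i x. i \<in> {..<N} \<Longrightarrow> x \<in> K i \<Longrightarrow> \<phi> x = z n x *\<^sub>R ?n i x"
    proof (rule glue_fields[of "{..<N}" K ?V ?n U "z n"])
      show "finite {..<N}" by simp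
      show "compact (K i)" "K i \<subseteq> ?V i" "open (?V i)" "C1_on (?V i) (?n i)" if "i \<in> {..<N}" for i
        using that K k by (auto simp: open_strip strip_field_C1)
      show "norm (?n i x) \<le> 1" if "i \<in> {..<N}" "x \<in> ?V i" for i x
        using that k norm_strip_field[of "k i" x c "m i"] by simp
      show "K i \<inter> K j \<subseteq> U" if "i \<in> {..<N}" "j \<in> {..<N}" "i \<noteq> j" for i j
        using KK[of i j] that U(2) by auto
    qed (use U z in auto)
    then show ?thesis by (intro exI[of _ \<phi>]) auto
  qed
  then obtain \<phi> where \<phi>: "\<And>n. \<phi> n \<in> test_fields" "\<And>n i x. i < N \<Longrightarrow> x \<in> K i \<Longrightarrow> \<phi> n x = z n x *\<^sub>R ?n i x"
    by metis
  note C = test_fieldsD(1)[OF \<phi>(1)]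
  have Fc: "continuous_on A (\<lambda>t. \<phi> n (?P t) \<bullet> (cos t, sin t))" for A n
    by (intro continuous_intros continuous_on_compose2[OF C1_on_continuous_on[OF C]]) auto

  have flux: "(\<lambda>n. integral {T i..T (Suc i)} (\<lambda>t. \<phi> n (?P t) \<bullet> (cos t, sin t)))
    \<longlonglongrightarrow> integral {T i..T (Suc i)} (\<lambda>t. ?n i (?P t) \<bullet> (cos t, sin t))" if i: "i < N" for i
  proof -
    let ?I = "{T i..T (Suc i)}"
    define g where "g t = (if ?P t \<in> Pts then 0 else ?n i (?P t) \<bullet> (cos t, sin t))" for t
    have PK: "?P t \<in> K i" if "t \<in> ?I" for t using UK[OF i] that by (auto simp: circ_arc_def)
    have eq: "\<phi> n (?P t) \<bullet> (cos t, sin t) = z n (?P t) * (?n i (?P t) \<bullet> (cos t, sin t))" if "t \<in> ?I" for n t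
      using \<phi>(2)[OF i PK[OF that]] by simp
    have "(\<lambda>n. integral ?I (\<lambda>t. \<phi> n (?P t) \<bullet> (cos t, sin t))) \<longlonglongrightarrow> integral ?I g"
    proof (rule dominated_convergence(2))
      show "(\<lambda>t. \<phi> n (?P t) \<bullet> (cos t, sin t)) integrable_on ?I" for n by (intro integrable_continuous_real Fc)
      show "(\<lambda>t. 1::real) integrable_on ?I" by (intro integrable_continuous_real continuous_on_const)
      show "norm (\<phi> n (?P t) \<bullet> (cos t, sin t)) \<le> 1" for n t
      proof -
        have "norm (\<phi> n (?P t) \<bullet> (cos t, sin t)) \<le> norm (\<phi> n (?P t)) * norm (cos t, sin t)"
          by (rule Cauchy_Schwarz_ineq2[unfolded real_norm_def[symmetric]])
        then show ?thesis using test_fieldsD(2)[OF \<phi>(1)[of n], of "?P t"] by (simp add: norm_Pair)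
      qed
      show "(\<lambda>n. \<phi> n (?P t) \<bullet> (cos t, sin t)) \<longlonglongrightarrow> g t" if t: "t \<in> ?I" for t
      proof (cases "?P t \<in> Pts")
        case False
        have "(\<lambda>n. z n (?P t) * (?n i (?P t) \<bullet> (cos t, sin t))) \<longlonglongrightarrow> 1 * (?n i (?P t) \<bullet> (cos t, sin t))"
          by (intro tendsto_mult z(5) False tendsto_const)
        then show ?thesis using False by (simp add: g_def eq[OF t])
      qed (simp add: g_def eq[OF t] z0)
    qed
    moreover have "integral ?I g = integral ?I (\<lambda>t. ?n i (?P t) \<bullet> (cos t, sin t))"
    proof (rule integral_spike)
      \<comment> \<open>Less than a full turn is parametrised injectively, so only finitely many
        angles hit \<open>Pts\<close>.\<close>
      have "inj_on ?P ?I"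
      proof (rule inj_onI)
        fix s t assume "s \<in> ?I" "t \<in> ?I" "?P s = ?P t"
        then show "s = t" using circ_point_inj[of 1 c s t] T(2)[OF i] by (auto simp: abs_less_iff)
      qed
      then have "finite (?P -` Pts \<inter> ?I)" using Pts by (rule finite_vimage_IntI[rotated])
      then show "negligible (?P -` Pts \<inter> ?I)" by (rule negligible_finite)
    qed (auto simp: g_def)
    ultimately show ?thesis by simp
  qed

  \<comment> \<open>On a lune the divergence is \<open>k i * z n\<close> plus the derivative of the
    cutoff along a unit vector; the second term is bounded by \<open>G n\<close>, whose integral
    tends to 0.\<close>
  have bulk: "(\<lambda>n. LINT x:L i|lborel. divergence (\<phi> n) x) \<longlonglongrightarrow> k i * measure lborel (L i)" if i: "i \<in> J" for i
  proof -
    note Li = J(3-5)[OF i] and iN = J(2)[OF i]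
    have LV: "L i \<subseteq> ?V i" using Li(3) K(2)[OF iN] by blast
    have Lb: "L i \<in> sets borel" using Li by auto
    have nc: "continuous_on (L i) (?n i)" by (rule continuous_on_subset[OF C1_on_continuous_on[OF strip_field_C1(1)[OF k[OF iN]]] LV])
    have fm: "L i \<in> fmeasurable lborel" by (intro open_bounded_fmeasurable Li)
    have div: "divergence (\<phi> n) x = k i * z n x + frechet_derivative (z n) (at x) (?n i x)" if x: "x \<in> L i" for n x
    proof -
      have "divergence (\<phi> n) x = z n x * divergence (?n i) x + frechet_derivative (z n) (at x) (?n i x)"
      proof (rule divergence_scaleR[OF Li(1) x])
        show "\<phi> n y = z n y *\<^sub>R ?n i y" if "y \<in> L i" for y using \<phi>(2)[OF iN] that Li(3) by blast
        show "C1_on (L i) (z n)" by (rule C1_on_subset[OF z(1)]) simp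
        show "C1_on (L i) (?n i)" by (rule C1_on_subset[OF strip_field_C1(1)[OF k[OF iN]] LV])
      qed
      then show ?thesis using strip_field_C1(2)[OF k[OF iN], of x c "m i"] LV x by auto
    qed
    have zint: "set_integrable lborel (L i) (\<lambda>x. k i * z n x)" for n
      by (intro continuous_set_integrable Li(2) Lb continuous_on_mult zc continuous_on_const)
    have dint: "set_integrable lborel (L i) (\<lambda>x. divergence (\<phi> n) x)" for n
    proof -
      have "continuous_on UNIV (\<lambda>x. divergence (\<phi> n) x)"
        unfolding divergence_def by (intro continuous_intros C1_on_frechet_continuous[OF C])
      then show ?thesis by (intro continuous_set_integrable Li(2) Lb)
    qed
    let ?r = "\<lambda>n x. divergence (\<phi> n) x - k i * z n x"
    have rint: "set_integrable lborel (L i) (?r n)" for n by (rule set_integral_diff(1)[OF dint zint])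
    have rb: "\<bar>LINT x:L i|lborel. ?r n x\<bar> \<le> (\<integral>x. G n x \<partial>lborel)" for n
    proof -
      have "\<bar>LINT x:L i|lborel. ?r n x\<bar> \<le> (\<integral>x. \<bar>indicat_real (L i) x *\<^sub>R ?r n x\<bar> \<partial>lborel)"
        unfolding set_lebesgue_integral_def using integral_norm_bound[of lborel "\<lambda>x. indicat_real (L i) x *\<^sub>R ?r n x"] by simp
      also have "\<dots> \<le> (\<integral>x. G n x \<partial>lborel)"
      proof (rule integral_mono)
        show "integrable lborel (\<lambda>x. \<bar>indicat_real (L i) x *\<^sub>R ?r n x\<bar>)"
          using rint[of n] unfolding set_integrable_def by (rule integrable_abs)
        show "\<bar>indicat_real (L i) x *\<^sub>R ?r n x\<bar> \<le> G n x" for x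
        proof (cases "x \<in> L i")
          case True
          have "\<bar>?r n x\<bar> \<le> G n x * norm (?n i x)" using z(6)[of n x "?n i x"] by (simp add: div[OF True])
          also have "norm (?n i x) = 1" using norm_strip_field[OF k[OF iN]] LV True by blast
          finally show ?thesis using True by simp
        qed (simp add: z(7))
      qed (rule z(8))
      finally show ?thesis .
    qed
    have r0: "(\<lambda>n. LINT x:L i|lborel. ?r n x) \<longlonglongrightarrow> 0"
      by (rule tendsto_0_le[OF z(9), where K=1]) (use rb in \<open>auto intro!: always_eventually order_trans[OF rb]\<close>)
    have z1: "(\<lambda>n. LINT x:L i|lborel. k i * z n x) \<longlonglongrightarrow> (LINT x:L i|lborel. k i)"
      unfolding set_lebesgue_integral_def
    proof (rule integral_dominated_convergence[where w="\<lambda>x. indicat_real (L i) x * k i"])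
      show "AE x in lborel. (\<lambda>n. indicat_real (L i) x *\<^sub>R (k i * z n x)) \<longlonglongrightarrow> indicat_real (L i) x *\<^sub>R k i"
      proof -
        have "Pts \<in> null_sets lborel" using Pts by (intro negligible_borel_null negligible_finite) (auto simp: finite_imp_closed)
        from AE_not_in[OF this] show ?thesis
        proof eventually_elim
          case (elim x)
          have "(\<lambda>n. indicat_real (L i) x *\<^sub>R (k i * z n x)) \<longlonglongrightarrow> indicat_real (L i) x *\<^sub>R (k i * 1)"
            by (intro tendsto_intros z(5) elim)
          then show ?case by simp
        qed
      qed
      show "AE x in lborel. norm (indicat_real (L i) x *\<^sub>R (k i * z n x)) \<le> indicat_real (L i) x * k i" for n
        using k[OF iN] z(2,3)[of n] by (auto simp: indicator_def abs_mult mult_left_le)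
      show "integrable lborel (\<lambda>x. indicat_real (L i) x * k i)" using fm by (auto simp: fmeasurable_def)
      show "(\<lambda>x. indicat_real (L i) x *\<^sub>R (k i * z n x)) \<in> borel_measurable lborel" for n
        using zint[of n] by (auto simp: set_integrable_def)
      show "(\<lambda>x. indicat_real (L i) x *\<^sub>R k i) \<in> borel_measurable lborel" using Lb by simp
    qed
    have "(LINT x:L i|lborel. divergence (\<phi> n) x) = (LINT x:L i|lborel. k i * z n x) + (LINT x:L i|lborel. ?r n x)" for n
      using set_integral_add(2)[OF zint[of n] rint[of n]] by simp
    moreover have "(LINT x:L i|lborel. k i) = k i * measure lborel (L i)"
      using fm by (simp add: set_lebesgue_integral_def mult.commute)
    ultimately show ?thesis using tendsto_add[OF z1 r0] by simp
  qed

  define X where "X n = (\<Sum>i<N. integral {T i..T (Suc i)} (\<lambda>t. \<phi> n (?P t) \<bullet> (cos t, sin t)))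
     + (\<Sum>i\<in>J. \<sigma> i * (LINT x:L i|lborel. divergence (\<phi> n) x))" for n
  have Xlim: "X \<longlonglongrightarrow> (\<Sum>i<N. integral {T i..T (Suc i)} (\<lambda>t. ?n i (?P t) \<bullet> (cos t, sin t)))
     + (\<Sum>i\<in>J. \<sigma> i * (k i * measure lborel (L i)))"
    unfolding X_def by (intro tendsto_add tendsto_sum tendsto_mult tendsto_const flux bulk) auto
  have Xle: "ereal (X n) \<le> perimeter S" for n
  proof -
    have Tmono: "T 0 \<le> T j" if "j \<le> N" for j using that
    proof (induction j)
      case (Suc j) then show ?case using T(1)[of j] by simp
    qed simp
    have comb: "(\<Sum>i<j. integral {T i..T (Suc i)} (\<lambda>t. \<phi> n (?P t) \<bullet> (cos t, sin t)))
      = integral {T 0..T j} (\<lambda>t. \<phi> n (?P t) \<bullet> (cos t, sin t))" if "j \<le> N" for j using that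
    proof (induction j)
      case (Suc j)
      have "integral {T 0..T j} (\<lambda>t. \<phi> n (?P t) \<bullet> (cos t, sin t)) + integral {T j..T (Suc j)} (\<lambda>t. \<phi> n (?P t) \<bullet> (cos t, sin t))
        = integral {T 0..T (Suc j)} (\<lambda>t. \<phi> n (?P t) \<bullet> (cos t, sin t))"
        using Suc Tmono[of j] T(1)[of j]
        by (intro Henstock_Kurzweil_Integration.integral_combine integrable_continuous_real Fc) auto
      then show ?case using Suc by simp
    qed simp
    have "continuous_on UNIV (\<lambda>x. divergence (\<phi> n) x)"
      unfolding divergence_def by (intro continuous_intros C1_on_frechet_continuous[OF C])
    \<comment> \<open>The disc integral is the flux through the whole circle, which the partition
      \<open>T\<close> cuts into the summands of \<open>X n\<close>.\<close>
    from int[OF this] have "X n = (LINT x:S|lborel. divergence (\<phi> n) x)"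
      unfolding X_def disc_gauss[OF C[of n], of c "T 0"] comb[OF order_refl] N by simp
    then show ?thesis unfolding perimeter_def by (auto intro!: SUP_upper2[OF \<phi>(1)[of n]])
  qed
  show ?thesis
    by (rule LIMSEQ_le_const2[of "\<lambda>n. ereal (X n)"]) (use Xlim Xle in auto)
qed

subsection \<open>Estimates for the rearrangement\<close>

lemma sin_three_tenths: "28/100 \<le> sin (3/10 :: real)"
proof -
  have p: "(3/10::real) < pi/2" using pi_gt3 by simp
  have "(sin (3/20::real))\<^sup>2 \<le> (3/20)\<^sup>2"
    by (intro power_mono sin_x_le_x sin_ge_zero) (use pi_gt3 in auto)
  then have c: "cos (3/10::real) \<ge> 955/1000"
    using cos_double_sin[of "3/20::real"] by (simp add: power2_eq_square)
  have t: "tan (3/10::real) > 3/10" using tan_excess_pos[of "3/10"] p by (simp add: tan_excess_def)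
  have "3/10 * (955/1000) \<le> tan (3/10::real) * cos (3/10)" using c t by (intro mult_mono) auto
  also have "\<dots> = sin (3/10)" using c by (simp add: tan_def)
  finally show ?thesis by simp
qed

text \<open>An arc of length 0 can only be replaced by its single point, which encloses nothing;
  hence a positive lune area forces positive angles.\<close>

lemma degenerate_replacement:
  assumes "outer_replacement c u u \<mu> \<tau> \<or> inner_replacement c u u \<mu> \<tau>"
  shows "\<mu> = 0"
proof -
  have ab: "arc_between \<tau> (circ_point c 1 u) (circ_point c 1 u)"
    and m: "measure lborel (inside (circ_arc c 1 u u \<union> \<tau>)) = \<mu>"
    using assms by (auto simp: outer_replacement_def inner_replacement_def)
  have "\<tau> = {circ_point c 1 u}"
    using ab unfolding arc_between_def
  proof
    assume "\<exists>c' r u' v'. 0 < r \<and> u' < v' \<and> v' < u' + 2 * pi \<and> \<tau> = circ_arc c' r u' v' \<and>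
        {circ_point c 1 u, circ_point c 1 u} = {circ_point c' r u', circ_point c' r v'}"
    then obtain c' r u' v' where *: "0 < r" "u' < v'" "v' < u' + 2 * pi"
      "{circ_point c 1 u, circ_point c 1 u} = {circ_point c' r u', circ_point c' r v'}" by blast
    then have "circ_point c' r u' = circ_point c' r v'" by (metis doubleton_eq_iff)
    then have "u' = v'" using * by (intro circ_point_inj) auto
    then show ?thesis using * by simp
  qed simp
  then have "circ_arc c 1 u u \<union> \<tau> = {circ_point c 1 u}" by (simp add: circ_arc_def)
  then show ?thesis using m by simp
qed

section \<open>Closed lunes as pieces of the calibration\<close>

context arc_frame
begin

lemma null_arc_between: "arc_between \<tau> p q \<Longrightarrow> \<tau> \<in> null_sets lborel"
proof -
  assume ab: "arc_between \<tau> p q"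
  have bor: "\<tau> \<in> sets borel" using arc_from_to_compact[OF arc_between_cases(1)[OF ab]] by (rule borel_compact)
  from arc_between_cases(2)[OF ab] show ?thesis
  proof
    assume "\<tau> = chord c m a"
    then show ?thesis using bor
      by (intro negligible_borel_null negligible_subset[OF negligible_axial_line[of c m "cos a"]]) (auto simp: chord_def)
  next
    assume "\<exists>s d r. s \<in> {1, -1} \<and> 0 < r \<and> r\<^sup>2 = (cos a - d)\<^sup>2 + (sin a)\<^sup>2 \<and> \<tau> = big_arc c m a s d r"
    then obtain s d r where r: "0 < r" and \<tau>: "\<tau> = big_arc c m a s d r" by blast
    show ?thesis
    proof (rule null_sphere_subset[OF _ bor])
      show "\<tau> \<subseteq> sphere (frame_point c m d 0) r"
        unfolding \<tau> big_arc_def by (rule subsetI) (simp only: sphere_coords[OF r] mem_Collect_eq)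
    qed
  qed
qed

abbreviation lune where "lune \<tau> \<equiv> inside (circ_arc c 1 u v \<union> \<tau>)"

text \<open>The compact piece on which a calibrating field is prescribed: the lune with its two
  bounding arcs.\<close>

definition closed_lune where "closed_lune \<tau> = (circ_arc c 1 u v \<union> \<tau>) \<union> lune \<tau>"

lemma compact_closed_lune:
  assumes "arc_from_to \<tau> p q"
  shows "compact (closed_lune \<tau>)"
proof -
  have cpt: "compact (circ_arc c 1 u v \<union> \<tau>)"
    using arc_from_to_compact[OF assms] arc_from_to_compact[OF sigma_arc] by (intro compact_Un) (simp_all add: sigma_eq)
  have "closed (closed_lune \<tau>)"
    unfolding closed_lune_def union_with_inside using cpt by (intro closed_Compl open_outside compact_imp_closed)
  moreover have "bounded (closed_lune \<tau>)"
    unfolding closed_lune_def using cpt by (intro bounded_Un[THEN iffD2] conjI bounded_inside compact_imp_bounded) auto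
  ultimately show ?thesis by (simp add: compact_eq_bounded_closed)
qed

lemma closed_lune_axial:
  assumes "\<And>z. z \<in> \<tau> \<Longrightarrow> 0 < axial c m z" "z \<in> closed_lune \<tau>"
  shows "0 < axial c m z"
proof -
  have *: "0 < axial c m z" if "z \<in> circ_arc c 1 u v \<union> \<tau>" for z
    using that assms(1) sigma_axial_pos unfolding sigma_eq by blast
  then show ?thesis using assms(2) inside_subset_halfplane[OF *, of "circ_arc c 1 u v \<union> \<tau>" z]
    unfolding closed_lune_def by blast
qed

text \<open>The endpoint \<open>p\<close> on \<tau> already gives \<open>k * sin a < 1\<close>,
  which puts the unit arc into the strip as well; the inside follows by lateral rays.\<close>

lemma closed_lune_strip:
  assumes k: "0 < k" and "\<And>z. z \<in> \<tau> \<Longrightarrow> k * \<bar>lateral c m z\<bar> < 1" "p \<in> \<tau>"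
  shows "closed_lune \<tau> \<subseteq> strip c m k"
proof -
  have ks: "k * sin a < 1"
    using assms(2)[OF assms(3)] sin_pos unfolding p_eq by simp
  have *: "k * \<bar>lateral c m z\<bar> < 1" if "z \<in> circ_arc c 1 u v \<union> \<tau>" for z
  proof (cases "z \<in> \<tau>")
    case False
    then have z: "(axial c m z)\<^sup>2 + (lateral c m z)\<^sup>2 = 1" "cos a \<le> axial c m z"
      using that by (auto simp: sigma_eq big_arc_def)
    have "(cos a)\<^sup>2 \<le> (axial c m z)\<^sup>2" using z(2) cos_pos by (intro power_mono) auto
    then have "(lateral c m z)\<^sup>2 \<le> (sin a)\<^sup>2" using z(1) sin_squared_eq[of a] by linarith
    then have "\<bar>lateral c m z\<bar> \<le> sin a" using sin_pos by (simp add: abs_le_square_iff[symmetric])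
    then have "k * \<bar>lateral c m z\<bar> \<le> k * sin a" using k by (intro mult_left_mono) auto
    then show ?thesis using ks by linarith
  qed (rule assms(2))
  then show ?thesis using inside_subset_strip[OF * k]
    unfolding closed_lune_def strip_def by blast
qed

lemma outer_summary:
  assumes rep: "outer_replacement c u v \<epsilon> \<tau>" and \<epsilon>: "0 < \<epsilon>" "\<epsilon> \<le> 1/100"
    and k: "0 < k" "k = 1 - \<epsilon>\<^sup>2 \<or> a \<le> pi/2 - 3/10 \<and> k \<le> 101/100"
  shows "arc_from_to \<tau> p q" "\<tau> \<inter> cball c 1 = {p, q}" "\<And>z. z \<in> \<tau> \<Longrightarrow> 0 < axial c m z"
    "measure lborel (lune \<tau>) = \<epsilon>" "\<tau> \<in> null_sets lborel" "closed_lune \<tau> \<subseteq> strip c m k"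
    "c \<notin> lune \<tau>" "closed_lune \<tau> \<inter> cball c 1 \<subseteq> circ_arc c 1 u v"
proof -
  have ab: "arc_between \<tau> p q" and area: "measure lborel (lune \<tau>) = \<epsilon>"
    using rep by (auto simp: outer_replacement_def)
  have ep: "\<epsilon> < pi" using \<epsilon>(2) pi_gt3 by linarith
  obtain d r where dr: "0 < d" "0 < r" "r\<^sup>2 = (cos a - d)\<^sup>2 + (sin a)\<^sup>2" "\<tau> = big_arc c m a 1 d r" and arc: "arc_from_to \<tau> p q"
    by (rule outer_shape[OF rep \<epsilon>(1) ep])
  show "arc_from_to \<tau> p q" by (rule arc)
  show facts: "\<tau> \<inter> cball c 1 = {p, q}" "\<And>z. z \<in> \<tau> \<Longrightarrow> 0 < axial c m z"
    by (rule outer_arc_facts[OF dr]; assumption?)+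
  show "measure lborel (lune \<tau>) = \<epsilon>" by (rule area)
  show "\<tau> \<in> null_sets lborel" by (rule null_arc_between[OF ab])
  have meas: "measure lborel (cap c m a 1 d r) = \<epsilon> + measure lborel (cap c m a 1 0 1)"
    by (rule outer_cap_measure[OF dr arc]) (use area in \<open>simp add: sigma_eq\<close>)
  \<comment> \<open>\<open>cos (pi/2 - 3/10) = sin (3/10)\<close>, which is at least
    \<open>28/100\<close>.\<close>
  have k': "k = 1 - \<epsilon>\<^sup>2 \<or> 28/100 \<le> cos a \<and> k \<le> 101/100"
  proof -
    have "28/100 \<le> cos a" if "a \<le> pi/2 - 3/10"
    proof -
      have "cos (pi/2 - 3/10) \<le> cos a" using that a_pos pi_gt3 by (intro cos_monotone_0_pi_le) auto
      then show ?thesis using sin_three_tenths by (simp add: cos_diff)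
    qed
    then show ?thesis using k(2) by blast
  qed
  show "closed_lune \<tau> \<subseteq> strip c m k"
    by (rule closed_lune_strip[OF k(1) outer_strip[OF dr meas \<epsilon> k(1) k']]) (use arc_from_to_ends[OF arc] in auto)
  note ol = outer_lune[OF arc facts]
  show "c \<notin> lune \<tau>" using ol(2) by (simp add: sigma_eq)
  have "lune \<tau> \<inter> cball c 1 = {}" using ol(1) by (simp add: sigma_eq)
  moreover have "{p, q} \<subseteq> circ_arc c 1 u v" using uv by (auto simp: circ_arc_def)
  ultimately show "closed_lune \<tau> \<inter> cball c 1 \<subseteq> circ_arc c 1 u v"
    unfolding closed_lune_def using facts(1) by blast
qed

lemma inner_summary:
  assumes rep: "inner_replacement c u v \<epsilon> \<tau>" and \<epsilon>: "0 < \<epsilon>" "\<epsilon> \<le> 1/100"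
    and k: "0 < k" "k < 1"
  shows "arc_from_to \<tau> p q" "\<tau> \<subseteq> cball c 1" "\<tau> \<inter> sphere c 1 = {p, q}" "\<And>z. z \<in> \<tau> \<Longrightarrow> 0 < axial c m z"
    "measure lborel (lune \<tau>) = \<epsilon>" "\<tau> \<in> null_sets lborel" "closed_lune \<tau> \<subseteq> strip c m k"
    "closed_lune \<tau> \<subseteq> cball c 1" "closed_lune \<tau> \<inter> sphere c 1 \<subseteq> circ_arc c 1 u v"
proof -
  have ab: "arc_between \<tau> p q" and area: "measure lborel (lune \<tau>) = \<epsilon>"
    using rep by (auto simp: inner_replacement_def)
  have e: "\<epsilon> < 1/20" using \<epsilon> by simp
  note sh = inner_shape[OF rep \<epsilon>(1) e]
  show "arc_from_to \<tau> p q" "\<tau> \<subseteq> cball c 1" "\<tau> \<inter> sphere c 1 = {p, q}" "\<And>z. z \<in> \<tau> \<Longrightarrow> 0 < axial c m z" by (rule sh; assumption?)+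
  show "measure lborel (lune \<tau>) = \<epsilon>" by (rule area)
  show "\<tau> \<in> null_sets lborel" by (rule null_arc_between[OF ab])
  show "closed_lune \<tau> \<subseteq> strip c m k"
  proof (rule closed_lune_strip[OF k(1)])
    show "p \<in> \<tau>" using arc_from_to_ends[OF sh(1)] by simp
    fix z assume "z \<in> \<tau>"
    then have "z \<in> cball c 1" using sh(2) by blast
    then have "(axial c m z)\<^sup>2 + (lateral c m z)\<^sup>2 \<le> 1" using unit_disc_coords(2)[where c=c and m=m and z=z] by simp
    then have "(lateral c m z)\<^sup>2 \<le> 1" using zero_le_power2[of "axial c m z"] by linarith
    then have "\<bar>lateral c m z\<bar> \<le> 1" by (simp add: abs_square_le_1)
    then have "k * \<bar>lateral c m z\<bar> \<le> k * 1" using k by (intro mult_left_mono) auto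
    then show "k * \<bar>lateral c m z\<bar> < 1" using k by linarith
  qed
  have "lune \<tau> \<subseteq> ball c 1" using inner_lune[OF sh(1-3)] by (simp add: sigma_eq)
  moreover have "ball c 1 \<subseteq> cball c 1" "ball c 1 \<inter> sphere c 1 = {}" by auto
  moreover have "circ_arc c 1 u v \<subseteq> sphere c 1" "sphere c 1 \<subseteq> cball c 1"
    by (auto simp: circ_arc_def circ_point_def dist_norm norm_Pair)
  moreover have "{p, q} \<subseteq> circ_arc c 1 u v" using uv by (auto simp: circ_arc_def)
  ultimately show "closed_lune \<tau> \<subseteq> cball c 1" "closed_lune \<tau> \<inter> sphere c 1 \<subseteq> circ_arc c 1 u v"
    unfolding closed_lune_def using sh(2,3) by blast+
qed

end

lemma kept_arc_strip:
  assumes "u \<le> v" "v < u + pi" and m: "m = (u + v)/2"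
  shows "circ_arc c 1 u v \<subseteq> strip c m 1"
proof
  fix z assume "z \<in> circ_arc c 1 u v"
  then obtain t where t: "u \<le> t" "t \<le> v" "z = circ_point c 1 t" by (auto simp: circ_arc_def)
  have "t - m < pi/2" "- (pi/2) < t - m" unfolding m using t(1,2) assms(2) by (simp_all add: field_simps)
  then have "0 < cos (t - m)" by (rule cos_gt_zero_pi[rotated])
  then have "(sin (t - m))\<^sup>2 < 1" using sin_cos_squared_add[of "t - m"] zero_less_power[of "cos (t - m)" 2] by linarith
  then show "z \<in> strip c m 1" by (simp add: strip_def t abs_square_less_1)
qed

lemma measure_differences:
  fixes B \<Omega> :: "'a::euclidean_space set"
  assumes B: "B \<in> fmeasurable lborel" and \<Omega>: "\<Omega> \<in> sets borel" "measure lborel \<Omega> = measure lborel B" "0 < measure lborel B"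
    and sd: "measure lborel (sym_diff B \<Omega>) = 4 * \<epsilon>"
  shows "measure lborel (\<Omega> - B) = 2 * \<epsilon>" "measure lborel (B - \<Omega>) = 2 * \<epsilon>"
proof -
  \<comment> \<open>\<open>measure\<close> is 0 by default on sets of infinite measure, so a
    positive value implies finiteness.\<close>
  have \<Omega>f: "emeasure lborel \<Omega> \<noteq> \<infinity>"
  proof
    assume "emeasure lborel \<Omega> = \<infinity>"
    then have "measure lborel \<Omega> = 0" by (simp add: measure_def)
    then show False using \<Omega> by simp
  qed
  have Bf: "emeasure lborel B \<noteq> \<infinity>" "B \<in> sets lborel" using B by (auto simp: fmeasurable_def)
  have fin: "emeasure lborel (\<Omega> - B) \<noteq> \<infinity>" "emeasure lborel (B - \<Omega>) \<noteq> \<infinity>"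
  proof -
    have "emeasure lborel (\<Omega> - B) \<le> emeasure lborel \<Omega>" "emeasure lborel (B - \<Omega>) \<le> emeasure lborel B"
      using \<Omega>(1) Bf by (auto intro!: emeasure_mono)
    then show "emeasure lborel (\<Omega> - B) \<noteq> \<infinity>" "emeasure lborel (B - \<Omega>) \<noteq> \<infinity>" using \<Omega>f Bf by (auto simp: top_unique)
  qed
  have "measure lborel (\<Omega> - \<Omega> \<inter> B) = measure lborel \<Omega> - measure lborel (\<Omega> \<inter> B)"
    using \<Omega>f \<Omega> Bf by (intro measure_Diff) auto
  moreover have "measure lborel (B - \<Omega> \<inter> B) = measure lborel B - measure lborel (\<Omega> \<inter> B)"
    using \<Omega> Bf by (intro measure_Diff) auto
  moreover have "\<Omega> - \<Omega> \<inter> B = \<Omega> - B" "B - \<Omega> \<inter> B = B - \<Omega>" by auto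
  ultimately have eq: "measure lborel (\<Omega> - B) = measure lborel (B - \<Omega>)" using \<Omega>(2) by simp
  have "measure lborel (sym_diff B \<Omega>) = measure lborel (B - \<Omega>) + measure lborel (\<Omega> - B)"
    using fin \<Omega>(1) Bf(2) by (intro measure_Union) auto
  then show "measure lborel (\<Omega> - B) = 2 * \<epsilon>" "measure lborel (B - \<Omega>) = 2 * \<epsilon>" using eq sd by auto
qed

text \<open>The angles are known only after the rearrangement has been unpacked, so the choice of
  curvatures enters as a hypothesis \<open>par\<close> over all admissible angles, with a common
  gain \<open>E\<close>.\<close>

lemma rearrangement_estimates:
  assumes R: "rearrangement B \<Omega> S" and \<Omega>: "\<Omega> \<in> sets borel" "measure lborel \<Omega> = pi" "measure lborel (sym_diff B \<Omega>) = 4 * \<epsilon>"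
    and \<epsilon>: "0 < \<epsilon>" "\<epsilon> \<le> 1/100"
    and par: "\<And>a b. 0 < a \<Longrightarrow> 0 < b \<Longrightarrow> a + b \<le> pi/2 \<Longrightarrow>
      \<exists>k1 k2. 0 < k2 \<and> k2 < 1 \<and> 0 < k1 \<and> (k1 = 1 - \<epsilon>\<^sup>2 \<or> a \<le> pi/2 - 3/10 \<and> k1 \<le> 101/100) \<and>
        E \<le> (k1 - k2) * \<epsilon> + (arc_flux a k1 - 2 * a) + (arc_flux b k2 - 2 * b)"
  obtains c where "measure lborel S = pi" "measure lborel (sym_diff S (ball c 1)) \<le> 4 * \<epsilon>"
    "ereal (2 * pi + 2 * E) \<le> perimeter S"
proof -
  obtain c t0 t1 t2 t3 t4 t5 t6 t7 t8 \<tau>1 \<tau>2 \<tau>3 \<tau>4 where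
    B: "B = ball c 1" and
    t1: "t1 = t0 + gamma_out B \<Omega> / 2" and t2: "t2 = t1 + (2 * pi - gamma_in B \<Omega> - gamma_out B \<Omega>) / 4" and
    t3: "t3 = t2 + gamma_in B \<Omega> / 2" and t4: "t4 = t3 + (2 * pi - gamma_in B \<Omega> - gamma_out B \<Omega>) / 4" and
    t5: "t5 = t4 + gamma_out B \<Omega> / 2" and t6: "t6 = t5 + (2 * pi - gamma_in B \<Omega> - gamma_out B \<Omega>) / 4" and
    t7: "t7 = t6 + gamma_in B \<Omega> / 2" and t8: "t8 = t7 + (2 * pi - gamma_in B \<Omega> - gamma_out B \<Omega>) / 4" and
    r1': "outer_replacement c t0 t1 (measure lborel (\<Omega> - B) / 2) \<tau>1" and r2': "inner_replacement c t2 t3 (measure lborel (B - \<Omega>) / 2) \<tau>2" and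
    r3': "outer_replacement c t4 t5 (measure lborel (\<Omega> - B) / 2) \<tau>3" and r4': "inner_replacement c t6 t7 (measure lborel (B - \<Omega>) / 2) \<tau>4" and
    S: "S = inside (\<tau>1 \<union> circ_arc c 1 t1 t2 \<union> \<tau>2 \<union> circ_arc c 1 t3 t4 \<union> \<tau>3 \<union> circ_arc c 1 t5 t6 \<union> \<tau>4 \<union> circ_arc c 1 t7 t8)"
    using R unfolding rearrangement_def Let_def by (elim exE conjE) blast
  have mB: "measure lborel B = pi" unfolding B by (simp add: measure_ball_plane)
  have "B \<in> fmeasurable lborel" unfolding B by (intro open_bounded_fmeasurable) auto
  note md = measure_differences[OF this \<Omega>(1) \<Omega>(2)[folded mB] _ \<Omega>(3)]
  have half: "measure lborel (\<Omega> - B) / 2 = \<epsilon>" "measure lborel (B - \<Omega>) / 2 = \<epsilon>" using md mB by simp_all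
  note r1 = r1'[unfolded half] and r2 = r2'[unfolded half] and r3 = r3'[unfolded half] and r4 = r4'[unfolded half]
  \<comment> \<open>Half-angles: an arc of length \<open>gamma_out B \<Omega> / 2\<close> on the
    unit circle subtends \<open>2 * a\<close>. The kept arcs have length \<open>s\<close>, and half
    the circle is \<open>2 * a + 2 * b + 2 * s\<close>.\<close>
  define a where "a = gamma_out B \<Omega> / 4"
  define b where "b = gamma_in B \<Omega> / 4"
  define s where "s = (2 * pi - gamma_in B \<Omega> - gamma_out B \<Omega>) / 4"
  have ts: "t1 = t0 + 2 * a" "t2 = t1 + s" "t3 = t2 + 2 * b" "t4 = t3 + s" "t5 = t4 + 2 * a" "t6 = t5 + s" "t7 = t6 + 2 * b" "t8 = t7 + s"
    using t1 t2 t3 t4 t5 t6 t7 t8 by (simp_all add: a_def b_def s_def)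
  have sum: "2 * a + 2 * b + 2 * s = pi" by (simp add: a_def b_def s_def field_simps)
  have ab0: "0 \<le> a" "0 \<le> b" using gamma_nonneg by (auto simp: a_def b_def)
  have s0: "0 \<le> s" using gamma_sum_le[OF B, of \<Omega>] by (simp add: s_def)
  \<comment> \<open>All four lunes have area \<epsilon>, which is positive, so no replaced arc is
    degenerate.\<close>
  have "a \<noteq> 0" using degenerate_replacement[of c t0 \<epsilon> \<tau>1] r1 \<epsilon> ts(1) by auto
  moreover have "b \<noteq> 0" using degenerate_replacement[of c t2 \<epsilon> \<tau>2] r2 \<epsilon> ts(3) by auto
  ultimately have ab: "0 < a" "0 < b" "a + b \<le> pi/2" using ab0 s0 sum by auto
  obtain k1 k2 where k: "0 < k2" "k2 < 1" "0 < k1" "k1 = 1 - \<epsilon>\<^sup>2 \<or> a \<le> pi/2 - 3/10 \<and> k1 \<le> 101/100"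
    and E: "E \<le> (k1 - k2) * \<epsilon> + (arc_flux a k1 - 2 * a) + (arc_flux b k2 - 2 * b)"
    using par[OF ab] by blast
  have apb: "2 * a < pi" "2 * b < pi" "s < pi" using sum ab s0 by linarith+
  define m where "m i = ([t0,t1,t2,t3,t4,t5,t6,t7,t8] ! i + [t0,t1,t2,t3,t4,t5,t6,t7,t8] ! Suc i) / 2" for i :: nat
  have mm: "m 0 = (t0 + t1)/2" "m 2 = (t2 + t3)/2" "m 4 = (t4 + t5)/2" "m 6 = (t6 + t7)/2"
    by (simp_all add: m_def eval_nat_numeral)
  interpret F0: arc_frame c t0 t1 "m 0" a using ts ab apb by unfold_locales (simp_all add: mm)
  interpret F2: arc_frame c t2 t3 "m 2" b using ts ab apb by unfold_locales (simp_all add: mm)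
  interpret F4: arc_frame c t4 t5 "m 4" a using ts ab apb by unfold_locales (simp_all add: mm)
  interpret F6: arc_frame c t6 t7 "m 6" b using ts ab apb by unfold_locales (simp_all add: mm)
  note o0 = F0.outer_summary[OF r1 \<epsilon> k(3,4)] and o4 = F4.outer_summary[OF r3 \<epsilon> k(3,4)]
  note i2 = F2.inner_summary[OF r2 \<epsilon> k(1,2)] and i6 = F6.inner_summary[OF r4 \<epsilon> k(1,2)]
  have opp: "axial c (x + pi) z = - axial c x z" for x z by (simp add: axial_def inner_prod_def)
  \<comment> \<open>Equal arcs face each other, so their axes are opposite and their closed lunes
    lie in opposite open half-planes.\<close>
  have m4: "m 4 = m 0 + pi" "m 6 = m 2 + pi" using ts sum by (simp_all add: mm field_simps)
  have K04: "F0.closed_lune \<tau>1 \<inter> F4.closed_lune \<tau>3 = {}"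
  proof -
    have "\<not> (z \<in> F0.closed_lune \<tau>1 \<and> z \<in> F4.closed_lune \<tau>3)" for z
    proof
      assume z: "z \<in> F0.closed_lune \<tau>1 \<and> z \<in> F4.closed_lune \<tau>3"
      have "0 < axial c (m 0) z" by (rule F0.closed_lune_axial[OF _ conjunct1[OF z]]) (rule o0(3))
      moreover have "0 < axial c (m 4) z" by (rule F4.closed_lune_axial[OF _ conjunct2[OF z]]) (rule o4(3))
      ultimately show False unfolding m4 opp by linarith
    qed
    then show ?thesis by blast
  qed
  have K26: "F2.closed_lune \<tau>2 \<inter> F6.closed_lune \<tau>4 = {}"
  proof -
    have "\<not> (z \<in> F2.closed_lune \<tau>2 \<and> z \<in> F6.closed_lune \<tau>4)" for z
    proof
      assume z: "z \<in> F2.closed_lune \<tau>2 \<and> z \<in> F6.closed_lune \<tau>4"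
      have "0 < axial c (m 2) z" by (rule F2.closed_lune_axial[OF _ conjunct1[OF z]]) (rule i2(4))
      moreover have "0 < axial c (m 6) z" by (rule F6.closed_lune_axial[OF _ conjunct2[OF z]]) (rule i6(4))
      ultimately show False unfolding m4 opp by linarith
    qed
    then show ?thesis by blast
  qed
  have tau_sub: "\<tau>1 \<subseteq> F0.closed_lune \<tau>1" "\<tau>3 \<subseteq> F4.closed_lune \<tau>3" "\<tau>2 \<subseteq> F2.closed_lune \<tau>2" "\<tau>4 \<subseteq> F6.closed_lune \<tau>4"
    "F2.lune \<tau>2 \<subseteq> F2.closed_lune \<tau>2"
    unfolding F0.closed_lune_def F2.closed_lune_def F4.closed_lune_def F6.closed_lune_def by blast+
  interpret lune_chain c t0 t1 t2 t3 t4 t5 t6 t7 t8 \<tau>1 \<tau>2 \<tau>3 \<tau>4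
  proof
    show "t0 < t1" "t1 \<le> t2" "t2 < t3" "t3 \<le> t4" "t4 < t5" "t5 \<le> t6" "t6 < t7" "t7 \<le> t8" "t8 = t0 + 2 * pi"
      using ts ab s0 sum by linarith+
    show "\<tau>1 \<inter> \<tau>3 = {}" using K04 tau_sub by blast
    show "\<tau>2 \<inter> \<tau>4 = {}" using K26 tau_sub by blast
    show "F2.lune \<tau>2 \<inter> \<tau>4 = {}" using K26 tau_sub by blast
  qed (rule o0 o4 i2 i6)+

  \<comment> \<open>Even indices belong to the replaced arcs, odd ones to the kept arcs, whose
    curvature is 1.\<close>
  define T where "T i = [t0,t1,t2,t3,t4,t5,t6,t7,t8] ! i" for i :: nat
  define K where "K i = [F0.closed_lune \<tau>1, U t1 t2, F2.closed_lune \<tau>2, U t3 t4, F4.closed_lune \<tau>3, U t5 t6, F6.closed_lune \<tau>4, U t7 t8] ! i" for i :: nat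
  define kk where "kk i = [k1, 1, k2, 1, k1, 1, k2, 1] ! i" for i :: nat
  define L where "L i = (if i = 0 then F0.lune \<tau>1 else if i = 2 then F2.lune \<tau>2 else if i = 4 then F4.lune \<tau>3 else F6.lune \<tau>4)" for i :: nat
  define sg where "sg i = (if i = 0 \<or> i = 4 then 1 else -1 :: real)" for i :: nat
  have T_simps: "T 0 = t0" "T 1 = t1" "T 2 = t2" "T 3 = t3" "T 4 = t4" "T 5 = t5" "T 6 = t6" "T 7 = t7" "T 8 = t8"
    by (simp_all add: T_def eval_nat_numeral)
  have K_simps: "K 0 = F0.closed_lune \<tau>1" "K 1 = U t1 t2" "K 2 = F2.closed_lune \<tau>2" "K 3 = U t3 t4"
    "K 4 = F4.closed_lune \<tau>3" "K 5 = U t5 t6" "K 6 = F6.closed_lune \<tau>4" "K 7 = U t7 t8"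
    by (simp_all add: K_def eval_nat_numeral)
  have kk_simps: "kk 0 = k1" "kk 1 = 1" "kk 2 = k2" "kk 3 = 1" "kk 4 = k1" "kk 5 = 1" "kk 6 = k2" "kk 7 = 1"
    by (simp_all add: kk_def eval_nat_numeral)
  have mT: "m i = (T i + T (Suc i))/2" for i by (simp add: m_def T_def)
  have cases8: "Q i" if "i < 8" "Q 0" "Q 1" "Q 2" "Q 3" "Q 4" "Q 5" "Q 6" "Q 7" for Q and i :: nat
  proof -
    have "i = 0 \<or> i = 1 \<or> i = 2 \<or> i = 3 \<or> i = 4 \<or> i = 5 \<or> i = 6 \<or> i = 7" using that(1) by auto
    then show ?thesis using that(2-) by (elim disjE) simp_all
  qed
  have Suc_simps: "Suc 0 = 1" "Suc 1 = 2" "Suc 2 = 3" "Suc 3 = 4" "Suc 4 = 5" "Suc 5 = 6" "Suc 6 = 7" "Suc 7 = 8" by simp_all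
  have "T i \<le> T (Suc i) \<and> T (Suc i) < T i + pi" if "i < 8" for i
    by (rule cases8[OF that, where Q="\<lambda>i. T i \<le> T (Suc i) \<and> T (Suc i) < T i + pi"];
      simp only: Suc_simps T_simps; use ts ab apb s0 in linarith)
  then have Tstep: "T i \<le> T (Suc i)" "T (Suc i) < T i + pi" if "i < 8" for i using that by blast+
  have Tmono: "T i \<le> T j" if "i \<le> j" "j \<le> 8" for i j
    using that
  proof (induction j rule: dec_induct)
    case (step n) then show ?case using Tstep(1)[of n] by simp
  qed simp
  have cU: "compact (U x y)" for x y unfolding circ_arc_def by (intro compact_continuous_image continuous_intros) auto
  have UK: "U (T i) (T (Suc i)) \<subseteq> K i" if "i < 8" for i
    by (rule cases8[OF that, where Q="\<lambda>i. U (T i) (T (Suc i)) \<subseteq> K i"];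
      simp only: Suc_simps T_simps K_simps F0.closed_lune_def F2.closed_lune_def F4.closed_lune_def F6.closed_lune_def; blast)
  have Kout: "K i \<inter> cball c 1 \<subseteq> P ` {T i..T (Suc i)}" if "i < 8" "i \<noteq> 2" "i \<noteq> 6" for i
  proof -
    have "i = 2 \<or> i = 6 \<or> K i \<inter> cball c 1 \<subseteq> U (T i) (T (Suc i))"
      by (rule cases8[OF that(1), where Q="\<lambda>i. i = 2 \<or> i = 6 \<or> K i \<inter> cball c 1 \<subseteq> U (T i) (T (Suc i))"];
        simp only: Suc_simps T_simps K_simps; use o0(8) o4(8) in blast)
    then show ?thesis using that(2,3) by (simp add: circ_arc_def)
  qed
  have Kin: "K i \<subseteq> cball c 1" "K i \<inter> sphere c 1 \<subseteq> P ` {T i..T (Suc i)}" if "i < 8" "i \<noteq> 0" "i \<noteq> 4" for i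
  proof -
    have "i = 0 \<or> i = 4 \<or> K i \<subseteq> cball c 1"
      by (rule cases8[OF that(1), where Q="\<lambda>i. i = 0 \<or> i = 4 \<or> K i \<subseteq> cball c 1"];
        simp only: Suc_simps T_simps K_simps; use i2(8) i6(8) U_cball in blast)
    then show "K i \<subseteq> cball c 1" using that(2,3) by simp
    have "i = 0 \<or> i = 4 \<or> K i \<inter> sphere c 1 \<subseteq> U (T i) (T (Suc i))"
      by (rule cases8[OF that(1), where Q="\<lambda>i. i = 0 \<or> i = 4 \<or> K i \<inter> sphere c 1 \<subseteq> U (T i) (T (Suc i))"];
        simp only: Suc_simps T_simps K_simps; use i2(9) i6(9) in blast)
    then show "K i \<inter> sphere c 1 \<subseteq> P ` {T i..T (Suc i)}" using that(2,3) by (simp add: circ_arc_def)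
  qed
  have Icc: "{T i..T (Suc i)} \<subseteq> {t0..t8}" if "i < 8" for i
    using Tmono[of 0 i] Tmono[of "Suc i" 8] that by (auto simp: T_simps)
  define Pts where "Pts = P ` T ` {..8}"
  have touch: "P x \<in> Pts" if h: "i < 8" "j < 8" "i \<noteq> j" "x \<in> {T i..T (Suc i)}" "y \<in> {T j..T (Suc j)}"
    "x = y \<or> x = t0 \<and> y = t8 \<or> x = t8 \<and> y = t0" for i j x y
  proof -
    have in_Pts: "P (T l) \<in> Pts" if "l \<le> 8" for l using that by (auto simp: Pts_def)
    from h(6) consider "x = y" | "x = t0" | "x = t8" by blast
    then show ?thesis
    proof cases
      case 1
      consider "i < j" | "j < i" using h(3) by linarith
      then show ?thesis
      proof cases
        case A: 1
        then have "T (Suc i) \<le> T j" using Tmono[of "Suc i" j] h(2) by simp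
        then have "x = T j" using 1 h(4,5) by auto
        then show ?thesis using in_Pts[of j] h(2) by simp
      next
        case A: 2
        then have "T (Suc j) \<le> T i" using Tmono[of "Suc j" i] h(1) by simp
        then have "x = T i" using 1 h(4,5) by auto
        then show ?thesis using in_Pts[of i] h(1) by simp
      qed
    next
      case 2 then show ?thesis using in_Pts[of 0] by (simp add: T_simps)
    next
      case 3 then show ?thesis using in_Pts[of 8] by (simp add: T_simps)
    qed
  qed
  \<comment> \<open>Two outer or two inner lunes are disjoint. In every other pair one piece meets
    the closed disc only along its arc and the other lies in the closed disc, so
    \<open>isect\<close> applies; kept arcs qualify for both roles.\<close>
  have KK: "K i \<inter> K j \<subseteq> Pts" if ij: "i < 8" "j < 8" "i \<noteq> j" for i j
  proof -
    consider "i \<in> {0, 4}" "j \<in> {0, 4}" | "i \<in> {2, 6}" "j \<in> {2, 6}" | "i \<noteq> 2" "i \<noteq> 6" "j \<noteq> 0" "j \<noteq> 4" | "j \<noteq> 2" "j \<noteq> 6" "i \<noteq> 0" "i \<noteq> 4"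
      by fastforce
    then show ?thesis
    proof cases
      case 1
      then have "K i \<inter> K j = {}" using ij K04 by (auto simp: K_simps)
      then show ?thesis by simp
    next
      case 2
      then have "K i \<inter> K j = {}" using ij K26 by (auto simp: K_simps)
      then show ?thesis by simp
    next
      case 3
      show ?thesis
        by (rule isect(1)[OF Kout[OF ij(1) 3(1,2)] Kin(2)[OF ij(2) 3(3,4)] Kin(1)[OF ij(2) 3(3,4)] Icc[OF ij(1)] Icc[OF ij(2)]])
           (rule touch[OF ij])
    next
      case 4
      show ?thesis
        by (rule isect(2)[OF Kout[OF ij(2) 4(1,2)] Kin(2)[OF ij(1) 4(3,4)] Kin(1)[OF ij(1) 4(3,4)] Icc[OF ij(2)] Icc[OF ij(1)]])
           (rule touch[OF ij(2,1) ij(3)[symmetric]])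
    qed
  qed
  have Kstrip: "K i \<subseteq> strip c (m i) (kk i)" if "i < 8" for i
  proof -
    have kept: "U (T j) (T (Suc j)) \<subseteq> strip c (m j) 1" if "j < 8" for j
      using Tstep[OF that] by (intro kept_arc_strip mT) auto
    have kept': "U t1 t2 \<subseteq> strip c (m 1) 1" "U t3 t4 \<subseteq> strip c (m 3) 1" "U t5 t6 \<subseteq> strip c (m 5) 1" "U t7 t8 \<subseteq> strip c (m 7) 1"
      using kept[of 1] kept[of 3] kept[of 5] kept[of 7] unfolding Suc_simps T_simps by simp_all
    show ?thesis
      by (rule cases8[OF that, where Q="\<lambda>i. K i \<subseteq> strip c (m i) (kk i)"]; simp only: K_simps kk_simps)
        (rule o0(6) kept' o4(6) i2(7) i6(7))+
  qed
  have Kcpt: "compact (K i)" if "i < 8" for i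
    by (rule cases8[OF that, where Q="\<lambda>i. compact (K i)"]; simp only: K_simps)
      (rule cU F0.compact_closed_lune[OF o0(1)] F2.compact_closed_lune[OF i2(1)]
      F4.compact_closed_lune[OF o4(1)] F6.compact_closed_lune[OF i6(1)])+
  note ri = region_integral[folded S]
  have J: "open (L i)" "bounded (L i)" "L i \<subseteq> K i" "i < 8" if "i \<in> {0, 2, 4, 6}" for i
    using that ri(5-12) by (auto simp: L_def K_simps F0.closed_lune_def F2.closed_lune_def F4.closed_lune_def F6.closed_lune_def)
  have mL: "measure lborel (L i) = \<epsilon>" if "i \<in> {0, 2, 4, 6}" for i
    using that o0(4) o4(4) i2(5) i6(5) by (auto simp: L_def)
  have int: "(LINT z:S|lborel. f z) = (LINT z:ball c 1|lborel. f z) + (\<Sum>i\<in>{0, 2, 4, 6}. sg i * (LINT z:L i|lborel. f z))"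
    if "continuous_on UNIV f" for f :: "plane \<Rightarrow> real"
    using ri(1)[OF that] by (simp add: sg_def L_def)
  have "ereal ((\<Sum>i<8. integral {T i..T (Suc i)} (\<lambda>t. strip_field c (m i) (kk i) (circ_point c 1 t) \<bullet> (cos t, sin t)))
     + (\<Sum>i\<in>{0, 2, 4, 6}. sg i * (kk i * measure lborel (L i)))) \<le> perimeter S"
  proof (rule perimeter_lower_bound[where K=K and Pts=Pts])
    show "T 8 = T 0 + 2 * pi" using t(9) by (simp add: T_simps)
    show "finite Pts" by (simp add: Pts_def)
    show "T (Suc i) < T i + 2 * pi" if "i < 8" for i using Tstep(2)[OF that] pi_gt_zero by linarith
    show "0 < kk i" if "i < 8" for i
      by (rule cases8[OF that, where Q="\<lambda>i. 0 < kk i"]; simp only: kk_simps; use k in linarith)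
  qed (use Tstep Kcpt Kstrip KK UK J int in auto)
  also have "(\<Sum>i<8. integral {T i..T (Suc i)} (\<lambda>t. strip_field c (m i) (kk i) (circ_point c 1 t) \<bullet> (cos t, sin t)))
     = (\<Sum>i<8. arc_flux ((T (Suc i) - T i)/2) (kk i))"
    by (intro sum.cong refl flux_eq_arc_flux mT Tstep(1)) auto
  \<comment> \<open>A kept arc contributes exactly its length, by
    \<open>arc_flux_one\<close>.\<close>
  also have "\<dots> = 2 * arc_flux a k1 + 2 * arc_flux b k2 + 4 * s"
  proof -
    have half_s: "arc_flux (s/2) 1 = s" using arc_flux_one[of "s/2"] s0 apb by simp
    have "(\<Sum>i<8. f i) = f 0 + f 1 + f 2 + f 3 + f 4 + f 5 + f 6 + f (7::nat)" for f :: "nat \<Rightarrow> real"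
      by (simp add: eval_nat_numeral)
    moreover have "(T (Suc 0) - T 0)/2 = a" "(T (Suc 1) - T 1)/2 = s/2" "(T (Suc 2) - T 2)/2 = b" "(T (Suc 3) - T 3)/2 = s/2"
      "(T (Suc 4) - T 4)/2 = a" "(T (Suc 5) - T 5)/2 = s/2" "(T (Suc 6) - T 6)/2 = b" "(T (Suc 7) - T 7)/2 = s/2"
      unfolding Suc_simps T_simps using ts by simp_all
    ultimately show ?thesis by (simp only: kk_simps half_s)
  qed
  also have "(\<Sum>i\<in>{0, 2, 4, 6}. sg i * (kk i * measure lborel (L i))) = 2 * ((k1 - k2) * \<epsilon>)"
    by (simp add: sg_def kk_simps mL algebra_simps)
  finally have per: "ereal (2 * arc_flux a k1 + 2 * arc_flux b k2 + 4 * s + 2 * ((k1 - k2) * \<epsilon>)) \<le> perimeter S" .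
  show ?thesis
  proof (rule that[of c])
    show "ereal (2 * pi + 2 * E) \<le> perimeter S"
    proof (rule order_trans[OF _ per])
      show "ereal (2 * pi + 2 * E) \<le> ereal (2 * arc_flux a k1 + 2 * arc_flux b k2 + 4 * s + 2 * ((k1 - k2) * \<epsilon>))"
        using E sum by simp
    qed
    show "measure lborel (sym_diff S (ball c 1)) \<le> 4 * \<epsilon>"
      using ri(2) o0(4) o4(4) i2(5) i6(5) by simp
    \<comment> \<open>Integrating the constant 1, the two outer lunes balance the two inner
      ones.\<close>
    have one: "(LINT z:X|lborel. 1::real) = measure lborel X" if "open X" "bounded X" for X :: "plane set"
      using open_bounded_fmeasurable[OF that] by (simp add: set_lebesgue_integral_def)
    have "(LINT z:S|lborel. 1::real) = (LINT z:ball c 1|lborel. 1) + (LINT z:F0.lune \<tau>1|lborel. 1)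
      + (LINT z:F4.lune \<tau>3|lborel. 1) - (LINT z:F2.lune \<tau>2|lborel. 1) - (LINT z:F6.lune \<tau>4|lborel. 1)"
      by (rule ri(1)) (rule continuous_on_const)
    then show "measure lborel S = pi"
      using o0(4) o4(4) i2(5) i6(5) ri(3-12) by (simp add: one measure_ball_plane)
  qed
qed

text \<open>In \<open>ereal\<close> a positive number divided by 0 is infinite. This settles
  vanishing asymmetry and also the case \<open>p = 0\<close>, which the bounds
  \<open>0 \<le> p \<le> 2 * pi\<close> leave open; an infinite perimeter is equally
  harmless.\<close>

lemma iso_quotient_lower_bound:
  fixes S :: "plane set"
  assumes S: "measure lborel S = pi" "measure lborel (sym_diff S (ball c 1)) \<le> 4 * \<epsilon>" and \<epsilon>: "0 < \<epsilon>"
    and E: "0 < E" "ereal (2 * pi + 2 * E) \<le> perimeter S"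
  shows "ereal (E * pi / (16 * \<epsilon>\<^sup>2)) \<le> iso_quotient S"
proof -
  have r1: "eq_radius S = 1" using S(1) by (simp add: eq_radius_def)
  let ?p = "perimeter (ball (0::plane) 1)" and ?A = "asymmetry S"
  obtain p where p: "?p = ereal p" "0 \<le> p" "p \<le> 2 * pi"
    using perimeter_nonneg[of "ball (0::plane) 1"] perimeter_disc_le[of "0::plane"] by (cases ?p) auto
  have "?A \<le> measure lborel (sym_diff S (ball c 1)) / pi"
    unfolding asymmetry_def r1 S(1) by (rule cINF_lower[OF bdd_belowI[of _ 0]]) auto
  also have "\<dots> \<le> 4 * \<epsilon> / pi" using S(2) by (intro divide_right_mono) auto
  finally have A1: "?A \<le> 4 * \<epsilon> / pi" .
  have A0: "0 \<le> ?A" unfolding asymmetry_def r1 S(1) by (rule cINF_greatest) auto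
  have \<delta>: "ereal (E / pi) \<le> iso_deficit S"
  proof (cases "perimeter S")
    case (real P)
    have PE: "2 * pi + 2 * E \<le> P" using E(2) real by simp
    show ?thesis
    proof (cases "p = 0")
      case True
      have "0 < P" using PE E(1) pi_gt_zero by linarith
      then show ?thesis unfolding iso_deficit_def r1 p(1) real using True by simp
    next
      case False
      then have p0: "0 < p" using p(2) by simp
      have "E / pi = 2 * E / (2 * pi)" by simp
      also have "\<dots> \<le> (P - p) / p" using PE E(1) p p0 by (intro frac_le) auto
      finally show ?thesis unfolding iso_deficit_def r1 p(1) real using p0 by simp
    qed
  next
    case PInf
    show ?thesis unfolding iso_deficit_def r1 p(1) PInf using p(2)
      by (cases "p = 0") (auto simp: divide_ereal_def)
  qed (use E(2) in simp)
  show ?thesis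
  proof (cases "?A = 0")
    case True
    have "0 < ereal (E / pi)" using E(1) by simp
    then have "0 < iso_deficit S" using \<delta> by (rule less_le_trans)
    then have "iso_quotient S = \<infinity>" unfolding iso_quotient_def True by (cases "iso_deficit S") auto
    then show ?thesis by simp
  next
    case False
    then have "0 < ?A\<^sup>2" by simp
    moreover have "?A\<^sup>2 \<le> (4 * \<epsilon> / pi)\<^sup>2" using A0 A1 by (intro power_mono)
    ultimately have "E / pi / (4 * \<epsilon> / pi)\<^sup>2 \<le> E / pi / ?A\<^sup>2"
      using E(1) by (intro divide_left_mono mult_pos_pos) auto
    moreover have "E / pi / (4 * \<epsilon> / pi)\<^sup>2 = E * pi / (16 * \<epsilon>\<^sup>2)"
      using \<epsilon> by (simp add: field_simps power2_eq_square)
    ultimately have "ereal (E * pi / (16 * \<epsilon>\<^sup>2)) \<le> ereal (E / pi) / ereal (?A\<^sup>2)"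
      using False by simp
    also have "\<dots> \<le> iso_quotient S"
      unfolding iso_quotient_def by (rule ereal_divide_right_mono[OF \<delta>]) (use False in simp)
    finally show ?thesis .
  qed
qed

theorem theorem2p8:
  fixes B :: "plane set" and c :: plane and r \<epsilon>0 :: real
    and \<Omega> \<Omega>_star :: "real \<Rightarrow> plane set"
  assumes "B = ball c r"
    and "measure lborel B = pi"
    and "0 < \<epsilon>0"
    and "\<And>\<epsilon>. 0 < \<epsilon> \<Longrightarrow> \<epsilon> < \<epsilon>0 \<Longrightarrow> \<Omega> \<epsilon> \<in> sets borel"
    and "\<And>\<epsilon>. 0 < \<epsilon> \<Longrightarrow> \<epsilon> < \<epsilon>0 \<Longrightarrow> measure lborel (\<Omega> \<epsilon>) = pi"
    and "\<And>\<epsilon>. 0 < \<epsilon> \<Longrightarrow> \<epsilon> < \<epsilon>0 \<Longrightarrow> measure lborel (sym_diff B (\<Omega> \<epsilon>)) = 4 * \<epsilon>"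
    and "\<And>\<epsilon>. 0 < \<epsilon> \<Longrightarrow> \<epsilon> < \<epsilon>0 \<Longrightarrow> rearrangement B (\<Omega> \<epsilon>) (\<Omega>_star \<epsilon>)"
  shows "ereal (pi / (8 * (4 - pi))) \<le> Liminf (at_right 0) (\<lambda>\<epsilon>. iso_quotient (\<Omega>_star \<epsilon>))"
proof -
  obtain C \<epsilon>1 where \<epsilon>1: "0 < \<epsilon>1" "\<epsilon>1 \<le> 1/100" and par: "\<And>\<epsilon> a b. 0 < \<epsilon> \<Longrightarrow> \<epsilon> < \<epsilon>1 \<Longrightarrow> 0 < a \<Longrightarrow> 0 < b \<Longrightarrow> a + b \<le> pi/2 \<Longrightarrow>
      \<exists>k1 k2. 0 < k2 \<and> k2 < 1 \<and> 0 < k1 \<and> (k1 = 1 - \<epsilon>\<^sup>2 \<or> a \<le> pi/2 - 3/10 \<and> k1 \<le> 101/100) \<and>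
        2/(4 - pi) * \<epsilon>\<^sup>2 - C * \<epsilon>^3 \<le> (k1 - k2) * \<epsilon> + (arc_flux a k1 - 2 * a) + (arc_flux b k2 - 2 * b)"
    by (rule calibration_parameters) blast
  have pi4: "0 < 4 - pi" using pi_less_4 by simp
  \<comment> \<open>The limit arises as \<open>2 / (4 - pi) * pi / 16\<close>; the linear term
    carries the cubic remainder of the calibration.\<close>
  define g where "g \<epsilon> = pi / (8 * (4 - pi)) - pi * C * \<epsilon> / 16" for \<epsilon>
  have bound: "ereal (g \<epsilon>) \<le> iso_quotient (\<Omega>_star \<epsilon>)" if \<epsilon>: "0 < \<epsilon>" "\<epsilon> < \<epsilon>0" "\<epsilon> < \<epsilon>1" "0 < 2/(4 - pi) - C * \<epsilon>" for \<epsilon>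
  proof -
    let ?E = "2/(4 - pi) * \<epsilon>\<^sup>2 - C * \<epsilon>^3"
    have E: "?E = \<epsilon>\<^sup>2 * (2/(4 - pi) - C * \<epsilon>)" by (simp add: algebra_simps eval_nat_numeral)
    have "\<epsilon> \<le> 1/100" using \<epsilon>1 \<epsilon> by simp
    then obtain x where "measure lborel (\<Omega>_star \<epsilon>) = pi" "measure lborel (sym_diff (\<Omega>_star \<epsilon>) (ball x 1)) \<le> 4 * \<epsilon>"
      "ereal (2 * pi + 2 * ?E) \<le> perimeter (\<Omega>_star \<epsilon>)"
      by (rule rearrangement_estimates[OF assms(7,4,5,6)[OF \<epsilon>(1,2)] \<epsilon>(1) _ par[OF \<epsilon>(1,3)]])
    from iso_quotient_lower_bound[OF this(1,2) \<epsilon>(1) _ this(3)]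
    have "ereal (?E * pi / (16 * \<epsilon>\<^sup>2)) \<le> iso_quotient (\<Omega>_star \<epsilon>)" unfolding E using \<epsilon> by simp
    moreover have "?E * pi / (16 * \<epsilon>\<^sup>2) = (2/(4 - pi) - C * \<epsilon>) * pi / 16" unfolding E using \<epsilon>(1) by simp
    moreover have "\<dots> = g \<epsilon>" using pi4 by (simp add: g_def field_simps)
    ultimately show ?thesis by simp
  qed
  have g: "(g \<longlongrightarrow> g 0) (at_right 0)"
    unfolding g_def by (intro tendsto_intros) auto
  \<comment> \<open>The gain must be positive before it may be divided by the squared asymmetry,
    which is the case for all small \<epsilon>.\<close>
  have "((\<lambda>\<epsilon>. 2/(4 - pi) - C * \<epsilon>) \<longlongrightarrow> 2/(4 - pi) - C * 0) (at_right 0)" by (intro tendsto_intros)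
  then have "\<forall>\<^sub>F \<epsilon> in at_right 0. 0 < 2/(4 - pi) - C * \<epsilon>" using pi4 by (intro order_tendstoD(1)) auto
  moreover have "\<forall>\<^sub>F \<epsilon> in at_right (0::real). \<epsilon> < \<epsilon>0" "\<forall>\<^sub>F \<epsilon> in at_right (0::real). \<epsilon> < \<epsilon>1"
    using assms(3) \<epsilon>1(1) by (auto intro: eventually_at_right_less eventually_at_rightI)
  moreover have "\<forall>\<^sub>F \<epsilon> in at_right (0::real). 0 < \<epsilon>" by (rule eventually_at_right_less)
  ultimately have "\<forall>\<^sub>F \<epsilon> in at_right 0. ereal (g \<epsilon>) \<le> iso_quotient (\<Omega>_star \<epsilon>)"
    by eventually_elim (rule bound)
  then have "Liminf (at_right 0) (\<lambda>\<epsilon>. ereal (g \<epsilon>)) \<le> Liminf (at_right 0) (\<lambda>\<epsilon>. iso_quotient (\<Omega>_star \<epsilon>))"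
    by (rule Liminf_mono)
  moreover have "Liminf (at_right 0) (\<lambda>\<epsilon>. ereal (g \<epsilon>)) = ereal (g 0)"
    using g by (intro lim_imp_Liminf) auto
  ultimately show ?thesis by (simp add: g_def)
qed
end
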